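(* Let $\mathsf T$ be a thermodynamically consistent open continuum thermodynamic system on $\Omega$, let $u$ be a smooth admissible trajectory of $\mathsf T$, and let $\{\Omega_i\}_{i=1}^N$ be a compatible finite partition of $\Omega$. Then $$\mathcal F[u]=\sum_{i=1}^N\mathcal F_i[u],\qquad \mathcal D[u]=\sum_{i=1}^N\mathcal D_i[u],\qquad \mathcal S[u]=\sum_{i=1}^N\mathcal S_i[u],\qquad \mathcal B[u]=\sum_{i=1}^N\mathcal B_i^{\mathrm{ext}}[u],$$ and summing over $i$ the local balances $$\frac{d}{dt}\mathcal F_i[u(t)]=-\mathcal D_i[u(t)]+\mathcal B_i^{\mathrm{ext}}[u(t)]+\mathcal B_i^{\mathrm{int}}[u(t)]+\mathcal S_i[u(t)]$$ recovers the global balance $$\frac{d}{dt}\mathcal F[u(t)]=-\mathcal D[u(t)]+\mathcal B[u(t)]+\mathcal S[u(t)].$$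
   Context: Let $\Omega\subset\mathbb R^d$ be a bounded Lipschitz domain with outward unit normal $n$, let $U\subset\mathbb R^m$ be nonempty, open and convex, and let $\psi:\overline\Omega\times U\to\mathbb R$ be a $C^2$ storage density such that $u\mapsto\psi(x,u)$ is convex on $U$ for each $x\in\overline\Omega$. The admissible field space is $\mathcal X:=\{u\in H^1(\Omega;\mathbb R^m): u(x)\in U\text{ for a.e. }x\in\Omega,\ \psi(\cdot,u(\cdot))\in L^1(\Omega)\}$. The free energy is $\mathcal F[u]:=\int_\Omega\psi(x,u(x))\,dx$, and the thermodynamic potential is $\mu[u](x):=D_u\psi(x,u(x))$. An open constitutive structure consists of: a reversible flux $J^{\mathrm{rev}}:\mathcal X\to L^1(\Omega;\mathbb R^{m\times d})$; a dissipative flux $J^{\mathrm{diss}}:\mathcal X\to L^1(\Omega;\mathbb R^{m\times d})$; a source $R:\mathcal X\to L^1(\Omega;\mathbb R^m)$; boundary port spaces $Y_e,Y_f$, trace maps $e:\mathcal X\to Y_e$, $f:\mathcal X\to Y_f$, and a continuous duality pairing $\langle\cdot,\cdot\rangle_Y:Y_e\times Y_f\to\mathbb R$. The boundary exchange is $\mathcal B[u]:=\langle e[u],f[u]\rangle_Y$. Divergences of $\mathbb R^{m\times d}$-valued fields are taken row-wise. The structure is thermodynamically admissible if there exist maps $q^{\mathrm{rev}},q^{\mathrm{diss}}:\mathcal X\to L^1(\Omega;\mathbb R^d)$ and $\sigma:\mathcal X\to L^1(\Omega)$ such that for every sufficiently smooth $u\in\mathcal X$: (1) $\mu[u]\cdot\operatorname{div}J^{\mathrm{rev}}[u]=\operatorname{div}q^{\mathrm{rev}}[u]$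 in $\mathscr D'(\Omega)$; (2) $\mu[u]\cdot\operatorname{div}J^{\mathrm{diss}}[u]=\operatorname{div}q^{\mathrm{diss}}[u]+\sigma[u]$ in $\mathscr D'(\Omega)$; (3) $\sigma[u](x)\ge0$ for a.e. $x\in\Omega$; (4) $-\int_{\partial\Omega}(q^{\mathrm{rev}}[u]+q^{\mathrm{diss}}[u])\cdot n\,dS=\mathcal B[u]$; and the source contribution $\mathcal S[u]:=\int_\Omega\mu[u]\cdot R[u]\,dx$ is finite. The dissipation is $\mathcal D[u]:=\int_\Omega\sigma[u]\,dx$. Write $q:=q^{\mathrm{rev}}+q^{\mathrm{diss}}$. An open continuum thermodynamic system is a tuple $\mathsf T=(\Omega,U,\mathcal X,\psi,\mu,J^{\mathrm{rev}},J^{\mathrm{diss}},R,Y_e,Y_f,e,f)$ in which $\Omega$ is a bounded Lipschitz domain, $U$ is a nonempty open convex state set, $\psi$ is a $C^2$ storage density convex in its second argument, $\mathcal X$ is the admissible field space and $\mu$ the thermodynamic potential determined by $(\Omega,U,\psi)$, and $J^{\mathrm{rev}},J^{\mathrm{diss}},R,Y_e,Y_f,e,f$ (with the pairing $\langle\cdot,\cdot\rangle_Y$) form a thermodynamically admissible open constitutive structure. A smooth admissible trajectory of $\mathsf T$ on $[0,T]$ is a map $u:[0,T]\to\mathcal X$ that is sufficiently regular in space and time for all terms in the evolution equation $\partial_tu+\operatorname{div}(J^{\mathrm{rev}}[u]+J^{\mathrm{diss}}[u])=R[u]$, in the boundary exchange $\mathcal B[u]$, in the thermodynamic admissibility conditions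 on $q^{\mathrm{rev}}[u],q^{\mathrm{diss}}[u],\sigma[u]$, and in the source contribution $\mathcal S[u]$ to be meaningful, and which satisfies almost everywhere $\partial_tu+\operatorname{div}(J^{\mathrm{rev}}[u]+J^{\mathrm{diss}}[u])=R[u]$ in $\Omega\times(0,T)$. $\mathsf T$ is thermodynamically consistent if every smooth admissible trajectory satisfies $\frac{d}{dt}\mathcal F[u(t)]=-\mathcal D[u(t)]+\mathcal B[u(t)]+\mathcal S[u(t)]$ for all $t\in[0,T]$. A finite family $\{\Omega_i\}_{i=1}^N$ of Lipschitz subdomains of $\Omega$ is a compatible finite partition of $\Omega$ if: (i) $\overline\Omega=\bigcup_{i=1}^N\overline{\Omega_i}$; (ii) the interiors of the $\Omega_i$ are pairwise disjoint; (iii) each $\Omega_i$ is Lipschitz; (iv) for each $i\ne j$ the interface $\Gamma_{ij}:=\partial\Omega_i\cap\partial\Omega_j\cap\Omega$ is either empty or a Lipschitz hypersurface on which the outer normals satisfy $n_j=-n_i$ a.e. For such a partition, with $n_i$ the outward unit normal of $\Omega_i$, set $\mathcal F_i[u]:=\int_{\Omega_i}\psi(x,u)\,dx$, $\mathcal D_i[u]:=\int_{\Omega_i}\sigma[u]\,dx$, $\mathcal S_i[u]:=\int_{\Omega_i}\mu[u]\cdot R[u]\,dx$, $\mathcal B_i^{\mathrm{ext}}[u]:=-\int_{\partial\Omega_i\cap\partial\Omega}q[u]\cdot n_i\,dS$, $\mathcal B_i^{\mathrm{int}}[u]:=-\sum_{j\ne i}\int_{\Gamma_{ij}}q[u]\cdot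 n_i\,dS$. *)

theory Defs
  imports "HOL-Analysis.Analysis"
begin

section \<open>Differentiability classes and differential operators\<close>

text \<open>
  \<open>Ck_on k S f\<close>: \<open>f\<close> is continuous on \<open>S\<close>, \<open>k\<close> times differentiable in the interior of \<open>S\<close>, and
  all derivatives of order at most \<open>k\<close> extend continuously to \<open>S\<close>.  For open \<open>S\<close> this is the usual
  class \<open>C^k(S)\<close>; for \<open>S = closure \<Omega>\<close> and \<open>S = closure \<Omega> \<times> U\<close> it is \<open>C^k\<close> up to the boundary of \<open>\<Omega>\<close>.
  The recursion runs through the directional derivatives.
\<close>

primrec Ck_on ::
  "nat \<Rightarrow> 'a::real_normed_vector set \<Rightarrow> ('a \<Rightarrow> 'b::real_normed_vector) \<Rightarrow> bool" where
  "Ck_on 0 S f \<longleftrightarrow> continuous_on S f"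
| "Ck_on (Suc k) S f \<longleftrightarrow> continuous_on S f \<and>
     (\<exists>f'. (\<forall>x\<in>interior S. (f has_derivative f' x) (at x)) \<and> (\<forall>v. Ck_on k S (\<lambda>x. f' x v)))"

definition grad :: "(real^'n \<Rightarrow> real) \<Rightarrow> real^'n \<Rightarrow> real^'n" where
  "grad f x = (\<chi> k. frechet_derivative f (at x) (axis k 1))"

definition vdiv :: "(real^'d \<Rightarrow> real^'d) \<Rightarrow> real^'d \<Rightarrow> real" where
  "vdiv q x = (\<Sum>k\<in>UNIV. frechet_derivative q (at x) (axis k 1) $ k)"

text \<open>Row-wise divergence; \<open>real^'d^'m\<close> is the type of matrices with rows indexed by \<open>'m\<close>.\<close>

definition mdiv :: "(real^'d \<Rightarrow> real^'d^'m) \<Rightarrow> real^'d \<Rightarrow> real^'m" where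
  "mdiv J x = (\<chi> i. vdiv (\<lambda>y. J y $ i) x)"

definition test_functions :: "(real^'d) set \<Rightarrow> (real^'d \<Rightarrow> real) set" where
  "test_functions \<Omega> = {\<phi>. (\<forall>k. Ck_on k UNIV \<phi>) \<and>
     compact (closure {x. \<phi> x \<noteq> 0}) \<and> closure {x. \<phi> x \<noteq> 0} \<subseteq> \<Omega>}"


section \<open>Function spaces\<close>

definition L2_on :: "(real^'d) set \<Rightarrow> (real^'d \<Rightarrow> 'b::euclidean_space) \<Rightarrow> bool" where
  "L2_on \<Omega> f \<longleftrightarrow> set_borel_measurable lebesgue \<Omega> f \<and>
     set_integrable lebesgue \<Omega> (\<lambda>x. (norm (f x))\<^sup>2)"

text \<open>\<open>G\<close> below is the weak Jacobian of \<open>u\<close>.\<close>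

definition H1_on :: "(real^'d) set \<Rightarrow> (real^'d \<Rightarrow> real^'m) \<Rightarrow> bool" where
  "H1_on \<Omega> u \<longleftrightarrow> L2_on \<Omega> u \<and>
     (\<exists>G :: real^'d \<Rightarrow> real^'d^'m. L2_on \<Omega> G \<and>
        (\<forall>\<phi>\<in>test_functions \<Omega>. \<forall>i j.
           (LINT x:\<Omega>|lebesgue. u x $ i * grad \<phi> x $ j) =
           - (LINT x:\<Omega>|lebesgue. G x $ i $ j * \<phi> x)))"

text \<open>
  Elements of \<open>H^1\<close> and \<open>L^1\<close> are represented by functions, so a map between such spaces has to
  respect equality almost everywhere.
\<close>

definition ae_eq_on :: "(real^'d) set \<Rightarrow> (real^'d \<Rightarrow> 'b) \<Rightarrow> (real^'d \<Rightarrow> 'b) \<Rightarrow> bool" where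
  "ae_eq_on \<Omega> f g \<longleftrightarrow> (AE x in lebesgue. x \<in> \<Omega> \<longrightarrow> f x = g x)"

definition L1_valued_map ::
  "(real^'d) set \<Rightarrow> (real^'d \<Rightarrow> 'a) set \<Rightarrow> ((real^'d \<Rightarrow> 'a) \<Rightarrow> real^'d \<Rightarrow> 'b::euclidean_space) \<Rightarrow> bool" where
  "L1_valued_map \<Omega> X \<Phi> \<longleftrightarrow>
     (\<forall>u\<in>X. set_integrable lebesgue \<Omega> (\<Phi> u)) \<and>
     (\<forall>u\<in>X. \<forall>v\<in>X. ae_eq_on \<Omega> u v \<longrightarrow> ae_eq_on \<Omega> (\<Phi> u) (\<Phi> v))"


section \<open>Surface measure\<close>

definition hausdorff_pre :: "nat \<Rightarrow> real \<Rightarrow> 'a::metric_space set \<Rightarrow> ennreal" where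
  "hausdorff_pre k \<delta> A =
     (INF C \<in> {C :: nat \<Rightarrow> 'a set. A \<subseteq> (\<Union>n. C n) \<and> (\<forall>n. bounded (C n) \<and> diameter (C n) \<le> \<delta>)}.
        \<Sum>n. if C n = {} then 0 else ennreal (diameter (C n) ^ k))"

definition hausdorff_outer :: "nat \<Rightarrow> 'a::metric_space set \<Rightarrow> ennreal" where
  "hausdorff_outer k A = (SUP \<delta>\<in>{0<..}. hausdorff_pre k \<delta> A)"

definition hausdorff_measure :: "nat \<Rightarrow> 'a::metric_space measure" where
  "hausdorff_measure k = measure_of UNIV (sets borel) (hausdorff_outer k)"

text \<open>
  The \<open>(d-1)\<close>-dimensional Hausdorff measure on \<open>\<real>^d\<close>.  The usual constant, which makes it agree
  with \<open>(d-1)\<close>-dimensional Lebesgue measure on hyperplanes, is fixed here by the requirement that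
  the unit cube \<open>[0,1]^d\<close> has surface area \<open>2 d\<close>.
\<close>

definition surface_measure :: "(real^'d) measure" where
  "surface_measure =
     scale_measure
       (ennreal (2 * real CARD('d)) /
          hausdorff_outer (CARD('d) - 1) (frontier (cbox (0 :: real^'d) 1)))
       (hausdorff_measure (CARD('d) - 1))"


section \<open>Lipschitz domains\<close>

text \<open>
  Around each boundary point \<open>x\<close>, in a cylinder with axis \<open>e\<close>, the set \<open>\<Omega>\<close> is the strict subgraph
  of a Lipschitz function \<open>\<gamma>\<close> on the hyperplane orthogonal to \<open>e\<close>.
\<close>

definition hproj :: "real^'d \<Rightarrow> real^'d \<Rightarrow> real^'d" where
  "hproj e y = y - (y \<bullet> e) *\<^sub>R e"

definition cylinder :: "real^'d \<Rightarrow> real^'d \<Rightarrow> real \<Rightarrow> real \<Rightarrow> (real^'d) set" where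
  "cylinder x e r h = {y. norm (hproj e (y - x)) < r \<and> \<bar>(y - x) \<bullet> e\<bar> < h}"

definition lipschitz_boundary :: "(real^'d) set \<Rightarrow> bool" where
  "lipschitz_boundary \<Omega> \<longleftrightarrow> (\<forall>x\<in>frontier \<Omega>. \<exists>e r h L (\<gamma> :: real^'d \<Rightarrow> real).
     norm e = 1 \<and> 0 < r \<and> 0 < h \<and> L-lipschitz_on {z. z \<bullet> e = 0} \<gamma> \<and>
     \<Omega> \<inter> cylinder x e r h = {y \<in> cylinder x e r h. y \<bullet> e < \<gamma> (hproj e y)})"

definition bounded_lipschitz_domain :: "(real^'d) set \<Rightarrow> bool" where
  "bounded_lipschitz_domain \<Omega> \<longleftrightarrow>
     open \<Omega> \<and> connected \<Omega> \<and> \<Omega> \<noteq> {} \<and> bounded \<Omega> \<and> lipschitz_boundary \<Omega>"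

text \<open>
  \<open>\<nu>\<close> is the outward unit normal of \<open>\<Omega>\<close> at \<open>x\<close> if near \<open>x\<close> the set \<open>\<Omega>\<close> coincides with the half-space
  \<open>(y - x) \<bullet> \<nu> < 0\<close> up to cones of arbitrarily small opening around the tangent hyperplane.  For a
  Lipschitz graph this happens at the points where the graph function is differentiable, hence
  (Rademacher) at almost every boundary point; the normal field is determined only up to surface
  null sets.
\<close>

definition outward_unit_normal_at :: "(real^'d) set \<Rightarrow> real^'d \<Rightarrow> real^'d \<Rightarrow> bool" where
  "outward_unit_normal_at \<Omega> x \<nu> \<longleftrightarrow> norm \<nu> = 1 \<and>
     (\<forall>\<epsilon>>0. \<exists>r>0. \<forall>y\<in>ball x r.
        ((y - x) \<bullet> \<nu> < - \<epsilon> * norm (y - x) \<longrightarrow> y \<in> \<Omega>) \<and>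
        ((y - x) \<bullet> \<nu> > \<epsilon> * norm (y - x) \<longrightarrow> y \<notin> \<Omega>))"

definition outward_unit_normal :: "(real^'d) set \<Rightarrow> (real^'d \<Rightarrow> real^'d) \<Rightarrow> bool" where
  "outward_unit_normal \<Omega> n \<longleftrightarrow>
     set_borel_measurable surface_measure (frontier \<Omega>) n \<and>
     (AE x in surface_measure. x \<in> frontier \<Omega> \<longrightarrow> outward_unit_normal_at \<Omega> x (n x))"

text \<open>
  Lipschitz hypersurfaces may have a boundary: locally they are bi-Lipschitz to a relatively open
  subset of a hyperplane (case \<open>w = 0\<close>) or of a closed half-hyperplane (case \<open>w \<noteq> 0\<close>).
\<close>

definition lipschitz_hypersurface :: "(real^'d) set \<Rightarrow> bool" where
  "lipschitz_hypersurface S \<longleftrightarrow>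
     (\<forall>x\<in>S. \<exists>V W e w L (\<phi> :: real^'d \<Rightarrow> real^'d).
        open V \<and> x \<in> V \<and> norm e = 1 \<and> w \<bullet> e = 0 \<and>
        openin (top_of_set {z. z \<bullet> e = 0 \<and> 0 \<le> z \<bullet> w}) W \<and>
        0 < L \<and> \<phi> ` (S \<inter> V) = W \<and>
        (\<forall>y\<in>S \<inter> V. \<forall>z\<in>S \<inter> V. dist y z / L \<le> dist (\<phi> y) (\<phi> z) \<and> dist (\<phi> y) (\<phi> z) \<le> L * dist y z))"


section \<open>Open continuum thermodynamic systems\<close>

text \<open>
  The admissible field space and the thermodynamic potential are determined by the components
  \<open>Omega\<close>, \<open>states\<close>, \<open>psi\<close> and are therefore not components of their own.  The port spaces are the
  normed spaces \<open>'ye\<close> and \<open>'yf\<close>.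
\<close>

record ('d, 'm, 'ye, 'yf) thermo_system =
  Omega :: "(real^'d) set"
  normal :: "real^'d \<Rightarrow> real^'d"
  states :: "(real^'m) set"
  psi :: "real^'d \<Rightarrow> real^'m \<Rightarrow> real"
  Jrev :: "(real^'d \<Rightarrow> real^'m) \<Rightarrow> real^'d \<Rightarrow> real^'d^'m"
  Jdiss :: "(real^'d \<Rightarrow> real^'m) \<Rightarrow> real^'d \<Rightarrow> real^'d^'m"
  Rsrc :: "(real^'d \<Rightarrow> real^'m) \<Rightarrow> real^'d \<Rightarrow> real^'m"
  etrace :: "(real^'d \<Rightarrow> real^'m) \<Rightarrow> 'ye"
  ftrace :: "(real^'d \<Rightarrow> real^'m) \<Rightarrow> 'yf"
  pairing :: "'ye \<Rightarrow> 'yf \<Rightarrow> real"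

text \<open>The maps whose existence is required by thermodynamic admissibility.\<close>

record ('d, 'm) thermo_witness =
  qrev :: "(real^'d \<Rightarrow> real^'m) \<Rightarrow> real^'d \<Rightarrow> real^'d"
  qdiss :: "(real^'d \<Rightarrow> real^'m) \<Rightarrow> real^'d \<Rightarrow> real^'d"
  sigma :: "(real^'d \<Rightarrow> real^'m) \<Rightarrow> real^'d \<Rightarrow> real"

definition field_space :: "('d::finite, 'm::finite, 'ye, 'yf) thermo_system \<Rightarrow> (real^'d \<Rightarrow> real^'m) set" where
  "field_space T = {u. H1_on (Omega T) u \<and>
     (AE x in lebesgue. x \<in> Omega T \<longrightarrow> u x \<in> states T) \<and>
     set_integrable lebesgue (Omega T) (\<lambda>x. psi T x (u x))}"

definition potential ::
  "('d::finite, 'm::finite, 'ye, 'yf) thermo_system \<Rightarrow> (real^'d \<Rightarrow> real^'m) \<Rightarrow> real^'d \<Rightarrow> real^'m" where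
  "potential T u x = grad (psi T x) (u x)"

definition qtot ::
  "('d::finite, 'm::finite) thermo_witness \<Rightarrow> (real^'d \<Rightarrow> real^'m) \<Rightarrow> real^'d \<Rightarrow> real^'d" where
  "qtot W u x = qrev W u x + qdiss W u x"

text \<open>
  The functionals over a measurable part \<open>A\<close> of the domain; \<open>A = Omega T\<close> gives the global ones.
\<close>

definition free_energy_on ::
  "('d::finite, 'm::finite, 'ye, 'yf) thermo_system \<Rightarrow> (real^'d) set \<Rightarrow> (real^'d \<Rightarrow> real^'m) \<Rightarrow> real" where
  "free_energy_on T A u = (LINT x:A|lebesgue. psi T x (u x))"

definition dissipation_on ::
  "('d::finite, 'm::finite) thermo_witness \<Rightarrow> (real^'d) set \<Rightarrow> (real^'d \<Rightarrow> real^'m) \<Rightarrow> real" where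
  "dissipation_on W A u = (LINT x:A|lebesgue. sigma W u x)"

definition source_on ::
  "('d::finite, 'm::finite, 'ye, 'yf) thermo_system \<Rightarrow> (real^'d) set \<Rightarrow> (real^'d \<Rightarrow> real^'m) \<Rightarrow> real" where
  "source_on T A u = (LINT x:A|lebesgue. potential T u x \<bullet> Rsrc T u x)"

abbreviation free_energy :: "('d::finite, 'm::finite, 'ye, 'yf) thermo_system \<Rightarrow> (real^'d \<Rightarrow> real^'m) \<Rightarrow> real" where
  "free_energy T \<equiv> free_energy_on T (Omega T)"

abbreviation dissipation ::
  "('d::finite, 'm::finite, 'ye, 'yf) thermo_system \<Rightarrow> ('d, 'm) thermo_witness \<Rightarrow> (real^'d \<Rightarrow> real^'m) \<Rightarrow> real" where
  "dissipation T W \<equiv> dissipation_on W (Omega T)"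

abbreviation source :: "('d::finite, 'm::finite, 'ye, 'yf) thermo_system \<Rightarrow> (real^'d \<Rightarrow> real^'m) \<Rightarrow> real" where
  "source T \<equiv> source_on T (Omega T)"

definition boundary_exchange ::
  "('d::finite, 'm::finite, 'ye, 'yf) thermo_system \<Rightarrow> (real^'d \<Rightarrow> real^'m) \<Rightarrow> real" where
  "boundary_exchange T u = pairing T (etrace T u) (ftrace T u)"

text \<open>
  The concrete meaning of ``sufficiently smooth'' for a single field: \<open>u\<close> takes its values in the
  state set on all of \<open>closure \<Omega>\<close>, and \<open>u\<close>, the fluxes and the \<open>q\<close>-fields at \<open>u\<close> are \<open>C^1\<close> up to the
  boundary.  Then the divergences are classical and \<open>q\<close> has classical boundary values.
\<close>

definition smooth_field ::
  "('d::finite, 'm::finite, 'ye, 'yf) thermo_system \<Rightarrow> ('d, 'm) thermo_witness \<Rightarrow> (real^'d \<Rightarrow> real^'m) \<Rightarrow> bool" where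
  "smooth_field T W u \<longleftrightarrow> u \<in> field_space T \<and>
     u ` closure (Omega T) \<subseteq> states T \<and>
     Ck_on 1 (closure (Omega T)) u \<and>
     Ck_on 1 (closure (Omega T)) (Jrev T u) \<and> Ck_on 1 (closure (Omega T)) (Jdiss T u) \<and>
     Ck_on 1 (closure (Omega T)) (qrev W u) \<and> Ck_on 1 (closure (Omega T)) (qdiss W u)"

definition open_constitutive_structure ::
  "('d::finite, 'm::finite, 'ye::real_normed_vector, 'yf::real_normed_vector) thermo_system \<Rightarrow> bool" where
  "open_constitutive_structure T \<longleftrightarrow>
     L1_valued_map (Omega T) (field_space T) (Jrev T) \<and>
     L1_valued_map (Omega T) (field_space T) (Jdiss T) \<and>
     L1_valued_map (Omega T) (field_space T) (Rsrc T) \<and>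
     (\<forall>u\<in>field_space T. \<forall>v\<in>field_space T. ae_eq_on (Omega T) u v \<longrightarrow>
        etrace T u = etrace T v \<and> ftrace T u = ftrace T v) \<and>
     bounded_bilinear (pairing T)"

definition thermodynamically_admissible ::
  "('d::finite, 'm::finite, 'ye, 'yf) thermo_system \<Rightarrow> ('d, 'm) thermo_witness \<Rightarrow> bool" where
  "thermodynamically_admissible T W \<longleftrightarrow>
     L1_valued_map (Omega T) (field_space T) (qrev W) \<and>
     L1_valued_map (Omega T) (field_space T) (qdiss W) \<and>
     L1_valued_map (Omega T) (field_space T) (sigma W) \<and>
     (\<forall>u. smooth_field T W u \<longrightarrow>
        (\<forall>\<phi>\<in>test_functions (Omega T).
           (LINT x:Omega T|lebesgue. (potential T u x \<bullet> mdiv (Jrev T u) x) * \<phi> x) =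
           - (LINT x:Omega T|lebesgue. qrev W u x \<bullet> grad \<phi> x)) \<and>
        (\<forall>\<phi>\<in>test_functions (Omega T).
           (LINT x:Omega T|lebesgue. (potential T u x \<bullet> mdiv (Jdiss T u) x) * \<phi> x) =
           - (LINT x:Omega T|lebesgue. qdiss W u x \<bullet> grad \<phi> x)
           + (LINT x:Omega T|lebesgue. sigma W u x * \<phi> x)) \<and>
        (AE x in lebesgue. x \<in> Omega T \<longrightarrow> 0 \<le> sigma W u x) \<and>
        - (LINT x:frontier (Omega T)|surface_measure. qtot W u x \<bullet> normal T x) =
          boundary_exchange T u \<and>
        set_integrable lebesgue (Omega T) (\<lambda>x. potential T u x \<bullet> Rsrc T u x))"

definition open_thermodynamic_system ::
  "('d::finite, 'm::finite, 'ye::real_normed_vector, 'yf::real_normed_vector) thermo_system \<Rightarrow>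
   ('d, 'm) thermo_witness \<Rightarrow> bool" where
  "open_thermodynamic_system T W \<longleftrightarrow>
     bounded_lipschitz_domain (Omega T) \<and>
     outward_unit_normal (Omega T) (normal T) \<and>
     open (states T) \<and> convex (states T) \<and> states T \<noteq> {} \<and>
     Ck_on 2 (closure (Omega T) \<times> states T) (\<lambda>(x, w). psi T x w) \<and>
     (\<forall>x\<in>closure (Omega T). convex_on (states T) (psi T x)) \<and>
     open_constitutive_structure T \<and>
     thermodynamically_admissible T W"

text \<open>
  Smooth trajectories: every \<open>u t\<close> is a smooth field, \<open>u\<close> and \<open>\<partial>\<^sub>t u\<close> are continuous on
  \<open>[0,\<tau>] \<times> closure \<Omega>\<close>, and the remaining terms of the evolution equation are continuous on
  \<open>[0,\<tau>] \<times> \<Omega>\<close>.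
\<close>

definition smooth_admissible_trajectory ::
  "('d::finite, 'm::finite, 'ye, 'yf) thermo_system \<Rightarrow> ('d, 'm) thermo_witness \<Rightarrow> real \<Rightarrow>
   (real \<Rightarrow> real^'d \<Rightarrow> real^'m) \<Rightarrow> bool" where
  "smooth_admissible_trajectory T W \<tau> u \<longleftrightarrow>
     0 < \<tau> \<and>
     (\<forall>t\<in>{0..\<tau>}. smooth_field T W (u t)) \<and>
     continuous_on ({0..\<tau>} \<times> closure (Omega T)) (\<lambda>(t, x). u t x) \<and>
     continuous_on ({0..\<tau>} \<times> Omega T) (\<lambda>(t, x). mdiv (\<lambda>y. Jrev T (u t) y + Jdiss T (u t) y) x) \<and>
     continuous_on ({0..\<tau>} \<times> Omega T) (\<lambda>(t, x). Rsrc T (u t) x) \<and>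
     (\<exists>u'. continuous_on ({0..\<tau>} \<times> closure (Omega T)) (\<lambda>(t, x). u' t x) \<and>
        (\<forall>t\<in>{0..\<tau>}. \<forall>x\<in>closure (Omega T).
           ((\<lambda>s. u s x) has_vector_derivative u' t x) (at t within {0..\<tau>})) \<and>
        (AE (t, x) in (lebesgue :: (real \<times> (real^'d)) measure). t \<in> {0<..<\<tau>} \<and> x \<in> Omega T \<longrightarrow>
           u' t x + mdiv (\<lambda>y. Jrev T (u t) y + Jdiss T (u t) y) x = Rsrc T (u t) x))"

definition thermodynamically_consistent ::
  "('d::finite, 'm::finite, 'ye, 'yf) thermo_system \<Rightarrow> ('d, 'm) thermo_witness \<Rightarrow> bool" where
  "thermodynamically_consistent T W \<longleftrightarrow>
     (\<forall>\<tau> u. smooth_admissible_trajectory T W \<tau> u \<longrightarrow>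
        (\<forall>t\<in>{0..\<tau>}. ((\<lambda>s. free_energy T (u s)) has_real_derivative
           - dissipation T W (u t) + boundary_exchange T (u t) + source T (u t)) (at t within {0..\<tau>})))"


section \<open>Partitions and local functionals\<close>

definition interface :: "(real^'d) set \<Rightarrow> (nat \<Rightarrow> (real^'d) set) \<Rightarrow> nat \<Rightarrow> nat \<Rightarrow> (real^'d) set" where
  "interface \<Omega> P i j = frontier (P i) \<inter> frontier (P j) \<inter> \<Omega>"

text \<open>The parts are \<open>P 1, \<dots>, P N\<close>, and \<open>n i\<close> is the outward unit normal of \<open>P i\<close>.\<close>

definition compatible_partition ::
  "(real^'d) set \<Rightarrow> nat \<Rightarrow> (nat \<Rightarrow> (real^'d) set) \<Rightarrow> (nat \<Rightarrow> real^'d \<Rightarrow> real^'d) \<Rightarrow> bool" where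
  "compatible_partition \<Omega> N P n \<longleftrightarrow>
     (\<forall>i\<in>{1..N}. P i \<subseteq> \<Omega> \<and> bounded_lipschitz_domain (P i) \<and> outward_unit_normal (P i) (n i)) \<and>
     closure \<Omega> = (\<Union>i\<in>{1..N}. closure (P i)) \<and>
     (\<forall>i\<in>{1..N}. \<forall>j\<in>{1..N}. i \<noteq> j \<longrightarrow> interior (P i) \<inter> interior (P j) = {}) \<and>
     (\<forall>i\<in>{1..N}. \<forall>j\<in>{1..N}. i \<noteq> j \<longrightarrow>
        interface \<Omega> P i j = {} \<or>
        lipschitz_hypersurface (interface \<Omega> P i j) \<and>
        (AE x in surface_measure. x \<in> interface \<Omega> P i j \<longrightarrow> n j x = - n i x))"

definition exchange_ext ::
  "('d::finite, 'm::finite, 'ye, 'yf) thermo_system \<Rightarrow> ('d, 'm) thermo_witness \<Rightarrow>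
   (nat \<Rightarrow> (real^'d) set) \<Rightarrow> (nat \<Rightarrow> real^'d \<Rightarrow> real^'d) \<Rightarrow> nat \<Rightarrow> (real^'d \<Rightarrow> real^'m) \<Rightarrow> real" where
  "exchange_ext T W P n i u =
     - (LINT x:frontier (P i) \<inter> frontier (Omega T)|surface_measure. qtot W u x \<bullet> n i x)"

definition exchange_int ::
  "('d::finite, 'm::finite, 'ye, 'yf) thermo_system \<Rightarrow> ('d, 'm) thermo_witness \<Rightarrow> nat \<Rightarrow>
   (nat \<Rightarrow> (real^'d) set) \<Rightarrow> (nat \<Rightarrow> real^'d \<Rightarrow> real^'d) \<Rightarrow> nat \<Rightarrow> (real^'d \<Rightarrow> real^'m) \<Rightarrow> real" where
  "exchange_int T W N P n i u =
     - (\<Sum>j\<in>{1..N} - {i}. LINT x:interface (Omega T) P i j|surface_measure. qtot W u x \<bullet> n i x)"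

definition local_rate ::
  "('d::finite, 'm::finite, 'ye, 'yf) thermo_system \<Rightarrow> ('d, 'm) thermo_witness \<Rightarrow> nat \<Rightarrow>
   (nat \<Rightarrow> (real^'d) set) \<Rightarrow> (nat \<Rightarrow> real^'d \<Rightarrow> real^'d) \<Rightarrow> nat \<Rightarrow> (real^'d \<Rightarrow> real^'m) \<Rightarrow> real" where
  "local_rate T W N P n i u =
     - dissipation_on W (P i) u + exchange_ext T W P n i u + exchange_int T W N P n i u
     + source_on T (P i) u"

end

theory Submission
  imports Defs
begin

text \<open>
  On a single part \<open>P i\<close> the balance has four ingredients.  Differentiation under the integral sign
  (\<open>free_energy_on_derivative\<close>) gives \<open>d/dt F\<^sub>i = \<integral> \<mu> \<bullet> \<partial>\<^sub>t u\<close>, and the evolution equation replaces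
  \<open>\<partial>\<^sub>t u\<close> by \<open>R - div (Jrev + Jdiss)\<close>.  The distributional identities of thermodynamic admissibility,
  tested against smooth functions that increase to the indicator of \<open>P i\<close>, turn the integral of
  \<open>\<mu> \<bullet> div J\<close> over \<open>P i\<close> into the dissipation plus the integral of \<open>div q\<close> (\<open>weak_divergence_integral\<close>,
  \<open>local_power_identity\<close>), and the divergence theorem turns the latter into the flux of \<open>q\<close> through the
  frontier of \<open>P i\<close>.  Finally, up to surface null sets that frontier is the disjoint union of its
  part on the frontier of the domain and of the interfaces (\<open>part_boundary_integral\<close>).

  The sums over the parts are additive for the same geometric reason: where two sets have outward
  normals at a common point, nested sets have equal normals and disjoint sets have opposite ones.
  Hence almost every point of the outer boundary lies on exactly one part, with the normal of the
  domain, and the two fluxes through an interface cancel.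

  The substance is the divergence theorem on a bounded Lipschitz domain with respect to Hausdorff
  measure (\<open>divergence_theorem_lipschitz\<close>).  Near a boundary point the domain is \<open>{G < 0}\<close> for a
  Lipschitz function \<open>G\<close> that grows with unit speed in a direction \<open>e\<close>.  The integral of \<open>\<partial>\<^sub>v \<phi>\<close> over
  \<open>{G < 0}\<close> is the limit, as \<open>h\<close> tends to \<open>0\<close>, of \<open>1/h\<close> times the signed integral of \<open>\<phi>\<close> over the region
  between the graph \<open>{G = 0}\<close> and its translate by \<open>h v\<close>.  Slicing this region along \<open>e\<close> expresses the limit
  as the integral of \<open>\<phi> \<partial>\<^sub>v G\<close> over the graph, with respect to the area of the projection along \<open>e\<close>
  (\<open>graph_measure\<close>).  At a point with outward normal \<open>n\<close> one has \<open>\<partial>\<^sub>v G = (v \<bullet> n) / (e \<bullet> n)\<close>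
  (\<open>G_directional_derivative\<close>), while projected area has the density \<open>e \<bullet> n\<close> with respect to surface
  measure (\<open>graph_measure_density\<close>); the product is the flux density \<open>v \<bullet> n\<close>.

  The density of projected area is found by cutting the graph into countably many pieces that are
  almost flat.  Projections of such a piece onto hyperplanes along \<open>e\<close> are almost isometric, and on
  hyperplanes the surface measure is tied to volume by Cavalieri's principle
  (\<open>emeasure_lborel_slices\<close>), which follows from the uniqueness of translation invariant measures.
\<close>

section \<open>The Hausdorff outer measure is a Borel measure\<close>

lemma hausdorff_pre_le:
  assumes "A \<subseteq> (\<Union>n. C n)" "\<And>n. bounded (C n)" "\<And>n. diameter (C n) \<le> \<delta>"
  shows "hausdorff_pre k \<delta> A \<le> (\<Sum>n. if C n = {} then 0 else ennreal (diameter (C n) ^ k))"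
  unfolding hausdorff_pre_def using assms by (intro INF_lower) auto

lemma hausdorff_pre_ge:
  assumes "\<And>C :: nat \<Rightarrow> 'a::metric_space set. A \<subseteq> (\<Union>n. C n) \<Longrightarrow> (\<And>n. bounded (C n)) \<Longrightarrow>
     (\<And>n. diameter (C n) \<le> \<delta>) \<Longrightarrow> b \<le> (\<Sum>n. if C n = {} then 0 else ennreal (diameter (C n) ^ k))"
  shows "b \<le> hausdorff_pre k \<delta> A"
  unfolding hausdorff_pre_def using assms by (intro INF_greatest) auto

lemma hausdorff_pre_antimono: "\<delta> \<le> \<delta>' \<Longrightarrow> hausdorff_pre k \<delta>' A \<le> hausdorff_pre k \<delta> A"
  by (rule hausdorff_pre_ge, rule hausdorff_pre_le) (auto intro: order_trans)

lemma hausdorff_pre_mono: "A \<subseteq> B \<Longrightarrow> hausdorff_pre k \<delta> A \<le> hausdorff_pre k \<delta> B"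
  by (rule hausdorff_pre_ge, rule hausdorff_pre_le) auto

lemma hausdorff_pre_empty:
  assumes "0 \<le> \<delta>" shows "hausdorff_pre k \<delta> {} = 0"
  using hausdorff_pre_le[of "{}" "\<lambda>_. {}" \<delta> k] assms by simp

text \<open>
  Nearly optimal covers of the \<open>A n\<close>, with errors that add up to \<open>e\<close>, are enumerated along the
  diagonals of \<open>\<nat> \<times> \<nat>\<close> to a single cover of the union.
\<close>

lemma hausdorff_pre_countable_subadditive:
  fixes A :: "nat \<Rightarrow> 'a::metric_space set"
  shows "hausdorff_pre k \<delta> (\<Union>n. A n) \<le> (\<Sum>n. hausdorff_pre k \<delta> (A n))"
proof (rule ennreal_le_epsilon)
  fix e :: real assume fin: "(\<Sum>n. hausdorff_pre k \<delta> (A n)) < top" and "0 < e"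
  have fin': "hausdorff_pre k \<delta> (A n) < top" for n
    using fin ennreal_suminf_lessD by blast
  define w where "w C = (if C = {} then 0 else ennreal (diameter C ^ k))" for C :: "'a set"
  have "\<exists>C. A n \<subseteq> (\<Union>m. C m) \<and> (\<forall>m. bounded (C m) \<and> diameter (C m) \<le> \<delta>) \<and>
      (\<Sum>m. w (C m)) \<le> hausdorff_pre k \<delta> (A n) + ennreal (e * (1/2) ^ Suc n)" for n
  proof -
    have "hausdorff_pre k \<delta> (A n) < hausdorff_pre k \<delta> (A n) + ennreal (e * (1/2) ^ Suc n)"
      using fin'[of n] \<open>0 < e\<close> by (simp add: ennreal_zero_less_mult_iff)
    then obtain C :: "nat \<Rightarrow> 'a set" where "C \<in> {C. A n \<subseteq> (\<Union>m. C m) \<and> (\<forall>m. bounded (C m) \<and> diameter (C m) \<le> \<delta>)}"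
        "(\<Sum>m. w (C m)) < hausdorff_pre k \<delta> (A n) + ennreal (e * (1/2) ^ Suc n)"
      unfolding hausdorff_pre_def[of k \<delta> "A n"] w_def INF_less_iff by (elim bexE)
    then show ?thesis by (intro exI[of _ C]) (simp add: less_imp_le)
  qed
  then have "\<exists>C. \<forall>n. A n \<subseteq> (\<Union>m. C n m) \<and> (\<forall>m. bounded (C n m) \<and> diameter (C n m) \<le> \<delta>) \<and>
      (\<Sum>m. w (C n m)) \<le> hausdorff_pre k \<delta> (A n) + ennreal (e * (1/2) ^ Suc n)"
    by (intro choice allI)
  then obtain C where C: "\<And>n. A n \<subseteq> (\<Union>m. C n m)" "\<And>n m. bounded (C n m)" "\<And>n m. diameter (C n m) \<le> \<delta>"
      "\<And>n. (\<Sum>m. w (C n m)) \<le> hausdorff_pre k \<delta> (A n) + ennreal (e * (1/2) ^ Suc n)"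
    by meson
  define D where "D i = (case prod_decode i of (n, m) \<Rightarrow> C n m)" for i
  have "hausdorff_pre k \<delta> (\<Union>n. A n) \<le> (\<Sum>i. w (D i))"
  unfolding w_def
  proof (rule hausdorff_pre_le)
    show "(\<Union>n. A n) \<subseteq> (\<Union>i. D i)"
    proof
      fix x assume "x \<in> (\<Union>n. A n)"
      then obtain n m where "x \<in> C n m" using C(1) by blast
      then have "x \<in> D (prod_encode (n, m))" by (simp add: D_def)
      then show "x \<in> (\<Union>i. D i)" by blast
    qed
  qed (auto simp: D_def C split: prod.split)
  also have "(\<Sum>i. w (D i)) = (\<Sum>n. \<Sum>m. w (C n m))"
    using suminf_ennreal_2dimen[of "\<lambda>n. \<Sum>m. w (C n m)" "\<lambda>(n,m). w (C n m)"]
    by (simp add: D_def split_beta)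
  also have "\<dots> \<le> (\<Sum>n. hausdorff_pre k \<delta> (A n) + ennreal (e * (1/2) ^ Suc n))"
    by (intro suminf_le C) auto
  also have "\<dots> = (\<Sum>n. hausdorff_pre k \<delta> (A n)) + (\<Sum>n. ennreal (e * (1/2) ^ Suc n))"
    by (intro suminf_add[symmetric]) auto
  also have "(\<Sum>n. ennreal (e * (1/2) ^ Suc n)) = ennreal e"
    using sums_mult[OF power_half_series, of e] \<open>0 < e\<close>
    by (subst suminf_ennreal_eq[where x=e]) (auto simp: field_simps)
  finally show "hausdorff_pre k \<delta> (\<Union>n. A n) \<le> (\<Sum>n. hausdorff_pre k \<delta> (A n)) + ennreal e" .
qed

lemma hausdorff_pre_Un: 
  assumes "0 \<le> \<delta>" shows "hausdorff_pre k \<delta> (A \<union> B) \<le> hausdorff_pre k \<delta> A + hausdorff_pre k \<delta> B"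
proof -
  have "hausdorff_pre k \<delta> (A \<union> B) \<le> (\<Sum>n. hausdorff_pre k \<delta> (binaryset A B n))"
    using hausdorff_pre_countable_subadditive[of k \<delta> "binaryset A B"] by (simp add: UN_binaryset_eq)
  also have "\<dots> = hausdorff_pre k \<delta> A + hausdorff_pre k \<delta> B"
    by (rule suminf_binaryset_eq) (simp add: hausdorff_pre_empty assms)
  finally show ?thesis .
qed

lemma hausdorff_pre_UN_finite:
  assumes "finite I" "0 \<le> \<delta>"
  shows "hausdorff_pre k \<delta> (\<Union>i\<in>I. A i) \<le> (\<Sum>i\<in>I. hausdorff_pre k \<delta> (A i))"
  using assms(1)
proof induction
  case empty then show ?case by (simp add: hausdorff_pre_empty assms)
next
  case (insert i I)
  then show ?case
    using hausdorff_pre_Un[OF assms(2), of k "A i" "\<Union>i\<in>I. A i"] by (auto intro: order_trans add_left_mono)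
qed

text \<open>
  The images of the pieces of a cover of \<open>A\<close> cover the image, and their diameters grow at most by
  the factor \<open>L\<close>; this changes the mesh from \<open>\<delta>\<close> to \<open>L * \<delta>\<close>, too.
\<close>

lemma hausdorff_pre_lipschitz:
  fixes f :: "'a::metric_space \<Rightarrow> 'b::metric_space"
  assumes "0 < L" and lip: "\<And>x y. x \<in> A \<Longrightarrow> y \<in> A \<Longrightarrow> dist (f x) (f y) \<le> L * dist x y"
  shows "hausdorff_pre k (L * \<delta>) (f ` A) \<le> ennreal (L ^ k) * hausdorff_pre k \<delta> A"
proof -
  have "hausdorff_pre k (L * \<delta>) (f ` A) \<le> ennreal (L ^ k) * (\<Sum>n. if C n = {} then 0 else ennreal (diameter (C n) ^ k))"
    if C: "A \<subseteq> (\<Union>n. C n)" "\<And>n. bounded (C n)" "\<And>n. diameter (C n) \<le> \<delta>" for C :: "nat \<Rightarrow> 'a set"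
  proof -
    define D where "D n = f ` (C n \<inter> A)" for n
    have D: "bounded (D n)" "diameter (D n) \<le> L * diameter (C n)" for n
    proof -
      have d: "dist (f x) (f y) \<le> L * diameter (C n)" if "x \<in> C n" "y \<in> C n" "x \<in> A" "y \<in> A" for x y
        using lip[OF that(3,4)] diameter_bounded_bound[OF C(2) that(1,2)] \<open>0 < L\<close>
        by (meson mult_left_mono less_imp_le order_trans)
      show "bounded (D n)"
        unfolding bounded_two_points D_def using d by (intro exI[of _ "L * diameter (C n)"]) auto
      show "diameter (D n) \<le> L * diameter (C n)"
      proof (cases "D n = {}")
        case True then show ?thesis using \<open>0 < L\<close> diameter_ge_0[OF C(2), of n] by simp
      next
        case False
        then have "(SUP (x, y)\<in>D n \<times> D n. dist x y) \<le> L * diameter (C n)"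
          using d by (intro cSUP_least) (auto simp: D_def)
        then show ?thesis using False by (simp add: diameter_def)
      qed
    qed
    have "hausdorff_pre k (L * \<delta>) (f ` A) \<le> (\<Sum>n. if D n = {} then 0 else ennreal (diameter (D n) ^ k))"
    proof (rule hausdorff_pre_le)
      show "f ` A \<subseteq> (\<Union>n. D n)" using C(1) unfolding D_def by blast
      show "diameter (D n) \<le> L * \<delta>" for n
        using D(2)[of n] C(3)[of n] \<open>0 < L\<close> by (meson mult_left_mono less_imp_le order_trans)
    qed (rule D)
    also have "\<dots> \<le> (\<Sum>n. ennreal (L ^ k) * (if C n = {} then 0 else ennreal (diameter (C n) ^ k)))"
    proof (intro suminf_le allI)
      fix n
      have "ennreal (diameter (D n) ^ k) \<le> ennreal ((L * diameter (C n)) ^ k)"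
        by (intro ennreal_leI power_mono D diameter_ge_0)
      also have "\<dots> = ennreal (L ^ k) * ennreal (diameter (C n) ^ k)"
        using \<open>0 < L\<close> diameter_ge_0[OF C(2)] by (simp add: power_mult_distrib ennreal_mult)
      finally show "(if D n = {} then 0 else ennreal (diameter (D n) ^ k)) \<le>
        ennreal (L ^ k) * (if C n = {} then 0 else ennreal (diameter (C n) ^ k))"
        by (auto simp: D_def)
    qed auto
    finally show ?thesis by simp
  qed
  note * = this
  have "hausdorff_pre k (L * \<delta>) (f ` A) / ennreal (L ^ k) \<le> hausdorff_pre k \<delta> A"
    using * \<open>0 < L\<close> by (intro hausdorff_pre_ge divide_le_posI_ennreal) (auto simp: mult.commute)
  then have "ennreal (L^k) * (hausdorff_pre k (L * \<delta>) (f ` A) / ennreal (L ^ k)) \<le> ennreal (L^k) * hausdorff_pre k \<delta> A"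
    by (rule mult_left_mono) simp
  then show ?thesis
    using \<open>0 < L\<close> by (simp add: ennreal_times_divide mult.commute[of "ennreal (L ^ k)" "hausdorff_pre k (L * \<delta>) (f ` A)"] mult_divide_eq_ennreal)
qed

lemma hausdorff_pre_le_outer: "0 < \<delta> \<Longrightarrow> hausdorff_pre k \<delta> A \<le> hausdorff_outer k A"
  unfolding hausdorff_outer_def by (rule SUP_upper) simp

lemma hausdorff_outer_mono: "A \<subseteq> B \<Longrightarrow> hausdorff_outer k A \<le> hausdorff_outer k B"
  unfolding hausdorff_outer_def by (rule SUP_mono) (use hausdorff_pre_mono in blast)

lemma hausdorff_outer_empty [simp]: "hausdorff_outer k {} = 0"
proof -
  have "hausdorff_outer k ({} :: 'a set) \<le> 0"
    unfolding hausdorff_outer_def by (rule SUP_least) (simp add: hausdorff_pre_empty)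
  then show ?thesis by simp
qed

lemma hausdorff_outer_countable_subadditive:
  "hausdorff_outer k (\<Union>n. A n) \<le> (\<Sum>n. hausdorff_outer k (A n))"
  unfolding hausdorff_outer_def[of k "\<Union>n. A n"]
proof (rule SUP_least)
  fix \<delta> :: real assume "\<delta> \<in> {0<..}"
  then have "(\<Sum>n. hausdorff_pre k \<delta> (A n)) \<le> (\<Sum>n. hausdorff_outer k (A n))"
    by (intro suminf_le) (auto intro: hausdorff_pre_le_outer)
  with hausdorff_pre_countable_subadditive[of k \<delta> A]
  show "hausdorff_pre k \<delta> (\<Union>n. A n) \<le> (\<Sum>n. hausdorff_outer k (A n))" by (rule order_trans)
qed

lemma hausdorff_outer_Un: "hausdorff_outer k (A \<union> B) \<le> hausdorff_outer k A + hausdorff_outer k B"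
proof -
  have "hausdorff_outer k (A \<union> B) \<le> (\<Sum>n. hausdorff_outer k (binaryset A B n))"
    using hausdorff_outer_countable_subadditive[of k "binaryset A B"] by (simp add: UN_binaryset_eq)
  also have "\<dots> = hausdorff_outer k A + hausdorff_outer k B"
    by (rule suminf_binaryset_eq) simp
  finally show ?thesis .
qed

lemma hausdorff_outer_lipschitz:
  fixes f :: "'a::metric_space \<Rightarrow> 'b::metric_space"
  assumes "0 < L" and lip: "\<And>x y. x \<in> A \<Longrightarrow> y \<in> A \<Longrightarrow> dist (f x) (f y) \<le> L * dist x y"
  shows "hausdorff_outer k (f ` A) \<le> ennreal (L ^ k) * hausdorff_outer k A"
  unfolding hausdorff_outer_def[of k "f ` A"]
proof (rule SUP_least)
  fix \<delta> :: real assume "\<delta> \<in> {0<..}"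
  then show "hausdorff_pre k \<delta> (f ` A) \<le> ennreal (L ^ k) * hausdorff_outer k A"
    using hausdorff_pre_lipschitz[OF assms, where k=k and \<delta>="\<delta> / L"] \<open>0 < L\<close>
      mult_left_mono[OF hausdorff_pre_le_outer[of "\<delta> / L" k A], of "ennreal (L ^ k)"]
    by (auto intro: order_trans)
qed

lemma hausdorff_outer_isometry:
  fixes f :: "'a::metric_space \<Rightarrow> 'b::metric_space"
  assumes iso: "\<And>x y. x \<in> A \<Longrightarrow> y \<in> A \<Longrightarrow> dist (f x) (f y) = dist x y"
  shows "hausdorff_outer k (f ` A) = hausdorff_outer k A"
proof (rule antisym)
  show "hausdorff_outer k (f ` A) \<le> hausdorff_outer k A"
    using hausdorff_outer_lipschitz[of 1 A f k] iso by simp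
  have "inj_on f A" by (intro inj_onI) (metis iso dist_eq_0_iff)
  then have "A = inv_into A f ` f ` A" by (simp add: inv_into_image_cancel)
  moreover have "hausdorff_outer k (inv_into A f ` f ` A) \<le> hausdorff_outer k (f ` A)"
  proof -
    have "dist (inv_into A f x) (inv_into A f y) \<le> 1 * dist x y" if "x \<in> f ` A" "y \<in> f ` A" for x y
      using that iso by (auto simp: inv_into_f_f[OF \<open>inj_on f A\<close>])
    from hausdorff_outer_lipschitz[OF _ this, where k=k] show ?thesis by simp
  qed
  ultimately show "hausdorff_outer k A \<le> hausdorff_outer k (f ` A)" by simp
qed

text \<open>
  A set of diameter less than \<open>d\<close> meets at most one of \<open>A\<close> and \<open>B\<close>, so that a sufficiently fine cover
  of the union splits into a cover of \<open>A\<close> and one of \<open>B\<close>.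
\<close>

lemma hausdorff_outer_separated:
  assumes "0 < d" and sep: "\<And>x y. x \<in> A \<Longrightarrow> y \<in> B \<Longrightarrow> d \<le> dist x y"
  shows "hausdorff_outer k A + hausdorff_outer k B \<le> hausdorff_outer k (A \<union> B)"
proof -
  let ?w = "\<lambda>C :: 'a set. if C = {} then 0 else ennreal (diameter C ^ k)"
  have small: "hausdorff_pre k \<delta> A + hausdorff_pre k \<delta> B \<le> hausdorff_pre k \<delta> (A \<union> B)" if "0 < \<delta>" "\<delta> < d" for \<delta>
  proof (rule hausdorff_pre_ge)
    fix C :: "nat \<Rightarrow> 'a set"
    assume C: "A \<union> B \<subseteq> (\<Union>n. C n)" "\<And>n. bounded (C n)" "\<And>n. diameter (C n) \<le> \<delta>"
    define CA where "CA n = (if C n \<inter> A = {} then {} else C n)" for n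
    define CB where "CB n = (if C n \<inter> B = {} then {} else C n)" for n
    have "hausdorff_pre k \<delta> A \<le> (\<Sum>n. ?w (CA n))" "hausdorff_pre k \<delta> B \<le> (\<Sum>n. ?w (CB n))"
    proof -
      have "A \<subseteq> (\<Union>n. CA n)" "B \<subseteq> (\<Union>n. CB n)"
        using C(1) unfolding CA_def CB_def by (auto; blast)+
      then show "hausdorff_pre k \<delta> A \<le> (\<Sum>n. ?w (CA n))" "hausdorff_pre k \<delta> B \<le> (\<Sum>n. ?w (CB n))"
        using C(2,3) \<open>0 < \<delta>\<close> by - (rule hausdorff_pre_le; simp add: CA_def CB_def; fail)+
    qed
    then have "hausdorff_pre k \<delta> A + hausdorff_pre k \<delta> B \<le> (\<Sum>n. ?w (CA n)) + (\<Sum>n. ?w (CB n))"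
      by (rule add_mono)
    also have "\<dots> = (\<Sum>n. ?w (CA n) + ?w (CB n))" by (rule suminf_add) auto
    also have "\<dots> \<le> (\<Sum>n. ?w (C n))"
    proof (intro suminf_le allI)
      fix n
      have "C n \<inter> A = {} \<or> C n \<inter> B = {}"
      proof (rule ccontr)
        assume "\<not> ?thesis"
        then obtain x y where "x \<in> C n" "x \<in> A" "y \<in> C n" "y \<in> B" by blast
        then show False
          using sep[of x y] diameter_bounded_bound[OF C(2)[of n], of x y] C(3)[of n] that by linarith
      qed
      then show "?w (CA n) + ?w (CB n) \<le> ?w (C n)" by (auto simp: CA_def CB_def)
    qed auto
    finally show "hausdorff_pre k \<delta> A + hausdorff_pre k \<delta> B \<le> (\<Sum>n. ?w (C n))" .
  qed
  have "hausdorff_pre k \<delta>1 A + hausdorff_pre k \<delta>2 B \<le> hausdorff_outer k (A \<union> B)" if "0 < \<delta>1" "0 < \<delta>2" for \<delta>1 \<delta>2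
  proof -
    define \<delta> where "\<delta> = min (min \<delta>1 \<delta>2) (d/2)"
    have "0 < \<delta>" "\<delta> < d" "\<delta> \<le> \<delta>1" "\<delta> \<le> \<delta>2" using that \<open>0 < d\<close> by (auto simp: \<delta>_def)
    then show ?thesis
      using small[of \<delta>] add_mono[OF hausdorff_pre_antimono[of \<delta> \<delta>1 k A] hausdorff_pre_antimono[of \<delta> \<delta>2 k B]]
        hausdorff_pre_le_outer[of \<delta> k "A \<union> B"] by (meson order_trans)
  qed
  then have "(SUP \<delta>2\<in>{0<..}. hausdorff_pre k \<delta>1 A + hausdorff_pre k \<delta>2 B) \<le> hausdorff_outer k (A \<union> B)" if "0 < \<delta>1" for \<delta>1
    using that by (intro SUP_least) auto
  then have "hausdorff_pre k \<delta>1 A + hausdorff_outer k B \<le> hausdorff_outer k (A \<union> B)" if "0 < \<delta>1" for \<delta>1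
    using that unfolding hausdorff_outer_def[of k B] by (subst ennreal_SUP_add_right) auto
  then have "(SUP \<delta>1\<in>{0<..}. hausdorff_pre k \<delta>1 A + hausdorff_outer k B) \<le> hausdorff_outer k (A \<union> B)"
    by (intro SUP_least) auto
  then show ?thesis
    unfolding hausdorff_outer_def[of k A]
    by (subst ennreal_SUP_add_left[symmetric]) auto
qed

lemma hausdorff_outer_space: "outer_measure_space (Pow UNIV) (hausdorff_outer k)"
  unfolding outer_measure_space_def positive_def increasing_def countably_subadditive_def
  by (auto intro: hausdorff_outer_mono hausdorff_outer_countable_subadditive)

text \<open>
  Caratheodory's criterion for a closed set \<open>F\<close>.  The sets \<open>a n\<close> of points of \<open>A\<close> at distance at least
  \<open>1 / (n + 1)\<close> from \<open>F\<close> exhaust \<open>A - F\<close> and are separated from \<open>F\<close>.  Among the rings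
  \<open>r n = a (n + 1) - a n\<close> any two of the same parity are separated, so the outer measures of all
  rings have a finite sum, and \<open>A - F\<close> exceeds \<open>a n\<close> by a set of arbitrarily small outer measure.
\<close>

lemma hausdorff_outer_closed_cut:
  fixes F :: "'a::metric_space set"
  assumes "closed F"
  shows "hausdorff_outer k (A \<inter> F) + hausdorff_outer k (A - F) = hausdorff_outer k A"
proof (rule antisym)
  let ?H = "hausdorff_outer k"
  show "?H A \<le> ?H (A \<inter> F) + ?H (A - F)"
    using hausdorff_outer_Un[of k "A \<inter> F" "A - F"] by (simp add: Int_Diff_Un)
  show "?H (A \<inter> F) + ?H (A - F) \<le> ?H A"
  proof (cases "F = {} \<or> ?H A = \<infinity>")
    case True then show ?thesis by auto
  next
    case False
    then have "F \<noteq> {}" and fin: "?H A < \<infinity>" by (auto simp: less_top)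
    define a where "a n = {x\<in>A. 1 / real (Suc n) \<le> infdist x F}" for n
    define r where "r n = a (Suc n) - a n" for n
    have a_sub: "a n \<subseteq> A - F" for n using infdist_zero[of _ F] by (force simp: a_def)
    have a_mono: "a m \<subseteq> a n" if "m \<le> n" for m n
    proof -
      have "1 / real (Suc n) \<le> 1 / real (Suc m)" using that by (auto intro!: divide_left_mono)
      then show ?thesis by (auto simp: a_def)
    qed
    have a_F: "?H (A \<inter> F) + ?H (a n) \<le> ?H A" for n
    proof -
      have "1 / real (Suc n) \<le> dist x y" if "x \<in> A \<inter> F" "y \<in> a n" for x y
        using that infdist_le[of x F y] by (auto simp: a_def dist_commute)
      then have "?H (A \<inter> F) + ?H (a n) \<le> ?H ((A \<inter> F) \<union> a n)"
        by (intro hausdorff_outer_separated) auto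
      also have "\<dots> \<le> ?H A" using a_sub[of n] by (intro hausdorff_outer_mono) auto
      finally show ?thesis .
    qed
    have gap: "\<exists>d>0. \<forall>x\<in>r n. \<forall>y\<in>a m. m + 1 \<le> n \<longrightarrow> d \<le> dist x y" for m n
    proof (cases "m + 1 \<le> n")
      case True
      have lt: "1 / real (Suc n) < 1 / real (Suc m)" using True by (auto simp: field_simps)
      have "1 / real (Suc m) - 1 / real (Suc n) \<le> dist x y" if "x \<in> r n" "y \<in> a m" for x y
      proof -
        have "infdist x F < 1 / real (Suc n)" "1 / real (Suc m) \<le> infdist y F"
          using that by (auto simp: r_def a_def not_le)
        moreover have "infdist y F \<le> infdist x F + dist x y"
          using infdist_triangle[of y F x] by (simp add: dist_commute)
        ultimately show ?thesis by linarith
      qed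
      then show ?thesis using lt by (intro exI[of _ "1 / real (Suc m) - 1 / real (Suc n)"]) auto
    qed (auto intro: exI[of _ 1])
    have r_a: "r n \<subseteq> a (Suc n)" for n by (auto simp: r_def)
    \<comment> \<open>The offset \<open>p\<close> selects the rings of even or of odd index.\<close>
    have sumr: "(\<Sum>j<n. ?H (r (2 * j + p))) \<le> ?H (\<Union>j<n. r (2 * j + p))" for n p
    proof (induction n)
      case 0 then show ?case by simp
    next
      case (Suc n)
      let ?U = "\<Union>j<n. r (2 * j + p)"
      have U: "?U \<subseteq> a (2 * n + p - 1)"
      proof -
        have "r (2 * j + p) \<subseteq> a (2 * n + p - 1)" if "j < n" for j
        proof -
          have "Suc (2 * j + p) \<le> 2 * n + p - 1" using that by linarith
          from r_a a_mono[OF this] show ?thesis by (rule subset_trans)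
        qed
        then show ?thesis by blast
      qed
      have "?H (r (2 * n + p)) + ?H ?U \<le> ?H (r (2 * n + p) \<union> ?U)"
      proof (cases "n = 0")
        case False
        obtain d where "d > 0" "\<forall>x\<in>r (2 * n + p). \<forall>y\<in>a (2 * n + p - 1). d \<le> dist x y"
          using gap[of "2 * n + p" "2 * n + p - 1"] False by auto
        then show ?thesis using U by (intro hausdorff_outer_separated[of d]) auto
      qed simp
      moreover have "(\<Union>j<Suc n. r (2 * j + p)) = r (2 * n + p) \<union> ?U" by (simp add: lessThan_Suc)
      ultimately show ?case using Suc.IH by (auto simp: add.commute intro: order_trans add_left_mono)
    qed
    have sum_le: "(\<Sum>j. ?H (r (2 * j + p))) \<le> ?H A" for p
    proof (rule suminf_le_const)
      fix n
      have "(\<Union>j<n. r (2 * j + p)) \<subseteq> A" using r_a a_sub by blast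
      then show "(\<Sum>j<n. ?H (r (2 * j + p))) \<le> ?H A"
        using order_trans[OF sumr hausdorff_outer_mono] by blast
    qed auto
    have "(\<Sum>n. ?H (r n)) \<le> ?H A + ?H A"
    proof (rule suminf_le_const)
      fix n
      have "(\<Sum>j<n. ?H (r j)) \<le> (\<Sum>j<2*n. ?H (r j))" by (intro sum_mono2) auto
      also have "\<dots> = (\<Sum>j<n. ?H (r (2 * j + 0))) + (\<Sum>j<n. ?H (r (2 * j + 1)))"
        by (induction n) (auto simp: algebra_simps)
      also have "\<dots> \<le> (\<Sum>j. ?H (r (2 * j + 0))) + (\<Sum>j. ?H (r (2 * j + 1)))"
        by (intro add_mono sum_le_suminf) auto
      also have "\<dots> \<le> ?H A + ?H A" by (intro add_mono sum_le)
      finally show "(\<Sum>j<n. ?H (r j)) \<le> ?H A + ?H A" .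
    qed auto
    then have fin_r: "(\<Sum>n. ?H (r n)) < top" using fin by (auto simp: top_unique less_top[symmetric])
    have tail: "?H (A \<inter> F) + ?H (A - F) \<le> ?H A + (\<Sum>j. ?H (r (j + n)))" for n
    proof -
      have cover: "A - F \<subseteq> a n \<union> (\<Union>j. r (j + n))"
      proof
        fix x assume x: "x \<in> A - F"
        then have "0 < infdist x F" using infdist_pos_not_in_closed[OF assms \<open>F \<noteq> {}\<close>] by blast
        then obtain m where "1 / real (Suc m) < infdist x F"
          by (metis inverse_eq_divide reals_Archimedean)
        then have "\<exists>m. x \<in> a m" using x by (auto simp: a_def intro: less_imp_le)
        then obtain m where m: "x \<in> a m" "\<And>i. i < m \<Longrightarrow> x \<notin> a i"
          using exists_least_iff[of "\<lambda>m. x \<in> a m"] by auto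
        show "x \<in> a n \<union> (\<Union>j. r (j + n))"
        proof (cases "m \<le> n")
          case True then show ?thesis using m a_mono by blast
        next
          case False
          then have "x \<in> r ((m - 1 - n) + n)" using m by (auto simp: r_def)
          then show ?thesis by blast
        qed
      qed
      have "?H (A - F) \<le> ?H (a n) + ?H (\<Union>j. r (j + n))"
        using hausdorff_outer_mono[OF cover, of k] hausdorff_outer_Un[of k "a n" "\<Union>j. r (j + n)"] by (rule order_trans)
      also have "\<dots> \<le> ?H (a n) + (\<Sum>j. ?H (r (j + n)))"
        by (intro add_left_mono hausdorff_outer_countable_subadditive)
      finally have "?H (A \<inter> F) + ?H (A - F) \<le> ?H (A \<inter> F) + (?H (a n) + (\<Sum>j. ?H (r (j + n))))"
        by (rule add_left_mono)
      also have "\<dots> \<le> ?H A + (\<Sum>j. ?H (r (j + n)))"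
        using add_right_mono[OF a_F[of n]] by (simp add: add.assoc)
      finally show ?thesis .
    qed
    have "(\<lambda>n. ?H A + (\<Sum>j. ?H (r (j + n)))) \<longlonglongrightarrow> ?H A + 0"
    proof (intro tendsto_add tendsto_const)
      have hn: "?H (r n) < top" for n using fin_r ennreal_suminf_lessD by blast
      define h where "h n = enn2real (?H (r n))" for n
      have h: "?H (r n) = ennreal (h n)" for n using hn[of n] by (simp add: h_def)
      have sm: "summable h"
      proof (rule summable_suminf_not_top)
        show "(\<Sum>n. ennreal (h n)) \<noteq> top" using fin_r by (simp add: h[symmetric])
      qed (simp add: h_def)
      have "(\<lambda>n. ennreal (\<Sum>j. h (j + n))) \<longlonglongrightarrow> ennreal 0"
        using suminf_exist_split2[OF sm] by (rule tendsto_ennrealI)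
      moreover have "(\<Sum>j. ?H (r (j + n))) = ennreal (\<Sum>j. h (j + n))" for n
      proof -
        have "summable (\<lambda>j. h (j + n))" using sm by (simp add: summable_iff_shift)
        then show ?thesis unfolding h by (intro suminf_ennreal2) (auto simp: h_def)
      qed
      ultimately show "(\<lambda>n. \<Sum>j. ?H (r (j + n))) \<longlonglongrightarrow> 0" by simp
    qed
    then show ?thesis using tail by (intro LIMSEQ_le_const) auto
  qed
qed

lemma sets_hausdorff_measure [simp, measurable_cong]: "sets (hausdorff_measure k) = sets borel"
  unfolding hausdorff_measure_def by (metis sets.sigma_sets_eq sets_measure_of space_borel subset_UNIV top_greatest Pow_UNIV)

lemma space_hausdorff_measure [simp]: "space (hausdorff_measure k) = UNIV"
  unfolding hausdorff_measure_def by (simp add: space_measure_of_conv)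

text \<open>
  Closed sets, hence all Borel sets, are measurable in the sense of Caratheodory, so the outer
  measure is countably additive on them.  This is needed before anything can be said about the
  measure: \<^const>\<open>measure_of\<close> returns the zero measure for a set function that is not countably additive.
\<close>

lemma emeasure_hausdorff_measure:
  assumes "A \<in> sets borel" shows "emeasure (hausdorff_measure k) A = hausdorff_outer k A"
proof -
  interpret s: sigma_algebra UNIV "Pow UNIV :: 'a set set" by (rule sigma_algebra_Pow)
  let ?L = "lambda_system UNIV (Pow UNIV) (hausdorff_outer k) :: 'a set set"
  have ms: "measure_space UNIV ?L (hausdorff_outer k)"
    by (rule s.caratheodory_lemma[OF hausdorff_outer_space])
  then have sa: "sigma_algebra UNIV ?L" by (simp add: measure_space_def)
  have "F \<in> ?L" if "closed F" for F :: "'a set"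
    using hausdorff_outer_closed_cut[OF that, of k]
    by (auto simp: lambda_system_def Int_commute Diff_eq)
  then have "sigma_sets UNIV (Collect closed) \<subseteq> ?L"
    by (intro sigma_algebra.sigma_sets_subset[OF sa]) auto
  then have sub: "sets borel \<subseteq> ?L" by (simp add: borel_eq_closed)
  have "measure_space UNIV (sets borel) (hausdorff_outer k :: 'a set \<Rightarrow> ennreal)"
    using ms sub sets.sigma_algebra_axioms[of "borel :: 'a measure"]
    by (auto simp: measure_space_def countably_additive_def positive_def subset_eq image_subset_iff)
  then show ?thesis
    unfolding hausdorff_measure_def using assms
    by (intro emeasure_measure_of_sigma) (auto simp: measure_space_def)
qed

section \<open>Surface measure on hyperplanes and Cavalieri's principle\<close>

lemma nn_integral_translate:
  fixes f :: "'a::euclidean_space \<Rightarrow> ennreal"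
  assumes [measurable]: "f \<in> borel_measurable borel"
  shows "(\<integral>\<^sup>+x. f (x + a) \<partial>lborel) = (\<integral>\<^sup>+x. f x \<partial>lborel)"
proof -
  have "(\<integral>\<^sup>+x. f x \<partial>lborel) = (\<integral>\<^sup>+x. f x \<partial>distr lborel borel ((+) a))"
    by (simp add: lborel_distr_plus)
  also have "\<dots> = (\<integral>\<^sup>+x. f (a + x) \<partial>lborel)"
    by (subst nn_integral_distr) auto
  finally show ?thesis by (simp add: add.commute)
qed

text \<open>
  Write \<open>M A * \<lambda> B\<close> as the double integral of \<open>indicator B y * indicator A x\<close>, replace \<open>x\<close> by \<open>x + y\<close>,
  exchange the integrals and replace \<open>y\<close> by \<open>y - x\<close>: then \<open>A\<close> is measured by Lebesgue measure and \<open>B\<close>,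
  after a reflection, by \<open>M\<close>.
\<close>

lemma haar_measure_unique:
  fixes M :: "'a::euclidean_space measure"
  assumes sets[measurable_cong]: "sets M = sets borel" and "sigma_finite_measure M"
    and trans: "\<And>a f. f \<in> borel_measurable borel \<Longrightarrow> (\<integral>\<^sup>+x. f (x + a) \<partial>M) = (\<integral>\<^sup>+x. f x \<partial>M)"
    and reflect: "\<And>f. f \<in> borel_measurable borel \<Longrightarrow> (\<integral>\<^sup>+x. f (- x) \<partial>M) = (\<integral>\<^sup>+x. f x \<partial>M)"
    and A[measurable]: "A \<in> sets borel" and B[measurable]: "B \<in> sets borel"
  shows "emeasure M A * emeasure lborel B = emeasure M B * emeasure lborel A"
proof -
  interpret M: sigma_finite_measure M by fact
  interpret P: pair_sigma_finite lborel M ..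
  have "emeasure M A * emeasure lborel B = (\<integral>\<^sup>+y. indicator B y * (\<integral>\<^sup>+x. indicator A x \<partial>M) \<partial>lborel)"
    by (simp add: nn_integral_multc mult.commute sets)
  also have "\<dots> = (\<integral>\<^sup>+y. indicator B y * (\<integral>\<^sup>+x. indicator A (x + y) \<partial>M) \<partial>lborel)"
    using trans[of "indicator A"] by simp
  also have "\<dots> = (\<integral>\<^sup>+y. \<integral>\<^sup>+x. indicator B y * indicator A (x + y) \<partial>M \<partial>lborel)"
    by (simp add: nn_integral_cmult)
  also have "\<dots> = (\<integral>\<^sup>+x. \<integral>\<^sup>+y. indicator B y * indicator A (x + y) \<partial>lborel \<partial>M)"
    by (rule P.Fubini'[symmetric]) measurable
  also have "\<dots> = (\<integral>\<^sup>+x. \<integral>\<^sup>+y. indicator B (y - x) * indicator A y \<partial>lborel \<partial>M)"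
  proof (rule nn_integral_cong)
    fix x
    show "(\<integral>\<^sup>+y. indicator B y * indicator A (x + y) \<partial>lborel) = (\<integral>\<^sup>+y. indicator B (y - x) * indicator A y \<partial>lborel)"
      using nn_integral_translate[of "\<lambda>y. indicator B (y - x) * indicator A y" x] by (simp add: add.commute)
  qed
  also have "\<dots> = (\<integral>\<^sup>+y. \<integral>\<^sup>+x. indicator B (y - x) * indicator A y \<partial>M \<partial>lborel)"
    by (rule P.Fubini') measurable
  also have "\<dots> = (\<integral>\<^sup>+y. (\<integral>\<^sup>+x. indicator B (y - x) \<partial>M) * indicator A y \<partial>lborel)"
    by (simp add: nn_integral_multc)
  also have "\<dots> = (\<integral>\<^sup>+y. (\<integral>\<^sup>+x. indicator B x \<partial>M) * indicator A y \<partial>lborel)"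
  proof -
    have "(\<integral>\<^sup>+x. indicator B (y - x) \<partial>M) = (\<integral>\<^sup>+x. indicator B x \<partial>M)" for y
      using reflect[of "\<lambda>x. indicator B (y + x)"] trans[of "indicator B" y] by (simp add: add.commute)
    then show ?thesis by simp
  qed
  also have "\<dots> = emeasure M B * emeasure lborel A"
    by (simp add: nn_integral_cmult sets)
  finally show ?thesis .
qed

text \<open>
  The image of Lebesgue measure under \<open>Q\<close> is again invariant, hence a multiple of Lebesgue measure;
  the factor is \<open>1\<close> because \<open>Q\<close> preserves the unit ball.
\<close>

lemma emeasure_lborel_orthogonal_vimage:
  fixes Q :: "real^'d \<Rightarrow> real^'d"
  assumes Q: "orthogonal_transformation Q" and A[measurable]: "A \<in> sets borel"
  shows "emeasure lborel (Q -` A) = emeasure lborel A"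
proof -
  have "bounded_linear Q" using Q by (simp add: orthogonal_transformation_def linear_conv_bounded_linear)
  then have "continuous_on UNIV Q" by (rule linear_continuous_on)
  then have [measurable]: "Q \<in> borel_measurable borel" by (rule borel_measurable_continuous_onI)
  have lin: "linear Q" using Q by (simp add: orthogonal_transformation_def)
  define M where "M = distr lborel borel Q"
  have em: "emeasure M C = emeasure lborel (Q -` C)" if "C \<in> sets borel" for C
    using that unfolding M_def by (subst emeasure_distr) auto
  have nn: "(\<integral>\<^sup>+x. f x \<partial>M) = (\<integral>\<^sup>+x. f (Q x) \<partial>lborel)" if "f \<in> borel_measurable borel" for f
    using that unfolding M_def by (subst nn_integral_distr) auto
  obtain Q' where Q': "\<And>x. Q (Q' x) = x"
    using orthogonal_transformation_surj[OF Q] by (metis surjD)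
  have "emeasure M A * emeasure lborel (ball 0 1 :: (real^'d) set) = emeasure M (ball 0 1) * emeasure lborel A"
  proof (rule haar_measure_unique)
    have "emeasure M (ball 0 (real n)) \<noteq> \<infinity>" for n
      using Q by (simp add: em vimage_def orthogonal_transformation_norm mem_ball dist_norm)
         (metis (no_types, lifting) Collect_cong ball_def dist_norm diff_0 norm_minus_cancel emeasure_lborel_ball_finite infinity_ennreal_def less_top top.not_eq_extremum)
    moreover have "(\<Union>n. ball 0 (real n)) = (UNIV :: (real^'d) set)"
      using reals_Archimedean2 by (auto simp: dist_norm)
    ultimately show "sigma_finite_measure M"
      by (intro sigma_finite_measure.intro exI[of _ "range (\<lambda>n. ball 0 (real n))"]) (auto simp: M_def)
  next
    fix a and f :: "real^'d \<Rightarrow> ennreal" assume [measurable]: "f \<in> borel_measurable borel"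
    have "(\<integral>\<^sup>+x. f (x + a) \<partial>M) = (\<integral>\<^sup>+x. f (Q (x + Q' a)) \<partial>lborel)"
      by (subst nn) (auto simp: linear_add[OF lin] Q')
    also have "\<dots> = (\<integral>\<^sup>+x. f x \<partial>M)"
      by (subst nn_integral_translate[of "\<lambda>x. f (Q x)"]) (auto simp: nn)
    finally show "(\<integral>\<^sup>+x. f (x + a) \<partial>M) = (\<integral>\<^sup>+x. f x \<partial>M)" .
  next
    fix f :: "real^'d \<Rightarrow> ennreal" assume [measurable]: "f \<in> borel_measurable borel"
    have "(lborel :: (real^'d) measure) = distr lborel borel uminus"
      using lborel_affine[of "-1" "0 :: real^'d"] by (simp add: density_1 cong: distr_cong)
    then have "(\<integral>\<^sup>+x. f (Q x) \<partial>lborel) = (\<integral>\<^sup>+x. f (Q x) \<partial>distr lborel borel uminus)" by simp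
    also have "\<dots> = (\<integral>\<^sup>+x. f (- Q x) \<partial>lborel)"
      by (subst nn_integral_distr) (auto simp: linear_neg[OF lin])
    finally show "(\<integral>\<^sup>+x. f (- x) \<partial>M) = (\<integral>\<^sup>+x. f x \<partial>M)" by (simp add: nn)
  qed (auto simp: M_def)
  moreover have "emeasure M (ball 0 1) = emeasure lborel (ball 0 1 :: (real^'d) set)"
    using Q by (subst em) (auto intro!: arg_cong[where f="emeasure lborel"] simp: orthogonal_transformation_norm)
  moreover have "emeasure lborel (ball 0 1 :: (real^'d) set) \<noteq> 0" "emeasure lborel (ball 0 1 :: (real^'d) set) \<noteq> top"
    using emeasure_lborel_ball_finite[of "0 :: real^'d" 1] 
    by (auto simp: emeasure_ball unit_ball_vol_pos[THEN less_imp_neq, THEN not_sym])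
  ultimately have "emeasure M A = emeasure lborel A"
    by (metis mult.commute ennreal_mult_cancel_left)
  then show ?thesis by (simp add: em)
qed

definition cube_face :: "'d \<Rightarrow> (real^'d) set" where
  "cube_face i = {z. z $ i = 0 \<and> (\<forall>j. j \<noteq> i \<longrightarrow> 0 \<le> z $ j \<and> z $ j \<le> 1)}"

lemma bounded_cube_face: "bounded (cube_face i)"
  by (rule bounded_subset[OF bounded_cbox[of 0 1]])
     (auto simp: cube_face_def mem_box_cart; metis order_refl zero_le_one)

text \<open>
  Self-similarity: the face is the union of \<open>2 ^ (d - 1)\<close> translates of its image under the scaling by
  \<open>1/2\<close>, and each of them contributes a fraction \<open>(1/2) ^ (d - 1)\<close> at half the mesh.  Therefore refining
  the mesh does not increase the covering sums.
\<close>

lemma hausdorff_cube_face_finite: "hausdorff_outer (CARD('d) - 1) (cube_face i :: (real^'d) set) < top"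
proof -
  let ?k = "CARD('d) - 1" and ?F = "cube_face i :: (real^'d) set"
  define f :: "'d set \<Rightarrow> real^'d \<Rightarrow> real^'d" where "f S x = (\<chi> j. (x $ j + (if j \<in> S then 1 else 0)) / 2)" for S x
  have df: "dist (f S x) (f S y) \<le> 1/2 * dist x y" for S x y
  proof -
    have "f S x - f S y = (1/2) *\<^sub>R (x - y)"
      by (simp add: f_def vec_eq_iff field_simps)
    then show ?thesis by (simp add: dist_norm)
  qed
  have cover: "?F \<subseteq> (\<Union>S\<in>Pow (UNIV - {i}). f S ` ?F)"
  proof
    fix z assume z: "z \<in> ?F"
    define S where "S = {j. j \<noteq> i \<and> 1/2 \<le> z $ j}"
    define x :: "real^'d" where "x = (\<chi> j. 2 * z $ j - (if j \<in> S then 1 else 0))"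
    have "z = f S x" by (simp add: f_def x_def vec_eq_iff)
    moreover have "x \<in> ?F" using z by (auto simp: cube_face_def x_def S_def not_le)
    ultimately show "z \<in> (\<Union>S\<in>Pow (UNIV - {i}). f S ` ?F)" by (auto simp: S_def)
  qed
  have half: "hausdorff_pre ?k (\<delta> / 2) ?F \<le> hausdorff_pre ?k \<delta> ?F" if "0 \<le> \<delta>" for \<delta>
  proof -
    have "hausdorff_pre ?k (\<delta> / 2) ?F \<le> hausdorff_pre ?k (\<delta> / 2) (\<Union>S\<in>Pow (UNIV - {i}). f S ` ?F)"
      by (rule hausdorff_pre_mono[OF cover])
    also have "\<dots> \<le> (\<Sum>S\<in>Pow (UNIV - {i}). hausdorff_pre ?k (\<delta> / 2) (f S ` ?F))"
      using that by (intro hausdorff_pre_UN_finite) auto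
    also have "\<dots> \<le> (\<Sum>S\<in>Pow (UNIV - {i} :: 'd set). ennreal ((1/2) ^ ?k) * hausdorff_pre ?k \<delta> ?F)"
      using hausdorff_pre_lipschitz[of "1/2" ?F, OF _ df] by (intro sum_mono) (auto simp: field_simps)
    also have "\<dots> = ennreal (2 ^ ?k) * (ennreal ((1/2) ^ ?k) * hausdorff_pre ?k \<delta> ?F)"
      by (simp add: card_Pow ennreal_power[symmetric])
    also have "\<dots> = hausdorff_pre ?k \<delta> ?F"
      by (simp add: mult.assoc[symmetric] ennreal_mult[symmetric] power_mult_distrib[symmetric])
    finally show ?thesis .
  qed
  define \<delta>0 where "\<delta>0 = diameter ?F + 1"
  have d0: "0 < \<delta>0" using diameter_ge_0[OF bounded_cube_face[of i]] by (simp add: \<delta>0_def)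
  have pow: "hausdorff_pre ?k (\<delta>0 / 2 ^ n) ?F \<le> hausdorff_pre ?k \<delta>0 ?F" for n
  proof (induction n)
    case (Suc n)
    then show ?case using half[of "\<delta>0 / 2 ^ n"] d0 by (auto simp: field_simps)
  qed simp
  have "hausdorff_outer ?k ?F \<le> hausdorff_pre ?k \<delta>0 ?F"
    unfolding hausdorff_outer_def
  proof (rule SUP_least)
    fix \<delta> :: real assume "\<delta> \<in> {0<..}"
    then obtain n where "(1/2) ^ n < \<delta> / \<delta>0"
      using real_arch_pow_inv[of "\<delta> / \<delta>0" "1/2"] d0 by auto
    then have "\<delta>0 / 2 ^ n \<le> \<delta>" using d0 by (simp add: field_simps power_divide)
    then show "hausdorff_pre ?k \<delta> ?F \<le> hausdorff_pre ?k \<delta>0 ?F"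
      using pow[of n] hausdorff_pre_antimono[of "\<delta>0 / 2 ^ n" \<delta> ?k ?F] by (meson order_trans)
  qed
  also have "\<dots> \<le> (\<Sum>n::nat. if (if n = 0 then ?F else {}) = {} then 0
       else ennreal (diameter (if n = 0 then ?F else {}) ^ ?k))"
    using bounded_cube_face[of i] d0
    by (intro hausdorff_pre_le) (auto simp: \<delta>0_def split: if_splits)
  also have "\<dots> = (\<Sum>n\<in>{0::nat}. if (if n = 0 then ?F else {}) = {} then 0
       else ennreal (diameter (if n = 0 then ?F else {}) ^ ?k))"
    by (intro suminf_finite) auto
  also have "\<dots> < top" by simp
  finally show ?thesis .
qed

lemma emeasure_unit_cube:
  "emeasure lborel (cbox 0 1 :: (real^'d) set) = 1" "emeasure lborel (box 0 1 :: (real^'d) set) = 1"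
proof -
  have ne: "cbox 0 1 \<noteq> ({} :: (real^'d) set)" by (simp add: interval_ne_empty_cart)
  have "emeasure lborel (cbox 0 1 :: (real^'d) set) = ennreal (measure lborel (cbox 0 1 :: (real^'d) set))"
    using emeasure_lborel_cbox_finite[of 0 "1 :: real^'d"] by (intro emeasure_eq_ennreal_measure) auto
  then show 1: "emeasure lborel (cbox 0 1 :: (real^'d) set) = 1"
    by (simp add: content_cbox_cart[OF ne])
  show "emeasure lborel (box 0 1 :: (real^'d) set) = 1"
    unfolding 1[symmetric] emeasure_lborel_cbox_eq emeasure_lborel_box_eq ..
qed

text \<open>
  A piece of diameter \<open>d\<close> of a cover of the face is contained in a cube of side \<open>2 d\<close> within the
  hyperplane.  Thickened by the unit interval in direction \<open>i\<close>, these cubes cover the unit cube, whose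
  volume is \<open>1\<close>.
\<close>

lemma hausdorff_cube_face_pos: "0 < hausdorff_outer (CARD('d) - 1) (cube_face i :: (real^'d) set)"
proof -
  let ?k = "CARD('d) - 1" and ?F = "cube_face i :: (real^'d) set"
  have "ennreal ((1/2) ^ ?k) \<le> hausdorff_pre ?k 1 ?F"
  proof (rule hausdorff_pre_ge)
    fix C :: "nat \<Rightarrow> (real^'d) set"
    assume C: "?F \<subseteq> (\<Union>n. C n)" "\<And>n. bounded (C n)" "\<And>n. diameter (C n) \<le> 1"
    define x where "x n = (SOME x. x \<in> C n)" for n
    define d where "d n = diameter (C n)" for n
    have d0: "0 \<le> d n" for n unfolding d_def by (rule diameter_ge_0[OF C(2)])
    define B :: "nat \<Rightarrow> (real^'d) set" where "B n = (if C n = {} then {} else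
      cbox (\<chi> j. if j = i then 0 else x n $ j - d n) (\<chi> j. if j = i then 1 else x n $ j + d n))" for n
    have cov: "cbox 0 1 \<subseteq> (\<Union>n. B n)"
    proof
      fix y :: "real^'d" assume y: "y \<in> cbox 0 1"
      define z :: "real^'d" where "z = (\<chi> j. if j = i then 0 else y $ j)"
      have "z \<in> ?F" using y by (auto simp: z_def cube_face_def mem_box_cart)
      then obtain n where n: "z \<in> C n" using C(1) by blast
      then have "x n \<in> C n" unfolding x_def by (rule someI)
      then have "dist z (x n) \<le> d n" unfolding d_def using n C(2) by (intro diameter_bounded_bound) auto
      then have "\<bar>z $ j - x n $ j\<bar> \<le> d n" for j
        using component_le_norm_cart[of "z - x n" j] by (simp add: dist_norm)
      then have "x n $ j - d n \<le> z $ j" "z $ j \<le> x n $ j + d n" for j by (smt (verit))+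
      moreover have "z $ j = y $ j" if "j \<noteq> i" for j using that by (simp add: z_def)
      ultimately have "y \<in> cbox (\<chi> j. if j = i then 0 else x n $ j - d n) (\<chi> j. if j = i then 1 else x n $ j + d n)"
        using y by (auto simp: mem_box_cart) (metis)+
      then have "y \<in> B n" using n by (auto simp: B_def)
      then show "y \<in> (\<Union>n. B n)" by blast
    qed
    have B: "emeasure lborel (B n) = ennreal (2 ^ ?k) * (if C n = {} then 0 else ennreal (d n ^ ?k))" for n
    proof (cases "C n = {}")
      case False
      let ?a = "\<chi> j. if j = i then 0 else x n $ j - d n" and ?b = "\<chi> j. if j = i then 1 else x n $ j + d n"
      have ne: "cbox ?a ?b \<noteq> {}" using d0[of n] by (auto simp: interval_ne_empty_cart(1))
      have "emeasure lborel (B n) = ennreal (measure lborel (cbox ?a ?b))"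
        using False emeasure_lborel_cbox_finite[of ?a ?b] by (simp add: B_def emeasure_eq_ennreal_measure)
      also have "measure lborel (cbox ?a ?b) = (\<Prod>j\<in>UNIV. if j = i then 1 else 2 * d n)"
        using content_cbox_cart[OF ne] by (auto intro!: prod.cong)
      also have "\<dots> = (2 * d n) ^ ?k"
      proof -
        have "(\<Prod>j\<in>UNIV. if j = i then 1 else 2 * d n) = (\<Prod>j\<in>UNIV - {i}. 2 * d n)"
          by (rule prod.mono_neutral_cong_right) auto
        then show ?thesis by simp
      qed
      finally show ?thesis using False d0[of n] by (simp add: power_mult_distrib ennreal_mult)
    qed (simp add: B_def)
    have "1 = emeasure lborel (cbox 0 1 :: (real^'d) set)"
      by (simp add: emeasure_unit_cube)
    also have "\<dots> \<le> emeasure lborel (\<Union>n. B n)"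
      by (rule emeasure_mono[OF cov]) (auto simp: B_def)
    also have "\<dots> \<le> (\<Sum>n. emeasure lborel (B n))"
      by (rule emeasure_subadditive_countably) (auto simp: B_def)
    also have "\<dots> = ennreal (2 ^ ?k) * (\<Sum>n. if C n = {} then 0 else ennreal (diameter (C n) ^ ?k))"
      unfolding B d_def by simp
    finally have "ennreal ((1/2) ^ ?k) * 1 \<le> ennreal ((1/2) ^ ?k) * (ennreal (2 ^ ?k) * (\<Sum>n. if C n = {} then 0 else ennreal (diameter (C n) ^ ?k)))"
      by (rule mult_left_mono) simp
    then show "ennreal ((1/2) ^ ?k) \<le> (\<Sum>n. if C n = {} then 0 else ennreal (diameter (C n) ^ ?k))"
      by (simp add: mult.assoc[symmetric] ennreal_mult[symmetric] power_mult_distrib[symmetric])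
  qed
  also have "\<dots> \<le> hausdorff_outer ?k ?F" by (rule hausdorff_pre_le_outer) simp
  finally show ?thesis by (rule less_le_trans[rotated]) simp
qed


text \<open>
  Hausdorff measure on the hyperplane orthogonal to \<open>e\<close>, as a measure on the whole space: then it can
  be multiplied with Lebesgue measure on the line spanned by \<open>e\<close>.
\<close>

definition hyperplane_measure :: "real^'d \<Rightarrow> (real^'d) measure" where
  "hyperplane_measure e = density (hausdorff_measure (CARD('d) - 1)) (indicator {z. z \<bullet> e = 0})"

lemma sets_hyperplane_measure [simp, measurable_cong]: "sets (hyperplane_measure e) = sets borel"
  by (simp add: hyperplane_measure_def)

lemma space_hyperplane_measure [simp]: "space (hyperplane_measure e) = UNIV"
  by (simp add: hyperplane_measure_def)

lemma emeasure_hyperplane_measure: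
  fixes e :: "real^'d"
  assumes [measurable]: "A \<in> sets borel"
  shows "emeasure (hyperplane_measure e) A = hausdorff_outer (CARD('d) - 1) {z. z \<bullet> e = 0 \<and> z \<in> A}"
proof -
  have "emeasure (hyperplane_measure e) A =
      emeasure (hausdorff_measure (CARD('d) - 1)) ({z. z \<bullet> e = 0} \<inter> A)"
    unfolding hyperplane_measure_def
    by (subst emeasure_density) (auto simp: indicator_inter_arith[symmetric] intro!: nn_integral_indicator)
  also have "{z. z \<bullet> e = 0} \<inter> A = {z. z \<bullet> e = 0 \<and> z \<in> A}" by auto
  finally show ?thesis by (simp add: emeasure_hausdorff_measure)
qed

lemma AE_hyperplane_measure: "AE z in hyperplane_measure e. z \<bullet> e = 0"
  unfolding hyperplane_measure_def by (subst AE_density) (auto simp: indicator_def)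

lemma nn_integral_hyperplane_isometry:
  fixes T :: "real^'d \<Rightarrow> real^'d"
  assumes [measurable]: "T \<in> borel_measurable borel" and f[measurable]: "f \<in> borel_measurable borel"
    and iso: "\<And>x y. dist (T x) (T y) = dist x y" and "surj T" and T: "\<And>x. T x \<bullet> e = 0 \<longleftrightarrow> x \<bullet> e = 0"
  shows "(\<integral>\<^sup>+z. f (T z) \<partial>hyperplane_measure e) = (\<integral>\<^sup>+z. f z \<partial>hyperplane_measure e)"
proof -
  have "distr (hyperplane_measure e) borel T = hyperplane_measure e"
  proof (rule measure_eqI)
    fix A assume "A \<in> sets (distr (hyperplane_measure e) borel T)"
    then have [measurable]: "A \<in> sets borel" by simp
    have im: "{z. z \<bullet> e = 0 \<and> z \<in> A} = T ` {z. z \<bullet> e = 0 \<and> T z \<in> A}"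
      using \<open>surj T\<close> T by (auto simp: image_iff) (metis surjD)
    have "emeasure (distr (hyperplane_measure e) borel T) A = hausdorff_outer (CARD('d) - 1) {z. z \<bullet> e = 0 \<and> T z \<in> A}"
      using emeasure_hyperplane_measure[of "T -` A" e] measurable_sets_borel[of T borel A]
      by (subst emeasure_distr) auto
    also have "\<dots> = emeasure (hyperplane_measure e) A"
      unfolding emeasure_hyperplane_measure[OF \<open>A \<in> sets borel\<close>] im
      by (rule hausdorff_outer_isometry[symmetric]) (rule iso)
    finally show "emeasure (distr (hyperplane_measure e) borel T) A = emeasure (hyperplane_measure e) A" .
  qed simp
  then have "(\<integral>\<^sup>+z. f z \<partial>hyperplane_measure e) = (\<integral>\<^sup>+z. f z \<partial>distr (hyperplane_measure e) borel T)" by simp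
  also have "\<dots> = (\<integral>\<^sup>+z. f (T z) \<partial>hyperplane_measure e)" by (rule nn_integral_distr) auto
  finally show ?thesis ..
qed

text \<open>
  Such a disc is a Lipschitz image of a face of the unit cube: scale the face by \<open>2 R\<close>, centre it at
  the origin and rotate it.
\<close>

lemma hausdorff_hyperplane_ball_finite:
  fixes e :: "real^'d"
  assumes "norm e = 1"
  shows "hausdorff_outer (CARD('d) - 1) {z. z \<bullet> e = 0 \<and> z \<in> cball 0 R} < top"
proof (cases "R \<le> 0")
  case True
  then have "{z. z \<bullet> e = 0 \<and> z \<in> cball 0 R} \<subseteq> (\<lambda>_. 0) ` cube_face (undefined :: 'd)"
  proof -
    have "0 \<in> cube_face (undefined :: 'd)" by (simp add: cube_face_def)
    moreover have "z = 0" if "z \<in> cball 0 R" for z :: "real^'d" using True that by (metis norm_le_zero_iff order_trans mem_cball_0)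
    ultimately show ?thesis by blast
  qed
  then have "hausdorff_outer (CARD('d) - 1) {z. z \<bullet> e = 0 \<and> z \<in> cball 0 R}
      \<le> hausdorff_outer (CARD('d) - 1) ((\<lambda>_. 0) ` cube_face (undefined :: 'd) :: (real^'d) set)"
    by (rule hausdorff_outer_mono)
  also have "\<dots> \<le> ennreal (1 ^ (CARD('d) - 1)) * hausdorff_outer (CARD('d) - 1) (cube_face (undefined :: 'd))"
    by (rule hausdorff_outer_lipschitz) auto
  also have "\<dots> < top" using hausdorff_cube_face_finite by simp
  finally show ?thesis .
next
  case False
  define i :: 'd where "i = undefined"
  obtain Q :: "real^'d \<Rightarrow> real^'d" where Q: "orthogonal_transformation Q" "Q (axis i 1) = e"
    by (rule orthogonal_transformation_exists_1[of "axis i 1" e, OF norm_axis_1 assms]) (rule that)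
  define g :: "real^'d \<Rightarrow> real^'d" where "g z = Q (\<chi> j. if j = i then 0 else 2 * R * z $ j - R)" for z
  have lin: "linear Q" using Q by (simp add: orthogonal_transformation_def)
  have "{z. z \<bullet> e = 0 \<and> z \<in> cball 0 R} \<subseteq> g ` cube_face i"
  proof clarify
    fix z assume z: "z \<bullet> e = 0" "z \<in> cball 0 R"
    obtain y where y: "z = Q y" using orthogonal_transformation_surj[OF Q(1)] by (metis surjD)
    have "y \<bullet> axis i 1 = 0" using z Q unfolding y orthogonal_transformation_def by metis
    then have yi: "y $ i = 0" by (simp add: inner_axis)
    have "norm y \<le> R" using z Q by (simp add: y orthogonal_transformation_norm)
    then have yR: "\<bar>y $ j\<bar> \<le> R" for j using component_le_norm_cart[of y j] by linarith
    define x :: "real^'d" where "x = (\<chi> j. if j = i then 0 else (y $ j + R) / (2 * R))"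
    have "(\<chi> j. if j = i then 0 else 2 * R * x $ j - R) = y" using False yi by (auto simp: vec_eq_iff x_def)
    then have "z = g x" unfolding g_def y by simp
    moreover have "x \<in> cube_face i"
    proof -
      have "0 \<le> y $ j + R" "y $ j + R \<le> 2 * R" for j using yR[of j] by linarith+
      then show ?thesis using False by (auto simp: cube_face_def x_def)
    qed
    ultimately show "z \<in> g ` cube_face i" by blast
  qed
  then have "hausdorff_outer (CARD('d) - 1) {z. z \<bullet> e = 0 \<and> z \<in> cball 0 R}
      \<le> hausdorff_outer (CARD('d) - 1) (g ` cube_face i)"
    by (rule hausdorff_outer_mono)
  also have "\<dots> \<le> ennreal ((2*R) ^ (CARD('d) - 1)) * hausdorff_outer (CARD('d) - 1) (cube_face i)"
  proof (rule hausdorff_outer_lipschitz)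
    fix x y :: "real^'d"
    have "dist (g x) (g y) = norm ((\<chi> j. if j = i then 0 else 2 * R * (x - y) $ j) :: real^'d)"
      unfolding g_def dist_norm linear_diff[OF lin, symmetric] orthogonal_transformation_norm[OF Q(1)]
      by (rule arg_cong[of _ _ norm]) (auto simp: vec_eq_iff algebra_simps)
    also have "\<dots> \<le> norm ((2 * R) *\<^sub>R (x - y))"
      by (rule norm_le_componentwise_cart) auto
    also have "\<dots> = 2 * R * dist x y" using False by (simp add: dist_norm)
    finally show "dist (g x) (g y) \<le> 2 * R * dist x y" .
  qed (use False in auto)
  also have "\<dots> < top" using hausdorff_cube_face_finite[of i] by (simp add: ennreal_mult_less_top)
  finally show ?thesis .
qed

lemma sigma_finite_hyperplane_measure:
  assumes "norm e = 1" shows "sigma_finite_measure (hyperplane_measure e)"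
proof (rule sigma_finite_measure.intro, intro exI conjI)
  show "countable (range (\<lambda>n. cball 0 (real n)))" by simp
  show "range (\<lambda>n. cball 0 (real n)) \<subseteq> sets (hyperplane_measure e)" by auto
  show "\<Union> (range (\<lambda>n. cball 0 (real n))) = space (hyperplane_measure e)"
    using real_arch_simple by (auto simp: dist_norm)
  show "\<forall>a\<in>range (\<lambda>n. cball 0 (real n)). emeasure (hyperplane_measure e) a \<noteq> \<infinity>"
    using hausdorff_hyperplane_ball_finite[OF assms] by (auto simp: emeasure_hyperplane_measure less_top)
qed

text \<open>
  The left-hand side is the measure of \<open>A\<close> under the image \<open>M\<close> of hyperplane measure times Lebesgue
  measure on the normal line.  It is translation and reflection invariant, hence a multiple of
  Lebesgue measure, and the unit cube shows that the factor is the measure of its face.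
\<close>

lemma hausdorff_slices_axis:
  fixes A :: "(real^'d) set" and i :: 'd
  defines "e \<equiv> axis i 1"
  assumes A[measurable]: "A \<in> sets borel"
  shows "(\<integral>\<^sup>+t. hausdorff_outer (CARD('d) - 1) {z. z \<bullet> e = 0 \<and> z + t *\<^sub>R e \<in> A} \<partial>lborel) =
    hausdorff_outer (CARD('d) - 1) (cube_face i :: (real^'d) set) * emeasure lborel A"
proof -
  let ?h = "hyperplane_measure e"
  have ne: "norm e = 1" by (simp add: e_def)
  have ee: "e \<bullet> e = 1" using ne by (simp add: norm_eq_1)
  interpret h: sigma_finite_measure ?h by (rule sigma_finite_hyperplane_measure[OF ne])
  interpret P: pair_sigma_finite ?h "lborel :: real measure" ..
  define M where "M = distr (?h \<Otimes>\<^sub>M lborel) borel (\<lambda>(z, t). z + t *\<^sub>R e)"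
  have sM[measurable_cong]: "sets M = sets borel" by (simp add: M_def)
  have nnM: "(\<integral>\<^sup>+x. f x \<partial>M) = (\<integral>\<^sup>+z. \<integral>\<^sup>+t. f (z + t *\<^sub>R e) \<partial>lborel \<partial>?h)"
    if [measurable]: "f \<in> borel_measurable borel" for f
    unfolding M_def by (subst nn_integral_distr) (auto simp: lborel.nn_integral_fst[symmetric])
  have emM: "emeasure M B = (\<integral>\<^sup>+z. \<integral>\<^sup>+t. indicator B (z + t *\<^sub>R e) \<partial>lborel \<partial>?h)"
    if [measurable]: "B \<in> sets borel" for B
    using nnM[of "indicator B"] by simp
  have "emeasure M A * emeasure lborel (cbox 0 1 :: (real^'d) set) = emeasure M (cbox 0 1) * emeasure lborel A"
  proof (rule haar_measure_unique)
    have "emeasure M (ball 0 (real n)) < \<infinity>" for n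
    proof -
      have "emeasure M (ball 0 (real n)) \<le> (\<integral>\<^sup>+z. \<integral>\<^sup>+t. indicator (cball 0 (real n)) z * indicator {- real n..real n} t \<partial>lborel \<partial>?h)"
        unfolding emM[OF borel_open[OF open_ball]]
      proof (intro nn_integral_mono_AE, use AE_hyperplane_measure[of e] in eventually_elim)
        fix z assume z: "z \<bullet> e = 0"
        have "z \<in> cball 0 (real n) \<and> t \<in> {- real n..real n}" if "z + t *\<^sub>R e \<in> ball 0 (real n)" for t
        proof -
          have "(norm (z + t *\<^sub>R e))\<^sup>2 = (norm z)\<^sup>2 + t\<^sup>2"
            unfolding power2_norm_eq_inner using z ee
            by (simp add: inner_simps inner_commute[of e z] power2_eq_square[of t])
          moreover have "(norm (z + t *\<^sub>R e))\<^sup>2 \<le> (real n)\<^sup>2"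
            using that by (intro power_mono) auto
          ultimately have "(norm z)\<^sup>2 \<le> (real n)\<^sup>2" "t\<^sup>2 \<le> (real n)\<^sup>2"
            using zero_le_power2[of t] zero_le_power2[of "norm z"] by linarith+
          then show ?thesis by (auto simp: power2_le_iff_abs_le abs_le_square_iff[symmetric] dist_norm)
        qed
        then show "(\<integral>\<^sup>+t. indicator (ball 0 (real n)) (z + t *\<^sub>R e) \<partial>lborel) \<le>
            (\<integral>\<^sup>+t. indicator (cball 0 (real n)) z * indicator {- real n..real n} t \<partial>lborel)"
          by (intro nn_integral_mono) (auto simp: indicator_def)
      qed
      also have "\<dots> = emeasure ?h (cball 0 (real n)) * ennreal (2 * real n)"
      proof -
        have "indicator (cball 0 (real n)) \<in> borel_measurable ?h"
          by (intro borel_measurable_indicator) simp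
        from nn_integral_multc[OF this, of "ennreal (2 * real n)"] show ?thesis
          by (simp add: nn_integral_cmult)
      qed
      also have "\<dots> < \<infinity>"
        using hausdorff_hyperplane_ball_finite[OF ne, of "real n"] by (simp add: emeasure_hyperplane_measure ennreal_mult_less_top)
      finally show ?thesis .
    qed
    moreover have "(\<Union>n. ball 0 (real n)) = (UNIV :: (real^'d) set)"
      using reals_Archimedean2 by (auto simp: dist_norm)
    ultimately show "sigma_finite_measure M"
      by (intro sigma_finite_measure.intro exI[of _ "range (\<lambda>n. ball 0 (real n))"]) (auto simp: M_def less_top)
  next
    fix a and f :: "real^'d \<Rightarrow> ennreal" assume [measurable]: "f \<in> borel_measurable borel"
    define s where "s = a \<bullet> e"
    define a' where "a' = a - s *\<^sub>R e"
    have a': "a' \<bullet> e = 0" using ee by (simp add: a'_def s_def inner_simps)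
    have "(\<integral>\<^sup>+x. f (x + a) \<partial>M) = (\<integral>\<^sup>+z. \<integral>\<^sup>+t. f ((z + a') + (t + s) *\<^sub>R e) \<partial>lborel \<partial>?h)"
      by (subst nnM) (auto simp: a'_def algebra_simps)
    also have "\<dots> = (\<integral>\<^sup>+z. \<integral>\<^sup>+t. f ((z + a') + t *\<^sub>R e) \<partial>lborel \<partial>?h)"
      by (intro nn_integral_cong nn_integral_translate[of "\<lambda>t. f ((_ + a') + t *\<^sub>R e)" s]) auto
    also have "\<dots> = (\<integral>\<^sup>+z. \<integral>\<^sup>+t. f (z + t *\<^sub>R e) \<partial>lborel \<partial>?h)"
    proof (rule nn_integral_hyperplane_isometry[where T="\<lambda>z. z + a'" and f="\<lambda>z. \<integral>\<^sup>+t. f (z + t *\<^sub>R e) \<partial>lborel"])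
      show "surj (\<lambda>z. z + a')" by (rule surjI[where f="\<lambda>z. z - a'"]) simp
    qed (auto simp: inner_simps a')
    also have "\<dots> = (\<integral>\<^sup>+x. f x \<partial>M)" by (simp add: nnM)
    finally show "(\<integral>\<^sup>+x. f (x + a) \<partial>M) = (\<integral>\<^sup>+x. f x \<partial>M)" .
  next
    fix f :: "real^'d \<Rightarrow> ennreal" assume [measurable]: "f \<in> borel_measurable borel"
    have refl1: "(\<integral>\<^sup>+t. g (- t) \<partial>lborel) = (\<integral>\<^sup>+t. g t \<partial>lborel)" if [measurable]: "g \<in> borel_measurable borel" for g :: "real \<Rightarrow> ennreal"
      using nn_integral_real_affine[of g "-1" 0] by simp
    have "(\<integral>\<^sup>+x. f (- x) \<partial>M) = (\<integral>\<^sup>+z. \<integral>\<^sup>+t. f (- z + (- t) *\<^sub>R e) \<partial>lborel \<partial>?h)"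
      by (subst nnM) auto
    also have "\<dots> = (\<integral>\<^sup>+z. \<integral>\<^sup>+t. f (- z + t *\<^sub>R e) \<partial>lborel \<partial>?h)"
      by (intro nn_integral_cong refl1[of "\<lambda>t. f (- _ + t *\<^sub>R e)"]) auto
    also have "\<dots> = (\<integral>\<^sup>+z. \<integral>\<^sup>+t. f (z + t *\<^sub>R e) \<partial>lborel \<partial>?h)"
    proof (rule nn_integral_hyperplane_isometry[where T=uminus and f="\<lambda>z. \<integral>\<^sup>+t. f (z + t *\<^sub>R e) \<partial>lborel"])
      show "surj (uminus :: real^'d \<Rightarrow> real^'d)" by (rule surjI[where f=uminus]) simp
    qed (auto simp: dist_minus)
    also have "\<dots> = (\<integral>\<^sup>+x. f x \<partial>M)" by (simp add: nnM)
    finally show "(\<integral>\<^sup>+x. f (- x) \<partial>M) = (\<integral>\<^sup>+x. f x \<partial>M)" .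
  qed (auto simp: M_def)
  moreover have "emeasure M (cbox 0 1) = hausdorff_outer (CARD('d) - 1) (cube_face i :: (real^'d) set)"
  proof -
    have cf: "closed (cube_face i :: (real^'d) set)"
    proof -
      have "cube_face i = {z :: real^'d. z $ i = 0} \<inter> cbox 0 1"
        by (auto simp: cube_face_def mem_box_cart) (metis order_refl zero_le_one)+
      then show ?thesis by (auto intro!: closed_Int closed_Collect_eq continuous_intros)
    qed
    have "emeasure M (cbox 0 1) = (\<integral>\<^sup>+z. \<integral>\<^sup>+t. indicator (cube_face i) z * indicator {0..1::real} t \<partial>lborel \<partial>?h)"
      unfolding emM[OF borel_closed[OF closed_cbox]]
    proof (intro nn_integral_cong_AE, use AE_hyperplane_measure[of e] in eventually_elim)
      fix z assume "z \<bullet> e = 0"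
      then have zi: "z $ i = 0" by (simp add: e_def inner_axis)
      have "z + t *\<^sub>R e \<in> cbox 0 1 \<longleftrightarrow> z \<in> cube_face i \<and> t \<in> {0..1}" for t
      proof -
        have "(z + t *\<^sub>R e) $ j = (if j = i then t else z $ j)" for j
          using zi by (simp add: axis_def e_def)
        then have "z + t *\<^sub>R e \<in> cbox 0 1 \<longleftrightarrow> (\<forall>j. 0 \<le> (if j = i then t else z $ j) \<and> (if j = i then t else z $ j) \<le> 1)"
          unfolding mem_box_cart by simp
        also have "\<dots> \<longleftrightarrow> 0 \<le> t \<and> t \<le> 1 \<and> (\<forall>j. j \<noteq> i \<longrightarrow> 0 \<le> z $ j \<and> z $ j \<le> 1)"
          by (rule iffI) (metis, auto)
        finally show ?thesis using zi by (auto simp: cube_face_def)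
      qed
      then have "indicator (cbox 0 1) (z + t *\<^sub>R e) = (indicator (cube_face i) z * indicator {0..1::real} t :: ennreal)" for t
        by (simp add: indicator_def)
      then show "(\<integral>\<^sup>+t. indicator (cbox 0 1) (z + t *\<^sub>R e) \<partial>lborel) =
            (\<integral>\<^sup>+t. indicator (cube_face i) z * indicator {0..1::real} t \<partial>lborel)"
        by (simp only:)
    qed
    also have "\<dots> = emeasure ?h (cube_face i)"
      using borel_closed[OF cf] by (simp add: nn_integral_cmult nn_integral_multc)
    also have "\<dots> = hausdorff_outer (CARD('d) - 1) (cube_face i :: (real^'d) set)"
      using borel_closed[OF cf]
      by (subst emeasure_hyperplane_measure) (auto simp: e_def inner_axis cube_face_def intro!: arg_cong[of _ _ "hausdorff_outer _"])
    finally show ?thesis .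
  qed
  moreover have "emeasure M A = (\<integral>\<^sup>+t. hausdorff_outer (CARD('d) - 1) {z. z \<bullet> e = 0 \<and> z + t *\<^sub>R e \<in> A} \<partial>lborel)"
  proof -
    have "emeasure M A = (\<integral>\<^sup>+t. \<integral>\<^sup>+z. indicator A (z + t *\<^sub>R e) \<partial>?h \<partial>lborel)"
      unfolding emM[OF A] by (rule P.Fubini'[symmetric]) measurable
    also have "\<dots> = (\<integral>\<^sup>+t. emeasure ?h {z. z + t *\<^sub>R e \<in> A} \<partial>lborel)"
    proof (rule nn_integral_cong)
      fix t
      have "{z. z + t *\<^sub>R e \<in> A} \<in> sets ?h" using A by measurable
      from nn_integral_indicator[OF this]
      show "(\<integral>\<^sup>+z. indicator A (z + t *\<^sub>R e) \<partial>?h) = emeasure ?h {z. z + t *\<^sub>R e \<in> A}"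
        by (simp add: indicator_def)
    qed
    also have "\<dots> = (\<integral>\<^sup>+t. hausdorff_outer (CARD('d) - 1) {z. z \<bullet> e = 0 \<and> z + t *\<^sub>R e \<in> A} \<partial>lborel)"
      by (intro nn_integral_cong, subst emeasure_hyperplane_measure) auto
    finally show ?thesis .
  qed
  ultimately show ?thesis by (simp add: emeasure_unit_cube)
qed

lemma hausdorff_slices:
  fixes A :: "(real^'d) set" and e :: "real^'d"
  assumes A: "A \<in> sets borel" and e: "norm e = 1"
  shows "(\<integral>\<^sup>+t. hausdorff_outer (CARD('d) - 1) {z. z \<bullet> e = 0 \<and> z + t *\<^sub>R e \<in> A} \<partial>lborel) =
    hausdorff_outer (CARD('d) - 1) (cube_face i :: (real^'d) set) * emeasure lborel A"
proof -
  obtain Q :: "real^'d \<Rightarrow> real^'d" where Q: "orthogonal_transformation Q" "Q (axis i 1) = e"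
    by (rule orthogonal_transformation_exists_1[of "axis i 1" e, OF norm_axis_1 e]) (rule that)
  have lin: "linear Q" using Q by (simp add: orthogonal_transformation_def)
  have inner: "Q x \<bullet> Q y = x \<bullet> y" for x y using Q by (simp add: orthogonal_transformation_def)
  have "continuous_on UNIV Q" using lin by (simp add: linear_continuous_on linear_conv_bounded_linear)
  then have [measurable]: "Q \<in> borel_measurable borel" by (rule borel_measurable_continuous_onI)
  have QA: "Q -` A \<in> sets borel" using A measurable_sets[of Q borel borel A] by simp
  have "hausdorff_outer (CARD('d) - 1) {z. z \<bullet> e = 0 \<and> z + t *\<^sub>R e \<in> A} =
      hausdorff_outer (CARD('d) - 1) {z. z \<bullet> axis i 1 = 0 \<and> z + t *\<^sub>R axis i 1 \<in> Q -` A}" for t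
  proof -
    have "{z. z \<bullet> e = 0 \<and> z + t *\<^sub>R e \<in> A} = Q ` {z. z \<bullet> axis i 1 = 0 \<and> z + t *\<^sub>R axis i 1 \<in> Q -` A}"
    proof (intro set_eqI iffI)
      fix z assume z: "z \<in> {z. z \<bullet> e = 0 \<and> z + t *\<^sub>R e \<in> A}"
      obtain y where y: "z = Q y" using orthogonal_transformation_surj[OF Q(1)] by (metis surjD)
      then show "z \<in> Q ` {z. z \<bullet> axis i 1 = 0 \<and> z + t *\<^sub>R axis i 1 \<in> Q -` A}"
        using z Q(2) inner[of y "axis i 1"] by (auto simp: linear_add[OF lin] linear_cmul[OF lin])
    qed (use Q(2) inner[of _ "axis i 1"] in \<open>auto simp: linear_add[OF lin] linear_cmul[OF lin]\<close>)
    then show ?thesis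
      using Q by (simp add: hausdorff_outer_isometry dist_norm orthogonal_transformation_norm flip: linear_diff[OF lin])
  qed
  then show ?thesis
    using hausdorff_slices_axis[OF QA, of i] emeasure_lborel_orthogonal_vimage[OF Q(1) A] by simp
qed


text \<open>
  The open and the closed unit cube have the same volume, and their slices are the open and the
  closed face.
\<close>

lemma hausdorff_open_cube_face:
  "hausdorff_outer (CARD('d) - 1) {z :: real^'d. z $ i = 0 \<and> (\<forall>j. j \<noteq> i \<longrightarrow> 0 < z $ j \<and> z $ j < 1)} =
   hausdorff_outer (CARD('d) - 1) (cube_face i :: (real^'d) set)"
proof -
  let ?F = "{z :: real^'d. z $ i = 0 \<and> (\<forall>j. j \<noteq> i \<longrightarrow> 0 < z $ j \<and> z $ j < 1)}"
  have "{z :: real^'d. z \<bullet> axis i 1 = 0 \<and> z + t *\<^sub>R axis i 1 \<in> box 0 1} = (if 0 < t \<and> t < 1 then ?F else {})" for t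
  proof -
    have "z + t *\<^sub>R axis i 1 \<in> box 0 1 \<longleftrightarrow> 0 < t \<and> t < 1 \<and> z \<in> ?F" if "z $ i = 0" for z :: "real^'d"
    proof -
      have "(z + t *\<^sub>R axis i 1) $ j = (if j = i then t else z $ j)" for j
        using that by (simp add: axis_def)
      then have "z + t *\<^sub>R axis i 1 \<in> box 0 1 \<longleftrightarrow> (\<forall>j. 0 < (if j = i then t else z $ j) \<and> (if j = i then t else z $ j) < 1)"
        unfolding mem_box_cart by simp
      also have "\<dots> \<longleftrightarrow> 0 < t \<and> t < 1 \<and> (\<forall>j. j \<noteq> i \<longrightarrow> 0 < z $ j \<and> z $ j < 1)"
        by (rule iffI) (metis, auto)
      finally show ?thesis using that by simp
    qed
    then show ?thesis by (auto simp: inner_axis)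
  qed
  then have "hausdorff_outer (CARD('d) - 1) {z :: real^'d. z \<bullet> axis i 1 = 0 \<and> z + t *\<^sub>R axis i 1 \<in> box 0 1} =
      hausdorff_outer (CARD('d) - 1) ?F * indicator {0<..<1} t" for t
    by simp
  then have "(\<integral>\<^sup>+t. hausdorff_outer (CARD('d) - 1) ?F * indicator {0<..<1::real} t \<partial>lborel) =
      hausdorff_outer (CARD('d) - 1) (cube_face i :: (real^'d) set) * emeasure lborel (box 0 1 :: (real^'d) set)"
    using hausdorff_slices_axis[of "box 0 1" i] by simp
  then show ?thesis
    by (simp add: nn_integral_cmult emeasure_unit_cube)
qed

lemma hausdorff_cube_face_const:
  "hausdorff_outer (CARD('d) - 1) (cube_face i :: (real^'d) set) = hausdorff_outer (CARD('d) - 1) (cube_face j :: (real^'d) set)"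
  using hausdorff_slices[of "cbox 0 1" "axis i 1" i] hausdorff_slices[of "cbox 0 1" "axis i 1" j]
  by (simp add: emeasure_unit_cube)

text \<open>
  This evaluates the constant that normalises the surface measure.  The \<open>2 d\<close> closed faces cover the
  frontier, and their relative interiors are disjoint with the same measure.  A face is indexed by
  its normal axis and by whether it is the one through the origin or the opposite one.
\<close>

lemma hausdorff_frontier_cube:
  "hausdorff_outer (CARD('d) - 1) (frontier (cbox (0 :: real^'d) 1)) =
   ennreal (2 * real CARD('d)) * hausdorff_outer (CARD('d) - 1) (cube_face i :: (real^'d) set)"
proof -
  let ?H = "hausdorff_outer (CARD('d) - 1) :: (real^'d) set \<Rightarrow> ennreal"
  let ?c = "?H (cube_face i)"
  define opn :: "'d \<Rightarrow> (real^'d) set" where "opn j = {z. z $ j = 0 \<and> (\<forall>k. k \<noteq> j \<longrightarrow> 0 < z $ k \<and> z $ k < 1)}" for j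
  define sh :: "'d \<times> bool \<Rightarrow> real^'d \<Rightarrow> real^'d" where "sh p z = z + (if snd p then axis (fst p) 1 else 0)" for p z
  have sh: "?H (sh p ` A) = ?H A" for p A
    by (rule hausdorff_outer_isometry) (simp add: sh_def)
  have two: "(\<Sum>p\<in>(UNIV :: ('d \<times> bool) set). ?c) = ennreal (2 * real CARD('d)) * ?c"
  proof -
    have "of_nat (CARD('d \<times> bool)) = ennreal (2 * real CARD('d))"
      unfolding ennreal_of_nat_eq_real_of_nat by (simp add: mult.commute)
    then show ?thesis by (simp only: sum_constant)
  qed
  have fr: "frontier (cbox (0 :: real^'d) 1) = cbox 0 1 - box 0 1"
    by (simp add: frontier_def closure_closed interior_cbox)
  show ?thesis
  proof (rule antisym)
    have "frontier (cbox (0 :: real^'d) 1) \<subseteq> (\<Union>p\<in>UNIV. sh p ` cube_face (fst p))"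
    proof
      fix z :: "real^'d" assume z: "z \<in> frontier (cbox 0 1)"
      then have le: "0 \<le> z $ j" "z $ j \<le> 1" for j by (auto simp: fr mem_box_cart)
      obtain j where "z $ j \<le> 0 \<or> 1 \<le> z $ j" using z by (auto simp: fr mem_box_cart not_less)
      then consider "z $ j = 0" | "z $ j = 1" using le[of j] by linarith
      then show "z \<in> (\<Union>p\<in>UNIV. sh p ` cube_face (fst p))"
      proof cases
        case 1
        then have "z \<in> cube_face j" using le by (auto simp: cube_face_def)
        then have "z \<in> sh (j, False) ` cube_face (fst (j, False))" by (simp add: sh_def)
        then show ?thesis by blast
      next
        case 2
        then have "z - axis j 1 \<in> cube_face j" using le by (auto simp: cube_face_def axis_def)
        then have "sh (j, True) (z - axis j 1) \<in> sh (j, True) ` cube_face (fst (j, True))" by auto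
        then have "z \<in> sh (j, True) ` cube_face (fst (j, True))" by (simp add: sh_def)
        then show ?thesis by blast
      qed
    qed
    then have "?H (frontier (cbox 0 1)) \<le> ?H (\<Union>p\<in>UNIV. sh p ` cube_face (fst p))" by (rule hausdorff_outer_mono)
    also have "\<dots> \<le> (\<Sum>p\<in>UNIV. ?H (sh p ` cube_face (fst p)))"
    proof -
      have "?H (\<Union>p\<in>I. A p) \<le> (\<Sum>p\<in>I. ?H (A p))" if "finite I" for I :: "('d \<times> bool) set" and A
        using that by induction (auto intro: order_trans[OF hausdorff_outer_Un] add_left_mono)
      then show ?thesis by simp
    qed
    also have "\<dots> = (\<Sum>p\<in>(UNIV :: ('d \<times> bool) set). ?c)"
      unfolding sh by (intro sum.cong refl hausdorff_cube_face_const)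
    finally show "?H (frontier (cbox 0 1)) \<le> ennreal (2 * real CARD('d)) * ?c" by (simp only: two)
  next
    have shim: "sh p ` opn (fst p) = {z :: real^'d. z $ fst p = (if snd p then 1 else 0) \<and> (\<forall>k. k \<noteq> fst p \<longrightarrow> 0 < z $ k \<and> z $ k < 1)}" for p
    proof (intro set_eqI iffI)
      fix z :: "real^'d" assume z: "z \<in> {z. z $ fst p = (if snd p then 1 else 0) \<and> (\<forall>k. k \<noteq> fst p \<longrightarrow> 0 < z $ k \<and> z $ k < 1)}"
      then have "z - (if snd p then axis (fst p) 1 else 0) \<in> opn (fst p)" by (auto simp: opn_def axis_def)
      then have "sh p (z - (if snd p then axis (fst p) 1 else 0)) \<in> sh p ` opn (fst p)" by blast
      then show "z \<in> sh p ` opn (fst p)" by (simp add: sh_def)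
    qed (auto simp: sh_def opn_def axis_def)
    have meas[measurable]: "sh p ` opn (fst p) \<in> sets borel" for p
      unfolding shim by measurable
    have disj: "disjoint_family_on (\<lambda>p. sh p ` opn (fst p)) UNIV"
    proof (unfold disjoint_family_on_def, intro ballI impI, rule ccontr)
      fix p q :: "'d \<times> bool" assume "p \<noteq> q" "sh p ` opn (fst p) \<inter> sh q ` opn (fst q) \<noteq> {}"
      then obtain z where z: "z \<in> sh p ` opn (fst p)" "z \<in> sh q ` opn (fst q)" by blast
      show False
      proof (cases "fst p = fst q")
        case True
        then have "snd p \<noteq> snd q" using \<open>p \<noteq> q\<close> by (simp add: prod_eq_iff)
        then show False using z True unfolding shim by (auto split: if_splits)
      next
        case False
        then have "0 < z $ fst p" "z $ fst p < 1" using z(2) unfolding shim by auto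
        moreover have "z $ fst p = 1 \<or> z $ fst p = 0" using z(1) unfolding shim by auto
        ultimately show False by auto
      qed
    qed
    have "ennreal (2 * real CARD('d)) * ?c = (\<Sum>p\<in>UNIV. ?H (sh p ` opn (fst p)))"
      unfolding two[symmetric] sh opn_def hausdorff_open_cube_face by (intro sum.cong refl hausdorff_cube_face_const)
    also have "\<dots> = (\<Sum>p\<in>UNIV. emeasure (hausdorff_measure (CARD('d) - 1)) (sh p ` opn (fst p)))"
      by (simp add: emeasure_hausdorff_measure)
    also have "\<dots> = emeasure (hausdorff_measure (CARD('d) - 1)) (\<Union>p\<in>UNIV. sh p ` opn (fst p))"
      using disj meas by (intro sum_emeasure) (auto simp del: split_paired_All simp: image_subset_iff)
    also have "\<dots> = ?H (\<Union>p\<in>UNIV. sh p ` opn (fst p))"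
      by (subst emeasure_hausdorff_measure) auto
    also have "\<dots> \<le> ?H (frontier (cbox 0 1))"
    proof (rule hausdorff_outer_mono, rule UN_least)
      fix p :: "'d \<times> bool"
      have "z \<in> cbox 0 1 - box 0 1" if z: "z $ fst p = (if snd p then 1 else 0)" "\<And>k. k \<noteq> fst p \<Longrightarrow> 0 < z $ k \<and> z $ k < 1" for z :: "real^'d"
      proof -
        have "0 \<le> z $ k \<and> z $ k \<le> 1" for k using z(1) z(2)[of k] by (cases "k = fst p") (auto intro: less_imp_le)
        moreover have "\<not> (0 < z $ fst p \<and> z $ fst p < 1)" using z(1) by auto
        ultimately show ?thesis by (auto simp: mem_box_cart)
      qed
      then show "sh p ` opn (fst p) \<subseteq> frontier (cbox 0 1)" unfolding fr shim by blast
    qed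
    finally show "ennreal (2 * real CARD('d)) * ?c \<le> ?H (frontier (cbox 0 1))" .
  qed
qed

lemma sets_surface_measure [simp, measurable_cong]: "sets surface_measure = sets borel"
  by (simp add: surface_measure_def)

lemma space_surface_measure [simp]: "space surface_measure = UNIV"
  using sets_eq_imp_space_eq[OF sets_surface_measure] by simp

text \<open>
  Hausdorff measure is surface measure times the Hausdorff measure of a unit face; so the estimates
  for Lipschitz images carry over to the surface measure.
\<close>

lemma hausdorff_eq_surface:
  fixes A :: "(real^'d) set"
  assumes "A \<in> sets borel"
  shows "hausdorff_outer (CARD('d) - 1) A =
    hausdorff_outer (CARD('d) - 1) (cube_face i :: (real^'d) set) * emeasure surface_measure A"
proof -
  let ?c = "hausdorff_outer (CARD('d) - 1) (cube_face i :: (real^'d) set)"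
  have c: "?c \<noteq> 0" "?c \<noteq> top"
    using hausdorff_cube_face_pos[of i] hausdorff_cube_face_finite[of i] by auto
  have "?c * emeasure surface_measure A =
      ?c * (ennreal (2 * real CARD('d)) / (ennreal (2 * real CARD('d)) * ?c)) * hausdorff_outer (CARD('d) - 1) A"
    unfolding surface_measure_def hausdorff_frontier_cube[of i] emeasure_scale_measure
      emeasure_hausdorff_measure[OF assms] by (simp only: mult.assoc)
  also have "?c * (ennreal (2 * real CARD('d)) / (ennreal (2 * real CARD('d)) * ?c)) = 1"
    using c by (simp add: ennreal_times_divide mult.commute[of ?c] ennreal_mult_eq_top_iff del: One_nat_def)
       (intro ennreal_divide_self, auto simp: ennreal_mult_eq_top_iff ennreal_mult_less_top less_top)
  finally show ?thesis by simp
qed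

text \<open>
  Cavalieri's principle for slices orthogonal to \<open>e\<close>.  It is the only link between surface measure and
  volume: by the normalisation no constant appears in it.
\<close>

lemma emeasure_lborel_slices:
  fixes A :: "(real^'d) set" and e :: "real^'d"
  assumes A[measurable]: "A \<in> sets borel" and e: "norm e = 1"
  shows "(\<integral>\<^sup>+t. emeasure surface_measure {z. z \<bullet> e = 0 \<and> z + t *\<^sub>R e \<in> A} \<partial>lborel) = emeasure lborel A"
proof -
  define i :: 'd where "i = undefined"
  let ?c = "hausdorff_outer (CARD('d) - 1) (cube_face i :: (real^'d) set)"
  have c: "?c \<noteq> 0" "?c \<noteq> top"
    using hausdorff_cube_face_pos[of i] hausdorff_cube_face_finite[of i] by auto
  have s: "emeasure surface_measure B = hausdorff_outer (CARD('d) - 1) B / ?c" if "B \<in> sets borel" for B :: "(real^'d) set"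
    using hausdorff_eq_surface[OF that, of i] c
    by (simp add: mult.commute[of ?c] mult_divide_eq_ennreal del: One_nat_def)
  interpret h: sigma_finite_measure "hyperplane_measure e" by (rule sigma_finite_hyperplane_measure[OF e])
  have [measurable]: "(\<lambda>t::real. emeasure (hyperplane_measure e) {z. z + t *\<^sub>R e \<in> A}) \<in> borel_measurable borel"
  proof -
    have "{p \<in> space (lborel \<Otimes>\<^sub>M hyperplane_measure e). snd p + fst p *\<^sub>R e \<in> A} \<in> sets (lborel \<Otimes>\<^sub>M hyperplane_measure e)"
      by measurable
    from h.measurable_emeasure_Pair[OF this] show ?thesis by (simp add: space_pair_measure vimage_def)
  qed
  have "(\<integral>\<^sup>+t. emeasure surface_measure {z. z \<bullet> e = 0 \<and> z + t *\<^sub>R e \<in> A} \<partial>lborel) =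
     (\<integral>\<^sup>+t. emeasure (hyperplane_measure e) {z. z + t *\<^sub>R e \<in> A} / ?c \<partial>lborel)"
    by (intro nn_integral_cong) (simp add: s emeasure_hyperplane_measure)
  also have "\<dots> = (\<integral>\<^sup>+t. emeasure (hyperplane_measure e) {z. z + t *\<^sub>R e \<in> A} \<partial>lborel) / ?c"
    by (intro nn_integral_divide) simp
  also have "(\<integral>\<^sup>+t. emeasure (hyperplane_measure e) {z. z + t *\<^sub>R e \<in> A} \<partial>lborel) = ?c * emeasure lborel A"
    unfolding hausdorff_slices[OF A e, of i, symmetric]
    by (intro nn_integral_cong) (simp add: emeasure_hyperplane_measure)
  also have "?c * emeasure lborel A / ?c = emeasure lborel A"
    using c
    by (simp add: mult.commute[of ?c] mult_divide_eq_ennreal del: One_nat_def)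
  finally show ?thesis .
qed

lemma emeasure_surface_lipschitz:
  fixes f :: "real^'d \<Rightarrow> real^'d"
  assumes A: "A \<in> sets borel" "f ` A \<in> sets borel" and "0 < L"
    and lip: "\<And>x y. x \<in> A \<Longrightarrow> y \<in> A \<Longrightarrow> dist (f x) (f y) \<le> L * dist x y"
  shows "emeasure surface_measure (f ` A) \<le> ennreal (L ^ (CARD('d) - 1)) * emeasure surface_measure A"
proof -
  define i :: 'd where "i = undefined"
  let ?c = "hausdorff_outer (CARD('d) - 1) (cube_face i :: (real^'d) set)"
  have c: "?c \<noteq> 0" "?c \<noteq> top"
    using hausdorff_cube_face_pos[of i] hausdorff_cube_face_finite[of i] by auto
  have "?c * emeasure surface_measure (f ` A) \<le> ?c * (ennreal (L ^ (CARD('d) - 1)) * emeasure surface_measure A)"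
  proof -
    have "hausdorff_outer (CARD('d) - 1) (f ` A) \<le> ennreal (L ^ (CARD('d) - 1)) * hausdorff_outer (CARD('d) - 1) A"
      by (rule hausdorff_outer_lipschitz[OF \<open>0 < L\<close>]) (rule lip)
    then show ?thesis
      unfolding hausdorff_eq_surface[OF A(1), of i] hausdorff_eq_surface[OF A(2), of i] by (simp only: ac_simps)
  qed
  then show ?thesis
    using c by (simp add: ennreal_mult_le_mult_iff del: One_nat_def)
qed

lemma emeasure_surface_hyperplane_ball_finite:
  fixes e :: "real^'d"
  assumes "norm e = 1"
  shows "emeasure surface_measure {z. z \<bullet> e = 0 \<and> z \<in> cball 0 R} < top"
proof -
  have "{z. z \<bullet> e = 0 \<and> z \<in> cball 0 R} \<in> sets borel"
    unfolding Collect_conj_eq Collect_mem_eq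
    by (intro sets.Int borel_closed closed_Collect_eq continuous_intros closed_cball)
  from hausdorff_eq_surface[OF this, of undefined] hausdorff_hyperplane_ball_finite[OF assms, of R]
  have "hausdorff_outer (CARD('d) - 1) (cube_face undefined :: (real^'d) set) *
      emeasure surface_measure {z. z \<bullet> e = 0 \<and> z \<in> cball 0 R} < top" by (simp only:)
  moreover have "hausdorff_outer (CARD('d) - 1) (cube_face undefined :: (real^'d) set) \<noteq> 0"
    using hausdorff_cube_face_pos[of "undefined :: 'd"] by (simp only: not_gr_zero[symmetric] not_not)
  ultimately show ?thesis
    unfolding less_top[symmetric] ennreal_mult_eq_top_iff by blast
qed

section \<open>The surface measure on a Lipschitz graph\<close>

lemma emeasure_surface_translation:
  fixes A :: "(real^'d) set"
  assumes A: "A \<in> sets borel" "(+) a ` A \<in> sets borel"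
  shows "emeasure surface_measure ((+) a ` A) = emeasure surface_measure A"
proof (rule antisym)
  show "emeasure surface_measure ((+) a ` A) \<le> emeasure surface_measure A"
    using emeasure_surface_lipschitz[OF A, of 1] by simp
  have im: "(+) (- a) ` (+) a ` A = A" by (auto simp: image_image)
  show "emeasure surface_measure A \<le> emeasure surface_measure ((+) a ` A)"
    using emeasure_surface_lipschitz[of "(+) a ` A" "(+) (- a)" 1] A unfolding im by (simp add: dist_norm)
qed

text \<open>
  The level set \<open>{G = 0}\<close> is the graph of a Lipschitz function over the hyperplane orthogonal to \<open>e\<close>, and
  \<open>G y\<close> is the signed height of \<open>y\<close> above it, measured along \<open>e\<close>.  A function \<open>\<gamma>\<close> on the hyperplane
  corresponds to \<open>G y = y \<bullet> e - \<gamma> (hproj e y)\<close>; in terms of \<open>G\<close> no coordinates of the hyperplane are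
  needed.
\<close>

locale lip_level =
  fixes e :: "real^'d" and G :: "real^'d \<Rightarrow> real" and K :: real
  assumes norm_e: "norm e = 1"
    and G_shift: "G (y + s *\<^sub>R e) = G y + s"
    and G_lip: "\<bar>G x - G y\<bar> \<le> K * norm (x - y)"
begin

definition foot :: "real^'d \<Rightarrow> real^'d" where "foot y = y - G y *\<^sub>R e"

lemma e_e: "e \<bullet> e = 1" using norm_e by (simp add: norm_eq_1)

lemma K_ge_1: "1 \<le> K"
  using G_lip[of "0 + 1 *\<^sub>R e" 0] G_shift[of 0 1] norm_e by simp

lemma G_continuous: "continuous_on A G"
proof -
  have "K-lipschitz_on A G"
    using G_lip K_ge_1 by (intro lipschitz_onI) (auto simp: dist_norm)
  then show ?thesis by (rule lipschitz_on_continuous_on)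
qed

lemma foot_continuous: "continuous_on A foot"
  unfolding foot_def by (intro continuous_intros G_continuous)

lemma G_measurable [measurable]: "G \<in> borel_measurable borel"
  by (rule borel_measurable_continuous_onI) (rule G_continuous)

lemma foot_measurable [measurable]: "foot \<in> borel_measurable borel"
  by (rule borel_measurable_continuous_onI) (rule foot_continuous)

lemma G_foot [simp]: "G (foot y) = 0"
  using G_shift[of y "- G y"] by (simp add: foot_def)

lemma foot_shift [simp]: "foot (y + s *\<^sub>R e) = foot y"
  by (simp add: foot_def G_shift algebra_simps)

lemma foot_eq: "G y = 0 \<Longrightarrow> foot y = y"
  by (simp add: foot_def)

lemma dist_foot: "dist (foot x) (foot y) \<le> (1 + K) * dist x y"
proof -
  have "foot x - foot y = (x - y) - (G x - G y) *\<^sub>R e" by (simp add: foot_def algebra_simps)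
  then have "norm (foot x - foot y) \<le> norm (x - y) + \<bar>G x - G y\<bar>"
    using norm_triangle_ineq4[of "x - y" "(G x - G y) *\<^sub>R e"] norm_e by simp
  also have "\<dots> \<le> (1 + K) * norm (x - y)" using G_lip[of x y] by (simp add: algebra_simps)
  finally show ?thesis by (simp add: dist_norm)
qed

text \<open>
  The area of the projection along \<open>e\<close> to the hyperplane orthogonal to \<open>e\<close>, as a measure on the graph:
  a set of feet is measured by the volume of the strip of height \<open>1\<close> above it.
\<close>

definition graph_measure :: "(real^'d) measure" where
  "graph_measure = distr (density lborel (indicator {y. 0 \<le> G y \<and> G y < 1})) borel foot"

lemma sets_graph_measure [simp, measurable_cong]: "sets graph_measure = sets borel"
  by (simp add: graph_measure_def)

lemma space_graph_measure [simp]: "space graph_measure = UNIV"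
  by (simp add: graph_measure_def)

lemma nn_integral_graph_measure:
  assumes [measurable]: "f \<in> borel_measurable borel"
  shows "(\<integral>\<^sup>+p. f p \<partial>graph_measure) = (\<integral>\<^sup>+y. indicator {y. 0 \<le> G y \<and> G y < 1} y * f (foot y) \<partial>lborel)"
  unfolding graph_measure_def by (subst nn_integral_distr, simp_all, subst nn_integral_density) auto

lemma AE_graph_measure: "AE p in graph_measure. G p = 0"
  unfolding graph_measure_def by (subst AE_distr_iff) auto

text \<open>
  Every point is \<open>p + s *\<^sub>R e\<close> for exactly one point \<open>p\<close> of the graph.  The change to these coordinates
  preserves volume, since it shifts every line parallel to \<open>e\<close> along itself: after the shift, Fubini's
  theorem and a translation leave the integral of \<open>indicator {0..<1} (G y - s)\<close> over \<open>s\<close>, which is \<open>1\<close>.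
\<close>

lemma nn_integral_coarea:
  assumes [measurable]: "f \<in> borel_measurable borel"
  shows "(\<integral>\<^sup>+y. f y \<partial>lborel) = (\<integral>\<^sup>+p. \<integral>\<^sup>+s. f (p + s *\<^sub>R e) \<partial>lborel \<partial>graph_measure)"
proof -
  let ?I = "\<lambda>r :: real. indicator {0..<1} r :: ennreal"
  have "(\<integral>\<^sup>+p. \<integral>\<^sup>+s. f (p + s *\<^sub>R e) \<partial>lborel \<partial>graph_measure) =
      (\<integral>\<^sup>+y. ?I (G y) * (\<integral>\<^sup>+s. f (foot y + s *\<^sub>R e) \<partial>lborel) \<partial>lborel)"
    by (subst nn_integral_graph_measure) (auto simp: indicator_def intro!: nn_integral_cong)
  also have "\<dots> = (\<integral>\<^sup>+y. ?I (G y) * (\<integral>\<^sup>+s. f (y + s *\<^sub>R e) \<partial>lborel) \<partial>lborel)"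
  proof -
    have "(\<integral>\<^sup>+s. f (foot y + s *\<^sub>R e) \<partial>lborel) = (\<integral>\<^sup>+s. f (y + s *\<^sub>R e) \<partial>lborel)" for y
      using nn_integral_translate[of "\<lambda>s. f (foot y + s *\<^sub>R e)" "G y"] by (simp add: foot_def algebra_simps)
    then show ?thesis by simp
  qed
  also have "\<dots> = (\<integral>\<^sup>+y. \<integral>\<^sup>+s. ?I (G y) * f (y + s *\<^sub>R e) \<partial>lborel \<partial>lborel)"
    by (simp add: nn_integral_cmult)
  also have "\<dots> = (\<integral>\<^sup>+s. \<integral>\<^sup>+y. ?I (G y) * f (y + s *\<^sub>R e) \<partial>lborel \<partial>lborel)"
    by (rule lborel_pair.Fubini'[symmetric]) measurable
  also have "\<dots> = (\<integral>\<^sup>+s. \<integral>\<^sup>+y. ?I (G y - s) * f y \<partial>lborel \<partial>lborel)"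
  proof (rule nn_integral_cong)
    fix s :: real
    have "G (y - s *\<^sub>R e) = G y - s" for y using G_shift[of y "- s"] by simp
    then show "(\<integral>\<^sup>+y. ?I (G y) * f (y + s *\<^sub>R e) \<partial>lborel) = (\<integral>\<^sup>+y. ?I (G y - s) * f y \<partial>lborel)"
      using nn_integral_translate[of "\<lambda>y. ?I (G y) * f (y + s *\<^sub>R e)" "- s *\<^sub>R e"] by simp
  qed
  also have "\<dots> = (\<integral>\<^sup>+y. \<integral>\<^sup>+s. ?I (G y - s) * f y \<partial>lborel \<partial>lborel)"
    by (rule lborel_pair.Fubini') measurable
  also have "\<dots> = (\<integral>\<^sup>+y. f y \<partial>lborel)"
  proof (rule nn_integral_cong)
    fix y
    have "?I (G y - s) = indicator {G y - 1<..G y} s" for s by (auto simp: indicator_def)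
    then show "(\<integral>\<^sup>+s. ?I (G y - s) * f y \<partial>lborel) = f y"
      by (simp add: nn_integral_multc)
  qed
  finally show ?thesis ..
qed

text \<open>
  The volume of the strip above \<open>E\<close> depends only on its height in direction \<open>e\<close>, so its base may be
  moved from the graph to the projection \<open>pr ` E\<close> of \<open>E\<close> along \<open>e\<close> to the hyperplane orthogonal to \<open>\<nu>\<close>.
  Sliced orthogonally to \<open>\<nu>\<close>, the new strip consists of translates of \<open>pr ` E\<close>.  The set \<open>A\<close> has height \<open>1\<close> in
  direction \<open>e\<close> and therefore height \<open>e \<bullet> \<nu>\<close> in direction \<open>\<nu>\<close>.
\<close>

lemma graph_measure_oblique:
  assumes E[measurable]: "E \<in> sets borel" and E0: "\<And>x. x \<in> E \<Longrightarrow> G x = 0"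
    and \<nu>: "norm \<nu> = 1" and c: "0 < e \<bullet> \<nu>"
  defines "pr \<equiv> \<lambda>x. x - ((x \<bullet> \<nu>) / (e \<bullet> \<nu>)) *\<^sub>R e"
  shows "pr ` E \<in> sets borel" "emeasure graph_measure E = ennreal (e \<bullet> \<nu>) * emeasure surface_measure (pr ` E)"
proof -
  let ?c = "e \<bullet> \<nu>"
  have nn: "\<nu> \<bullet> \<nu> = 1" using \<nu> by (simp add: norm_eq_1)
  define A where "A = {y. foot y \<in> E \<and> 0 \<le> y \<bullet> \<nu> \<and> y \<bullet> \<nu> < ?c}"
  have A[measurable]: "A \<in> sets borel" unfolding A_def by measurable
  define E' where "E' = {z. z \<bullet> \<nu> = 0 \<and> foot z \<in> E}"
  have E'[measurable]: "E' \<in> sets borel" unfolding E'_def by measurable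
  have pr_E: "pr ` E = E'"
  proof (intro set_eqI iffI)
    fix z assume "z \<in> pr ` E"
    then obtain x where x: "x \<in> E" "z = pr x" by blast
    have "foot z = foot x" using foot_shift[of x "- ((x \<bullet> \<nu>) / ?c)"] by (simp add: x pr_def)
    moreover have "z \<bullet> \<nu> = 0" using c by (simp add: x pr_def inner_simps)
    ultimately show "z \<in> E'" using x E0 by (simp add: E'_def foot_eq)
  next
    fix z assume z: "z \<in> E'"
    then have "pr (foot z) = z" using c by (simp add: pr_def foot_def E'_def inner_simps)
    then show "z \<in> pr ` E" using z by (force simp: E'_def)
  qed
  then show "pr ` E \<in> sets borel" by simp
  have "emeasure lborel A = (\<integral>\<^sup>+p. \<integral>\<^sup>+s. indicator A (p + s *\<^sub>R e) \<partial>lborel \<partial>graph_measure)"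
    using nn_integral_coarea[of "indicator A"] by simp
  also have "\<dots> = (\<integral>\<^sup>+p. indicator E p \<partial>graph_measure)"
  proof (intro nn_integral_cong_AE, use AE_graph_measure in eventually_elim)
    fix p assume p: "G p = 0"
    have "p + s *\<^sub>R e \<in> A \<longleftrightarrow> p \<in> E \<and> s \<in> {- (p \<bullet> \<nu>) / ?c..<1 - (p \<bullet> \<nu>) / ?c}" for s
      using c by (auto simp: A_def foot_eq[OF p] inner_simps field_simps)
    then have "indicator A (p + s *\<^sub>R e) = (indicator E p * indicator {- (p \<bullet> \<nu>) / ?c..<1 - (p \<bullet> \<nu>) / ?c} s :: ennreal)" for s
      by (simp add: indicator_def)
    then show "(\<integral>\<^sup>+s. indicator A (p + s *\<^sub>R e) \<partial>lborel) = (indicator E p :: ennreal)"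
      by (simp add: nn_integral_cmult)
  qed
  also have "\<dots> = emeasure graph_measure E" by simp
  finally have 1: "emeasure lborel A = emeasure graph_measure E" .
  have slice: "emeasure surface_measure {z. z \<bullet> \<nu> = 0 \<and> z + t *\<^sub>R \<nu> \<in> A} = emeasure surface_measure E' * indicator {0..<?c} t" for t
  proof (cases "t \<in> {0..<?c}")
    case False
    then have "{z. z \<bullet> \<nu> = 0 \<and> z + t *\<^sub>R \<nu> \<in> A} = {}" by (auto simp: A_def inner_simps nn)
    then have "emeasure surface_measure {z. z \<bullet> \<nu> = 0 \<and> z + t *\<^sub>R \<nu> \<in> A} = 0" by (simp only: emeasure_empty)
    then show ?thesis using False by simp
  next
    case True
    let ?a = "(t / ?c) *\<^sub>R e - t *\<^sub>R \<nu>"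
    have eq: "{z. z \<bullet> \<nu> = 0 \<and> z + t *\<^sub>R \<nu> \<in> A} = (+) ?a ` E'"
    proof (intro set_eqI iffI)
      fix z assume z: "z \<in> {z. z \<bullet> \<nu> = 0 \<and> z + t *\<^sub>R \<nu> \<in> A}"
      have "foot (z - ?a) = foot (z + t *\<^sub>R \<nu>)"
        using foot_shift[of "z + t *\<^sub>R \<nu>" "- (t / ?c)"] by (simp add: algebra_simps)
      moreover have "(z - ?a) \<bullet> \<nu> = 0" using z c by (simp add: inner_simps nn)
      ultimately have "z - ?a \<in> E'" using z by (simp add: E'_def A_def)
      then have "?a + (z - ?a) \<in> (+) ?a ` E'" by (rule imageI)
      then show "z \<in> (+) ?a ` E'" by simp
    next
      fix z assume "z \<in> (+) ?a ` E'"
      then obtain y where y: "y \<in> E'" "z = ?a + y" by blast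
      have "foot (z + t *\<^sub>R \<nu>) = foot y" using foot_shift[of y "t / ?c"] by (simp add: y algebra_simps)
      then show "z \<in> {z. z \<bullet> \<nu> = 0 \<and> z + t *\<^sub>R \<nu> \<in> A}"
        using y(1) True c by (simp add: A_def E'_def y(2) inner_simps nn)
    qed
    have "(+) ?a ` E' \<in> sets borel" unfolding eq[symmetric] by measurable
    then show ?thesis using True unfolding eq by (simp add: emeasure_surface_translation[OF E'])
  qed
  have "emeasure lborel A = ennreal ?c * emeasure surface_measure E'"
    using emeasure_lborel_slices[OF A \<nu>] c unfolding slice by (simp add: nn_integral_cmult mult.commute)
  then show "emeasure graph_measure E = ennreal ?c * emeasure surface_measure (pr ` E)"
    by (simp add: 1 pr_E)
qed

text \<open>
  If the chords of \<open>E\<close> are almost orthogonal to \<open>\<nu>\<close>, then the oblique projection along \<open>e\<close> moves every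
  chord \<open>x - y\<close> by at most \<open>\<theta> * norm (x - y)\<close>.  So it distorts the surface measure at most by the powers of
  \<open>1 + \<theta>\<close> and \<open>1 / (1 - \<theta>)\<close>.
\<close>

lemma graph_measure_flat:
  assumes E[measurable]: "E \<in> sets borel" and E0: "\<And>x. x \<in> E \<Longrightarrow> G x = 0"
    and \<nu>: "norm \<nu> = 1" and c: "0 < e \<bullet> \<nu>" and \<theta>: "0 \<le> \<theta>" 
    and flat: "\<And>x y. x \<in> E \<Longrightarrow> y \<in> E \<Longrightarrow> \<bar>(y - x) \<bullet> \<nu>\<bar> \<le> \<theta> * (e \<bullet> \<nu>) * norm (y - x)"
  shows "emeasure graph_measure E \<le> ennreal ((e \<bullet> \<nu>) * (1 + \<theta>) ^ (CARD('d) - 1)) * emeasure surface_measure E"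
    and "\<theta> < 1 \<Longrightarrow> ennreal (e \<bullet> \<nu>) * emeasure surface_measure E \<le> ennreal ((1 / (1 - \<theta>)) ^ (CARD('d) - 1)) * emeasure graph_measure E"
proof -
  let ?c = "e \<bullet> \<nu>"
  define pr where "pr x = x - ((x \<bullet> \<nu>) / ?c) *\<^sub>R e" for x
  note o = graph_measure_oblique[OF E E0 \<nu> c, folded pr_def]
  have d: "norm ((pr x - pr y) - (x - y)) \<le> \<theta> * norm (x - y)" if "x \<in> E" "y \<in> E" for x y
  proof -
    have "(pr x - pr y) - (x - y) = (((y - x) \<bullet> \<nu>) / ?c) *\<^sub>R e"
      by (simp add: pr_def inner_simps diff_divide_distrib algebra_simps)
    then have "norm ((pr x - pr y) - (x - y)) = \<bar>(y - x) \<bullet> \<nu>\<bar> / ?c" using norm_e c by simp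
    also have "\<dots> \<le> \<theta> * norm (x - y)"
      using flat[OF that] c by (simp add: field_simps norm_minus_commute)
    finally show ?thesis .
  qed
  have up: "dist (pr x) (pr y) \<le> (1 + \<theta>) * dist x y" if "x \<in> E" "y \<in> E" for x y
    using d[OF that] norm_triangle_ineq[of "(pr x - pr y) - (x - y)" "x - y"]
    by (simp add: dist_norm algebra_simps)
  have low: "(1 - \<theta>) * dist x y \<le> dist (pr x) (pr y)" if "x \<in> E" "y \<in> E" for x y
    using d[OF that] norm_triangle_ineq2[of "x - y" "(x - y) - (pr x - pr y)"]
    by (simp add: dist_norm algebra_simps norm_minus_commute)
  have "emeasure graph_measure E = ennreal ?c * emeasure surface_measure (pr ` E)" by (rule o)
  also have "\<dots> \<le> ennreal ?c * (ennreal ((1 + \<theta>) ^ (CARD('d) - 1)) * emeasure surface_measure E)"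
    by (intro mult_left_mono emeasure_surface_lipschitz E o up) (use \<theta> in auto)
  finally show "emeasure graph_measure E \<le> ennreal (?c * (1 + \<theta>) ^ (CARD('d) - 1)) * emeasure surface_measure E"
    using c \<theta> by (simp add: ennreal_mult mult.assoc)
  assume "\<theta> < 1"
  have inj: "inj_on pr E"
  proof (rule inj_onI)
    fix x y assume "x \<in> E" "y \<in> E" "pr x = pr y"
    then show "x = y" using low[of x y] \<open>\<theta> < 1\<close> by (simp add: mult_le_0_iff)
  qed
  have im: "inv_into E pr ` pr ` E = E" using inj by (simp add: inv_into_image_cancel)
  have "emeasure surface_measure (inv_into E pr ` pr ` E) \<le> ennreal ((1 / (1 - \<theta>)) ^ (CARD('d) - 1)) * emeasure surface_measure (pr ` E)"
  proof (rule emeasure_surface_lipschitz)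
    fix x y assume "x \<in> pr ` E" "y \<in> pr ` E"
    then obtain x' y' where xy: "x' \<in> E" "y' \<in> E" "x = pr x'" "y = pr y'" by blast
    have "dist x' y' \<le> 1 / (1 - \<theta>) * dist x y"
      using low[OF xy(1,2)] \<open>\<theta> < 1\<close> unfolding xy(3,4) by (simp add: pos_le_divide_eq mult.commute)
    then show "dist (inv_into E pr x) (inv_into E pr y) \<le> 1 / (1 - \<theta>) * dist x y"
      using xy inj by (simp add: inv_into_f_f)
  next
    show "inv_into E pr ` pr ` E \<in> sets borel" unfolding im by (rule E)
  qed (use o(1) \<open>\<theta> < 1\<close> in simp_all)
  then have "ennreal ?c * emeasure surface_measure E \<le> ennreal ?c * (ennreal ((1 / (1 - \<theta>)) ^ (CARD('d) - 1)) * emeasure surface_measure (pr ` E))"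
    unfolding im by (rule mult_left_mono) simp
  also have "\<dots> = ennreal ((1 / (1 - \<theta>)) ^ (CARD('d) - 1)) * emeasure graph_measure E"
  proof -
    have "emeasure graph_measure E = ennreal ?c * emeasure surface_measure (pr ` E)" by (rule o)
    then show ?thesis by (simp only: mult.left_commute)
  qed
  finally show "ennreal ?c * emeasure surface_measure E \<le> ennreal ((1 / (1 - \<theta>)) ^ (CARD('d) - 1)) * emeasure graph_measure E" .
qed

lemma graph_measure_null:
  assumes "E \<in> sets borel" "\<And>x. x \<in> E \<Longrightarrow> G x = 0" "emeasure surface_measure E = 0"
  shows "emeasure graph_measure E = 0"
proof -
  have "\<bar>(y - x) \<bullet> e\<bar> \<le> 1 * (e \<bullet> e) * norm (y - x)" for x y
    using Cauchy_Schwarz_ineq2[of "y - x" e] by (simp add: e_e norm_e)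
  from graph_measure_flat(1)[OF assms(1,2) norm_e _ _ this] show ?thesis
    using assms(3) by (simp add: e_e)
qed

text \<open>
  The graph is the image of the hyperplane under the Lipschitz map \<open>foot\<close>.
\<close>

lemma surface_measure_graph_finite:
  "emeasure surface_measure ({x. G x = 0} \<inter> cball 0 R) < top"
proof -
  let ?D = "{z. z \<bullet> e = 0 \<and> z \<in> cball 0 (2 * R)}"
  have cl: "closed ?D"
    unfolding Collect_conj_eq Collect_mem_eq
    by (intro closed_Int closed_Collect_eq continuous_intros closed_cball)
  have "bounded ?D" by (rule bounded_subset[OF bounded_cball[of 0 "2 * R"]]) blast
  with cl have "compact ?D" by (simp only: compact_eq_bounded_closed)
  then have "compact (foot ` ?D)" by (intro compact_continuous_image foot_continuous)
  then have im: "foot ` ?D \<in> sets borel" by (intro borel_closed compact_imp_closed)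
  have sub: "{x. G x = 0} \<inter> cball 0 R \<subseteq> foot ` ?D"
  proof
    fix x assume x: "x \<in> {x. G x = 0} \<inter> cball 0 R"
    let ?z = "x - (x \<bullet> e) *\<^sub>R e"
    have "foot ?z = x" using x foot_shift[of x "- (x \<bullet> e)"] by (simp add: foot_eq)
    moreover have "norm ?z \<le> norm x + norm x"
      using norm_triangle_ineq4[of x "(x \<bullet> e) *\<^sub>R e"] Cauchy_Schwarz_ineq2[of x e] norm_e by simp
    then have "?z \<in> ?D" using x by (simp add: inner_simps e_e)
    ultimately show "x \<in> foot ` ?D" by force
  qed
  have "emeasure surface_measure ({x. G x = 0} \<inter> cball 0 R) \<le> emeasure surface_measure (foot ` ?D)"
    using im by (intro emeasure_mono sub) auto
  also have "\<dots> \<le> ennreal ((1 + K) ^ (CARD('d) - 1)) * emeasure surface_measure ?D"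
    using K_ge_1 by (intro emeasure_surface_lipschitz im dist_foot borel_closed cl) auto
  also have "\<dots> < top" using emeasure_surface_hyperplane_ball_finite[OF norm_e, of "2 * R"]
    by (simp add: ennreal_mult_less_top)
  finally show ?thesis .
qed

end

lemma ennreal_le_limit:
  fixes a b :: ennreal
  assumes "f \<longlonglongrightarrow> 1" "\<And>j. 0 \<le> f j" "\<And>j. a \<le> ennreal (f j) * b"
  shows "a \<le> b"
proof (cases b)
  case (real r)
  have "(\<lambda>j. ennreal (f j * r)) \<longlonglongrightarrow> ennreal (1 * r)"
    by (intro tendsto_ennrealI tendsto_mult assms tendsto_const)
  moreover have "a \<le> ennreal (f j * r)" for j
    using assms(2,3)[of j] real by (simp add: ennreal_mult)
  ultimately show ?thesis using real by (intro LIMSEQ_le_const[of "\<lambda>j. ennreal (f j * r)"]) auto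
qed simp

text \<open>
  The pieces may overlap because the estimate is inherited by all measurable subsets of a piece.
\<close>

lemma emeasure_le_countable_cover:
  fixes B :: "'i \<Rightarrow> 'a set"
  assumes "sets M = sets N" "countable I" and B: "\<And>i. i \<in> I \<Longrightarrow> B i \<in> sets M"
    and le: "\<And>i A. i \<in> I \<Longrightarrow> A \<in> sets M \<Longrightarrow> A \<subseteq> B i \<Longrightarrow> emeasure M A \<le> r * emeasure N A"
  shows "emeasure M (\<Union>i\<in>I. B i) \<le> r * emeasure N (\<Union>i\<in>I. B i)"
proof (cases "I = {}")
  case False
  define C where "C n = B (from_nat_into I n)" for n
  have C: "C n \<in> sets M" for n using B from_nat_into[OF False] by (simp add: C_def)
  have "range C \<subseteq> sets M" using C by blast
  then have rD: "range (disjointed C) \<subseteq> sets M" by (rule sets.range_disjointed_sets)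
  then have D: "disjointed C n \<in> sets M" for n by blast
  have U: "(\<Union>i\<in>I. B i) = (\<Union>n. disjointed C n)"
  proof -
    have "(\<Union>n. disjointed C n) = (\<Union>n. C n)" by (rule UN_disjointed_eq)
    also have "\<dots> = (\<Union>i\<in>range (from_nat_into I). B i)" by (simp add: C_def)
    also have "\<dots> = (\<Union>i\<in>I. B i)" using range_from_nat_into[OF False \<open>countable I\<close>] by simp
    finally show ?thesis by simp
  qed
  have "emeasure M (\<Union>n. disjointed C n) = (\<Sum>n. emeasure M (disjointed C n))"
    using suminf_emeasure[OF rD disjoint_family_disjointed] by simp
  also have "\<dots> \<le> (\<Sum>n. r * emeasure N (disjointed C n))"
  proof (rule suminf_le)
    fix n
    show "emeasure M (disjointed C n) \<le> r * emeasure N (disjointed C n)"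
      using le[OF from_nat_into[OF False] D, of n n] disjointed_subset[of C n] by (simp add: C_def)
  qed auto
  also have "\<dots> = r * emeasure N (\<Union>n. disjointed C n)"
    using suminf_emeasure[OF rD[unfolded \<open>sets M = sets N\<close>] disjoint_family_disjointed] by simp
  finally show ?thesis by (simp add: U)
qed simp


lemma density_surface_bounds:
  fixes N :: "'a measure" and g :: "'a \<Rightarrow> real"
  assumes [measurable]: "A \<in> sets N" "g \<in> borel_measurable N"
    and "\<And>x. x \<in> A \<Longrightarrow> a \<le> g x" "\<And>x. x \<in> A \<Longrightarrow> g x \<le> b"
  shows "ennreal a * emeasure N A \<le> emeasure (density N (\<lambda>x. ennreal (g x))) A"
    and "emeasure (density N (\<lambda>x. ennreal (g x))) A \<le> ennreal b * emeasure N A"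
proof -
  have eq: "emeasure (density N (\<lambda>x. ennreal (g x))) A = (\<integral>\<^sup>+x. ennreal (g x) * indicator A x \<partial>N)"
    by (rule emeasure_density) auto
  have "ennreal a * emeasure N A = (\<integral>\<^sup>+x. ennreal a * indicator A x \<partial>N)" by (simp add: nn_integral_cmult)
  also have "\<dots> \<le> (\<integral>\<^sup>+x. ennreal (g x) * indicator A x \<partial>N)"
    using assms by (intro nn_integral_mono) (auto simp: indicator_def intro: ennreal_leI)
  finally show "ennreal a * emeasure N A \<le> emeasure (density N (\<lambda>x. ennreal (g x))) A" by (simp add: eq)
  have "(\<integral>\<^sup>+x. ennreal (g x) * indicator A x \<partial>N) \<le> (\<integral>\<^sup>+x. ennreal b * indicator A x \<partial>N)"
    using assms by (intro nn_integral_mono) (auto simp: indicator_def intro: ennreal_leI)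
  also have "\<dots> = ennreal b * emeasure N A" by (simp add: nn_integral_cmult)
  finally show "emeasure (density N (\<lambda>x. ennreal (g x))) A \<le> ennreal b * emeasure N A" by (simp add: eq)
qed

text \<open>
  \<open>C\<close> is a window in which the open set \<open>\<Omega>\<close> is the region below the graph.
\<close>

locale lip_patch = lip_level e G K for e :: "real^'d" and G K +
  fixes \<Omega> C :: "(real^'d) set"
  assumes open_\<Omega>: "open \<Omega>" and open_C: "open C"
    and patch: "\<And>x. x \<in> C \<Longrightarrow> x \<in> \<Omega> \<longleftrightarrow> G x < 0"
begin

lemma frontier_patch:
  assumes x: "x \<in> C"
  shows "x \<in> frontier \<Omega> \<longleftrightarrow> G x = 0"
proof
  assume fr: "x \<in> frontier \<Omega>"
  then have "x \<notin> \<Omega>" using open_\<Omega> by (auto simp: frontier_def interior_open)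
  then have "0 \<le> G x" using patch[OF x] by simp
  moreover have "\<not> 0 < G x"
  proof
    assume "0 < G x"
    have "open (C \<inter> {y. 0 < G y})"
      by (intro open_Int open_C open_Collect_less continuous_intros G_continuous)
    then have "C \<inter> {y. 0 < G y} \<inter> closure \<Omega> = {}"
      using patch by (subst open_Int_closure_eq_empty) auto
    then show False using fr x \<open>0 < G x\<close> by (auto simp: frontier_def)
  qed
  ultimately show "G x = 0" by simp
next
  assume G0: "G x = 0"
  then have "x \<notin> \<Omega>" using patch[OF x] by simp
  moreover have "x \<in> closure \<Omega>"
    unfolding closure_approachable
  proof (intro allI impI)
    fix r :: real assume "0 < r"
    obtain s where s: "0 < s" "ball x s \<subseteq> C" using open_C x by (auto simp: open_contains_ball)
    define t where "t = min r s / 2"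
    have t: "0 < t" "t < r" "t < s" using s \<open>0 < r\<close> by (auto simp: t_def)
    have d: "dist (x + (- t) *\<^sub>R e) x = t" using t norm_e by (simp add: dist_norm)
    then have "x + (- t) *\<^sub>R e \<in> C" using s t by (auto simp: subset_iff dist_commute)
    moreover have "G (x + (- t) *\<^sub>R e) < 0" using G_shift[of x "- t"] G0 t by simp
    ultimately have "x + (- t) *\<^sub>R e \<in> \<Omega>" using patch by blast
    then show "\<exists>y\<in>\<Omega>. dist y x < r" using d t by (intro bexI[of _ "x + (- t) *\<^sub>R e"]) auto
  qed
  ultimately show "x \<in> frontier \<Omega>" using open_\<Omega> by (auto simp: frontier_def interior_open)
qed

text \<open>
  The open cone below \<open>x\<close> with axis \<open>e\<close> and slope \<open>K\<close> lies in \<open>\<Omega>\<close> near \<open>x\<close>, so all its directions \<open>\<nu> - a *\<^sub>R e\<close>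
  with \<open>a > K\<close> have a nonpositive component along the outward normal \<open>\<nu>\<close>.
\<close>

lemma normal_ge:
  assumes x: "x \<in> C" "G x = 0" and \<nu>: "outward_unit_normal_at \<Omega> x \<nu>"
  shows "1 / K \<le> e \<bullet> \<nu>"
proof -
  have nn: "norm \<nu> = 1" using \<nu> by (simp add: outward_unit_normal_at_def)
  have le: "1 \<le> a * (e \<bullet> \<nu>)" if a: "K < a" for a
  proof (rule ccontr)
    assume neg: "\<not> 1 \<le> a * (e \<bullet> \<nu>)"
    define w where "w = \<nu> - a *\<^sub>R e"
    define \<epsilon> where "\<epsilon> = (w \<bullet> \<nu>) / 2 / (1 + a)"
    have w: "0 < w \<bullet> \<nu>" using neg nn by (simp add: w_def inner_simps norm_eq_1)
    have nw: "norm w \<le> 1 + a" using norm_triangle_ineq4[of \<nu> "a *\<^sub>R e"] nn norm_e a K_ge_1 by (simp add: w_def)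
    have a0: "0 < 1 + a" using a K_ge_1 by simp
    then have "0 < \<epsilon>" using w by (simp add: \<epsilon>_def)
    then obtain r where r: "0 < r" "\<And>y. y \<in> ball x r \<Longrightarrow> \<epsilon> * norm (y - x) < (y - x) \<bullet> \<nu> \<Longrightarrow> y \<notin> \<Omega>"
      using \<nu> unfolding outward_unit_normal_at_def by blast
    obtain s where s: "0 < s" "ball x s \<subseteq> C" using open_C x by (auto simp: open_contains_ball)
    define t where "t = min r s / 2 / (1 + a)"
    have t: "0 < t" using s r a0 by (simp add: t_def)
    have "norm (t *\<^sub>R w) \<le> t * (1 + a)" using nw t by simp
    also have "t * (1 + a) = min r s / 2" unfolding t_def using a0 by (intro nonzero_divide_eq_eq[THEN iffD1, symmetric]) auto
    also have "\<dots> < min r s" using s r by auto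
    finally have nt: "norm (t *\<^sub>R w) < min r s" .
    then have C: "x + t *\<^sub>R w \<in> C" using s by (auto simp: dist_norm subset_iff)
    have "G (x + t *\<^sub>R w) = G (x + t *\<^sub>R \<nu> + (- (t * a)) *\<^sub>R e)" by (simp add: w_def algebra_simps)
    also have "\<dots> = G (x + t *\<^sub>R \<nu>) - t * a" by (simp only: G_shift)
    also have "\<dots> \<le> t * K - t * a" using G_lip[of "x + t *\<^sub>R \<nu>" x] x t nn by (simp add: mult.commute)
    also have "\<dots> < 0" using a t by simp
    finally have "x + t *\<^sub>R w \<in> \<Omega>" using C patch by blast
    moreover have "\<epsilon> * norm (t *\<^sub>R w) < (t *\<^sub>R w) \<bullet> \<nu>"
    proof -
      have "\<epsilon> * norm w \<le> \<epsilon> * (1 + a)" using nw \<open>0 < \<epsilon>\<close> by simp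
      also have "\<epsilon> * (1 + a) = (w \<bullet> \<nu>) / 2"
        unfolding \<epsilon>_def using a0 by (intro nonzero_divide_eq_eq[THEN iffD1, symmetric]) auto
      also have "\<dots> < w \<bullet> \<nu>" using w by simp
      finally show ?thesis using t by (simp add: mult.left_commute)
    qed
    ultimately show False using r(2)[of "x + t *\<^sub>R w"] nt by (auto simp: dist_norm)
  qed
  have pos: "0 < e \<bullet> \<nu>" using le[of "K + 1"] K_ge_1 by (smt (verit) mult_nonneg_nonpos)
  have "1 / (e \<bullet> \<nu>) \<le> K"
  proof (rule field_le_epsilon)
    fix d :: real assume "0 < d"
    then show "1 / (e \<bullet> \<nu>) \<le> K + d" using le[of "K + d"] pos by (simp add: field_simps)
  qed
  then show ?thesis using pos K_ge_1 by (simp add: field_simps)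
qed

text \<open>
  Near \<open>x\<close> the two cones around the normal belong to \<open>\<Omega>\<close> and to its exterior, respectively; the graph
  is the frontier and stays away from both.
\<close>

lemma normal_flat:
  assumes x: "x \<in> C" "G x = 0" and \<nu>: "outward_unit_normal_at \<Omega> x \<nu>" and \<epsilon>: "0 < \<epsilon>"
  obtains r where "0 < r" "\<And>y. dist y x < r \<Longrightarrow> y \<in> C \<Longrightarrow> G y = 0 \<Longrightarrow> \<bar>(y - x) \<bullet> \<nu>\<bar> \<le> \<epsilon> * norm (y - x)"
proof -
  obtain r where r: "0 < r" "\<And>y. y \<in> ball x r \<Longrightarrow> (y - x) \<bullet> \<nu> < - \<epsilon> * norm (y - x) \<Longrightarrow> y \<in> \<Omega>"
     "\<And>y. y \<in> ball x r \<Longrightarrow> \<epsilon> * norm (y - x) < (y - x) \<bullet> \<nu> \<Longrightarrow> y \<notin> \<Omega>"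
    using \<nu> \<epsilon> unfolding outward_unit_normal_at_def by blast
  have "\<bar>(y - x) \<bullet> \<nu>\<bar> \<le> \<epsilon> * norm (y - x)" if y: "dist y x < r" "y \<in> C" "G y = 0" for y
  proof (rule ccontr)
    assume "\<not> ?thesis"
    then consider "(y - x) \<bullet> \<nu> < - \<epsilon> * norm (y - x)" | "\<epsilon> * norm (y - x) < (y - x) \<bullet> \<nu>" by linarith
    then show False
    proof cases
      case 1
      then have "y \<in> \<Omega>" using r(2) y by (simp add: dist_commute)
      then show False using patch[of y] y by simp
    next
      case 2
      have "open (ball x r \<inter> {z. \<epsilon> * norm (z - x) < (z - x) \<bullet> \<nu>})"
        by (intro open_Int open_ball open_Collect_less continuous_intros)
      then have "ball x r \<inter> {z. \<epsilon> * norm (z - x) < (z - x) \<bullet> \<nu>} \<inter> closure \<Omega> = {}"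
        using r(3) by (subst open_Int_closure_eq_empty) auto
      moreover have "y \<in> closure \<Omega>" using frontier_patch[of y] y by (simp add: frontier_def)
      ultimately show False using 2 y by (auto simp: dist_commute)
    qed
  qed
  then show ?thesis using that r(1) by blast
qed

text \<open>
  The foot of \<open>x + h *\<^sub>R v\<close> is a point of the graph at distance \<open>O(h)\<close> from \<open>x\<close>, so its offset
  \<open>h v - G (x + h v) e\<close> from \<open>x\<close> is orthogonal to \<open>\<nu>\<close> up to \<open>o(h)\<close>.
\<close>

lemma G_directional_derivative:
  assumes x: "x \<in> C" "G x = 0" and \<nu>: "outward_unit_normal_at \<Omega> x \<nu>"
  shows "((\<lambda>h. G (x + h *\<^sub>R v) / h) \<longlongrightarrow> (v \<bullet> \<nu>) / (e \<bullet> \<nu>)) (at 0)"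
proof -
  have c: "0 < e \<bullet> \<nu>" using normal_ge[OF assms] K_ge_1 by (smt (verit) divide_pos_pos)
  define M where "M = (1 + K) * norm v + 1"
  have M: "0 < M" using K_ge_1 by (simp add: M_def add_nonneg_pos)
  show ?thesis
  proof (rule tendstoI)
    fix \<epsilon> :: real assume "0 < \<epsilon>"
    define \<eta> where "\<eta> = \<epsilon> * (e \<bullet> \<nu>) / (2 * M)"
    have \<eta>: "0 < \<eta>" using \<open>0 < \<epsilon>\<close> c M by (simp add: \<eta>_def)
    obtain r where r: "0 < r" "\<And>y. dist y x < r \<Longrightarrow> y \<in> C \<Longrightarrow> G y = 0 \<Longrightarrow> \<bar>(y - x) \<bullet> \<nu>\<bar> \<le> \<eta> * norm (y - x)"
      using normal_flat[OF assms \<eta>] by blast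
    obtain s where s: "0 < s" "ball x s \<subseteq> C" using open_C x by (auto simp: open_contains_ball)
    have "dist (G (x + h *\<^sub>R v) / h) ((v \<bullet> \<nu>) / (e \<bullet> \<nu>)) < \<epsilon>" if h: "h \<noteq> 0" "\<bar>h\<bar> < min r s / M" for h
    proof -
      define y where "y = foot (x + h *\<^sub>R v)"
      have "dist y x \<le> (1 + K) * norm (h *\<^sub>R v)"
        using dist_foot[of "x + h *\<^sub>R v" x] x by (simp add: y_def foot_eq dist_norm)
      also have "\<dots> \<le> \<bar>h\<bar> * M" by (simp add: M_def algebra_simps)
      finally have dy: "dist y x \<le> \<bar>h\<bar> * M" .
      also have "\<bar>h\<bar> * M < min r s" using h M by (simp add: field_simps)
      finally have "dist y x < r" "y \<in> C" using s by (auto simp: dist_commute subset_iff)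
      then have "\<bar>(y - x) \<bullet> \<nu>\<bar> \<le> \<eta> * norm (y - x)" using r(2)[of y] by (simp add: y_def)
      also have "\<dots> \<le> \<eta> * (\<bar>h\<bar> * M)" using dy \<eta> by (simp add: dist_norm)
      finally have 1: "\<bar>(y - x) \<bullet> \<nu>\<bar> \<le> \<eta> * (\<bar>h\<bar> * M)" .
      have 2: "(y - x) \<bullet> \<nu> = h * (v \<bullet> \<nu>) - G (x + h *\<^sub>R v) * (e \<bullet> \<nu>)"
        by (simp add: y_def foot_def inner_simps)
      have "G (x + h *\<^sub>R v) / h - (v \<bullet> \<nu>) / (e \<bullet> \<nu>) = - ((y - x) \<bullet> \<nu>) / (h * (e \<bullet> \<nu>))"
        using h c unfolding 2 by (simp add: field_simps)
      then have "\<bar>G (x + h *\<^sub>R v) / h - (v \<bullet> \<nu>) / (e \<bullet> \<nu>)\<bar> = \<bar>(y - x) \<bullet> \<nu>\<bar> / (\<bar>h\<bar> * (e \<bullet> \<nu>))"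
        using c by (simp add: abs_mult)
      also have "\<dots> \<le> \<eta> * (\<bar>h\<bar> * M) / (\<bar>h\<bar> * (e \<bullet> \<nu>))"
        using 1 c h by (intro divide_right_mono) auto
      also have "\<dots> = \<epsilon> / 2" using h c M by (simp add: \<eta>_def)
      finally show ?thesis using \<open>0 < \<epsilon>\<close> by (simp add: dist_real_def)
    qed
    then show "\<forall>\<^sub>F h in at 0. dist (G (x + h *\<^sub>R v) / h) ((v \<bullet> \<nu>) / (e \<bullet> \<nu>)) < \<epsilon>"
      using r s M unfolding eventually_at by (intro exI[of _ "min r s / M"]) auto
  qed
qed

text \<open>
  \<open>B (m, p, \<nu>)\<close> collects the points of \<open>E\<close> close to \<open>p\<close> whose normal is close to \<open>\<nu>\<close> and where the
  flatness of the graph holds already at the scale \<open>1 / (m + 1)\<close>.  With \<open>p\<close> and \<open>\<nu>\<close> in countable dense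
  sets these pieces cover \<open>E\<close>, and \<open>graph_measure_flat\<close> applies to each of their subsets.  Flatness is
  required only with respect to a countable dense set \<open>Q\<close> of points, which makes the pieces
  measurable; it extends to all points of \<open>E\<close> by continuity.
\<close>

lemma graph_measure_density_bounds:
  assumes E[measurable]: "E \<in> sets borel" and EC: "E \<subseteq> C" and E0: "\<And>x. x \<in> E \<Longrightarrow> G x = 0"
    and nE: "\<And>x. x \<in> E \<Longrightarrow> outward_unit_normal_at \<Omega> x (n x)"
    and n[measurable]: "n \<in> borel_measurable borel"
    and \<theta>: "0 < \<theta>" "\<theta> \<le> 1 / 2"
  defines "D \<equiv> density surface_measure (\<lambda>x. ennreal (e \<bullet> n x))"
  shows "emeasure graph_measure E \<le> ennreal ((1 + \<theta>) ^ CARD('d)) * emeasure D E"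
    and "emeasure D E \<le> ennreal ((1 / (1 - \<theta>)) ^ CARD('d)) * emeasure graph_measure E"
proof -
  let ?k = "CARD('d) - 1"
  have k: "x ^ CARD('d) = x * x ^ ?k" for x :: real
    by (metis One_nat_def Suc_pred power_Suc zero_less_card_finite)
  \<comment> \<open>Since \<open>e \<bullet> n\<close> is at least \<open>1 / K\<close>, errors of size \<open>\<epsilon>\<close> in the normals are small relative to \<open>e \<bullet> n\<close>.\<close>
  define \<epsilon> where "\<epsilon> = \<theta> / (4 * K)"
  have \<epsilon>: "0 < \<epsilon>" using \<theta> K_ge_1 by (simp add: \<epsilon>_def)
  have \<epsilon>K: "4 * K * \<epsilon> = \<theta>" using K_ge_1 by (simp add: \<epsilon>_def)
  obtain Q where Q: "countable Q" "Q \<subseteq> E" "E \<subseteq> closure Q" by (rule separable[of E])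
  obtain Z :: "(real^'d) set" where Z: "countable Z" "Z \<subseteq> sphere 0 1" "sphere 0 1 \<subseteq> closure Z" by (rule separable[of "sphere 0 1 :: (real^'d) set"])
  define B where "B = (\<lambda>(m::nat, p, \<nu>). {x\<in>E. dist x p < 1 / (2 * real (Suc m)) \<and> dist (n x) \<nu> < \<epsilon> \<and>
    (\<forall>y\<in>Q. dist y x < 1 / real (Suc m) \<longrightarrow> \<bar>(y - x) \<bullet> n x\<bar> \<le> \<epsilon> * norm (y - x))})"
  define I where "I = (UNIV :: nat set) \<times> Q \<times> Z"
  have "countable I" using Q Z by (simp add: I_def)
  have Bm: "B i \<in> sets borel" for i
  proof -
    obtain m p \<nu> where i: "i = (m, p, \<nu>)" by (cases i)
    have "B i = E \<inter> {x. dist x p < 1 / (2 * real (Suc m)) \<and> dist (n x) \<nu> < \<epsilon>} \<inter>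
       (\<Inter>y\<in>Q. {x. dist y x < 1 / real (Suc m) \<longrightarrow> \<bar>(y - x) \<bullet> n x\<bar> \<le> \<epsilon> * norm (y - x)})"
      by (auto simp: B_def i)
    moreover have "(\<Inter>y\<in>Q. {x. dist y x < 1 / real (Suc m) \<longrightarrow> \<bar>(y - x) \<bullet> n x\<bar> \<le> \<epsilon> * norm (y - x)}) \<in> sets borel"
    proof (cases "Q = {}")
      case False
      then show ?thesis
        by (intro sets.countable_INT'' Q(1)) measurable
    qed simp
    ultimately show ?thesis by simp
  qed
  have UB: "(\<Union>i\<in>I. B i) = E"
  proof (intro set_eqI iffI)
    fix x assume x: "x \<in> E"
    obtain r where r: "0 < r" "\<And>y. dist y x < r \<Longrightarrow> y \<in> C \<Longrightarrow> G y = 0 \<Longrightarrow> \<bar>(y - x) \<bullet> n x\<bar> \<le> \<epsilon> * norm (y - x)"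
      using normal_flat[OF _ E0[OF x] nE[OF x] \<epsilon>] x EC by blast
    obtain m where m: "1 / real (Suc m) < r" using reals_Archimedean[OF r(1)] by (auto simp: inverse_eq_divide)
    obtain p where p: "p \<in> Q" "dist p x < 1 / (2 * real (Suc m))"
    proof -
      have pos: "0 < 1 / (2 * real (Suc m))" by simp
      have "x \<in> closure Q" using Q(3) x by (rule subsetD)
      then have "\<exists>p\<in>Q. dist p x < 1 / (2 * real (Suc m))" using pos closure_approachable[of x Q] by (simp only:)
      then show ?thesis by (elim bexE) (rule that)
    qed
    have "n x \<in> sphere 0 1" using nE[OF x] by (simp add: outward_unit_normal_at_def)
    then obtain \<nu> where \<nu>: "\<nu> \<in> Z" "dist \<nu> (n x) < \<epsilon>"
    proof -
      have "n x \<in> closure Z" using Z(3) \<open>n x \<in> sphere 0 1\<close> by (rule subsetD)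
      then have "\<exists>\<nu>\<in>Z. dist \<nu> (n x) < \<epsilon>" using \<epsilon> closure_approachable[of "n x" Z] by blast
      then show ?thesis by (elim bexE) (rule that)
    qed
    have "x \<in> B (m, p, \<nu>)"
      unfolding B_def using x p \<nu> r(2) m Q(2) EC E0 by (auto simp: dist_commute subset_iff)
    then show "x \<in> (\<Union>i\<in>I. B i)" using p \<nu> by (force simp: I_def)
  qed (auto simp: B_def)
  have piece: "emeasure graph_measure A \<le> ennreal ((1 + \<theta>) ^ CARD('d)) * emeasure D A \<and>
      emeasure D A \<le> ennreal ((1 / (1 - \<theta>)) ^ CARD('d)) * emeasure graph_measure A"
    if i: "i \<in> I" and A[measurable]: "A \<in> sets borel" and AB: "A \<subseteq> B i" for i A
  proof (cases "A = {}")
    case False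
    obtain m p \<nu> where i': "i = (m, p, \<nu>)" by (cases i)
    have Ax: "x \<in> E" "dist x p < 1 / (2 * real (Suc m))" "norm (n x - \<nu>) < \<epsilon>"
       "\<And>y. y \<in> Q \<Longrightarrow> dist y x < 1 / real (Suc m) \<Longrightarrow> \<bar>(y - x) \<bullet> n x\<bar> \<le> \<epsilon> * norm (y - x)"
      if "x \<in> A" for x
      using AB that by (auto simp: B_def i' dist_norm)
    have \<nu>1: "norm \<nu> = 1" using i Z by (auto simp: I_def i')
    let ?c = "e \<bullet> \<nu>"
    have near: "\<bar>e \<bullet> n x - ?c\<bar> \<le> \<epsilon>" if "x \<in> A" for x
      using Cauchy_Schwarz_ineq2[of e "n x - \<nu>"] Ax(3)[OF that] norm_e by (simp add: inner_simps)
    define \<kappa> where "\<kappa> = 1 / K"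
    have low: "\<kappa> \<le> e \<bullet> n x" if "x \<in> A" for x
      unfolding \<kappa>_def using normal_ge[of x "n x"] Ax(1)[OF that] EC E0 nE by blast
    obtain x0 where "x0 \<in> A" using False by blast
    have \<epsilon>1: "\<epsilon> \<le> \<kappa> / 8" using \<theta> K_ge_1 by (simp add: \<epsilon>_def \<kappa>_def field_simps)
    have K0: "0 < \<kappa>" using K_ge_1 by (simp add: \<kappa>_def)
    have c: "3 / 4 * \<kappa> \<le> ?c" using near[OF \<open>x0 \<in> A\<close>] low[OF \<open>x0 \<in> A\<close>] \<epsilon>1 K0 by linarith
    have c0: "0 < ?c" using c K0 by linarith
    have \<epsilon>\<theta>: "\<epsilon> = \<theta> * \<kappa> / 4" by (simp add: \<epsilon>_def \<kappa>_def)
    have "2 * \<epsilon> \<le> \<theta> * (3 / 4 * \<kappa>)" using \<epsilon>\<theta> mult_pos_pos[OF \<theta>(1) K0] by (simp add: algebra_simps)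
    also have "\<dots> \<le> \<theta> * ?c" using c \<theta> by (intro mult_left_mono) auto
    finally have \<epsilon>c: "2 * \<epsilon> \<le> \<theta> * ?c" .
    have flat: "\<bar>(y - x) \<bullet> \<nu>\<bar> \<le> \<theta> * ?c * norm (y - x)" if x: "x \<in> A" and y: "y \<in> A" for x y
    proof -
      have d: "dist y x < 1 / real (Suc m)"
      proof -
        have "dist y x < 1 / (2 * real (Suc m)) + 1 / (2 * real (Suc m))"
          using dist_triangle2[of y x p] add_strict_mono[OF Ax(2)[OF y] Ax(2)[OF x]] by (rule le_less_trans)
        also have "\<dots> = 1 / real (Suc m)" by (simp add: field_simps)
        finally show ?thesis .
      qed
      have "\<bar>(y - x) \<bullet> n x\<bar> \<le> \<epsilon> * norm (y - x)"
      proof -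
        obtain f where f: "\<And>j. f j \<in> Q" "f \<longlonglongrightarrow> y"
          using Q(3) Ax(1)[OF y] closure_sequential by (metis subset_iff)
        have "eventually (\<lambda>j. dist (f j) x < 1 / real (Suc m)) sequentially"
          using d by (intro order_tendstoD(2)[of "\<lambda>j. dist (f j) x" "dist y x"] tendsto_intros f)
        then have "eventually (\<lambda>j. \<bar>(f j - x) \<bullet> n x\<bar> \<le> \<epsilon> * norm (f j - x)) sequentially"
          by (rule eventually_mono) (use Ax(4)[OF x] f(1) in blast)
        then show ?thesis
          by (intro tendsto_le[of sequentially "\<lambda>j. \<epsilon> * norm (f j - x)" _ "\<lambda>j. \<bar>(f j - x) \<bullet> n x\<bar>"] tendsto_intros f) auto
      qed
      moreover have "\<bar>(y - x) \<bullet> (\<nu> - n x)\<bar> \<le> norm (y - x) * \<epsilon>"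
        using Cauchy_Schwarz_ineq2[of "y - x" "\<nu> - n x"] Ax(3)[OF x] mult_left_mono[of "norm (\<nu> - n x)" \<epsilon> "norm (y - x)"]
        by (simp add: norm_minus_commute)
      moreover have "(y - x) \<bullet> \<nu> = (y - x) \<bullet> n x + (y - x) \<bullet> (\<nu> - n x)" by (simp add: inner_simps)
      ultimately have "\<bar>(y - x) \<bullet> \<nu>\<bar> \<le> 2 * \<epsilon> * norm (y - x)" by (simp add: algebra_simps)
      also have "\<dots> \<le> \<theta> * ?c * norm (y - x)" using \<epsilon>c by (intro mult_right_mono) auto
      finally show ?thesis .
    qed
    have A0: "G x = 0" if "x \<in> A" for x using Ax(1)[OF that] E0 by blast
    note fl = graph_measure_flat[OF A A0 \<nu>1 c0 less_imp_le[OF \<theta>(1)] flat]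
    have gm: "(\<lambda>x. e \<bullet> n x) \<in> borel_measurable surface_measure" by measurable
    have As: "A \<in> sets surface_measure" by simp
    define a where "a = ?c - \<epsilon>"
    define b where "b = ?c + \<epsilon>"
    have ab: "a \<le> e \<bullet> n x" "e \<bullet> n x \<le> b" if "x \<in> A" for x
      using near[OF that] by (auto simp: a_def b_def abs_le_iff)
    have D1: "ennreal a * emeasure surface_measure A \<le> emeasure D A"
      unfolding D_def by (rule density_surface_bounds(1)[OF As gm]) (use ab in auto)
    have D2: "emeasure D A \<le> ennreal b * emeasure surface_measure A"
      unfolding D_def by (rule density_surface_bounds(2)[OF As gm]) (use ab in auto)
    have cb: "b \<le> (1 + \<theta>) * ?c" using \<epsilon>c \<epsilon> by (simp add: b_def algebra_simps)
    have ca: "?c \<le> (1 + \<theta>) * a"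
    proof -
      have "(1 + \<theta>) * \<epsilon> \<le> 2 * \<epsilon>" using \<theta> \<epsilon> by simp
      then show ?thesis using \<epsilon>c by (simp add: a_def algebra_simps)
    qed
    have a0: "0 \<le> a" using ca c0 \<theta> by (smt (verit) mult_nonneg_nonpos)
    have "emeasure graph_measure A \<le> ennreal (?c * (1 + \<theta>) ^ ?k) * emeasure surface_measure A" by (rule fl(1))
    also have "\<dots> \<le> ennreal ((1 + \<theta>) ^ CARD('d) * a) * emeasure surface_measure A"
      unfolding k using ca \<theta> by (intro mult_right_mono ennreal_leI) (auto simp: mult.commute mult.left_commute intro: mult_left_mono)
    also have "\<dots> = ennreal ((1 + \<theta>) ^ CARD('d)) * (ennreal a * emeasure surface_measure A)"
      using a0 \<theta> by (simp add: ennreal_mult mult.assoc)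
    also have "\<dots> \<le> ennreal ((1 + \<theta>) ^ CARD('d)) * emeasure D A" by (intro mult_left_mono D1) auto
    finally have 1: "emeasure graph_measure A \<le> ennreal ((1 + \<theta>) ^ CARD('d)) * emeasure D A" .
    have "1 + \<theta> \<le> 1 / (1 - \<theta>)" using \<theta> by (simp add: field_simps)
    then have "b \<le> 1 / (1 - \<theta>) * ?c" using cb c0 by (meson mult_right_mono less_imp_le order_trans)
    then have "emeasure D A \<le> ennreal (1 / (1 - \<theta>) * ?c) * emeasure surface_measure A"
      using D2 by (meson ennreal_leI mult_right_mono order_trans zero_le)
    also have "\<dots> = ennreal (1 / (1 - \<theta>)) * (ennreal ?c * emeasure surface_measure A)"
      using c0 \<theta> by (subst ennreal_mult) (auto simp: mult.assoc)
    also have "\<dots> \<le> ennreal (1 / (1 - \<theta>)) * (ennreal ((1 / (1 - \<theta>)) ^ ?k) * emeasure graph_measure A)"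
      using \<theta> by (intro mult_left_mono fl(2)) auto
    also have "\<dots> = ennreal ((1 / (1 - \<theta>)) ^ CARD('d)) * emeasure graph_measure A"
      unfolding k using \<theta> by (subst ennreal_mult) (auto simp: mult.assoc)
    finally show ?thesis using 1 by blast
  qed simp
  have sD: "sets D = sets borel" by (simp add: D_def)
  show "emeasure graph_measure E \<le> ennreal ((1 + \<theta>) ^ CARD('d)) * emeasure D E"
    using emeasure_le_countable_cover[OF _ \<open>countable I\<close>, of graph_measure D B "ennreal ((1 + \<theta>) ^ CARD('d))"] Bm piece sD
    unfolding UB by simp
  show "emeasure D E \<le> ennreal ((1 / (1 - \<theta>)) ^ CARD('d)) * emeasure graph_measure E"
    using emeasure_le_countable_cover[OF _ \<open>countable I\<close>, of D graph_measure B "ennreal ((1 / (1 - \<theta>)) ^ CARD('d))"] Bm piece sD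
    unfolding UB by simp
qed

lemma graph_measure_density:
  assumes E: "E \<in> sets borel" "E \<subseteq> C" "\<And>x. x \<in> E \<Longrightarrow> G x = 0"
    and nE: "\<And>x. x \<in> E \<Longrightarrow> outward_unit_normal_at \<Omega> x (n x)"
    and n: "n \<in> borel_measurable borel"
  shows "emeasure graph_measure E = emeasure (density surface_measure (\<lambda>x. ennreal (e \<bullet> n x))) E"
proof -
  let ?t = "\<lambda>j. 1 / real (Suc (Suc j))"
  have t: "0 < ?t j" "?t j \<le> 1 / 2" for j by (auto simp: field_simps)
  have t0: "?t \<longlonglongrightarrow> 0" using LIMSEQ_Suc[OF LIMSEQ_inverse_real_of_nat] by (simp add: inverse_eq_divide)
  let ?D = "density surface_measure (\<lambda>x. ennreal (e \<bullet> n x))"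
  have b: "emeasure graph_measure E \<le> ennreal ((1 + ?t j) ^ CARD('d)) * emeasure ?D E"
    "emeasure ?D E \<le> ennreal ((1 / (1 - ?t j)) ^ CARD('d)) * emeasure graph_measure E" for j
    by (rule graph_measure_density_bounds; (fact E | fact nE | fact n | fact t))+
  show ?thesis
  proof (rule antisym)
    have "(\<lambda>j. (1 + ?t j) ^ CARD('d)) \<longlonglongrightarrow> (1 + 0) ^ CARD('d)" by (intro tendsto_intros t0)
    then have l: "(\<lambda>j. (1 + ?t j) ^ CARD('d)) \<longlonglongrightarrow> 1" by simp
    show "emeasure graph_measure E \<le> emeasure ?D E"
      by (rule ennreal_le_limit[OF l _ b(1)]) simp
    have "(\<lambda>j. (1 / (1 - ?t j)) ^ CARD('d)) \<longlonglongrightarrow> (1 / (1 - 0)) ^ CARD('d)" by (intro tendsto_intros t0) auto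
    then have l: "(\<lambda>j. (1 / (1 - ?t j)) ^ CARD('d)) \<longlonglongrightarrow> 1" by simp
    have "0 \<le> (1 / (1 - ?t j)) ^ CARD('d)" for j using t(2)[of j] by (intro zero_le_power) simp
    then show "emeasure ?D E \<le> emeasure graph_measure E"
      by (rule ennreal_le_limit[OF l _ b(2)])
  qed
qed

end

section \<open>The Gauss-Green formula below a Lipschitz graph\<close>

context lip_level
begin

lemma graph_measure_ball_finite: "emeasure graph_measure (cball 0 R) < top"
proof -
  have "emeasure graph_measure (cball 0 R) = (\<integral>\<^sup>+y. indicator {y. 0 \<le> G y \<and> G y < 1} y * indicator (cball 0 R) (foot y) \<partial>lborel)"
    using nn_integral_graph_measure[of "indicator (cball 0 R)"] borel_measurable_indicator[OF borel_closed[OF closed_cball], of 0 R] by simp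
  also have "\<dots> \<le> (\<integral>\<^sup>+y. indicator (cball (0 :: real^'d) (R + 1)) y \<partial>lborel)"
  proof (rule nn_integral_mono)
    fix y
    have "norm y \<le> R + 1" if "0 \<le> G y" "G y < 1" "norm (foot y) \<le> R"
      using that norm_triangle_ineq[of "foot y" "G y *\<^sub>R e"] norm_e by (simp add: foot_def)
    then show "indicator {y. 0 \<le> G y \<and> G y < 1} y * indicator (cball 0 R) (foot y) \<le> (indicator (cball 0 (R + 1)) y :: ennreal)"
      by (auto simp: indicator_def)
  qed
  also have "\<dots> < top" using emeasure_lborel_cball_finite[of "0 :: real^'d" "R + 1"] by simp
  finally show ?thesis .
qed

lemma sigma_finite_graph_measure: "sigma_finite_measure graph_measure"
proof (rule sigma_finite_measure.intro, intro exI conjI)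
  show "countable (range (\<lambda>n. cball 0 (real n)))" by simp
  show "range (\<lambda>n. cball 0 (real n)) \<subseteq> sets graph_measure" by auto
  show "\<Union> (range (\<lambda>n. cball 0 (real n))) = space graph_measure"
    using real_arch_simple by (auto simp: dist_norm)
  show "\<forall>a\<in>range (\<lambda>n. cball 0 (real n)). emeasure graph_measure a \<noteq> \<infinity>"
    using graph_measure_ball_finite by (auto simp: less_top)
qed

lemma integral_coarea:
  fixes F :: "real^'d \<Rightarrow> real"
  assumes F: "integrable lborel F"
  shows "(\<integral>y. F y \<partial>lborel) = (\<integral>p. (\<integral>s. F (p + s *\<^sub>R e) \<partial>lborel) \<partial>graph_measure)"
    and "integrable graph_measure (\<lambda>p. \<integral>s. F (p + s *\<^sub>R e) \<partial>lborel)"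
proof -
  interpret g: sigma_finite_measure graph_measure by (rule sigma_finite_graph_measure)
  interpret P: pair_sigma_finite graph_measure "lborel :: real measure" ..
  have [measurable]: "F \<in> borel_measurable borel" using F by simp
  have eq: "lborel = distr (graph_measure \<Otimes>\<^sub>M (lborel :: real measure)) borel (\<lambda>(p, s). p + s *\<^sub>R e)"
  proof (rule measure_eqI)
    fix A assume "A \<in> sets (lborel :: (real^'d) measure)"
    then have [measurable]: "A \<in> sets borel" by simp
    have "emeasure lborel A = (\<integral>\<^sup>+p. \<integral>\<^sup>+s. indicator A (p + s *\<^sub>R e) \<partial>lborel \<partial>graph_measure)"
      using nn_integral_coarea[of "indicator A"] by simp
    also have "\<dots> = (\<integral>\<^sup>+x. indicator A x \<partial>distr (graph_measure \<Otimes>\<^sub>M (lborel :: real measure)) borel (\<lambda>(p, s). p + s *\<^sub>R e))"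
      by (subst nn_integral_distr) (auto simp: lborel.nn_integral_fst[symmetric])
    finally show "emeasure lborel A = emeasure (distr (graph_measure \<Otimes>\<^sub>M (lborel :: real measure)) borel (\<lambda>(p, s). p + s *\<^sub>R e)) A"
      by simp
  qed simp
  have int: "integrable (graph_measure \<Otimes>\<^sub>M lborel) (\<lambda>(p, s). F (p + s *\<^sub>R e))"
    using F by (subst (asm) eq, subst (asm) integrable_distr_eq) (auto simp: split_beta')
  have "(\<integral>y. F y \<partial>lborel) = (\<integral>x. (case x of (p, s) \<Rightarrow> F (p + s *\<^sub>R e)) \<partial>(graph_measure \<Otimes>\<^sub>M lborel))"
    by (subst eq, subst integral_distr) (auto simp: split_beta')
  also have "\<dots> = (\<integral>p. (\<integral>s. F (p + s *\<^sub>R e) \<partial>lborel) \<partial>graph_measure)"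
    using P.integral_fst'[OF int] by simp
  finally show "(\<integral>y. F y \<partial>lborel) = (\<integral>p. (\<integral>s. F (p + s *\<^sub>R e) \<partial>lborel) \<partial>graph_measure)" .
  show "integrable graph_measure (\<lambda>p. \<integral>s. F (p + s *\<^sub>R e) \<partial>lborel)"
    using P.integrable_fst'[OF int] by simp
qed

text \<open>
  The segment from \<open>x\<close> to \<open>y\<close> may leave the region below the graph.  After a descent by \<open>K * norm (x - y)\<close>
  in direction \<open>e\<close> it does not, so the path down, across and up stays in the region, and its length is
  \<open>(2 * K + 1) * norm (x - y)\<close>.
\<close>

lemma lipschitz_below_graph:
  fixes f :: "real^'d \<Rightarrow> real"
  assumes cont: "continuous_on {x. G x \<le> 0} f"
    and der: "\<And>x. G x < 0 \<Longrightarrow> (f has_derivative f' x) (at x)"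
    and bnd: "\<And>x v. G x < 0 \<Longrightarrow> \<bar>f' x v\<bar> \<le> B * norm v" and B: "0 \<le> B"
    and x: "G x \<le> 0" and y: "G y \<le> 0"
  shows "\<bar>f x - f y\<bar> \<le> B * (2 * K + 1) * norm (x - y)"
proof -
  have seg: "\<bar>f a - f b\<bar> \<le> B * norm (a - b)" if s: "\<And>z. z \<in> closed_segment a b \<Longrightarrow> G z < 0" for a b
  proof -
    have "norm (f a - f b) \<le> B * norm (a - b)"
    proof (rule differentiable_bound[of "closed_segment a b" f f' B])
      fix z assume z: "z \<in> closed_segment a b"
      show "(f has_derivative f' z) (at z within closed_segment a b)"
        using der[OF s[OF z]] by (rule has_derivative_at_withinI)
      show "onorm (f' z) \<le> B" using bnd[OF s[OF z]] by (intro onorm_bound B) auto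
    qed auto
    then show ?thesis by simp
  qed
  have main: "\<bar>f x - f y\<bar> \<le> B * (2 * K + 1) * norm (x - y)" if x: "G x < 0" and y: "G y < 0" for x y
  proof -
    define m where "m = K * norm (x - y)"
    have m: "0 \<le> m" using K_ge_1 by (simp add: m_def)
    have down: "\<bar>f a - f (a - m *\<^sub>R e)\<bar> \<le> B * m" if "G a < 0" for a
    proof -
      have "G z < 0" if z: "z \<in> closed_segment a (a - m *\<^sub>R e)" for z
      proof -
        obtain u where "0 \<le> u" "z = (1 - u) *\<^sub>R a + u *\<^sub>R (a - m *\<^sub>R e)"
          using z unfolding in_segment by blast
        then have u: "0 \<le> u" "z = a + (- (u * m)) *\<^sub>R e" by (simp_all add: algebra_simps)
        then show ?thesis using mult_nonneg_nonneg[OF u(1) m] \<open>G a < 0\<close> G_shift[of a "- (u * m)"] by simp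
      qed
      then have "\<bar>f a - f (a - m *\<^sub>R e)\<bar> \<le> B * norm (a - (a - m *\<^sub>R e))" by (rule seg)
      then show ?thesis using m norm_e by simp
    qed
    have "\<bar>f (x - m *\<^sub>R e) - f (y - m *\<^sub>R e)\<bar> \<le> B * norm ((x - m *\<^sub>R e) - (y - m *\<^sub>R e))"
    proof (rule seg)
      fix z assume "z \<in> closed_segment (x - m *\<^sub>R e) (y - m *\<^sub>R e)"
      then obtain u where "0 \<le> u" "u \<le> 1" "z = (1 - u) *\<^sub>R (x - m *\<^sub>R e) + u *\<^sub>R (y - m *\<^sub>R e)"
        unfolding in_segment by blast
      then have u: "0 \<le> u" "u \<le> 1" "z = (x + u *\<^sub>R (y - x)) + (- m) *\<^sub>R e"
        by (simp_all add: algebra_simps)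
      have "G z = G (x + u *\<^sub>R (y - x)) - m" unfolding u(3) G_shift by simp
      also have "\<dots> \<le> G x + K * (u * norm (y - x)) - m" using G_lip[of "x + u *\<^sub>R (y - x)" x] u(1) by simp
      also have "\<dots> \<le> G x" using u K_ge_1 mult_left_le_one_le[of "norm (y - x)" u]
        by (simp add: m_def norm_minus_commute)
      finally show "G z < 0" using x by simp
    qed
    then have "\<bar>f x - f y\<bar> \<le> B * m + B * norm (x - y) + B * m" using down[OF x] down[OF y] by simp
    then show ?thesis by (simp add: m_def algebra_simps)
  qed
  have lim: "((\<lambda>t. f (a + (- t) *\<^sub>R e)) \<longlongrightarrow> f a) (at_right 0)" if a: "G a \<le> 0" for a
  proof -
    have "filterlim (\<lambda>t. a + (- t) *\<^sub>R e) (at a within {x. G x \<le> 0}) (at_right 0)"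
      unfolding filterlim_at
    proof
      show "\<forall>\<^sub>F t in at_right 0. a + (- t) *\<^sub>R e \<in> {x. G x \<le> 0} \<and> a + (- t) *\<^sub>R e \<noteq> a"
        using a norm_e eventually_at_right_less[of "0::real"] by (auto elim!: eventually_mono simp: G_shift[of a "- _", simplified])
      have "((\<lambda>t. a + (- t) *\<^sub>R e) \<longlongrightarrow> a + (- 0) *\<^sub>R e) (at_right 0)" by (intro tendsto_intros)
      then show "((\<lambda>t. a + (- t) *\<^sub>R e) \<longlongrightarrow> a) (at_right 0)" by simp
    qed
    moreover have "(f \<longlongrightarrow> f a) (at a within {x. G x \<le> 0})" using cont a by (auto simp: continuous_on_def)
    ultimately show ?thesis by (rule filterlim_compose[rotated])
  qed
  have "eventually (\<lambda>t. \<bar>f (x + (- t) *\<^sub>R e) - f (y + (- t) *\<^sub>R e)\<bar> \<le> B * (2 * K + 1) * norm (x - y)) (at_right 0)"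
    using eventually_at_right_less[of "0::real"]
  proof eventually_elim
    fix t :: real assume "0 < t"
    then have "G (x + (- t) *\<^sub>R e) < 0" "G (y + (- t) *\<^sub>R e) < 0" using x y G_shift[of x "- t"] G_shift[of y "- t"] by auto
    from main[OF this] show "\<bar>f (x + (- t) *\<^sub>R e) - f (y + (- t) *\<^sub>R e)\<bar> \<le> B * (2 * K + 1) * norm (x - y)" by simp
  qed
  then show ?thesis
    by (intro tendsto_upperbound[OF tendsto_rabs[OF tendsto_diff[OF lim[OF x] lim[OF y]]]]) auto
qed

end

lemma integral_translate:
  fixes F :: "'a::euclidean_space \<Rightarrow> real"
  assumes "F \<in> borel_measurable borel"
  shows "(\<integral>x. F (x + a) \<partial>lborel) = (\<integral>x. F x \<partial>lborel)"
proof -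
  have "(\<integral>x. F x \<partial>lborel) = (\<integral>x. F x \<partial>distr lborel borel ((+) a))" by (simp add: lborel_distr_plus)
  also have "\<dots> = (\<integral>x. F (a + x) \<partial>lborel)" using assms by (subst integral_distr) auto
  finally show ?thesis by (simp add: add.commute)
qed

lemma integrable_bounded_support:
  fixes F :: "'a::euclidean_space \<Rightarrow> real"
  assumes [measurable]: "F \<in> borel_measurable borel" and "\<And>x. \<bar>F x\<bar> \<le> B" and "\<And>x. R < norm x \<Longrightarrow> F x = 0"
  shows "integrable lborel F"
proof (rule Bochner_Integration.integrable_bound)
  show "integrable lborel (\<lambda>x::'a. B * indicator (cball 0 R) x :: real)"
    using emeasure_lborel_cball_finite[of "0::'a" R] by (intro integrable_mult_right integrable_real_indicator) auto
  show "AE x in lborel. norm (F x) \<le> norm (B * indicator (cball 0 R) x :: real)"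
    using assms by (intro AE_I2) (auto simp: indicator_def abs_le_iff intro: order_trans[OF _ abs_ge_self])
qed simp

text \<open>
  Dominated convergence for the difference quotients of a Lipschitz function with bounded support;
  a translation then moves the increment from the function \<open>\<phi>\<close> to the set \<open>A\<close>.
\<close>

lemma difference_quotient_integral:
  fixes \<phi> :: "real^'d \<Rightarrow> real"
  assumes lip: "\<And>x y. \<bar>\<phi> x - \<phi> y\<bar> \<le> M * norm (x - y)"
    and supp: "\<And>x. R < norm x \<Longrightarrow> \<phi> x = 0"
    and [measurable]: "A \<in> sets borel"
    and der: "\<And>x. x \<in> A \<Longrightarrow> (\<phi> has_derivative \<phi>' x) (at x)"
  defines "h \<equiv> \<lambda>j::nat. 1 / real (Suc j)"
  shows "integrable lborel (\<lambda>x. indicator A x * \<phi>' x v)"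
    and "(\<lambda>j. (\<integral>x. \<phi> x * (indicator A (x - h j *\<^sub>R v) - indicator A x) \<partial>lborel) / h j)
      \<longlonglongrightarrow> (\<integral>x. indicator A x * \<phi>' x v \<partial>lborel)"
proof -
  have M: "0 \<le> M" using lip[of 0 "axis undefined 1"] by (simp add: norm_axis_1)
  have "M-lipschitz_on UNIV \<phi>" using lip M by (intro lipschitz_onI) (auto simp: dist_norm)
  then have "continuous_on UNIV \<phi>" by (rule lipschitz_on_continuous_on)
  then have [measurable]: "\<phi> \<in> borel_measurable borel" by (rule borel_measurable_continuous_onI)
  obtain B where B: "\<And>x. \<bar>\<phi> x\<bar> \<le> B"
  proof
    fix x
    let ?z = "(\<bar>R\<bar> + 1) *\<^sub>R axis undefined 1 :: real^'d"
    have nz: "norm ?z = \<bar>R\<bar> + 1" by (simp add: norm_axis_1)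
    then have "\<phi> ?z = 0" by (intro supp) simp
    show "\<bar>\<phi> x\<bar> \<le> M * (\<bar>R\<bar> + (\<bar>R\<bar> + 1))"
    proof (cases "R < norm x")
      case True then show ?thesis using supp M by simp
    next
      case False
      have "\<bar>\<phi> x\<bar> \<le> M * norm (x - ?z)" using lip[of x ?z] \<open>\<phi> ?z = 0\<close> by simp
      also have "\<dots> \<le> M * (\<bar>R\<bar> + (\<bar>R\<bar> + 1))"
        using False M norm_triangle_ineq4[of x ?z] unfolding nz by (intro mult_left_mono) auto
      finally show ?thesis .
    qed
  qed
  have h: "0 < h j" "h j \<le> 1" for j by (auto simp: h_def)
  have h0: "h \<longlonglongrightarrow> 0" using LIMSEQ_inverse_real_of_nat by (simp add: h_def inverse_eq_divide)
  define q where "q j x = indicator A x * ((\<phi> (x + h j *\<^sub>R v) - \<phi> x) / h j)" for j x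
  have [measurable]: "q j \<in> borel_measurable borel" for j unfolding q_def by measurable
  have lim: "(\<lambda>j. q j x) \<longlonglongrightarrow> indicator A x * \<phi>' x v" for x
  proof (cases "x \<in> A")
    case True
    have "((\<lambda>t. \<phi> (x + t *\<^sub>R v)) has_derivative (\<lambda>t. \<phi>' x (t *\<^sub>R v))) (at 0)"
    proof (rule has_derivative_compose[of "\<lambda>t. x + t *\<^sub>R v" "\<lambda>t. t *\<^sub>R v" 0 UNIV \<phi> "\<phi>' x"])
      show "((\<lambda>t. x + t *\<^sub>R v) has_derivative (\<lambda>t. t *\<^sub>R v)) (at 0)" by (auto intro!: derivative_eq_intros)
    qed (use der[OF True] in simp)
    moreover have "\<phi>' x (t *\<^sub>R v) = t * \<phi>' x v" for t
      using has_derivative_linear[OF der[OF True]] by (simp add: linear_cmul)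
    ultimately have "((\<lambda>t. \<phi> (x + t *\<^sub>R v)) has_field_derivative \<phi>' x v) (at 0)"
      by (simp add: has_field_derivative_def mult_commute_abs)
    then have "(\<lambda>t. (\<phi> (x + t *\<^sub>R v) - \<phi> x) / t) \<midarrow>0\<rightarrow> \<phi>' x v"
      by (simp add: has_field_derivative_iff)
    moreover have "filterlim h (at 0) sequentially"
      using h0 h by (intro filterlim_atI) (auto simp: less_imp_neq[THEN not_sym])
    ultimately have "(\<lambda>j. (\<phi> (x + h j *\<^sub>R v) - \<phi> x) / h j) \<longlonglongrightarrow> \<phi>' x v"
      by (rule filterlim_compose)
    then show ?thesis using True by (simp add: q_def)
  qed (simp add: q_def)
  let ?w = "\<lambda>x::real^'d. M * norm v * indicator (cball 0 (R + norm v)) x :: real"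
  have dom: "norm (q j x) \<le> ?w x" for j x
  proof (cases "norm x \<le> R + norm v")
    case True
    have "\<bar>\<phi> (x + h j *\<^sub>R v) - \<phi> x\<bar> / h j \<le> M * norm v"
      using lip[of "x + h j *\<^sub>R v" x] h[of j] by (simp add: field_simps)
    then show ?thesis using True h[of j] M by (auto simp: q_def indicator_def abs_mult)
  next
    case False
    have "norm x \<le> norm (x + h j *\<^sub>R v) + norm (h j *\<^sub>R v)" using norm_triangle_ineq4[of "x + h j *\<^sub>R v" "h j *\<^sub>R v"] by simp
    moreover have "norm (h j *\<^sub>R v) \<le> norm v" using h[of j] by (simp add: mult_left_le_one_le)
    ultimately have "R < norm (x + h j *\<^sub>R v)" "R < norm x" using False norm_ge_zero[of v] by linarith+
    then show ?thesis using supp M by (simp add: q_def)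
  qed
  have w: "integrable lborel ?w"
    using emeasure_lborel_cball_finite[of "0::real^'d" "R + norm v"]
    by (intro integrable_mult_right integrable_real_indicator) auto
  have meas[measurable]: "(\<lambda>x. indicator A x * \<phi>' x v) \<in> borel_measurable borel"
    by (rule borel_measurable_LIMSEQ_real[where u=q]) (use lim in auto)
  show "integrable lborel (\<lambda>x. indicator A x * \<phi>' x v)"
    by (rule integrable_dominated_convergence[of _ lborel q ?w]) (use lim dom w in auto)
  have "(\<lambda>j. \<integral>x. q j x \<partial>lborel) \<longlonglongrightarrow> (\<integral>x. indicator A x * \<phi>' x v \<partial>lborel)"
    by (rule integral_dominated_convergence[of _ _ _ ?w]) (use lim dom w in auto)
  moreover have "(\<integral>x. q j x \<partial>lborel) = (\<integral>x. \<phi> x * (indicator A (x - h j *\<^sub>R v) - indicator A x) \<partial>lborel) / h j" for j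
  proof -
    have hv: "norm (h j *\<^sub>R v) \<le> norm v" using h[of j] by (simp add: mult_left_le_one_le)
    have B0: "0 \<le> B" using B[of 0] by simp
    have i1: "integrable lborel (\<lambda>x. indicator A x * \<phi> (x + h j *\<^sub>R v))"
    proof (rule integrable_bounded_support[where B=B and R="R + norm v"])
      fix x :: "real^'d" assume "R + norm v < norm x"
      then have "R < norm (x + h j *\<^sub>R v)"
        using hv norm_triangle_ineq4[of "x + h j *\<^sub>R v" "h j *\<^sub>R v"] by simp
      then show "indicator A x * \<phi> (x + h j *\<^sub>R v) = 0" using supp by simp
    qed (use B B0 in \<open>auto simp: indicator_def\<close>)
    have i2: "integrable lborel (\<lambda>x. indicator A x * \<phi> x)" "integrable lborel (\<lambda>x. indicator A (x - h j *\<^sub>R v) * \<phi> x)"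
      by (rule integrable_bounded_support[where B=B and R=R]; use B B0 supp in \<open>auto simp: indicator_def\<close>)+
    have "(\<integral>x. q j x \<partial>lborel) = (\<integral>x. indicator A x * \<phi> (x + h j *\<^sub>R v) - indicator A x * \<phi> x \<partial>lborel) / h j"
    proof -
      have "q j x = (indicator A x * \<phi> (x + h j *\<^sub>R v) - indicator A x * \<phi> x) / h j" for x
        by (simp add: q_def right_diff_distrib)
      then show ?thesis by simp
    qed
    also have "\<dots> = ((\<integral>x. indicator A x * \<phi> (x + h j *\<^sub>R v) \<partial>lborel) - (\<integral>x. indicator A x * \<phi> x \<partial>lborel)) / h j"
      by (simp add: Bochner_Integration.integral_diff i1 i2)
    also have "(\<integral>x. indicator A x * \<phi> (x + h j *\<^sub>R v) \<partial>lborel) = (\<integral>x. indicator A (x - h j *\<^sub>R v) * \<phi> x \<partial>lborel)"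
      using integral_translate[of "\<lambda>x. indicator A (x - h j *\<^sub>R v) * \<phi> x" "h j *\<^sub>R v"] by simp
    also have "(\<integral>x. indicator A (x - h j *\<^sub>R v) * \<phi> x \<partial>lborel) - (\<integral>x. indicator A x * \<phi> x \<partial>lborel) =
        (\<integral>x. \<phi> x * (indicator A (x - h j *\<^sub>R v) - indicator A x) \<partial>lborel)"
      using Bochner_Integration.integral_diff[OF i2(2) i2(1)] by (simp add: algebra_simps)
    finally show ?thesis .
  qed
  ultimately show "(\<lambda>j. (\<integral>x. \<phi> x * (indicator A (x - h j *\<^sub>R v) - indicator A x) \<partial>lborel) / h j)
      \<longlonglongrightarrow> (\<integral>x. indicator A x * \<phi>' x v \<partial>lborel)" by simp
qed

context lip_patch
begin

text \<open>
  The normal field is measurable on the frontier only; multiplied by the indicator of the frontier it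
  becomes a Borel function.
\<close>

lemma AE_normal_borel:
  assumes n: "outward_unit_normal \<Omega> n"
  obtains n0 where "n0 \<in> borel_measurable borel" "\<And>x. x \<in> frontier \<Omega> \<Longrightarrow> n0 x = n x"
    "AE x in surface_measure. x \<in> frontier \<Omega> \<longrightarrow> outward_unit_normal_at \<Omega> x (n0 x)"
proof
  let ?n = "\<lambda>x. indicator (frontier \<Omega>) x *\<^sub>R n x"
  show "?n \<in> borel_measurable borel"
    using n by (simp add: outward_unit_normal_def set_borel_measurable_def cong: measurable_cong_sets)
  show "?n x = n x" if "x \<in> frontier \<Omega>" for x using that by simp
  show "AE x in surface_measure. x \<in> frontier \<Omega> \<longrightarrow> outward_unit_normal_at \<Omega> x (?n x)"
    using n by (auto simp: outward_unit_normal_def elim!: eventually_mono)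
qed

lemma frontier_Int_C_borel: "C \<inter> frontier \<Omega> \<in> sets borel"
  using open_C by (intro sets.Int borel_open borel_closed) auto

text \<open>
  The two measures agree where normals exist; the remaining points of the frontier are a null set for
  the surface measure and, because projection decreases area, for the graph measure.
\<close>

lemma graph_measure_eq_density:
  assumes [measurable]: "n \<in> borel_measurable borel"
    and n: "AE x in surface_measure. x \<in> frontier \<Omega> \<longrightarrow> outward_unit_normal_at \<Omega> x (n x)"
  shows "density graph_measure (\<lambda>x. ennreal (indicator C x)) =
    density surface_measure (\<lambda>x. ennreal (indicator (C \<inter> frontier \<Omega>) x * (e \<bullet> n x)))"
proof (rule measure_eqI)
  have [measurable]: "C \<in> sets borel" using open_C by simp
  have [measurable]: "frontier \<Omega> \<in> sets borel" by (intro borel_closed) simp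
  obtain Z where Z: "Z \<in> null_sets surface_measure" "{x. \<not> (x \<in> frontier \<Omega> \<longrightarrow> outward_unit_normal_at \<Omega> x (n x))} \<subseteq> Z"
    using n by (auto simp: eventually_ae_filter)
  have Zm[measurable]: "Z \<in> sets borel" using Z(1) by (auto simp: null_sets_def)
  fix A assume "A \<in> sets (density graph_measure (\<lambda>x. ennreal (indicator C x)))"
  then have [measurable]: "A \<in> sets borel" by simp
  define E where "E = {x\<in>A. x \<in> C \<and> G x = 0}"
  have [measurable]: "E \<in> sets borel" unfolding E_def by measurable
  have E_front: "E = A \<inter> (C \<inter> frontier \<Omega>)" using frontier_patch by (auto simp: E_def)
  have 1: "emeasure (density graph_measure (\<lambda>x. ennreal (indicator C x))) A = emeasure graph_measure E"
  proof -
    have "emeasure (density graph_measure (\<lambda>x. ennreal (indicator C x))) A = (\<integral>\<^sup>+x. ennreal (indicator C x) * indicator A x \<partial>graph_measure)"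
      by (rule emeasure_density) auto
    also have "\<dots> = (\<integral>\<^sup>+x. indicator E x \<partial>graph_measure)"
      by (rule nn_integral_cong_AE, use AE_graph_measure in eventually_elim) (auto simp: E_def indicator_def)
    finally show ?thesis by simp
  qed
  let ?D = "density surface_measure (\<lambda>x. ennreal (e \<bullet> n x))"
  have 2: "emeasure (density surface_measure (\<lambda>x. ennreal (indicator (C \<inter> frontier \<Omega>) x * (e \<bullet> n x)))) A = emeasure ?D E"
    by (subst (1 2) emeasure_density) (auto simp: E_front indicator_def intro!: nn_integral_cong)
  have "emeasure surface_measure (E \<inter> Z) = 0"
  proof (rule emeasure_eq_0)
    show "Z \<in> sets surface_measure" "emeasure surface_measure Z = 0" using Z(1) by (simp_all add: null_sets_def)
    show "E \<inter> Z \<subseteq> Z" by blast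
  qed
  then have "emeasure graph_measure (E \<inter> Z) = 0"
    by (intro graph_measure_null) (auto simp: E_def)
  moreover have "emeasure ?D (E \<inter> Z) = 0"
  proof -
    have "(\<integral>\<^sup>+x. ennreal (e \<bullet> n x) * indicator (E \<inter> Z) x \<partial>surface_measure) = 0"
      using AE_not_in[OF Z(1)] by (subst nn_integral_0_iff_AE) (auto elim!: eventually_mono simp: indicator_def)
    then show ?thesis by (subst emeasure_density) auto
  qed
  moreover have "emeasure graph_measure (E - Z) = emeasure ?D (E - Z)"
  proof (rule graph_measure_density)
    fix x assume x: "x \<in> E - Z"
    then show "G x = 0" by (auto simp: E_def)
    show "outward_unit_normal_at \<Omega> x (n x)" using x Z(2) unfolding E_front by auto
  qed (auto simp: E_def)
  moreover have split: "emeasure N E = emeasure N (E - Z) + emeasure N (E \<inter> Z)" if "sets N = sets borel" for N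
  proof -
    have "(E - Z) \<union> (E \<inter> Z) = E" "(E - Z) \<inter> (E \<inter> Z) = {}" by blast+
    then show ?thesis using plus_emeasure[of "E - Z" N "E \<inter> Z"] that by simp
  qed
  moreover have "emeasure graph_measure E = emeasure graph_measure (E - Z) + emeasure graph_measure (E \<inter> Z)"
    by (rule split) simp
  moreover have "emeasure ?D E = emeasure ?D (E - Z) + emeasure ?D (E \<inter> Z)"
    by (rule split) simp
  ultimately have "emeasure graph_measure E = emeasure ?D E" by (simp only:)
  then show "emeasure (density graph_measure (\<lambda>x. ennreal (indicator C x))) A =
    emeasure (density surface_measure (\<lambda>x. ennreal (indicator (C \<inter> frontier \<Omega>) x * (e \<bullet> n x)))) A"
    unfolding 1 2 .
qed simp

lemma integral_graph_measure:
  fixes f :: "real^'d \<Rightarrow> real"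
  assumes [measurable]: "n \<in> borel_measurable borel"
    and n: "AE x in surface_measure. x \<in> frontier \<Omega> \<longrightarrow> outward_unit_normal_at \<Omega> x (n x)"
    and [measurable]: "f \<in> borel_measurable borel"
  shows "(\<integral>p. indicator C p * f p \<partial>graph_measure) = (\<integral>x. indicator (C \<inter> frontier \<Omega>) x * (e \<bullet> n x) * f x \<partial>surface_measure)"
proof -
  have [measurable]: "C \<in> sets borel" using open_C by simp
  have [measurable]: "frontier \<Omega> \<in> sets borel" by (intro borel_closed) simp
  have "(\<integral>p. indicator C p * f p \<partial>graph_measure) = (\<integral>p. f p \<partial>density graph_measure (\<lambda>x. ennreal (indicator C x)))"
    by (subst integral_density) auto
  also have "\<dots> = (\<integral>x. indicator (C \<inter> frontier \<Omega>) x * (e \<bullet> n x) * f x \<partial>surface_measure)"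
    unfolding graph_measure_eq_density[OF assms(1) n]
  proof (subst integral_density)
    show "AE x in surface_measure. 0 \<le> indicator (C \<inter> frontier \<Omega>) x * (e \<bullet> n x)"
      using n
    proof eventually_elim
      fix x assume x: "x \<in> frontier \<Omega> \<longrightarrow> outward_unit_normal_at \<Omega> x (n x)"
      show "0 \<le> indicator (C \<inter> frontier \<Omega>) x * (e \<bullet> n x)"
      proof (cases "x \<in> C \<inter> frontier \<Omega>")
        case True
        then have "1 / K \<le> e \<bullet> n x" using x frontier_patch[of x] by (intro normal_ge) auto
        then show ?thesis using True K_ge_1 by (simp add: order_trans[OF _ \<open>1 / K \<le> e \<bullet> n x\<close>])
      qed simp
    qed
  qed auto
  finally show ?thesis .
qed

text \<open>
  In the coordinates \<open>p + s *\<^sub>R e\<close> the translate of \<open>{G < 0}\<close> by \<open>h v\<close> is, on the line through the point \<open>p\<close> of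
  the graph, the half-line \<open>s < a\<close> with \<open>a = - G (p - h v)\<close>.  So the increment of the integral along this line is
  \<open>a * \<phi> p\<close> up to \<open>O(a\<^sup>2)\<close>, where \<open>a / h\<close> converges to \<open>(v \<bullet> n) / (e \<bullet> n)\<close> and is bounded by \<open>K * norm v\<close>.
\<close>

lemma divergence_lipschitz:
  fixes \<phi> :: "real^'d \<Rightarrow> real"
  assumes n0[measurable]: "n \<in> borel_measurable borel"
    and n: "AE x in surface_measure. x \<in> frontier \<Omega> \<longrightarrow> outward_unit_normal_at \<Omega> x (n x)"
    and lip: "\<And>x y. \<bar>\<phi> x - \<phi> y\<bar> \<le> M * norm (x - y)"
    and supp: "\<And>x. R < norm x \<Longrightarrow> \<phi> x = 0"
    and van: "\<And>x. G x = 0 \<Longrightarrow> x \<notin> C \<Longrightarrow> \<phi> x = 0"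
    and der: "\<And>x. G x < 0 \<Longrightarrow> (\<phi> has_derivative \<phi>' x) (at x)"
  shows "(\<integral>x. indicator {x. G x < 0} x * \<phi>' x v \<partial>lborel) =
    (\<integral>x. indicator (C \<inter> frontier \<Omega>) x * (v \<bullet> n x) * \<phi> x \<partial>surface_measure)"
proof -
  have [measurable]: "C \<in> sets borel" using open_C by simp
  have [measurable]: "frontier \<Omega> \<in> sets borel" by (intro borel_closed) simp
  let ?A = "{x. G x < 0}"
  have [measurable]: "?A \<in> sets borel" by measurable
  have M: "0 \<le> M" using lip[of 0 "axis undefined 1"] by (simp add: norm_axis_1)
  have "M-lipschitz_on UNIV \<phi>" using lip M by (intro lipschitz_onI) (auto simp: dist_norm)
  then have cont: "continuous_on UNIV \<phi>" by (rule lipschitz_on_continuous_on)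
  then have [measurable]: "\<phi> \<in> borel_measurable borel" by (rule borel_measurable_continuous_onI)
  define h :: "nat \<Rightarrow> real" where "h j = 1 / real (Suc j)" for j
  have h: "0 < h j" "h j \<le> 1" for j by (auto simp: h_def)
  have h0: "h \<longlonglongrightarrow> 0" using LIMSEQ_inverse_real_of_nat by (simp add: h_def[abs_def] inverse_eq_divide)
  define F where "F j x = \<phi> x * (indicator ?A (x - h j *\<^sub>R v) - indicator ?A x)" for j x
  define a where "a j p = - G (p - h j *\<^sub>R v)" for j p
  \<comment> \<open>The net change of the half-line, a signed indicator of the interval between \<open>0\<close> and \<open>a j p\<close>.\<close>
  define k where "k j p s = (indicator {..<a j p} s - indicator {..<0} s :: real)" for j p s
  define I where "I j p = (\<integral>s. F j (p + s *\<^sub>R e) \<partial>lborel)" for j p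
  have lim1: "(\<lambda>j. (\<integral>x. F j x \<partial>lborel) / h j) \<longlonglongrightarrow> (\<integral>x. indicator ?A x * \<phi>' x v \<partial>lborel)"
    unfolding F_def h_def
    by (rule difference_quotient_integral(2)[OF lip supp _ der]) auto
  obtain B where B: "\<And>x. \<bar>\<phi> x\<bar> \<le> B"
  proof -
    have "compact (\<phi> ` cball 0 R)" by (intro compact_continuous_image continuous_on_subset[OF cont]) auto
    then obtain b where b: "\<And>x. x \<in> cball 0 R \<Longrightarrow> norm (\<phi> x) \<le> b" using compact_imp_bounded bounded_iff by (metis imageI)
    have "\<bar>\<phi> x\<bar> \<le> \<bar>b\<bar>" for x
      using b[of x] supp[of x] by (cases "norm x \<le> R") auto
    then show ?thesis by (rule that)
  qed
  have B0: "0 \<le> B" using B[of 0] by simp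
  have [measurable]: "F j \<in> borel_measurable borel" for j unfolding F_def by measurable
  have Fi: "integrable lborel (F j)" for j
    by (rule integrable_bounded_support[where B=B and R=R]) (use B B0 supp in \<open>auto simp: F_def indicator_def\<close>)
  have IF: "(\<integral>x. F j x \<partial>lborel) = (\<integral>p. I j p \<partial>graph_measure)" "integrable graph_measure (I j)" for j
    unfolding I_def by (rule integral_coarea[OF Fi])+
  have a_le: "\<bar>a j p\<bar> \<le> K * h j * norm v" if "G p = 0" for j p
    using G_lip[of "p - h j *\<^sub>R v" p] that h[of j] by (simp add: a_def mult.assoc)
  have Fk: "F j (p + s *\<^sub>R e) = \<phi> (p + s *\<^sub>R e) * k j p s" if "G p = 0" for j p s
  proof -
    have "p + s *\<^sub>R e - h j *\<^sub>R v = (p - h j *\<^sub>R v) + s *\<^sub>R e" by (simp add: algebra_simps)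
    then have "G (p + s *\<^sub>R e - h j *\<^sub>R v) = s - a j p" by (simp only: G_shift a_def)
    moreover have "G (p + s *\<^sub>R e) = s" using that by (simp add: G_shift)
    ultimately show ?thesis by (simp add: F_def k_def indicator_def)
  qed
  have k_abs: "\<bar>k j p s\<bar> = indicator {min 0 (a j p)..<max 0 (a j p)} s" for j p s
    by (auto simp: k_def indicator_def)
  have k_sgn: "k j p s = sgn (a j p) * indicator {min 0 (a j p)..<max 0 (a j p)} s" for j p s
    by (auto simp: k_def indicator_def sgn_if)
  have ki: "integrable lborel (k j p)" "(\<integral>s. k j p s \<partial>lborel) = a j p" for j p
  proof -
    have i: "integrable lborel (\<lambda>s. indicator {min 0 (a j p)..<max 0 (a j p)} s :: real)"
      by (rule integrable_real_indicator) auto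
    then show "integrable lborel (k j p)" unfolding k_sgn by (rule integrable_mult_right)
    have "(\<integral>s. k j p s \<partial>lborel) = sgn (a j p) * (max 0 (a j p) - min 0 (a j p))"
      unfolding k_sgn by simp
    also have "\<dots> = a j p" by (auto simp: sgn_if)
    finally show "(\<integral>s. k j p s \<partial>lborel) = a j p" .
  qed
  have ka: "(\<integral>s. \<bar>k j p s\<bar> \<partial>lborel) = \<bar>a j p\<bar>" for j p
    unfolding k_abs by auto
  have ki2: "integrable lborel (\<lambda>s. \<phi> (p + s *\<^sub>R e) * k j p s)" for j p
  proof (rule Bochner_Integration.integrable_bound)
    show "integrable lborel (\<lambda>s. B * k j p s)" using ki(1) by (rule integrable_mult_right)
    show "AE s in lborel. norm (\<phi> (p + s *\<^sub>R e) * k j p s) \<le> norm (B * k j p s)"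
      using B B0 by (intro AE_I2) (auto simp: abs_mult intro: mult_right_mono)
    show "(\<lambda>s. \<phi> (p + s *\<^sub>R e) * k j p s) \<in> borel_measurable lborel"
      unfolding k_def by measurable
  qed
  have I_eq: "I j p = (\<integral>s. \<phi> (p + s *\<^sub>R e) * k j p s \<partial>lborel)" if "G p = 0" for j p
    unfolding I_def by (simp add: Fk[OF that])
  have I_near: "\<bar>I j p - a j p * \<phi> p\<bar> \<le> M * \<bar>a j p\<bar> * \<bar>a j p\<bar>" if p: "G p = 0" for j p
  proof -
    have i3: "integrable lborel (\<lambda>s. \<phi> p * k j p s)" using ki(1) by (rule integrable_mult_right)
    have "I j p - a j p * \<phi> p = (\<integral>s. (\<phi> (p + s *\<^sub>R e) - \<phi> p) * k j p s \<partial>lborel)"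
      using Bochner_Integration.integral_diff[OF ki2 i3] by (simp add: I_eq[OF p] left_diff_distrib ki(2) mult.commute[of "a j p"])
    also have "\<bar>\<dots>\<bar> \<le> (\<integral>s. \<bar>(\<phi> (p + s *\<^sub>R e) - \<phi> p) * k j p s\<bar> \<partial>lborel)"
      using integral_norm_bound[of lborel "\<lambda>s. (\<phi> (p + s *\<^sub>R e) - \<phi> p) * k j p s"] by simp
    also have "\<dots> \<le> (\<integral>s. M * \<bar>a j p\<bar> * \<bar>k j p s\<bar> \<partial>lborel)"
    proof (rule integral_mono)
      show "integrable lborel (\<lambda>s. \<bar>(\<phi> (p + s *\<^sub>R e) - \<phi> p) * k j p s\<bar>)"
        using ki2 i3 by (intro integrable_abs) (simp add: left_diff_distrib)
      show "integrable lborel (\<lambda>s. M * \<bar>a j p\<bar> * \<bar>k j p s\<bar>)"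
        using ki(1) by (intro integrable_mult_right integrable_abs)
      fix s
      show "\<bar>(\<phi> (p + s *\<^sub>R e) - \<phi> p) * k j p s\<bar> \<le> M * \<bar>a j p\<bar> * \<bar>k j p s\<bar>"
      proof (cases "k j p s = 0")
        case False
        then have "\<bar>s\<bar> \<le> \<bar>a j p\<bar>" by (auto simp: k_def indicator_def of_bool_def split: if_splits)
        then have "\<bar>\<phi> (p + s *\<^sub>R e) - \<phi> p\<bar> \<le> M * \<bar>a j p\<bar>"
          using lip[of "p + s *\<^sub>R e" p] norm_e mult_left_mono[of "\<bar>s\<bar>" "\<bar>a j p\<bar>" M] M by simp
        then show ?thesis unfolding abs_mult by (intro mult_right_mono) auto
      qed simp
    qed
    also have "\<dots> = M * \<bar>a j p\<bar> * \<bar>a j p\<bar>" by (simp add: ka)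
    finally show ?thesis .
  qed
  define g where "g p = indicator C p * (\<phi> p * ((v \<bullet> n p) / (e \<bullet> n p)))" for p
  have [measurable]: "g \<in> borel_measurable borel" unfolding g_def by measurable
  let ?w = "\<lambda>p::real^'d. (K * norm v * B) * indicator (cball 0 (R + K * norm v)) p :: real"
  have Kv: "0 \<le> K * norm v" using K_ge_1 by simp
  have gm_normal: "AE p in graph_measure. p \<in> C \<longrightarrow> outward_unit_normal_at \<Omega> p (n p)"
  proof -
    have "AE p in density surface_measure (\<lambda>x. ennreal (indicator (C \<inter> frontier \<Omega>) x * (e \<bullet> n x))). outward_unit_normal_at \<Omega> p (n p)"
      using n by (subst AE_density) (auto elim!: eventually_mono simp: indicator_def)
    then have "AE p in density graph_measure (\<lambda>x. ennreal (indicator C x)). outward_unit_normal_at \<Omega> p (n p)"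
      by (simp only: graph_measure_eq_density[OF n0 n])
    then show ?thesis by (subst (asm) AE_density) (auto elim!: eventually_mono simp: indicator_def split: if_splits)
  qed
  have lim2: "(\<lambda>j. \<integral>p. I j p / h j \<partial>graph_measure) \<longlonglongrightarrow> (\<integral>p. g p \<partial>graph_measure)"
  proof (rule integral_dominated_convergence[of _ _ _ ?w])
    show "integrable graph_measure ?w"
      using graph_measure_ball_finite by (intro integrable_mult_right integrable_real_indicator) auto
    show "AE p in graph_measure. (\<lambda>j. I j p / h j) \<longlonglongrightarrow> g p"
      using AE_graph_measure gm_normal
    proof eventually_elim
      fix p assume p: "G p = 0" and nor: "p \<in> C \<longrightarrow> outward_unit_normal_at \<Omega> p (n p)"
      have "(\<lambda>j. a j p / h j * \<phi> p) \<longlonglongrightarrow> g p"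
      proof (cases "p \<in> C")
        case False
        then show ?thesis using van[OF p] by (simp add: g_def)
      next
        case True
        have "filterlim (\<lambda>j. - h j) (at 0) sequentially"
          using tendsto_minus[OF h0] h by (intro filterlim_atI) (auto simp: less_imp_neq[THEN not_sym])
        from filterlim_compose[OF G_directional_derivative[OF True p, of "n p" v] this]
        have "(\<lambda>j. G (p + (- h j) *\<^sub>R v) / (- h j)) \<longlonglongrightarrow> (v \<bullet> n p) / (e \<bullet> n p)" using nor True by simp
        then have "(\<lambda>j. a j p / h j) \<longlonglongrightarrow> (v \<bullet> n p) / (e \<bullet> n p)" by (simp add: a_def)
        from tendsto_mult[OF this tendsto_const[of "\<phi> p"]] show ?thesis using True by (simp add: g_def mult.commute)
      qed
      moreover have "(\<lambda>j. I j p / h j - a j p / h j * \<phi> p) \<longlonglongrightarrow> 0"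
      proof (rule Lim_null_comparison)
        have "norm (I j p / h j - a j p / h j * \<phi> p) \<le> M * (K * norm v) * (K * norm v) * h j" for j
        proof -
          have "I j p / h j - a j p / h j * \<phi> p = (I j p - a j p * \<phi> p) / h j" by (simp add: diff_divide_distrib)
          then have "norm (I j p / h j - a j p / h j * \<phi> p) = \<bar>I j p - a j p * \<phi> p\<bar> / h j" using h[of j] by simp
          also have "\<dots> \<le> M * \<bar>a j p\<bar> * \<bar>a j p\<bar> / h j"
            using I_near[OF p, of j] h[of j] by (intro divide_right_mono) auto
          also have "\<dots> \<le> M * (K * h j * norm v) * (K * h j * norm v) / h j"
            using a_le[OF p, of j] h[of j] M by (intro divide_right_mono mult_mono) (auto intro: mult_nonneg_nonneg order_trans[OF abs_ge_zero])
          also have "\<dots> = M * (K * norm v) * (K * norm v) * h j" using h[of j] by simp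
          finally show ?thesis .
        qed
        then show "\<forall>\<^sub>F j in sequentially. norm (I j p / h j - a j p / h j * \<phi> p) \<le> M * (K * norm v) * (K * norm v) * h j"
          by simp
        show "(\<lambda>j. M * (K * norm v) * (K * norm v) * h j) \<longlonglongrightarrow> 0"
          using tendsto_mult_right_zero[OF h0] .
      qed
      ultimately show "(\<lambda>j. I j p / h j) \<longlonglongrightarrow> g p"
        by (rule Lim_transform)
    qed
    show "AE p in graph_measure. norm (I j p / h j) \<le> ?w p" for j
      using AE_graph_measure
    proof eventually_elim
      fix p assume p: "G p = 0"
      have ahv: "K * h j * norm v \<le> K * norm v" using h[of j] Kv mult_left_le_one_le[of "K * norm v" "h j"] by (simp add: mult.commute mult.left_commute)
      show "norm (I j p / h j) \<le> ?w p"
      proof (cases "norm p \<le> R + K * norm v")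
        case True
        have "\<bar>I j p\<bar> \<le> (\<integral>s. \<bar>\<phi> (p + s *\<^sub>R e) * k j p s\<bar> \<partial>lborel)"
          unfolding I_eq[OF p] using integral_norm_bound[of lborel "\<lambda>s. \<phi> (p + s *\<^sub>R e) * k j p s"] by simp
        also have "\<dots> \<le> (\<integral>s. B * \<bar>k j p s\<bar> \<partial>lborel)"
        proof (rule integral_mono)
          show "integrable lborel (\<lambda>s. \<bar>\<phi> (p + s *\<^sub>R e) * k j p s\<bar>)" using ki2 by (rule integrable_abs)
          show "integrable lborel (\<lambda>s. B * \<bar>k j p s\<bar>)" using ki(1) by (intro integrable_mult_right integrable_abs)
        qed (use B in \<open>auto simp: abs_mult intro: mult_right_mono\<close>)
        also have "\<dots> = B * \<bar>a j p\<bar>" by (simp add: ka)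
        also have "\<dots> \<le> B * (K * h j * norm v)" using a_le[OF p] B0 by (rule mult_left_mono)
        finally have "\<bar>I j p\<bar> / h j \<le> B * (K * h j * norm v) / h j" using h[of j] by (intro divide_right_mono) auto
        then show ?thesis using True h[of j] by (simp add: ac_simps)
      next
        case False
        have z: "\<phi> (p + s *\<^sub>R e) * k j p s = 0" for s
        proof (cases "k j p s = 0")
          case F: False
          then have "\<bar>s\<bar> \<le> \<bar>a j p\<bar>" by (auto simp: k_def indicator_def of_bool_def split: if_splits)
          then have "\<bar>s\<bar> \<le> K * norm v" using a_le[OF p, of j] ahv by linarith
          then have "R < norm (p + s *\<^sub>R e)"
            using False norm_triangle_ineq4[of "p + s *\<^sub>R e" "s *\<^sub>R e"] norm_e by simp
          then show ?thesis using supp by simp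
        qed simp
        then have "I j p = 0" by (simp only: I_eq[OF p] z Bochner_Integration.integral_zero)
        then show ?thesis using False by simp
      qed
    qed
  qed (use IF(2) in \<open>auto intro: borel_measurable_divide borel_measurable_integrable\<close>)
  have "(\<lambda>j. \<integral>p. I j p / h j \<partial>graph_measure) \<longlonglongrightarrow> (\<integral>x. indicator ?A x * \<phi>' x v \<partial>lborel)"
    using lim1 by (simp add: IF(1))
  with lim2 have "(\<integral>x. indicator ?A x * \<phi>' x v \<partial>lborel) = (\<integral>p. g p \<partial>graph_measure)"
    by (rule LIMSEQ_unique[rotated])
  also have "\<dots> = (\<integral>x. indicator (C \<inter> frontier \<Omega>) x * (e \<bullet> n x) * (\<phi> x * ((v \<bullet> n x) / (e \<bullet> n x))) \<partial>surface_measure)"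
    unfolding g_def by (rule integral_graph_measure[OF n0 n]) measurable
  also have "\<dots> = (\<integral>x. indicator (C \<inter> frontier \<Omega>) x * (v \<bullet> n x) * \<phi> x \<partial>surface_measure)"
  proof (rule integral_cong_AE)
    show "AE x in surface_measure. indicator (C \<inter> frontier \<Omega>) x * (e \<bullet> n x) * (\<phi> x * ((v \<bullet> n x) / (e \<bullet> n x))) =
        indicator (C \<inter> frontier \<Omega>) x * (v \<bullet> n x) * \<phi> x"
      using n
    proof eventually_elim
      fix x assume x: "x \<in> frontier \<Omega> \<longrightarrow> outward_unit_normal_at \<Omega> x (n x)"
      show "indicator (C \<inter> frontier \<Omega>) x * (e \<bullet> n x) * (\<phi> x * ((v \<bullet> n x) / (e \<bullet> n x))) =
        indicator (C \<inter> frontier \<Omega>) x * (v \<bullet> n x) * \<phi> x"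
      proof (cases "x \<in> C \<inter> frontier \<Omega>")
        case True
        then have "1 / K \<le> e \<bullet> n x" using x frontier_patch[of x] by (intro normal_ge) auto
        moreover have "0 < 1 / K" using K_ge_1 by simp
        ultimately have "e \<bullet> n x \<noteq> 0" by linarith
        then show ?thesis by simp
      qed simp
    qed
  qed measurable
  finally show ?thesis .
qed

text \<open>
  Here the data are given on one side of the graph only.  The product \<open>b * f\<close>, extended by \<open>0\<close> outside
  the window, is Lipschitz on \<open>{G \<le> 0}\<close>, and the reflection of \<open>{G > 0}\<close> along \<open>e\<close> extends it to a Lipschitz
  function with bounded support on the whole space.
\<close>

lemma divergence_patch:
  fixes f b :: "real^'d \<Rightarrow> real"
  assumes n0: "n \<in> borel_measurable borel"
    and n: "AE x in surface_measure. x \<in> frontier \<Omega> \<longrightarrow> outward_unit_normal_at \<Omega> x (n x)"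
    and cont: "continuous_on (closure \<Omega>) f"
    and der: "\<And>x. x \<in> \<Omega> \<Longrightarrow> (f has_derivative f' x) (at x)"
    and bnd: "\<And>x w. x \<in> \<Omega> \<Longrightarrow> \<bar>f' x w\<bar> \<le> B * norm w"
    and bf: "\<And>x. x \<in> closure \<Omega> \<Longrightarrow> \<bar>f x\<bar> \<le> Bf"
    and db: "\<And>x. (b has_derivative b' x) (at x)"
    and bb': "\<And>x w. \<bar>b' x w\<bar> \<le> Bb * norm w"
    and b0: "\<And>x. \<bar>b x\<bar> \<le> B0"
    and S: "compact S" "S \<subseteq> C" and bS: "\<And>x. x \<notin> S \<Longrightarrow> b x = 0"
    and nonneg: "0 \<le> B" "0 \<le> Bf" "0 \<le> Bb" "0 \<le> B0"
  shows "(\<integral>x. indicator \<Omega> x * (b x * f' x v + b' x v * f x) \<partial>lborel) =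
    (\<integral>x. indicator (frontier \<Omega>) x * (v \<bullet> n x) * (b x * f x) \<partial>surface_measure)"
proof -
  define \<phi>0 where "\<phi>0 x = (if x \<in> C then b x * f x else 0)" for x
  define D where "D x w = (if x \<in> C then b x * f' x w + b' x w * f x else 0)" for x w
  have cS: "closed S" using S(1) by (rule compact_imp_closed)
  have b'S: "b' x w = 0" if "x \<notin> S" for x w
  proof -
    have "((\<lambda>_. 0) has_derivative b' x) (at x)"
      by (rule has_derivative_transform_within_open[OF db open_Compl[OF cS]]) (use that bS in auto)
    then have "b' x = (\<lambda>_. 0)" by (rule has_derivative_unique) (rule has_derivative_const)
    then show ?thesis by simp
  qed
  have cl: "x \<in> closure \<Omega>" if "x \<in> C" "G x \<le> 0" for x
    using that patch[of x] frontier_patch[of x] closure_subset by (cases "G x = 0") (auto simp: frontier_def)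
  have \<phi>0S: "\<phi>0 x = 0" if "x \<notin> S" for x using bS that by (simp add: \<phi>0_def)
  have cont_b: "continuous_on A b" for A
    using db by (intro continuous_at_imp_continuous_on ballI has_derivative_continuous) auto
  have cont0: "continuous_on {x. G x \<le> 0} \<phi>0"
  proof -
    have U: "{x. G x \<le> 0} = (C \<inter> {x. G x \<le> 0}) \<union> (- S \<inter> {x. G x \<le> 0})" using S(2) by blast
    have "continuous_on ((C \<inter> {x. G x \<le> 0}) \<union> (- S \<inter> {x. G x \<le> 0})) \<phi>0"
    proof (rule continuous_on_Un_local_open)
      show "openin (top_of_set ((C \<inter> {x. G x \<le> 0}) \<union> (- S \<inter> {x. G x \<le> 0}))) (C \<inter> {x. G x \<le> 0})"
        unfolding U[symmetric] using openin_open_Int[OF open_C, of "{x. G x \<le> 0}"] by (simp only: Int_commute)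
      show "openin (top_of_set ((C \<inter> {x. G x \<le> 0}) \<union> (- S \<inter> {x. G x \<le> 0}))) (- S \<inter> {x. G x \<le> 0})"
        unfolding U[symmetric] using openin_open_Int[OF open_Compl[OF cS], of "{x. G x \<le> 0}"] by (simp only: Int_commute)
      have "continuous_on (C \<inter> {x. G x \<le> 0}) (\<lambda>x. b x * f x)"
        by (intro continuous_intros cont_b continuous_on_subset[OF cont]) (use cl in auto)
      then show "continuous_on (C \<inter> {x. G x \<le> 0}) \<phi>0" by (rule continuous_on_eq) (auto simp: \<phi>0_def)
      have "continuous_on (- S \<inter> {x. G x \<le> 0}) (\<lambda>_. 0 :: real)" by (rule continuous_on_const)
      then show "continuous_on (- S \<inter> {x. G x \<le> 0}) \<phi>0" by (rule continuous_on_eq) (auto simp: \<phi>0S)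
    qed
    then show ?thesis by (simp only: U[symmetric])
  qed
  have der0: "(\<phi>0 has_derivative D x) (at x)" if x: "G x < 0" for x
  proof (cases "x \<in> C")
    case True
    then have "((\<lambda>x. b x * f x) has_derivative (\<lambda>w. b x * f' x w + b' x w * f x)) (at x)"
      using patch x by (intro has_derivative_mult db der) auto
    then have "(\<phi>0 has_derivative (\<lambda>w. b x * f' x w + b' x w * f x)) (at x)"
      by (rule has_derivative_transform_within_open[OF _ open_C True]) (simp add: \<phi>0_def)
    moreover have "D x = (\<lambda>w. b x * f' x w + b' x w * f x)" using True by (simp add: D_def fun_eq_iff)
    ultimately show ?thesis by simp
  next
    case False
    then have "x \<in> - S" using S(2) by blast
    have "((\<lambda>_. 0) has_derivative (\<lambda>_. 0 :: real)) (at x)" by (rule has_derivative_const)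
    then have "(\<phi>0 has_derivative (\<lambda>_. 0)) (at x)"
      by (rule has_derivative_transform_within_open[OF _ _ \<open>x \<in> - S\<close>]) (use cS \<phi>0S in auto)
    moreover have "D x = (\<lambda>_. 0)" using False by (simp add: D_def fun_eq_iff)
    ultimately show ?thesis by simp
  qed
  define B1 where "B1 = B0 * B + Bb * Bf"
  have B1: "0 \<le> B1" using nonneg by (simp add: B1_def)
  have bnd0: "\<bar>D x w\<bar> \<le> B1 * norm w" if x: "G x < 0" for x w
  proof (cases "x \<in> C")
    case True
    then have "x \<in> \<Omega>" using patch x by blast
    then have "x \<in> closure \<Omega>" using closure_subset by blast
    have "\<bar>b x * f' x w + b' x w * f x\<bar> \<le> \<bar>b x\<bar> * \<bar>f' x w\<bar> + \<bar>b' x w\<bar> * \<bar>f x\<bar>"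
      unfolding abs_mult[symmetric] by (rule abs_triangle_ineq)
    also have "\<dots> \<le> B0 * (B * norm w) + (Bb * norm w) * Bf"
      using \<open>x \<in> \<Omega>\<close> \<open>x \<in> closure \<Omega>\<close> nonneg by (intro add_mono mult_mono b0 bnd bb' bf) auto
    finally show ?thesis using True by (simp add: D_def B1_def algebra_simps)
  qed (use B1 in \<open>simp add: D_def\<close>)
  \<comment> \<open>Reflection of the upper side along \<open>e\<close>; it leaves the lower side fixed.\<close>
  define r where "r x = x - (2 * max (G x) 0) *\<^sub>R e" for x
  define \<phi> where "\<phi> x = \<phi>0 (r x)" for x
  have Gr: "G (r x) = - \<bar>G x\<bar>" for x
    using G_shift[of x "- (2 * max (G x) 0)"] by (simp add: r_def)
  have r_eq: "r x = x" if "G x \<le> 0" for x using that by (simp add: r_def)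
  define L where "L = B1 * (2 * K + 1) * (1 + 2 * K)"
  obtain RS where RS: "\<And>x. x \<in> S \<Longrightarrow> norm x \<le> RS" using compact_imp_bounded[OF S(1)] bounded_iff by blast
  define R where "R = RS + 2 * (\<bar>G 0\<bar> + K * RS)"
  have "(\<integral>x. indicator {x. G x < 0} x * D x v \<partial>lborel) =
    (\<integral>x. indicator (C \<inter> frontier \<Omega>) x * (v \<bullet> n x) * \<phi> x \<partial>surface_measure)"
  proof (rule divergence_lipschitz[OF n0 n])
    fix x y
    have "r x - r y = (x - y) - (2 * (max (G x) 0 - max (G y) 0)) *\<^sub>R e" by (simp add: r_def algebra_simps)
    then have "norm (r x - r y) \<le> norm (x - y) + \<bar>2 * (max (G x) 0 - max (G y) 0)\<bar>"
      using norm_triangle_ineq4[of "x - y" "(2 * (max (G x) 0 - max (G y) 0)) *\<^sub>R e"] norm_e by simp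
    also have "\<bar>2 * (max (G x) 0 - max (G y) 0)\<bar> \<le> 2 * (K * norm (x - y))" using G_lip[of x y] by (auto simp: max_def)
    finally have rr: "norm (r x - r y) \<le> (1 + 2 * K) * norm (x - y)" by (simp add: algebra_simps)
    have "\<bar>\<phi> x - \<phi> y\<bar> \<le> B1 * (2 * K + 1) * norm (r x - r y)"
      unfolding \<phi>_def by (rule lipschitz_below_graph[OF cont0 der0 bnd0 B1]) (auto simp: Gr)
    also have "\<dots> \<le> B1 * (2 * K + 1) * ((1 + 2 * K) * norm (x - y))"
      using rr B1 K_ge_1 by (intro mult_left_mono) auto
    finally show "\<bar>\<phi> x - \<phi> y\<bar> \<le> L * norm (x - y)" by (simp add: L_def mult.assoc)
  next
    fix x :: "real^'d" assume x: "R < norm x"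
    show "\<phi> x = 0"
    proof (rule ccontr)
      assume "\<phi> x \<noteq> 0"
      then have "r x \<in> S" using \<phi>0S by (auto simp: \<phi>_def)
      then have nr: "norm (r x) \<le> RS" by (rule RS)
      have "\<bar>G x\<bar> \<le> \<bar>G 0\<bar> + K * norm (r x)" using G_lip[of "r x" 0] Gr[of x] by simp
      also have "\<dots> \<le> \<bar>G 0\<bar> + K * RS" using nr K_ge_1 by simp
      finally have "\<bar>2 * max (G x) 0\<bar> \<le> 2 * (\<bar>G 0\<bar> + K * RS)" by (auto simp: max_def)
      moreover have "norm x \<le> norm (r x) + \<bar>2 * max (G x) 0\<bar>"
        using norm_triangle_ineq[of "r x" "(2 * max (G x) 0) *\<^sub>R e"] norm_e by (simp add: r_def)
      ultimately show False using x nr by (simp add: R_def)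
    qed
  next
    fix x assume "G x = 0" "x \<notin> C"
    then show "\<phi> x = 0" by (simp add: \<phi>_def r_eq \<phi>0_def)
  next
    fix x assume x: "G x < 0"
    have "open {x. G x < 0}" by (intro open_Collect_less continuous_intros G_continuous)
    with der0[OF x] show "(\<phi> has_derivative D x) (at x)"
      by (rule has_derivative_transform_within_open) (use x in \<open>auto simp: \<phi>_def r_eq\<close>)
  qed
  moreover have "indicator {x. G x < 0} x * D x v = indicator \<Omega> x * (b x * f' x v + b' x v * f x)" for x
  proof (cases "x \<in> C")
    case True then show ?thesis using patch[OF True] by (simp add: D_def indicator_def)
  next
    case False
    then have "x \<notin> S" using S(2) by blast
    then show ?thesis using False bS b'S by (simp add: D_def)
  qed
  moreover have "indicator (C \<inter> frontier \<Omega>) x * (v \<bullet> n x) * \<phi> x = indicator (frontier \<Omega>) x * (v \<bullet> n x) * (b x * f x)" for x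
  proof (cases "x \<in> C")
    case True
    then show ?thesis using frontier_patch[OF True] by (auto simp: indicator_def \<phi>_def r_eq \<phi>0_def)
  next
    case False
    then have "x \<notin> S" using S(2) by blast
    then show ?thesis using False bS by simp
  qed
  ultimately show ?thesis by (simp only:)
qed

end

section \<open>The divergence theorem on bounded Lipschitz domains\<close>

text \<open>
  The local description \<open>y \<bullet> e < \<gamma> (hproj e y)\<close> says that \<open>G y = y \<bullet> e - \<gamma> (hproj e y)\<close> is negative.
\<close>

lemma lipschitz_boundary_patch:
  fixes \<Omega> :: "(real^'d) set"
  assumes \<Omega>: "bounded_lipschitz_domain \<Omega>" and x: "x \<in> frontier \<Omega>"
  shows "\<exists>e G K C. lip_patch e G K \<Omega> C \<and> x \<in> C"
proof -
  have "lipschitz_boundary \<Omega>" using \<Omega> by (simp add: bounded_lipschitz_domain_def)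
  from bspec[OF this[unfolded lipschitz_boundary_def] x] obtain e r h L and \<gamma> :: "real^'d \<Rightarrow> real" where e: "norm e = 1" and rh: "0 < r" "0 < h"
    and \<gamma>: "L-lipschitz_on {z. z \<bullet> e = 0} \<gamma>"
    and eq: "\<Omega> \<inter> cylinder x e r h = {y \<in> cylinder x e r h. y \<bullet> e < \<gamma> (hproj e y)}"
    by (elim exE conjE) (rule that)
  have ee: "e \<bullet> e = 1" using e by (simp add: norm_eq_1)
  define G where "G y = y \<bullet> e - \<gamma> (hproj e y)" for y
  have hp: "hproj e y \<in> {z. z \<bullet> e = 0}" for y by (simp add: hproj_def inner_simps ee)
  have hd: "norm (hproj e y) \<le> norm y" for y
  proof -
    have "(norm (hproj e y))\<^sup>2 = (norm y)\<^sup>2 - (y \<bullet> e)\<^sup>2"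
      unfolding power2_norm_eq_inner by (simp add: hproj_def inner_simps ee inner_commute[of e y] power2_eq_square[of "y \<bullet> e"])
    then have "(norm (hproj e y))\<^sup>2 \<le> (norm y)\<^sup>2" by simp
    then show ?thesis by (rule power2_le_imp_le) simp
  qed
  have hdiff: "hproj e y - hproj e z = hproj e (y - z)" for y z by (simp add: hproj_def inner_simps algebra_simps)
  have "lip_patch e G (1 + L) \<Omega> (cylinder x e r h)"
  proof
    show "norm e = 1" by (rule e)
    show "G (y + s *\<^sub>R e) = G y + s" for y s
    proof -
      have "hproj e (y + s *\<^sub>R e) = hproj e y" by (simp add: hproj_def inner_simps ee algebra_simps)
      then show ?thesis by (simp add: G_def inner_simps ee)
    qed
    show "\<bar>G y - G z\<bar> \<le> (1 + L) * norm (y - z)" for y z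
    proof -
      have "\<bar>\<gamma> (hproj e y) - \<gamma> (hproj e z)\<bar> \<le> L * norm (hproj e (y - z))"
        using lipschitz_onD[OF \<gamma> hp hp, of y z] by (simp add: dist_norm hdiff)
      also have "\<dots> \<le> L * norm (y - z)" using hd lipschitz_on_nonneg[OF \<gamma>] by (intro mult_left_mono) auto
      finally have 1: "\<bar>\<gamma> (hproj e y) - \<gamma> (hproj e z)\<bar> \<le> L * norm (y - z)" .
      have "\<bar>(y - z) \<bullet> e\<bar> \<le> norm (y - z)" using Cauchy_Schwarz_ineq2[of "y - z" e] e by simp
      moreover have "G y - G z = (y - z) \<bullet> e - (\<gamma> (hproj e y) - \<gamma> (hproj e z))" by (simp add: G_def inner_simps)
      ultimately have "\<bar>G y - G z\<bar> \<le> norm (y - z) + L * norm (y - z)" using 1 by linarith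
      then show ?thesis by (simp add: algebra_simps)
    qed
    show "open \<Omega>" using \<Omega> by (simp add: bounded_lipschitz_domain_def)
    show "open (cylinder x e r h)"
      unfolding cylinder_def hproj_def
      by (intro open_Collect_conj open_Collect_less continuous_intros)
    show "y \<in> \<Omega> \<longleftrightarrow> G y < 0" if "y \<in> cylinder x e r h" for y
    proof -
      have "y \<in> \<Omega> \<longleftrightarrow> y \<in> \<Omega> \<inter> cylinder x e r h" using that by blast
      also have "\<dots> \<longleftrightarrow> y \<bullet> e < \<gamma> (hproj e y)" unfolding eq using that by blast
      finally show ?thesis by (simp add: G_def)
    qed
  qed
  moreover have "x \<in> cylinder x e r h" using rh by (simp add: cylinder_def hproj_def)
  ultimately show ?thesis by blast
qed

text \<open>
  Every line parallel to \<open>e\<close> meets the level set in a single point.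
\<close>

lemma (in lip_level) level_set_null: "emeasure lborel {x. G x = 0} = 0"
proof -
  have [measurable]: "{x. G x = 0} \<in> sets borel" by measurable
  have "emeasure lborel {x. G x = 0} = (\<integral>\<^sup>+p. \<integral>\<^sup>+s. indicator {x. G x = 0} (p + s *\<^sub>R e) \<partial>lborel \<partial>graph_measure)"
    using nn_integral_coarea[of "indicator {x. G x = 0}"] by simp
  also have "\<dots> = (\<integral>\<^sup>+p. \<integral>\<^sup>+s. indicator {- G p} s \<partial>lborel \<partial>graph_measure)"
  proof -
    have "indicator {x. G x = 0} (p + s *\<^sub>R e) = (indicator {- G p} s :: ennreal)" for p s
      by (auto simp: indicator_def G_shift)
    then show ?thesis by (simp only:)
  qed
  finally show ?thesis by simp
qed

lemma frontier_compact: "bounded_lipschitz_domain \<Omega> \<Longrightarrow> compact (frontier \<Omega>)"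
  by (simp add: bounded_lipschitz_domain_def compact_frontier_bounded)

lemma frontier_finite_patches:
  fixes \<Omega> :: "(real^'d) set"
  assumes \<Omega>: "bounded_lipschitz_domain \<Omega>"
  obtains F where "finite F" "frontier \<Omega> \<subseteq> \<Union>F"
    "\<forall>C\<in>F. \<exists>e G K. lip_patch e G K \<Omega> C"
proof -
  let ?P = "{C. \<exists>e G K. lip_patch e G K \<Omega> C}"
  have cov: "frontier \<Omega> \<subseteq> \<Union>?P"
  proof
    fix x assume "x \<in> frontier \<Omega>"
    from lipschitz_boundary_patch[OF \<Omega> this] obtain C where "C \<in> ?P" "x \<in> C" by auto
    then show "x \<in> \<Union>?P" by (rule UnionI)
  qed
  have op: "open C" if "C \<in> ?P" for C
  proof -
    obtain e G K where "lip_patch e G K \<Omega> C" using \<open>C \<in> ?P\<close> by auto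
    then show ?thesis by (rule lip_patch.open_C)
  qed
  obtain F where F: "F \<subseteq> ?P" "finite F" "frontier \<Omega> \<subseteq> \<Union>F"
    by (rule compactE[OF frontier_compact[OF \<Omega>] cov op])
  show ?thesis by (rule that[OF F(2,3)]) (use F(1) in auto)
qed

lemma surface_frontier_finite:
  fixes \<Omega> :: "(real^'d) set"
  assumes \<Omega>: "bounded_lipschitz_domain \<Omega>"
  shows "emeasure surface_measure (frontier \<Omega>) < top"
proof -
  obtain F :: "(real^'d) set set" where F: "finite F" "frontier \<Omega> \<subseteq> \<Union>F" "\<forall>C\<in>F. \<exists>e G K. lip_patch e G K \<Omega> C"
    by (rule frontier_finite_patches[OF \<Omega>])
  obtain R where R: "frontier \<Omega> \<subseteq> cball 0 R"
    using bounded_subset_ballD[OF compact_imp_bounded[OF frontier_compact[OF \<Omega>]], of 0] ball_subset_cball by blast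
  have fm: "C \<inter> frontier \<Omega> \<in> sets borel" if "C \<in> F" for C
    using F(3)[rule_format, OF that] by (auto dest: lip_patch.frontier_Int_C_borel)
  have fin: "emeasure surface_measure (C \<inter> frontier \<Omega>) < top" if C: "C \<in> F" for C
  proof -
    obtain e G K where "lip_patch e G K \<Omega> C" using F(3)[rule_format, OF C] by blast
    then interpret lip_patch e G K \<Omega> C .
    have "emeasure surface_measure (C \<inter> frontier \<Omega>) \<le> emeasure surface_measure ({x. G x = 0} \<inter> cball 0 R)"
      using R frontier_patch by (intro emeasure_mono) auto
    then show ?thesis using surface_measure_graph_finite[of R] by (rule le_less_trans)
  qed
  have "emeasure surface_measure (frontier \<Omega>) \<le> emeasure surface_measure (\<Union>C\<in>F. C \<inter> frontier \<Omega>)"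
  proof (rule emeasure_mono)
    show "(\<Union>C\<in>F. C \<inter> frontier \<Omega>) \<in> sets surface_measure"
      using sets.finite_UN[of F "\<lambda>C. C \<inter> frontier \<Omega>" "borel :: (real^'d) measure"] F(1) fm by simp
  qed (use F(2) in blast)
  also have "\<dots> \<le> (\<Sum>C\<in>F. emeasure surface_measure (C \<inter> frontier \<Omega>))"
    using F(1) fm by (intro emeasure_subadditive_finite) auto
  also have "\<dots> < top" using fin by (simp add: less_top F(1))
  finally show ?thesis .
qed

lemma frontier_null:
  fixes \<Omega> :: "(real^'d) set"
  assumes \<Omega>: "bounded_lipschitz_domain \<Omega>"
  shows "frontier \<Omega> \<in> null_sets lborel"
proof -
  obtain F :: "(real^'d) set set" where F: "finite F" "frontier \<Omega> \<subseteq> \<Union>F" "\<forall>C\<in>F. \<exists>e G K. lip_patch e G K \<Omega> C"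
    by (rule frontier_finite_patches[OF \<Omega>])
  have "C \<inter> frontier \<Omega> \<in> null_sets lborel" if C: "C \<in> F" for C
  proof -
    obtain e G K where "lip_patch e G K \<Omega> C" using F(3)[rule_format, OF C] by blast
    then interpret lip_patch e G K \<Omega> C .
    have "{x. G x = 0} \<in> sets lborel" by measurable
    with level_set_null have "{x. G x = 0} \<in> null_sets lborel" by (simp add: null_sets_def)
    then show ?thesis
      by (rule null_sets_subset) (use frontier_Int_C_borel frontier_patch in auto)
  qed
  then have "(\<Union>C\<in>F. C \<inter> frontier \<Omega>) \<in> null_sets lborel"
    using F(1) by (intro null_sets_UN') (auto intro: countable_finite)
  moreover have "(\<Union>C\<in>F. C \<inter> frontier \<Omega>) = frontier \<Omega>" using F(2) by blast
  ultimately show ?thesis by simp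
qed

text \<open>
  A continuously differentiable bump function with support \<open>cball p r\<close>; its derivative is written out
  in \<open>bump'\<close>.
\<close>

definition bump :: "real^'d \<Rightarrow> real \<Rightarrow> real^'d \<Rightarrow> real" where
  "bump p r x = (max 0 (r\<^sup>2 - (norm (x - p))\<^sup>2))\<^sup>2"

definition bump' :: "real^'d \<Rightarrow> real \<Rightarrow> real^'d \<Rightarrow> real^'d \<Rightarrow> real" where
  "bump' p r x w = 2 * max 0 (r\<^sup>2 - (norm (x - p))\<^sup>2) * (- 2 * ((x - p) \<bullet> w))"

lemma DERIV_pos_part_square: "((\<lambda>s::real. (max 0 s)\<^sup>2) has_field_derivative 2 * max 0 s) (at s)"
proof -
  consider "s < 0" | "s = 0" | "0 < s" by linarith
  then show ?thesis
  proof cases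
    case 1
    have "((\<lambda>s::real. 0) has_field_derivative 0) (at s)" by simp
    then have "((\<lambda>s::real. (max 0 s)\<^sup>2) has_field_derivative 0) (at s)"
      by (rule has_field_derivative_transform_within_open[of _ _ _ "{..<0}"]) (use 1 in auto)
    then show ?thesis using 1 by simp
  next
    case 2
    have "(\<lambda>t::real. (max 0 t)\<^sup>2 / t) \<midarrow>0\<rightarrow> 0"
    proof (rule Lim_null_comparison)
      show "\<forall>\<^sub>F t in at 0. norm ((max 0 t)\<^sup>2 / t) \<le> \<bar>t\<bar>"
        by (intro always_eventually allI) (auto simp: max_def power2_eq_square)
      show "(\<lambda>t::real. \<bar>t\<bar>) \<midarrow>0\<rightarrow> 0" by (intro tendsto_rabs_zero tendsto_ident_at)
    qed
    then show ?thesis using 2 by (simp add: has_field_derivative_iff)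
  next
    case 3
    have "((\<lambda>s::real. s\<^sup>2) has_field_derivative 2 * s) (at s)" by (auto intro!: derivative_eq_intros)
    then have "((\<lambda>s::real. (max 0 s)\<^sup>2) has_field_derivative 2 * s) (at s)"
      by (rule has_field_derivative_transform_within_open[of _ _ _ "{0<..}"]) (use 3 in auto)
    then show ?thesis using 3 by simp
  qed
qed

lemma has_derivative_bump: "(bump p r has_derivative bump' p r x) (at x)"
proof -
  have 1: "((\<lambda>x. r\<^sup>2 - (x - p) \<bullet> (x - p)) has_derivative (\<lambda>w. - 2 * ((x - p) \<bullet> w))) (at x)"
    by (auto intro!: derivative_eq_intros simp: inner_commute)
  have "((\<lambda>s::real. (max 0 s)\<^sup>2) has_derivative (\<lambda>t. 2 * max 0 (r\<^sup>2 - (x - p) \<bullet> (x - p)) * t)) (at (r\<^sup>2 - (x - p) \<bullet> (x - p)))"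
    using DERIV_pos_part_square unfolding has_field_derivative_def .
  from has_derivative_compose[OF 1 this] show ?thesis
    by (simp add: bump_def[abs_def] bump'_def[abs_def] power2_norm_eq_inner)
qed

lemma bump_bounds:
  assumes "0 < r"
  shows "0 \<le> bump p r x" "\<bar>bump p r x\<bar> \<le> (r\<^sup>2)\<^sup>2" "\<bar>bump' p r x w\<bar> \<le> 4 * r\<^sup>2 * r * norm w"
    and "x \<notin> cball p r \<Longrightarrow> bump p r x = 0" "x \<in> ball p r \<Longrightarrow> 0 < bump p r x"
proof -
  show "0 \<le> bump p r x" by (simp add: bump_def)
  show "\<bar>bump p r x\<bar> \<le> (r\<^sup>2)\<^sup>2" proof -
    have "0 \<le> max 0 (r\<^sup>2 - (norm (x - p))\<^sup>2)" "max 0 (r\<^sup>2 - (norm (x - p))\<^sup>2) \<le> r\<^sup>2" by auto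
    then have "(max 0 (r\<^sup>2 - (norm (x - p))\<^sup>2))\<^sup>2 \<le> (r\<^sup>2)\<^sup>2" by (intro power_mono)
    then show ?thesis unfolding bump_def by (simp only: abs_power2)
  qed
  have out: "r\<^sup>2 - (norm (x - p))\<^sup>2 \<le> 0" if "r \<le> norm (x - p)"
    using power_mono[OF that, of 2] assms by simp
  show "x \<notin> cball p r \<Longrightarrow> bump p r x = 0"
    using out by (simp add: bump_def dist_norm norm_minus_commute max_def)
  have inn: "0 < r\<^sup>2 - (norm (x - p))\<^sup>2" if "norm (x - p) < r"
    using power_strict_mono[OF that, of 2] by simp
  then show "x \<in> ball p r \<Longrightarrow> 0 < bump p r x" by (simp add: bump_def dist_norm norm_minus_commute)
  show "\<bar>bump' p r x w\<bar> \<le> 4 * r\<^sup>2 * r * norm w"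
  proof (cases "r \<le> norm (x - p)")
    case True
    then show ?thesis using out assms by (simp add: bump'_def max_def)
  next
    case False
    have "\<bar>bump' p r x w\<bar> = 4 * (r\<^sup>2 - (norm (x - p))\<^sup>2) * \<bar>(x - p) \<bullet> w\<bar>"
      using inn False by (simp add: bump'_def abs_mult)
    also have "\<dots> \<le> 4 * r\<^sup>2 * (r * norm w)"
    proof (rule mult_mono)
      show "\<bar>(x - p) \<bullet> w\<bar> \<le> r * norm w"
        using Cauchy_Schwarz_ineq2[of "x - p" w] False mult_right_mono[of "norm (x - p)" r "norm w"] by simp
    qed (use inn False assms in auto)
    finally show ?thesis by (simp add: mult.assoc)
  qed
qed

text \<open>
  The integrands of the divergence theorem: continuous up to the boundary and differentiable inside
  with a bounded derivative.  The class is closed under products and under reciprocals of positive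
  functions, so it contains the members of a partition of unity.
\<close>

definition derivative_bounded_on :: "(real^'d) set \<Rightarrow> (real^'d \<Rightarrow> real) \<Rightarrow> (real^'d \<Rightarrow> real^'d \<Rightarrow> real) \<Rightarrow> bool" where
  "derivative_bounded_on \<Omega> f f' \<longleftrightarrow> continuous_on (closure \<Omega>) f \<and>
     (\<forall>x\<in>\<Omega>. (f has_derivative f' x) (at x)) \<and> (\<exists>B\<ge>0. \<forall>x\<in>\<Omega>. \<forall>w. \<bar>f' x w\<bar> \<le> B * norm w)"

lemma measurable_directional_derivative:
  fixes f :: "real^'d \<Rightarrow> real"
  assumes "open \<Omega>" and cont: "continuous_on \<Omega> f" and der: "\<And>x. x \<in> \<Omega> \<Longrightarrow> (f has_derivative f' x) (at x)"
  shows "(\<lambda>x. indicator \<Omega> x * f' x v) \<in> borel_measurable borel"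
proof -
  define g where "g x = indicator \<Omega> x * f x" for x
  have [measurable]: "\<Omega> \<in> sets borel" using assms(1) by simp
  have [measurable]: "g \<in> borel_measurable borel"
    using borel_measurable_continuous_on_indicator[OF _ cont] assms(1) by (simp add: g_def[abs_def])
  define h :: "nat \<Rightarrow> real" where "h j = 1 / real (Suc j)" for j
  have h: "0 < h j" for j by (simp add: h_def)
  have h0: "h \<longlonglongrightarrow> 0" using LIMSEQ_inverse_real_of_nat by (simp add: h_def[abs_def] inverse_eq_divide)
  have lim: "(\<lambda>j. indicator \<Omega> x * ((g (x + h j *\<^sub>R v) - g x) / h j)) \<longlonglongrightarrow> indicator \<Omega> x * f' x v" for x
  proof (cases "x \<in> \<Omega>")
    case True
    have dg: "(g has_derivative f' x) (at x)"
      by (rule has_derivative_transform_within_open[OF der[OF True] assms(1) True]) (simp add: g_def)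
    have "((\<lambda>t. g (x + t *\<^sub>R v)) has_derivative (\<lambda>t. f' x (t *\<^sub>R v))) (at 0)"
    proof (rule has_derivative_compose[of "\<lambda>t. x + t *\<^sub>R v" "\<lambda>t. t *\<^sub>R v" 0 UNIV g "f' x"])
      show "((\<lambda>t. x + t *\<^sub>R v) has_derivative (\<lambda>t. t *\<^sub>R v)) (at 0)" by (auto intro!: derivative_eq_intros)
    qed (use dg in simp)
    moreover have "f' x (t *\<^sub>R v) = t * f' x v" for t
      using has_derivative_linear[OF dg] by (simp add: linear_cmul)
    ultimately have "((\<lambda>t. g (x + t *\<^sub>R v)) has_field_derivative f' x v) (at 0)"
      by (simp add: has_field_derivative_def mult_commute_abs)
    then have "(\<lambda>t. (g (x + t *\<^sub>R v) - g x) / t) \<midarrow>0\<rightarrow> f' x v" by (simp add: has_field_derivative_iff)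
    moreover have "filterlim h (at 0) sequentially"
      using h0 h by (intro filterlim_atI) (auto simp: less_imp_neq[THEN not_sym])
    ultimately have "(\<lambda>j. (g (x + h j *\<^sub>R v) - g x) / h j) \<longlonglongrightarrow> f' x v" by (rule filterlim_compose)
    then show ?thesis using True by simp
  qed simp
  show ?thesis
    by (rule borel_measurable_LIMSEQ_real[where u="\<lambda>j x. indicator \<Omega> x * ((g (x + h j *\<^sub>R v) - g x) / h j)"])
       (use lim in auto)
qed

lemma derivative_bounded_integrable:
  assumes "open \<Omega>" "bounded \<Omega>" "derivative_bounded_on \<Omega> f f'"
  shows "integrable lborel (\<lambda>x. indicator \<Omega> x * f' x v)"
proof -
  obtain B where B: "0 \<le> B" "\<And>x w. x \<in> \<Omega> \<Longrightarrow> \<bar>f' x w\<bar> \<le> B * norm w"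
    using assms(3) by (auto simp: derivative_bounded_on_def)
  obtain R where R: "\<Omega> \<subseteq> ball 0 R" using bounded_subset_ballD[OF assms(2), of 0] by blast
  show ?thesis
  proof (rule integrable_bounded_support[where B="B * norm v" and R=R])
    show "(\<lambda>x. indicator \<Omega> x * f' x v) \<in> borel_measurable borel"
      using assms(1,3) continuous_on_subset[OF _ closure_subset]
      by (intro measurable_directional_derivative[of \<Omega> f]) (auto simp: derivative_bounded_on_def)
    fix x
    show "\<bar>indicator \<Omega> x * f' x v\<bar> \<le> B * norm v" using B by (auto simp: indicator_def)
    show "R < norm x \<Longrightarrow> indicator \<Omega> x * f' x v = 0" using R by (auto simp: indicator_def)
  qed
qed


text \<open>
  A translation of the whole space moves nothing across a boundary.
\<close>

lemma integral_derivative_bounded_support: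
  fixes \<phi> :: "real^'d \<Rightarrow> real"
  assumes der: "\<And>x. (\<phi> has_derivative \<phi>' x) (at x)"
    and bnd: "\<And>x w. \<bar>\<phi>' x w\<bar> \<le> B * norm w"
    and supp: "\<And>x. R < norm x \<Longrightarrow> \<phi> x = 0"
  shows "(\<integral>x. \<phi>' x v \<partial>lborel) = 0"
proof -
  have B: "0 \<le> B" using bnd[of 0 "axis undefined 1"] by (simp add: norm_axis_1)
  have lip: "\<bar>\<phi> x - \<phi> y\<bar> \<le> B * norm (x - y)" for x y
  proof -
    have "norm (\<phi> x - \<phi> y) \<le> B * norm (x - y)"
      by (rule differentiable_bound[of UNIV \<phi> \<phi>' B]) (use der bnd B in \<open>auto intro!: onorm_bound\<close>)
    then show ?thesis by simp
  qed
  have "(\<lambda>j. (\<integral>x. \<phi> x * (indicator UNIV (x - (1 / real (Suc j)) *\<^sub>R v) - indicator UNIV x) \<partial>lborel) / (1 / real (Suc j)))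
      \<longlonglongrightarrow> (\<integral>x. indicator UNIV x * \<phi>' x v \<partial>lborel)"
    by (rule difference_quotient_integral(2)[OF lip supp _ der]) auto
  then show ?thesis using LIMSEQ_unique[OF tendsto_const] by fastforce
qed

lemma derivative_bounded_on_imp_bounded:
  assumes "derivative_bounded_on \<Omega> f f'" "compact (closure \<Omega>)"
  obtains B where "0 \<le> B" "\<forall>x\<in>closure \<Omega>. \<bar>f x\<bar> \<le> B"
proof -
  have "compact (f ` closure \<Omega>)"
    using assms by (intro compact_continuous_image) (auto simp: derivative_bounded_on_def)
  then obtain b where b: "\<forall>y\<in>f ` closure \<Omega>. norm y \<le> b" using compact_imp_bounded bounded_iff by blast
  show ?thesis by (rule that[of "\<bar>b\<bar>"]) (use b in \<open>force+\<close>)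
qed

lemma derivative_bounded_on_mult:
  assumes f: "derivative_bounded_on \<Omega> f f'" and g: "derivative_bounded_on \<Omega> g g'" and c: "compact (closure \<Omega>)"
  shows "derivative_bounded_on \<Omega> (\<lambda>x. f x * g x) (\<lambda>x w. f x * g' x w + f' x w * g x)"
proof -
  obtain Bf where Bf: "0 \<le> Bf" "\<forall>x\<in>closure \<Omega>. \<bar>f x\<bar> \<le> Bf" by (rule derivative_bounded_on_imp_bounded[OF f c])
  obtain Bg where Bg: "0 \<le> Bg" "\<forall>x\<in>closure \<Omega>. \<bar>g x\<bar> \<le> Bg" by (rule derivative_bounded_on_imp_bounded[OF g c])
  obtain B1 where B1: "0 \<le> B1" "\<And>x w. x \<in> \<Omega> \<Longrightarrow> \<bar>f' x w\<bar> \<le> B1 * norm w" using f by (auto simp: derivative_bounded_on_def)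
  obtain B2 where B2: "0 \<le> B2" "\<And>x w. x \<in> \<Omega> \<Longrightarrow> \<bar>g' x w\<bar> \<le> B2 * norm w" using g by (auto simp: derivative_bounded_on_def)
  have "\<bar>f x * g' x w + f' x w * g x\<bar> \<le> (Bf * B2 + B1 * Bg) * norm w" if x: "x \<in> \<Omega>" for x w
  proof -
    have x': "x \<in> closure \<Omega>" using x closure_subset by blast
    have "\<bar>f x * g' x w + f' x w * g x\<bar> \<le> \<bar>f x\<bar> * \<bar>g' x w\<bar> + \<bar>f' x w\<bar> * \<bar>g x\<bar>"
      unfolding abs_mult[symmetric] by (rule abs_triangle_ineq)
    also have "\<dots> \<le> Bf * (B2 * norm w) + (B1 * norm w) * Bg"
      using Bf(1) Bg(1) B1(1) B2(1) by (intro add_mono mult_mono Bf(2)[rule_format] Bg(2)[rule_format] B1(2) B2(2) x x') auto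
    finally show ?thesis by (simp add: algebra_simps)
  qed
  moreover have "0 \<le> Bf * B2 + B1 * Bg" using Bf(1) Bg(1) B1(1) B2(1) by simp
  ultimately have "\<exists>B\<ge>0. \<forall>x\<in>\<Omega>. \<forall>w. \<bar>f x * g' x w + f' x w * g x\<bar> \<le> B * norm w" by blast
  then show ?thesis
    using f g unfolding derivative_bounded_on_def by (auto intro!: continuous_on_mult has_derivative_mult)
qed

lemma derivative_bounded_on_inverse:
  assumes f: "derivative_bounded_on \<Omega> f f'" and c: "compact (closure \<Omega>)" and pos: "\<And>x. x \<in> closure \<Omega> \<Longrightarrow> 0 < f x"
  shows "derivative_bounded_on \<Omega> (\<lambda>x. inverse (f x)) (\<lambda>x w. - (inverse (f x) * f' x w * inverse (f x)))"
proof (cases "\<Omega> = {}")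
  case True then show ?thesis by (auto simp: derivative_bounded_on_def intro: exI[of _ 0])
next
  case False
  then have "closure \<Omega> \<noteq> {}" by simp
  then obtain x0 where x0: "x0 \<in> closure \<Omega>" "\<And>x. x \<in> closure \<Omega> \<Longrightarrow> f x0 \<le> f x"
    using continuous_attains_inf[OF c] f unfolding derivative_bounded_on_def by metis
  define m where "m = inverse (f x0)"
  have m: "0 < m" "\<And>x. x \<in> closure \<Omega> \<Longrightarrow> \<bar>inverse (f x)\<bar> \<le> m"
    using pos x0 by (auto simp: m_def less_imp_le intro!: le_imp_inverse_le)
  obtain B1 where B1: "0 \<le> B1" "\<And>x w. x \<in> \<Omega> \<Longrightarrow> \<bar>f' x w\<bar> \<le> B1 * norm w" using f by (auto simp: derivative_bounded_on_def)
  have "\<bar>- (inverse (f x) * f' x w * inverse (f x))\<bar> \<le> (m * B1 * m) * norm w" if x: "x \<in> \<Omega>" for x w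
  proof -
    have x': "x \<in> closure \<Omega>" using x closure_subset by blast
    have "\<bar>inverse (f x)\<bar> * \<bar>f' x w\<bar> * \<bar>inverse (f x)\<bar> \<le> m * (B1 * norm w) * m"
      using m(1) B1(1) by (intro mult_mono m(2) B1(2) x x') auto
    then show ?thesis by (simp only: abs_minus_cancel abs_mult) (simp add: ac_simps)
  qed
  moreover have "0 \<le> m * B1 * m" using m B1 by simp
  ultimately have "\<exists>B\<ge>0. \<forall>x\<in>\<Omega>. \<forall>w. \<bar>- (inverse (f x) * f' x w * inverse (f x))\<bar> \<le> B * norm w" by blast
  moreover have "((\<lambda>x. inverse (f x)) has_derivative (\<lambda>w. - (inverse (f x) * f' x w * inverse (f x)))) (at x)" if "x \<in> \<Omega>" for x
  proof -
    have "x \<in> closure \<Omega>" using that closure_subset by blast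
    then have "f x \<noteq> 0" using pos by force
    then show ?thesis using f that by (intro Deriv.has_derivative_inverse) (auto simp: derivative_bounded_on_def)
  qed
  moreover have "continuous_on (closure \<Omega>) (\<lambda>x. inverse (f x))"
    using f pos by (intro continuous_on_inverse) (force simp: derivative_bounded_on_def)+
  ultimately show ?thesis unfolding derivative_bounded_on_def by blast
qed

lemma derivative_bounded_on_bump: "0 < r \<Longrightarrow> derivative_bounded_on \<Omega> (bump p r) (bump' p r)"
  unfolding derivative_bounded_on_def
  using has_derivative_bump bump_bounds(3)[of r p]
  by (auto intro!: exI[of _ "4 * r\<^sup>2 * r"] continuous_at_imp_continuous_on has_derivative_continuous)

lemma derivative_bounded_on_sum:
  assumes "finite I" "\<And>i. i \<in> I \<Longrightarrow> derivative_bounded_on \<Omega> (f i) (f' i)"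
  shows "derivative_bounded_on \<Omega> (\<lambda>x. \<Sum>i\<in>I. f i x) (\<lambda>x w. \<Sum>i\<in>I. f' i x w)"
proof -
  have "\<exists>B\<ge>0. \<forall>x\<in>\<Omega>. \<forall>w. \<bar>\<Sum>i\<in>I. f' i x w\<bar> \<le> B * norm w"
  proof -
    have "\<forall>i\<in>I. \<exists>B\<ge>0. \<forall>x\<in>\<Omega>. \<forall>w. \<bar>f' i x w\<bar> \<le> B * norm w" using assms(2) by (auto simp: derivative_bounded_on_def)
    then obtain B where B: "\<And>i. i \<in> I \<Longrightarrow> 0 \<le> B i" "\<And>i x w. i \<in> I \<Longrightarrow> x \<in> \<Omega> \<Longrightarrow> \<bar>f' i x w\<bar> \<le> B i * norm w"
      unfolding bchoice_iff by blast
    have "\<bar>\<Sum>i\<in>I. f' i x w\<bar> \<le> (\<Sum>i\<in>I. B i) * norm w" if "x \<in> \<Omega>" for x w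
      unfolding sum_distrib_right using B(2) that by (intro order_trans[OF sum_abs] sum_mono) auto
    then show ?thesis using B(1) by (intro exI[of _ "\<Sum>i\<in>I. B i"]) (auto intro: sum_nonneg)
  qed
  then show ?thesis
    using assms(2) unfolding derivative_bounded_on_def by (auto intro!: continuous_on_sum has_derivative_sum)
qed

lemma surface_integrable:
  fixes f :: "real^'d \<Rightarrow> real"
  assumes \<Omega>: "bounded_lipschitz_domain \<Omega>" and n: "outward_unit_normal \<Omega> n" and f: "continuous_on (frontier \<Omega>) f"
  shows "integrable surface_measure (\<lambda>x. indicator (frontier \<Omega>) x * (v \<bullet> n x) * f x)"
proof -
  have fr: "frontier \<Omega> \<in> sets borel" by (intro borel_closed) simp
  have [measurable]: "(\<lambda>x. indicator (frontier \<Omega>) x *\<^sub>R n x) \<in> borel_measurable borel"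
    using n by (simp add: outward_unit_normal_def set_borel_measurable_def cong: measurable_cong_sets)
  have [measurable]: "(\<lambda>x. indicator (frontier \<Omega>) x * f x) \<in> borel_measurable borel"
    using borel_measurable_continuous_on_indicator[OF fr f] by simp
  have eq: "indicator (frontier \<Omega>) x * (v \<bullet> n x) * f x = (v \<bullet> (indicator (frontier \<Omega>) x *\<^sub>R n x)) * (indicator (frontier \<Omega>) x * f x)" for x
    by (simp add: indicator_def)
  have "compact (f ` frontier \<Omega>)" by (intro compact_continuous_image f frontier_compact \<Omega>)
  then obtain b where b: "\<forall>y\<in>f ` frontier \<Omega>. norm y \<le> b" using compact_imp_bounded bounded_iff by blast
  show ?thesis
  proof (rule Bochner_Integration.integrable_bound)
    show "integrable surface_measure (\<lambda>x. norm v * \<bar>b\<bar> * indicator (frontier \<Omega>) x)"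
      using surface_frontier_finite[OF \<Omega>] fr by (intro integrable_mult_right integrable_real_indicator) auto
    show "(\<lambda>x. indicator (frontier \<Omega>) x * (v \<bullet> n x) * f x) \<in> borel_measurable surface_measure"
      unfolding eq by measurable
    have "AE x in surface_measure. x \<in> frontier \<Omega> \<longrightarrow> outward_unit_normal_at \<Omega> x (n x)"
      using n by (simp add: outward_unit_normal_def)
    then show "AE x in surface_measure. norm (indicator (frontier \<Omega>) x * (v \<bullet> n x) * f x) \<le> norm (norm v * \<bar>b\<bar> * indicator (frontier \<Omega>) x)"
    proof eventually_elim
      fix x assume x: "x \<in> frontier \<Omega> \<longrightarrow> outward_unit_normal_at \<Omega> x (n x)"
      show "norm (indicator (frontier \<Omega>) x * (v \<bullet> n x) * f x) \<le> norm (norm v * \<bar>b\<bar> * indicator (frontier \<Omega>) x)"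
      proof (cases "x \<in> frontier \<Omega>")
        case True
        then have "norm (n x) = 1" using x by (simp add: outward_unit_normal_at_def)
        then have "\<bar>v \<bullet> n x\<bar> \<le> norm v" using Cauchy_Schwarz_ineq2[of v "n x"] by simp
        moreover have "\<bar>f x\<bar> \<le> \<bar>b\<bar>" using b True by force
        ultimately have "\<bar>v \<bullet> n x\<bar> * \<bar>f x\<bar> \<le> norm v * \<bar>b\<bar>" by (intro mult_mono) auto
        then show ?thesis using True by (simp add: abs_mult)
      qed simp
    qed
  qed
qed

text \<open>
  Finitely many balls cover the closure of \<open>\<Omega>\<close>, each inside \<open>\<Omega>\<close> or inside a window where \<open>\<Omega>\<close> lies below a
  Lipschitz graph.  Let \<open>S\<close> be the sum of the corresponding bump functions.  Then \<open>f\<close> is the sum of the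
  products of the bump functions with \<open>g = f / S\<close>, and the formula holds for each of these products:
  for a ball inside \<open>\<Omega>\<close> both sides vanish, and for the others it is \<open>divergence_patch\<close>.
\<close>

theorem divergence_theorem_lipschitz:
  fixes f :: "real^'d \<Rightarrow> real"
  assumes \<Omega>: "bounded_lipschitz_domain \<Omega>" and n: "outward_unit_normal \<Omega> n"
    and f: "derivative_bounded_on \<Omega> f f'"
  shows "(\<integral>x. indicator \<Omega> x * f' x v \<partial>lborel) =
    (\<integral>x. indicator (frontier \<Omega>) x * (v \<bullet> n x) * f x \<partial>surface_measure)"
proof -
  have o: "open \<Omega>" and bd: "bounded \<Omega>" using \<Omega> by (auto simp: bounded_lipschitz_domain_def)
  have c: "compact (closure \<Omega>)" using bd by (simp add: compact_closure)
  have "\<exists>r>0. (cball x r \<subseteq> \<Omega>) \<or> (\<exists>e G K C. lip_patch e G K \<Omega> C \<and> cball x r \<subseteq> C)" if x: "x \<in> closure \<Omega>" for x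
  proof (cases "x \<in> \<Omega>")
    case True
    then show ?thesis using o open_contains_cball by metis
  next
    case False
    then have "x \<in> frontier \<Omega>" using x o by (simp add: frontier_def interior_open)
    from lipschitz_boundary_patch[OF \<Omega> this] obtain e G K C where C: "lip_patch e G K \<Omega> C" "x \<in> C" by auto
    from lip_patch.open_C[OF C(1)] C(2) obtain r where "0 < r" "cball x r \<subseteq> C" using open_contains_cball by metis
    then show ?thesis using C by blast
  qed
  then obtain r where r: "\<And>x. x \<in> closure \<Omega> \<Longrightarrow> 0 < r x"
    "\<And>x. x \<in> closure \<Omega> \<Longrightarrow> cball x (r x) \<subseteq> \<Omega> \<or> (\<exists>e G K C. lip_patch e G K \<Omega> C \<and> cball x (r x) \<subseteq> C)"
    by metis
  have cov: "closure \<Omega> \<subseteq> (\<Union>x\<in>closure \<Omega>. ball x (r x))" using r(1) by force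
  obtain F where F: "F \<subseteq> closure \<Omega>" "finite F" "closure \<Omega> \<subseteq> (\<Union>x\<in>F. ball x (r x))"
    by (rule compactE_image[OF c _ cov]) auto
  define S where "S x = (\<Sum>p\<in>F. bump p (r p) x)" for x
  define S' where "S' x w = (\<Sum>p\<in>F. bump' p (r p) x w)" for x w
  have rF: "0 < r p" if "p \<in> F" for p using r(1) F(1) that by blast
  have dS: "derivative_bounded_on \<Omega> S S'"
    unfolding S_def[abs_def] S'_def[abs_def] using F(2) rF by (intro derivative_bounded_on_sum derivative_bounded_on_bump)
  have Spos: "0 < S x" if x: "x \<in> closure \<Omega>" for x
  proof -
    obtain p where p: "p \<in> F" "x \<in> ball p (r p)" using F(3) x by blast
    then have "0 < bump p (r p) x" using rF bump_bounds(5) by blast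
    also have "\<dots> \<le> S x" unfolding S_def using F(2) p rF bump_bounds(1) by (intro member_le_sum) auto
    finally show ?thesis .
  qed
  define g where "g x = f x * inverse (S x)" for x
  define g' where "g' x w = f x * - (inverse (S x) * S' x w * inverse (S x)) + f' x w * inverse (S x)" for x w
  have dg: "derivative_bounded_on \<Omega> g g'"
    unfolding g_def[abs_def] g'_def[abs_def]
    by (intro derivative_bounded_on_mult f derivative_bounded_on_inverse dS c Spos)
  obtain Bg where Bg: "0 \<le> Bg" "\<forall>x\<in>closure \<Omega>. \<bar>g x\<bar> \<le> Bg" by (rule derivative_bounded_on_imp_bounded[OF dg c])
  have cg: "continuous_on (closure \<Omega>) g" and der_g: "\<And>x. x \<in> \<Omega> \<Longrightarrow> (g has_derivative g' x) (at x)"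
    using dg by (auto simp: derivative_bounded_on_def)
  obtain B where B: "0 \<le> B" "\<And>x w. x \<in> \<Omega> \<Longrightarrow> \<bar>g' x w\<bar> \<le> B * norm w" using dg by (auto simp: derivative_bounded_on_def)
  have n_AE: "AE x in surface_measure. x \<in> frontier \<Omega> \<longrightarrow> outward_unit_normal_at \<Omega> x (n x)"
    using n by (simp add: outward_unit_normal_def)
  have fr_cl: "x \<in> frontier \<Omega> \<Longrightarrow> x \<in> closure \<Omega>" for x by (simp add: frontier_def)
  have piece: "(\<integral>x. indicator \<Omega> x * (bump p (r p) x * g' x v + bump' p (r p) x v * g x) \<partial>lborel) =
    (\<integral>x. indicator (frontier \<Omega>) x * (v \<bullet> n x) * (bump p (r p) x * g x) \<partial>surface_measure)" if p: "p \<in> F" for p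
  proof -
    have rp: "0 < r p" by (rule rF[OF p])
    have "p \<in> closure \<Omega>" using p F(1) by blast
    from r(2)[OF this] show ?thesis
    proof
      assume sub: "cball p (r p) \<subseteq> \<Omega>"
      define \<phi> where "\<phi> x = (if x \<in> \<Omega> then bump p (r p) x * g x else 0)" for x
      define \<phi>' where "\<phi>' x w = indicator \<Omega> x * (bump p (r p) x * g' x w + bump' p (r p) x w * g x)" for x w
      have "derivative_bounded_on \<Omega> (\<lambda>x. bump p (r p) x * g x) (\<lambda>x w. bump p (r p) x * g' x w + bump' p (r p) x w * g x)"
        by (intro derivative_bounded_on_mult derivative_bounded_on_bump rp dg c)
      then obtain Bp where Bp: "0 \<le> Bp" "\<And>x w. x \<in> \<Omega> \<Longrightarrow> \<bar>bump p (r p) x * g' x w + bump' p (r p) x w * g x\<bar> \<le> Bp * norm w"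
        and dp: "\<And>x. x \<in> \<Omega> \<Longrightarrow> ((\<lambda>x. bump p (r p) x * g x) has_derivative (\<lambda>w. bump p (r p) x * g' x w + bump' p (r p) x w * g x)) (at x)"
        by (auto simp: derivative_bounded_on_def)
      have "(\<integral>x. \<phi>' x v \<partial>lborel) = 0"
      proof (rule integral_derivative_bounded_support)
        fix x
        show "(\<phi> has_derivative \<phi>' x) (at x)"
        proof (cases "x \<in> \<Omega>")
          case True
          have "(\<phi> has_derivative (\<lambda>w. bump p (r p) x * g' x w + bump' p (r p) x w * g x)) (at x)"
            by (rule has_derivative_transform_within_open[OF dp[OF True] o True]) (simp add: \<phi>_def)
          then show ?thesis using True by (simp add: \<phi>'_def[abs_def])
        next
          case False
          then have x: "x \<in> - cball p (r p)" using sub by blast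
          have "((\<lambda>_. 0) has_derivative (\<lambda>_. 0 :: real)) (at x)" by (rule has_derivative_const)
          then have "(\<phi> has_derivative (\<lambda>_. 0)) (at x)"
            by (rule has_derivative_transform_within_open[OF _ _ x]) (use bump_bounds(4)[OF rp, of _ p] in \<open>auto simp: \<phi>_def\<close>)
          then show ?thesis using False by (simp add: \<phi>'_def[abs_def])
        qed
      next
        fix x w show "\<bar>\<phi>' x w\<bar> \<le> Bp * norm w" using Bp by (simp add: \<phi>'_def indicator_def)
      next
        fix x :: "real^'d" assume "norm p + r p < norm x"
        then have "x \<notin> cball p (r p)" using norm_triangle_ineq2[of x p] by (simp add: dist_norm norm_minus_commute)
        then show "\<phi> x = 0" using bump_bounds(4)[OF rp, of x p] by (simp add: \<phi>_def)
      qed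
      moreover have z: "indicator (frontier \<Omega>) x * (v \<bullet> n x) * (bump p (r p) x * g x) = 0" for x
      proof (cases "x \<in> frontier \<Omega>")
        case True
        then have "x \<notin> cball p (r p)" using sub o by (auto simp: frontier_def interior_open)
        then show ?thesis using bump_bounds(4)[OF rp, of x p] by simp
      qed simp
      ultimately show ?thesis unfolding \<phi>'_def by (simp only: z Bochner_Integration.integral_zero)
    next
      assume "\<exists>e G K C. lip_patch e G K \<Omega> C \<and> cball p (r p) \<subseteq> C"
      then obtain e G K C where C: "lip_patch e G K \<Omega> C" "cball p (r p) \<subseteq> C" by blast
      interpret lip_patch e G K \<Omega> C by (rule C(1))
      obtain n0 where n0: "n0 \<in> borel_measurable borel" "\<And>x. x \<in> frontier \<Omega> \<Longrightarrow> n0 x = n x"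
        "AE x in surface_measure. x \<in> frontier \<Omega> \<longrightarrow> outward_unit_normal_at \<Omega> x (n0 x)"
        using AE_normal_borel[OF n] by blast
      have "(\<integral>x. indicator \<Omega> x * (bump p (r p) x * g' x v + bump' p (r p) x v * g x) \<partial>lborel) =
          (\<integral>x. indicator (frontier \<Omega>) x * (v \<bullet> n0 x) * (bump p (r p) x * g x) \<partial>surface_measure)"
        by (rule divergence_patch[OF n0(1,3) cg der_g B(2) Bg(2)[rule_format] has_derivative_bump bump_bounds(3)[OF rp]
              bump_bounds(2)[OF rp] compact_cball C(2) bump_bounds(4)[OF rp] B(1) Bg(1)])
           (use rp in auto)
      also have "\<dots> = (\<integral>x. indicator (frontier \<Omega>) x * (v \<bullet> n x) * (bump p (r p) x * g x) \<partial>surface_measure)"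
        by (intro Bochner_Integration.integral_cong refl) (auto simp: indicator_def n0(2))
      finally show ?thesis .
    qed
  qed
  have sum_b: "(\<Sum>p\<in>F. bump p (r p) x * g x) = f x" if "x \<in> closure \<Omega>" for x
    using Spos[OF that] by (simp add: g_def sum_distrib_right[symmetric] S_def[symmetric])
  have sum_d: "(\<Sum>p\<in>F. bump p (r p) x * g' x v + bump' p (r p) x v * g x) = f' x v" if "x \<in> \<Omega>" for x
  proof -
    have "x \<in> closure \<Omega>" using that closure_subset by blast
    then have "S x \<noteq> 0" using Spos by force
    moreover have "(\<Sum>p\<in>F. bump p (r p) x * g' x v + bump' p (r p) x v * g x) = S x * g' x v + S' x v * g x"
      by (simp add: sum.distrib sum_distrib_right S_def S'_def)
    ultimately show ?thesis by (simp add: g_def g'_def field_simps)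
  qed
  have "(\<integral>x. indicator \<Omega> x * f' x v \<partial>lborel) =
      (\<integral>x. (\<Sum>p\<in>F. indicator \<Omega> x * (bump p (r p) x * g' x v + bump' p (r p) x v * g x)) \<partial>lborel)"
    by (intro Bochner_Integration.integral_cong refl) (auto simp: indicator_def sum_d)
  also have "\<dots> = (\<Sum>p\<in>F. \<integral>x. indicator \<Omega> x * (bump p (r p) x * g' x v + bump' p (r p) x v * g x) \<partial>lborel)"
  proof (rule Bochner_Integration.integral_sum)
    fix p assume "p \<in> F"
    then have "derivative_bounded_on \<Omega> (\<lambda>x. bump p (r p) x * g x) (\<lambda>x w. bump p (r p) x * g' x w + bump' p (r p) x w * g x)"
      by (intro derivative_bounded_on_mult derivative_bounded_on_bump rF dg c)
    then show "integrable lborel (\<lambda>x. indicator \<Omega> x * (bump p (r p) x * g' x v + bump' p (r p) x v * g x))"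
      by (rule derivative_bounded_integrable[OF o bd])
  qed
  also have "\<dots> = (\<Sum>p\<in>F. \<integral>x. indicator (frontier \<Omega>) x * (v \<bullet> n x) * (bump p (r p) x * g x) \<partial>surface_measure)"
    by (intro sum.cong refl piece)
  also have "\<dots> = (\<integral>x. (\<Sum>p\<in>F. indicator (frontier \<Omega>) x * (v \<bullet> n x) * (bump p (r p) x * g x)) \<partial>surface_measure)"
  proof (rule Bochner_Integration.integral_sum[symmetric])
    fix p assume "p \<in> F"
    then have "derivative_bounded_on \<Omega> (\<lambda>x. bump p (r p) x * g x) (\<lambda>x w. bump p (r p) x * g' x w + bump' p (r p) x w * g x)"
      by (intro derivative_bounded_on_mult derivative_bounded_on_bump rF dg c)
    then have "continuous_on (closure \<Omega>) (\<lambda>x. bump p (r p) x * g x)" by (simp add: derivative_bounded_on_def)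
    then show "integrable surface_measure (\<lambda>x. indicator (frontier \<Omega>) x * (v \<bullet> n x) * (bump p (r p) x * g x))"
      by (intro surface_integrable[OF \<Omega> n]) (erule continuous_on_subset, use fr_cl in blast)
  qed
  also have "\<dots> = (\<integral>x. indicator (frontier \<Omega>) x * (v \<bullet> n x) * f x \<partial>surface_measure)"
    by (intro Bochner_Integration.integral_cong refl)
       (auto simp: indicator_def sum_distrib_left[symmetric] sum_b fr_cl)
  finally show ?thesis .
qed

section \<open>Test functions and divergences in the sense of distributions\<close>

text \<open>
  The family \<open>t\<^sup>-\<^sup>n exp (- 1 / t)\<close>, extended by \<open>0\<close>, contains the standard smooth cut-off function (\<open>n = 0\<close>),
  and its linear span is closed under differentiation.
\<close>

definition cutoff :: "nat \<Rightarrow> real \<Rightarrow> real" where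
  "cutoff n t = (if 0 < t then (1 / t) ^ n * exp (- (1 / t)) else 0)"

lemma cutoff_div_tendsto: "((\<lambda>t. cutoff n t / t) \<longlongrightarrow> 0) (at 0)"
proof -
  have "((\<lambda>s::real. s ^ (Suc n) / exp s) \<longlongrightarrow> 0) at_top" by (rule tendsto_power_div_exp_0)
  then have "((\<lambda>t::real. (inverse t) ^ (Suc n) / exp (inverse t)) \<longlongrightarrow> 0) (at_right 0)"
    by (rule filterlim_compose) (rule filterlim_inverse_at_top_right)
  then have R: "((\<lambda>t. cutoff n t / t) \<longlongrightarrow> 0) (at_right 0)"
    by (rule Lim_transform_eventually)
       (auto simp: eventually_at_filter cutoff_def exp_minus field_simps intro!: always_eventually)
  have "((\<lambda>t::real. 0) \<longlongrightarrow> 0) (at_left (0::real))" by simp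
  then have L: "((\<lambda>t. cutoff n t / t) \<longlongrightarrow> 0) (at_left 0)"
    by (rule Lim_transform_eventually) (auto simp: eventually_at_filter cutoff_def intro!: always_eventually)
  show ?thesis using L R by (rule filterlim_split_at)
qed

lemma DERIV_cutoff: "(cutoff n has_field_derivative cutoff (n + 2) t - real n * cutoff (n + 1) t) (at t)"
proof -
  consider "t < 0" | "t = 0" | "0 < t" by linarith
  then show ?thesis
  proof cases
    case 1
    have "((\<lambda>_. 0) has_field_derivative 0) (at t)" by simp
    then have "(cutoff n has_field_derivative 0) (at t)"
      by (rule has_field_derivative_transform_within_open[of _ _ _ "{..<0}"]) (use 1 in \<open>auto simp: cutoff_def\<close>)
    then show ?thesis using 1 by (simp add: cutoff_def)
  next
    case 2
    then show ?thesis using cutoff_div_tendsto[of n]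
      by (simp add: has_field_derivative_iff) (simp add: cutoff_def)
  next
    case 3
    have "((\<lambda>t. (1 / t) ^ n * exp (- (1 / t))) has_field_derivative
        (1 / t) ^ n * (exp (- (1 / t)) * (1 / t ^ 2)) + (real n * (1 / t) ^ (n - 1) * (- 1 / t ^ 2)) * exp (- (1 / t))) (at t)"
      using 3 by (auto intro!: derivative_eq_intros simp: power2_eq_square)
    then have "(cutoff n has_field_derivative
        (1 / t) ^ n * (exp (- (1 / t)) * (1 / t ^ 2)) + (real n * (1 / t) ^ (n - 1) * (- 1 / t ^ 2)) * exp (- (1 / t))) (at t)"
      by (rule has_field_derivative_transform_within_open[of _ _ _ "{0<..}"]) (use 3 in \<open>auto simp: cutoff_def\<close>)
    moreover have "(1 / t) ^ n * (exp (- (1 / t)) * (1 / t ^ 2)) + (real n * (1 / t) ^ (n - 1) * (- 1 / t ^ 2)) * exp (- (1 / t))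
       = cutoff (n + 2) t - real n * cutoff (n + 1) t"
      using 3 by (cases n) (auto simp: cutoff_def power_add power2_eq_square field_simps)
    ultimately show ?thesis by simp
  qed
qed

lemma Ck_on_continuous: "Ck_on k S f \<Longrightarrow> continuous_on S f"
  by (cases k) auto

lemma Ck_on_const: "Ck_on k S (\<lambda>_. c)"
proof (induction k arbitrary: c)
  case (Suc k)
  then show ?case by (auto intro!: exI[of _ "\<lambda>_ _. 0"])
qed simp

lemma Ck_on_Suc_D: "Ck_on (Suc k) S f \<Longrightarrow> Ck_on k S f"
proof (induction k arbitrary: f)
  case (Suc k)
  then obtain f' where f': "\<forall>x\<in>interior S. (f has_derivative f' x) (at x)" "\<forall>v. Ck_on (Suc k) S (\<lambda>x. f' x v)"
    unfolding Ck_on.simps(2)[of "Suc k"] by blast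
  then have "\<forall>v. Ck_on k S (\<lambda>x. f' x v)" using Suc.IH by blast
  with f' Ck_on_continuous[OF Suc.prems] show ?case by auto
qed simp

lemma Ck_on_add:
  fixes f g :: "'a::real_normed_vector \<Rightarrow> real"
  shows "Ck_on k S f \<Longrightarrow> Ck_on k S g \<Longrightarrow> Ck_on k S (\<lambda>x. f x + g x)"
proof (induction k arbitrary: f g)
  case 0 then show ?case by (auto intro: continuous_on_add)
next
  case (Suc k)
  obtain f' where f': "\<forall>x\<in>interior S. (f has_derivative f' x) (at x)" "\<forall>v. Ck_on k S (\<lambda>x. f' x v)"
    using Suc.prems(1) by auto
  obtain g' where g': "\<forall>x\<in>interior S. (g has_derivative g' x) (at x)" "\<forall>v. Ck_on k S (\<lambda>x. g' x v)"
    using Suc.prems(2) by auto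
  have "continuous_on S (\<lambda>x. f x + g x)" using Suc.prems by (auto intro: continuous_on_add)
  moreover have "\<forall>x\<in>interior S. ((\<lambda>x. f x + g x) has_derivative (\<lambda>v. f' x v + g' x v)) (at x)"
    using f' g' by (auto intro: has_derivative_add)
  moreover have "\<forall>v. Ck_on k S (\<lambda>x. f' x v + g' x v)" using Suc.IH f' g' by auto
  ultimately show ?case unfolding Ck_on.simps by (intro conjI exI[of _ "\<lambda>x v. f' x v + g' x v"])
qed

lemma Ck_on_mult:
  fixes f g :: "'a::real_normed_vector \<Rightarrow> real"
  shows "Ck_on k S f \<Longrightarrow> Ck_on k S g \<Longrightarrow> Ck_on k S (\<lambda>x. f x * g x)"
proof (induction k arbitrary: f g)
  case 0 then show ?case by (auto intro: continuous_on_mult)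
next
  case (Suc k)
  obtain f' where f': "\<forall>x\<in>interior S. (f has_derivative f' x) (at x)" "\<forall>v. Ck_on k S (\<lambda>x. f' x v)"
    using Suc.prems(1) by auto
  obtain g' where g': "\<forall>x\<in>interior S. (g has_derivative g' x) (at x)" "\<forall>v. Ck_on k S (\<lambda>x. g' x v)"
    using Suc.prems(2) by auto
  have "continuous_on S (\<lambda>x. f x * g x)" using Suc.prems by (auto intro: continuous_on_mult)
  moreover have "\<forall>x\<in>interior S. ((\<lambda>x. f x * g x) has_derivative (\<lambda>v. f x * g' x v + f' x v * g x)) (at x)"
    using f' g' by (auto intro: has_derivative_mult)
  moreover have "\<forall>v. Ck_on k S (\<lambda>x. f x * g' x v + f' x v * g x)"
    using Suc.IH f' g' Ck_on_Suc_D[OF Suc.prems(1)] Ck_on_Suc_D[OF Suc.prems(2)] by (auto intro!: Ck_on_add)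
  ultimately show ?case unfolding Ck_on.simps by (intro conjI exI[of _ "\<lambda>x v. f x * g' x v + f' x v * g x"])
qed

lemma Ck_on_affine: "Ck_on k S (\<lambda>x::'a::real_inner. a + c * (x \<bullet> v))"
proof (cases k)
  case (Suc j)
  have "\<forall>x\<in>interior S. ((\<lambda>x. a + c * (x \<bullet> v)) has_derivative (\<lambda>w. c * (w \<bullet> v))) (at x)"
    by (auto intro!: derivative_eq_intros)
  then show ?thesis
    unfolding Suc Ck_on.simps by (intro conjI exI[of _ "\<lambda>_ w. c * (w \<bullet> v)"]) (auto intro!: continuous_intros Ck_on_const)
qed (auto intro!: continuous_intros)

text \<open>
  By induction on \<open>k\<close>, for all \<open>n\<close> at once: the derivative is a combination of members of the same
  family times an affine function.
\<close>

lemma Ck_on_cutoff: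
  fixes p :: "'a::real_inner"
  shows "Ck_on k UNIV (\<lambda>x. cutoff n (r\<^sup>2 - (x - p) \<bullet> (x - p)))"
proof (induction k arbitrary: n)
  have cont: "continuous_on A (cutoff n)" for A n
    using DERIV_cutoff by (intro continuous_at_imp_continuous_on ballI) (rule DERIV_isCont)
  have c: "continuous_on UNIV (\<lambda>x. cutoff n (r\<^sup>2 - (x - p) \<bullet> (x - p)))" for n
    by (intro continuous_on_compose2[OF cont[of UNIV n]] continuous_intros) auto
  {
    case 0 then show ?case using c by simp
  next
    case (Suc k)
    let ?g = "\<lambda>x. r\<^sup>2 - (x - p) \<bullet> (x - p)"
    let ?g' = "\<lambda>x w. 2 * (p \<bullet> w) + (- 2) * (x \<bullet> w)"
    have dg: "(?g has_derivative ?g' x) (at x)" for x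
      by (auto intro!: derivative_eq_intros simp: inner_simps inner_commute)
    have d: "((\<lambda>x. cutoff n (?g x)) has_derivative (\<lambda>w. (cutoff (n + 2) (?g x) + (- real n) * cutoff (n + 1) (?g x)) * ?g' x w)) (at x)" for x
    proof -
      have "(cutoff n has_derivative (\<lambda>t. (cutoff (n + 2) (?g x) + (- real n) * cutoff (n + 1) (?g x)) * t)) (at (?g x))"
        using DERIV_cutoff[of n "?g x"] by (simp add: has_field_derivative_def)
      from has_derivative_compose[OF dg this] show ?thesis .
    qed
    have "Ck_on k UNIV (\<lambda>x. (cutoff (n + 2) (?g x) + (- real n) * cutoff (n + 1) (?g x)) * ?g' x w)" for w
      by (intro Ck_on_mult Ck_on_add Ck_on_const Suc.IH Ck_on_affine)
    then show ?case
      unfolding Ck_on.simps using c d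
      by (intro conjI exI[of _ "\<lambda>x w. (cutoff (n + 2) (?g x) + (- real n) * cutoff (n + 1) (?g x)) * ?g' x w"]) auto
  }
qed

text \<open>
  Write \<open>A\<close> as a countable union of balls whose closures lie in \<open>A\<close>, with smooth functions \<open>b j\<close> between
  \<open>0\<close> and \<open>1\<close> that are positive exactly on the \<open>j\<close>-th ball.  The power \<open>m\<close> in
  \<open>\<phi> m = 1 - (\<Prod>j<m. 1 - b j) ^ m\<close> drives \<open>\<phi> m\<close> to \<open>1\<close> wherever some \<open>b j\<close> is positive.
\<close>

lemma test_functions_approximate_indicator:
  fixes A :: "(real^'d) set"
  assumes A: "open A"
  obtains \<phi> :: "nat \<Rightarrow> real^'d \<Rightarrow> real" where "\<forall>m. \<phi> m \<in> test_functions A"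
    "\<forall>m x. 0 \<le> \<phi> m x \<and> \<phi> m x \<le> 1" "\<forall>x. (\<lambda>m. \<phi> m x) \<longlonglongrightarrow> indicator A x"
proof (cases "A = {}")
  case True
  show ?thesis
    by (rule that[of "\<lambda>_ _. 0"]) (auto simp: True test_functions_def Ck_on_const)
next
  case False
  let ?B = "{ball x r | x r. cball x r \<subseteq> A}"
  obtain B where B: "B \<subseteq> ?B" "countable B" "\<Union>B = \<Union>?B"
    by (rule Lindelof[of ?B]) auto
  have UB: "\<Union>?B = A"
  proof (intro set_eqI iffI)
    fix x assume "x \<in> \<Union>?B"
    then obtain p r where "x \<in> ball p r" "cball p r \<subseteq> A" by blast
    then show "x \<in> A" by auto
  next
    fix x assume "x \<in> A"
    then obtain r where "r > 0" "cball x r \<subseteq> A" using A by (auto simp: open_contains_cball)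
    then have "ball x r \<in> ?B" "x \<in> ball x r" by auto
    then show "x \<in> \<Union>?B" by blast
  qed
  have Bne: "B \<noteq> {}" using False B(3) UB by auto
  have "\<forall>j. \<exists>p r. from_nat_into B j = ball p r \<and> cball p r \<subseteq> A"
  proof
    fix j
    have "from_nat_into B j \<in> ?B" using from_nat_into[OF Bne, of j] B(1) by (rule subsetD[rotated])
    then show "\<exists>p r. from_nat_into B j = ball p r \<and> cball p r \<subseteq> A" by auto
  qed
  then obtain p r where prj: "\<forall>j. from_nat_into B j = ball (p j) (r j) \<and> cball (p j) (r j) \<subseteq> A"
    unfolding choice_iff by (elim exE)
  then have pr: "from_nat_into B j = ball (p j) (r j)" "cball (p j) (r j) \<subseteq> A" for j by auto
  have cov: "\<exists>j. x \<in> ball (p j) (r j)" if "x \<in> A" for x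
  proof -
    have "x \<in> \<Union>B" using \<open>x \<in> A\<close> unfolding B(3) UB .
    then obtain b where b: "b \<in> B" "x \<in> b" by (rule UnionE)
    obtain j where "from_nat_into B j = b" using from_nat_into_surj[OF B(2) b(1)] by (elim exE)
    then have "x \<in> ball (p j) (r j)" using b(2) pr(1)[of j] by simp
    then show ?thesis by (rule exI)
  qed
  define b where "b j x = cutoff 0 (max 0 (r j) ^ 2 - (x - p j) \<bullet> (x - p j))" for j x
  have b01: "0 \<le> b j x" "b j x \<le> 1" for j x by (auto simp: b_def cutoff_def)
  have bpos: "0 < b j x \<longleftrightarrow> x \<in> ball (p j) (r j)" for j x
  proof -
    have "0 < b j x \<longleftrightarrow> (norm (x - p j))\<^sup>2 < (max 0 (r j))\<^sup>2"
      by (simp add: b_def cutoff_def power2_norm_eq_inner)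
    also have "\<dots> \<longleftrightarrow> norm (x - p j) < max 0 (r j)" by (auto intro: power_less_imp_less_base power_strict_mono)
    also have "\<dots> \<longleftrightarrow> x \<in> ball (p j) (r j)" by (auto simp: dist_norm norm_minus_commute less_max_iff_disj)
    finally show ?thesis .
  qed
  define \<phi> where "\<phi> m x = 1 - (\<Prod>j<m. 1 - b j x) ^ m" for m x
  have P01: "0 \<le> (\<Prod>j<m. 1 - b j x)" "(\<Prod>j<m. 1 - b j x) \<le> 1" for m x
    using b01 by (auto intro: prod_nonneg prod_le_1)
  have smooth: "Ck_on k UNIV (\<phi> m)" for k m
  proof -
    have 1: "Ck_on k UNIV (\<lambda>x. 1 - b j x)" for j
      using Ck_on_add[OF Ck_on_const[of k UNIV 1] Ck_on_mult[OF Ck_on_const[of k UNIV "-1"] Ck_on_cutoff[of k 0 "max 0 (r j)" "p j"]]]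
      by (simp add: b_def)
    have 2: "Ck_on k UNIV (\<lambda>x. \<Prod>j<i. 1 - b j x)" for i
      by (induction i) (auto intro: Ck_on_const Ck_on_mult 1)
    have 3: "Ck_on k UNIV (\<lambda>x. (\<Prod>j<m. 1 - b j x) ^ i)" for i
      by (induction i) (auto intro: Ck_on_const Ck_on_mult 2)
    show ?thesis
      using Ck_on_add[OF Ck_on_const[of k UNIV 1] Ck_on_mult[OF Ck_on_const[of k UNIV "-1"] 3[of m]]]
      by (simp add: \<phi>_def[abs_def])
  qed
  show ?thesis
  proof (rule that; intro allI conjI)
    fix m
    let ?C = "\<Union>j<m. cball (p j) (r j)"
    have C: "compact ?C" by (intro compact_UN) auto
    have "{x. \<phi> m x \<noteq> 0} \<subseteq> ?C"
    proof
      fix x assume x: "x \<in> {x. \<phi> m x \<noteq> 0}"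
      have "\<exists>j<m. b j x \<noteq> 0"
      proof (rule ccontr)
        assume "\<not> ?thesis"
        then have "(\<Prod>j<m. 1 - b j x) = 1" by (intro prod.neutral) auto
        then show False using x by (simp add: \<phi>_def)
      qed
      then obtain j where "j < m" "0 < b j x" using b01(1) by (metis less_le)
      then show "x \<in> ?C" using bpos[of j x] by (auto intro: less_imp_le)
    qed
    then have "closure {x. \<phi> m x \<noteq> 0} \<subseteq> ?C" using C compact_imp_closed by (intro closure_minimal) auto
    then show "\<phi> m \<in> test_functions A"
    proof -
      assume sub: "closure {x. \<phi> m x \<noteq> 0} \<subseteq> ?C"
      have "compact (?C \<inter> closure {x. \<phi> m x \<noteq> 0})" using C by (intro compact_Int_closed) auto
      also have "?C \<inter> closure {x. \<phi> m x \<noteq> 0} = closure {x. \<phi> m x \<noteq> 0}" using sub by blast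
      finally have "compact (closure {x. \<phi> m x \<noteq> 0})" .
      moreover have "?C \<subseteq> A" using pr(2) by (rule UN_least)
      ultimately show ?thesis using smooth sub unfolding test_functions_def by auto
    qed
  next
    fix m x show "0 \<le> \<phi> m x" "\<phi> m x \<le> 1" using P01 by (auto simp: \<phi>_def power_le_one)
  next
    fix x
    show "(\<lambda>m. \<phi> m x) \<longlonglongrightarrow> indicator A x"
    proof (cases "x \<in> A")
      case True
      then obtain j where j: "0 < b j x" using cov bpos by blast
      have "(\<lambda>m. (\<Prod>j<m. 1 - b j x) ^ m) \<longlonglongrightarrow> 0"
      proof (rule tendsto_sandwich[OF _ _ tendsto_const])
        show "(\<lambda>m. (1 - b j x) ^ m) \<longlonglongrightarrow> 0" using j b01(2)[of j x] by (intro LIMSEQ_realpow_zero) auto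
        show "\<forall>\<^sub>F m in sequentially. 0 \<le> (\<Prod>j<m. 1 - b j x) ^ m" using P01 by simp
        show "\<forall>\<^sub>F m in sequentially. (\<Prod>j<m. 1 - b j x) ^ m \<le> (1 - b j x) ^ m"
          using eventually_gt_at_top[of j]
        proof eventually_elim
          fix m assume "j < m"
          then have "(\<Prod>i<m. 1 - b i x) = (1 - b j x) * (\<Prod>i\<in>{..<m} - {j}. 1 - b i x)"
            by (intro prod.remove) auto
          also have "\<dots> \<le> (1 - b j x) * 1" using b01 by (intro mult_left_mono prod_le_1) auto
          finally show "(\<Prod>i<m. 1 - b i x) ^ m \<le> (1 - b j x) ^ m" using P01 by (intro power_mono) auto
        qed
      qed
      from tendsto_diff[OF tendsto_const[of 1] this] show ?thesis using True by (simp add: \<phi>_def)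
    next
      case False
      have "b j x = 0" for j
      proof -
        have "x \<notin> ball (p j) (r j)" using subset_trans[OF ball_subset_cball pr(2)[of j]] False by blast
        then show ?thesis using bpos[of j x] b01(1)[of j x] by linarith
      qed
      then show ?thesis using False by (simp add: \<phi>_def)
    qed
  qed
qed


text \<open>
  The directional derivatives extend continuously to the compact closure, so they are bounded, and
  finitely many directions suffice by linearity.
\<close>

lemma C1_up_to_boundary:
  fixes F :: "real^'d \<Rightarrow> 'b::euclidean_space"
  assumes o: "open \<Omega>" and bd: "bounded \<Omega>" and F: "Ck_on 1 (closure \<Omega>) F"
  obtains F' B where "\<forall>x\<in>\<Omega>. (F has_derivative F' x) (at x)" "\<forall>v. continuous_on (closure \<Omega>) (\<lambda>x. F' x v)"
    "0 \<le> B" "\<forall>x\<in>\<Omega>. \<forall>w. norm (F' x w) \<le> B * norm w"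
proof -
  obtain F' where F': "\<forall>x\<in>interior (closure \<Omega>). (F has_derivative F' x) (at x)"
    "\<forall>v. continuous_on (closure \<Omega>) (\<lambda>x. F' x v)"
    using F by (auto simp: One_nat_def)
  have c: "compact (closure \<Omega>)" using bd by (simp add: compact_closure)
  have sub: "\<Omega> \<subseteq> interior (closure \<Omega>)" using o by (simp add: interior_maximal closure_subset)
  have "\<forall>k. \<exists>b. \<forall>x\<in>closure \<Omega>. norm (F' x (axis k 1)) \<le> b"
  proof
    fix k
    have "compact ((\<lambda>x. F' x (axis k 1)) ` closure \<Omega>)" using F'(2) c by (intro compact_continuous_image) auto
    then show "\<exists>b. \<forall>x\<in>closure \<Omega>. norm (F' x (axis k 1)) \<le> b" using compact_imp_bounded bounded_iff by (metis imageI)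
  qed
  then obtain b where b: "\<forall>k. \<forall>x\<in>closure \<Omega>. norm (F' x (axis k 1)) \<le> b k" unfolding choice_iff by (elim exE)
  define B where "B = (\<Sum>k\<in>(UNIV :: 'd set). \<bar>b k\<bar>)"
  have "norm (F' x w) \<le> B * norm w" if x: "x \<in> \<Omega>" for x w
  proof -
    have xc: "x \<in> closure \<Omega>" using x closure_subset by blast
    have lin: "linear (F' x)" using F'(1) sub x has_derivative_linear by blast
    have "w = (\<Sum>k\<in>UNIV. (w $ k) *\<^sub>R axis k 1)" using basis_expansion[of w] by (simp add: scalar_mult_eq_scaleR)
    then have "F' x w = F' x (\<Sum>k\<in>UNIV. (w $ k) *\<^sub>R axis k 1)" by simp
    also have "\<dots> = (\<Sum>k\<in>UNIV. (w $ k) *\<^sub>R F' x (axis k 1))"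
      by (simp add: linear_sum[OF lin] linear_cmul[OF lin])
    finally have "norm (F' x w) \<le> (\<Sum>k\<in>UNIV. norm ((w $ k) *\<^sub>R F' x (axis k 1)))" by (simp only: norm_sum)
    also have "\<dots> \<le> (\<Sum>k\<in>UNIV. \<bar>b k\<bar> * norm w)"
    proof (rule sum_mono)
      fix k
      have "norm (F' x (axis k 1)) \<le> \<bar>b k\<bar>" using b xc by (meson abs_ge_self order_trans)
      then have "\<bar>w $ k\<bar> * norm (F' x (axis k 1)) \<le> norm w * \<bar>b k\<bar>"
        by (intro mult_mono component_le_norm_cart) auto
      then show "norm ((w $ k) *\<^sub>R F' x (axis k 1)) \<le> \<bar>b k\<bar> * norm w" by (simp add: mult.commute)
    qed
    finally show ?thesis by (simp add: B_def sum_distrib_right)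
  qed
  moreover have "0 \<le> B" by (simp add: B_def sum_nonneg)
  moreover have "\<forall>x\<in>\<Omega>. (F has_derivative F' x) (at x)" using F'(1) sub by blast
  ultimately show ?thesis using F'(2) by (intro that[of F' B]) auto
qed

lemma C1_component:
  fixes q :: "real^'d \<Rightarrow> real^'d"
  assumes o: "open \<Omega>" and bd: "bounded \<Omega>" and q: "Ck_on 1 (closure \<Omega>) q"
  shows "derivative_bounded_on \<Omega> (\<lambda>x. q x $ k) (\<lambda>x w. frechet_derivative q (at x) w $ k)"
proof -
  obtain q' B where q': "\<forall>x\<in>\<Omega>. (q has_derivative q' x) (at x)" "0 \<le> B" "\<forall>x\<in>\<Omega>. \<forall>w. norm (q' x w) \<le> B * norm w"
    by (rule C1_up_to_boundary[OF o bd q])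
  have fd: "frechet_derivative q (at x) = q' x" if "x \<in> \<Omega>" for x
    using q'(1) that frechet_derivative_at by metis
  have "((\<lambda>x. q x $ k) has_derivative (\<lambda>w. q' x w $ k)) (at x)" if "x \<in> \<Omega>" for x
    using q'(1) that by (intro bounded_linear.has_derivative[OF bounded_linear_vec_nth]) auto
  moreover have "\<bar>q' x w $ k\<bar> \<le> B * norm w" if "x \<in> \<Omega>" for x w
    using component_le_norm_cart[of "q' x w" k] q'(3) that by (meson order_trans)
  moreover have "continuous_on (closure \<Omega>) (\<lambda>x. q x $ k)"
    using Ck_on_continuous[OF q] by (intro continuous_on_component)
  ultimately show ?thesis unfolding derivative_bounded_on_def using q'(2) by (auto simp: fd intro!: exI[of _ B])
qed

lemma derivative_bounded_on_subset:
  assumes "derivative_bounded_on \<Omega> f f'" "A \<subseteq> \<Omega>"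
  shows "derivative_bounded_on A f f'"
  using assms closure_mono[OF assms(2)] continuous_on_subset unfolding derivative_bounded_on_def by blast

lemma set_integral_lebesgue_lborel:
  fixes f :: "real^'d \<Rightarrow> real"
  assumes "(\<lambda>x. indicator A x * f x) \<in> borel_measurable borel"
  shows "(LINT x:A|lebesgue. f x) = (\<integral>x. indicator A x * f x \<partial>lborel)"
  using assms unfolding set_lebesgue_integral_def by (subst integral_completion) auto

lemma integrable_lborel_imp_set_integrable_lebesgue:
  fixes f :: "real^'d \<Rightarrow> real"
  assumes "integrable lborel (\<lambda>x. indicator A x * f x)"
  shows "set_integrable lebesgue A f"
  using assms unfolding set_integrable_def by (simp add: integrable_completion)

theorem divergence_theorem_vector:
  fixes q :: "real^'d \<Rightarrow> real^'d"
  assumes A: "bounded_lipschitz_domain A" and n: "outward_unit_normal A n"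
    and q: "\<And>k. derivative_bounded_on A (\<lambda>x. q x $ k) (\<lambda>x w. frechet_derivative q (at x) w $ k)"
  shows "(LINT x:A|lebesgue. vdiv q x) = (LINT x:frontier A|surface_measure. q x \<bullet> n x)"
    and "set_integrable lebesgue A (vdiv q)"
    and "set_integrable surface_measure (frontier A) (\<lambda>x. q x \<bullet> n x)"
proof -
  have o: "open A" and bd: "bounded A" using A by (auto simp: bounded_lipschitz_domain_def)
  have int: "integrable lborel (\<lambda>x. indicator A x * frechet_derivative q (at x) (axis k 1) $ k)" for k
    by (rule derivative_bounded_integrable[OF o bd q])
  have eq: "indicator A x * vdiv q x = (\<Sum>k\<in>UNIV. indicator A x * frechet_derivative q (at x) (axis k 1) $ k)" for x
    by (simp add: vdiv_def sum_distrib_left)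
  have "integrable lborel (\<lambda>x. indicator A x * vdiv q x)" unfolding eq using int by (rule Bochner_Integration.integrable_sum)
  then show "set_integrable lebesgue A (vdiv q)" by (rule integrable_lborel_imp_set_integrable_lebesgue)
  have m: "(\<lambda>x. indicator A x * vdiv q x) \<in> borel_measurable borel"
    using \<open>integrable lborel (\<lambda>x. indicator A x * vdiv q x)\<close> by simp
  have cont: "continuous_on (frontier A) (\<lambda>x. q x $ k)" for k
    using q[of k] unfolding derivative_bounded_on_def by (auto elim!: continuous_on_subset simp: frontier_def)
  have intS: "integrable surface_measure (\<lambda>x. indicator (frontier A) x * (axis k 1 \<bullet> n x) * q x $ k)" for k
    by (rule surface_integrable[OF A n cont])
  have eqS: "indicator (frontier A) x * (q x \<bullet> n x) = (\<Sum>k\<in>UNIV. indicator (frontier A) x * (axis k 1 \<bullet> n x) * q x $ k)" for x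
  proof -
    have "q x \<bullet> n x = (\<Sum>k\<in>UNIV. q x $ k * n x $ k)" by (simp add: inner_vec_def)
    then show ?thesis by (simp add: sum_distrib_left inner_axis' mult.commute mult.left_commute)
  qed
  have "integrable surface_measure (\<lambda>x. indicator (frontier A) x * (q x \<bullet> n x))"
    unfolding eqS using intS by (rule Bochner_Integration.integrable_sum)
  then show "set_integrable surface_measure (frontier A) (\<lambda>x. q x \<bullet> n x)" by (simp add: set_integrable_def)
  have "(LINT x:A|lebesgue. vdiv q x) = (\<Sum>k\<in>UNIV. \<integral>x. indicator A x * frechet_derivative q (at x) (axis k 1) $ k \<partial>lborel)"
    unfolding set_integral_lebesgue_lborel[OF m] eq using int by (rule Bochner_Integration.integral_sum)
  also have "\<dots> = (\<Sum>k\<in>UNIV. \<integral>x. indicator (frontier A) x * (axis k 1 \<bullet> n x) * q x $ k \<partial>surface_measure)"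
    by (intro sum.cong refl divergence_theorem_lipschitz[OF A n q])
  also have "\<dots> = (\<integral>x. indicator (frontier A) x * (q x \<bullet> n x) \<partial>surface_measure)"
    unfolding eqS using intS by (rule Bochner_Integration.integral_sum[symmetric])
  finally show "(LINT x:A|lebesgue. vdiv q x) = (LINT x:frontier A|surface_measure. q x \<bullet> n x)"
    by (simp add: set_lebesgue_integral_def)
qed

text \<open>
  The divergence theorem for \<open>\<phi> q\<close>, whose boundary term vanishes.
\<close>

lemma test_function_integration_by_parts:
  fixes q :: "real^'d \<Rightarrow> real^'d"
  assumes \<Omega>: "bounded_lipschitz_domain \<Omega>" and n: "outward_unit_normal \<Omega> n"
    and q: "\<And>k. derivative_bounded_on \<Omega> (\<lambda>x. q x $ k) (\<lambda>x w. frechet_derivative q (at x) w $ k)"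
    and \<phi>: "\<phi> \<in> test_functions \<Omega>"
  shows "(LINT x:\<Omega>|lebesgue. vdiv q x * \<phi> x) = - (LINT x:\<Omega>|lebesgue. q x \<bullet> grad \<phi> x)"
proof -
  have o: "open \<Omega>" and bd: "bounded \<Omega>" using \<Omega> by (auto simp: bounded_lipschitz_domain_def)
  have c: "compact (closure \<Omega>)" using bd by (simp add: compact_closure)
  have "Ck_on 1 UNIV \<phi>" using \<phi> by (simp only: test_functions_def mem_Collect_eq)
  then obtain \<phi>1 where \<phi>1: "\<forall>x. (\<phi> has_derivative \<phi>1 x) (at x)" "\<forall>v. continuous_on UNIV (\<lambda>x. \<phi>1 x v)"
    by (auto simp: One_nat_def)
  have "Ck_on 1 (closure \<Omega>) \<phi>"
    using \<phi>1 Ck_on_continuous[OF \<open>Ck_on 1 UNIV \<phi>\<close>]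
    by (auto simp: One_nat_def intro!: exI[of _ \<phi>1] intro: continuous_on_subset)
  then obtain \<phi>' B where \<phi>': "\<forall>x\<in>\<Omega>. (\<phi> has_derivative \<phi>' x) (at x)" "0 \<le> B" "\<forall>x\<in>\<Omega>. \<forall>w. norm (\<phi>' x w) \<le> B * norm w"
    using C1_up_to_boundary[OF o bd] by metis
  have fd: "frechet_derivative \<phi> (at x) = \<phi>' x" if "x \<in> \<Omega>" for x
    using \<phi>'(1) that frechet_derivative_at by metis
  have d\<phi>: "derivative_bounded_on \<Omega> \<phi> \<phi>'"
    unfolding derivative_bounded_on_def using \<phi>' Ck_on_continuous[OF \<open>Ck_on 1 (closure \<Omega>) \<phi>\<close>] by (auto intro!: exI[of _ B])
  have \<phi>0: "\<phi> x = 0" if "x \<in> frontier \<Omega>" for x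
  proof -
    have "x \<notin> \<Omega>" using that o by (simp add: frontier_def interior_open)
    moreover have "{x. \<phi> x \<noteq> 0} \<subseteq> \<Omega>"
    proof -
      have "closure {x. \<phi> x \<noteq> 0} \<subseteq> \<Omega>" using \<phi> by (simp add: test_functions_def)
      then show ?thesis by (rule order_trans[OF closure_subset])
    qed
    ultimately show ?thesis by auto
  qed
  let ?D = "\<lambda>k x w. q x $ k * \<phi>' x w + frechet_derivative q (at x) w $ k * \<phi> x"
  have dm: "derivative_bounded_on \<Omega> (\<lambda>x. q x $ k * \<phi> x) (?D k)" for k
    by (rule derivative_bounded_on_mult[OF q d\<phi> c])
  have int: "integrable lborel (\<lambda>x. indicator \<Omega> x * ?D k x (axis k 1))" for k
    by (rule derivative_bounded_integrable[OF o bd dm])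
  have zero: "(\<integral>x. indicator \<Omega> x * ?D k x (axis k 1) \<partial>lborel) = 0" for k
  proof -
    have z: "indicator (frontier \<Omega>) x * (axis k 1 \<bullet> n x) * (q x $ k * \<phi> x) = 0" for x
      using \<phi>0 by (simp add: indicator_def)
    show ?thesis
      unfolding divergence_theorem_lipschitz[OF \<Omega> n dm] by (simp only: z Bochner_Integration.integral_zero)
  qed
  have pt: "indicator \<Omega> x * (vdiv q x * \<phi> x + q x \<bullet> grad \<phi> x) = (\<Sum>k\<in>UNIV. indicator \<Omega> x * ?D k x (axis k 1))" for x
    by (auto simp: indicator_def vdiv_def grad_def inner_vec_def fd sum.distrib sum_distrib_right)
  have i1: "set_integrable lebesgue \<Omega> (\<lambda>x. vdiv q x * \<phi> x)"
  proof (rule integrable_lborel_imp_set_integrable_lebesgue)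
    have "integrable lborel (\<lambda>x. indicator \<Omega> x * (?D k x (axis k 1) - q x $ k * \<phi>' x (axis k 1)))" for k
    proof -
      obtain Bq where Bq: "0 \<le> Bq" "\<forall>x\<in>closure \<Omega>. \<bar>q x $ k\<bar> \<le> Bq" by (rule derivative_bounded_on_imp_bounded[OF q c])
      have "integrable lborel (\<lambda>x. indicator \<Omega> x * (q x $ k) * (indicator \<Omega> x * \<phi>' x (axis k 1)))"
      proof (rule Bochner_Integration.integrable_bound)
        show "integrable lborel (\<lambda>x. Bq * (indicator \<Omega> x * \<phi>' x (axis k 1)))"
          using derivative_bounded_integrable[OF o bd d\<phi>] by (rule integrable_mult_right)
        have "continuous_on \<Omega> (\<lambda>x. q x $ k)"
          using q[of k] closure_subset unfolding derivative_bounded_on_def by (blast intro: continuous_on_subset)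
        then have "(\<lambda>x. indicator \<Omega> x * (q x $ k)) \<in> borel_measurable borel"
          using borel_measurable_continuous_on_indicator[of \<Omega> "\<lambda>x. q x $ k"] o by simp
        moreover have "(\<lambda>x. indicator \<Omega> x * \<phi>' x (axis k 1)) \<in> borel_measurable borel"
          using derivative_bounded_integrable[OF o bd d\<phi>] by simp
        ultimately show "(\<lambda>x. indicator \<Omega> x * (q x $ k) * (indicator \<Omega> x * \<phi>' x (axis k 1))) \<in> borel_measurable lborel" by simp
        show "AE x in lborel. norm (indicator \<Omega> x * (q x $ k) * (indicator \<Omega> x * \<phi>' x (axis k 1))) \<le> norm (Bq * (indicator \<Omega> x * \<phi>' x (axis k 1)))"
          using Bq closure_subset[of \<Omega>] by (intro AE_I2) (auto simp: indicator_def abs_mult intro!: mult_right_mono)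
      qed
      then have "integrable lborel (\<lambda>x. indicator \<Omega> x * ?D k x (axis k 1) - indicator \<Omega> x * (q x $ k) * (indicator \<Omega> x * \<phi>' x (axis k 1)))"
        by (rule Bochner_Integration.integrable_diff[OF int])
      then show ?thesis by (rule back_subst[of "integrable lborel"]) (auto simp: indicator_def fun_eq_iff)
    qed
    then have "integrable lborel (\<lambda>x. \<Sum>k\<in>UNIV. indicator \<Omega> x * (?D k x (axis k 1) - q x $ k * \<phi>' x (axis k 1)))"
      by (rule Bochner_Integration.integrable_sum)
    then show "integrable lborel (\<lambda>x. indicator \<Omega> x * (vdiv q x * \<phi> x))"
      by (rule back_subst[of "integrable lborel"]) (auto simp: vdiv_def sum_distrib_left sum_distrib_right mult.assoc)
  qed
  have isum: "integrable lborel (\<lambda>x. indicator \<Omega> x * (vdiv q x * \<phi> x + q x \<bullet> grad \<phi> x))"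
    unfolding pt using int by (rule Bochner_Integration.integrable_sum)
  then have i2: "set_integrable lebesgue \<Omega> (\<lambda>x. vdiv q x * \<phi> x + q x \<bullet> grad \<phi> x)"
    by (rule integrable_lborel_imp_set_integrable_lebesgue)
  have i3: "set_integrable lebesgue \<Omega> (\<lambda>x. q x \<bullet> grad \<phi> x)"
    using set_integral_diff(1)[OF i2 i1] by simp
  have "(LINT x:\<Omega>|lebesgue. vdiv q x * \<phi> x + q x \<bullet> grad \<phi> x) = (\<integral>x. indicator \<Omega> x * (vdiv q x * \<phi> x + q x \<bullet> grad \<phi> x) \<partial>lborel)"
    using isum by (intro set_integral_lebesgue_lborel) simp
  also have "\<dots> = (\<Sum>k\<in>UNIV. \<integral>x. indicator \<Omega> x * ?D k x (axis k 1) \<partial>lborel)"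
    unfolding pt using int by (rule Bochner_Integration.integral_sum)
  also have "\<dots> = 0" by (simp only: zero sum.neutral_const)
  finally show ?thesis using set_integral_add(2)[OF i1 i3] by simp
qed

text \<open>
  If the divergence of \<open>q\<close> in the sense of distributions is \<open>g\<close>, then \<open>g\<close> and \<open>vdiv q\<close> have the same
  integrals against test functions, and indicators of open sets are bounded limits of test functions.
\<close>

lemma weak_divergence_integral:
  fixes q :: "real^'d \<Rightarrow> real^'d"
  assumes \<Omega>: "bounded_lipschitz_domain \<Omega>" and n: "outward_unit_normal \<Omega> n"
    and q: "\<And>k. derivative_bounded_on \<Omega> (\<lambda>x. q x $ k) (\<lambda>x w. frechet_derivative q (at x) w $ k)"
    and g: "set_integrable lebesgue \<Omega> g"
    and weak: "\<And>\<phi>. \<phi> \<in> test_functions \<Omega> \<Longrightarrow> (LINT x:\<Omega>|lebesgue. g x * \<phi> x) = - (LINT x:\<Omega>|lebesgue. q x \<bullet> grad \<phi> x)"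
    and A: "open A" "A \<subseteq> \<Omega>"
  shows "(LINT x:A|lebesgue. g x) = (LINT x:A|lebesgue. vdiv q x)"
proof -
  obtain \<phi> :: "nat \<Rightarrow> real^'d \<Rightarrow> real" where \<phi>: "\<forall>m. \<phi> m \<in> test_functions A"
    "\<forall>m x. 0 \<le> \<phi> m x \<and> \<phi> m x \<le> 1" "\<forall>x. (\<lambda>m. \<phi> m x) \<longlonglongrightarrow> indicator A x"
    by (rule test_functions_approximate_indicator[OF A(1)])
  have \<phi>\<Omega>: "\<phi> m \<in> test_functions \<Omega>" for m using \<phi>(1)[rule_format, of m] A(2) by (auto simp: test_functions_def)
  have \<phi>m: "\<phi> m \<in> borel_measurable lebesgue" for m
  proof -
    have "Ck_on 0 UNIV (\<phi> m)" using \<phi>(1)[rule_format, of m] unfolding test_functions_def by blast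
    then have "\<phi> m \<in> borel_measurable borel" by (intro borel_measurable_continuous_onI) simp
    then have "\<phi> m \<in> borel_measurable lborel" by simp
    then show ?thesis by (rule measurable_completion)
  qed
  have lim: "(\<lambda>m. LINT x:\<Omega>|lebesgue. f x * \<phi> m x) \<longlonglongrightarrow> (LINT x:A|lebesgue. f x)"
    if f: "set_integrable lebesgue \<Omega> f" for f :: "real^'d \<Rightarrow> real"
  proof -
    have fi: "integrable lebesgue (\<lambda>x. indicator \<Omega> x * f x)" using f by (simp add: set_integrable_def)
    have "(\<lambda>m. \<integral>x. (indicator \<Omega> x * f x) * \<phi> m x \<partial>lebesgue) \<longlonglongrightarrow> (\<integral>x. (indicator \<Omega> x * f x) * indicator A x \<partial>lebesgue)"
    proof (rule integral_dominated_convergence[where w="\<lambda>x. norm (indicator \<Omega> x * f x)"])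
      show "(\<lambda>x. (indicator \<Omega> x * f x) * indicator A x) \<in> borel_measurable lebesgue"
      proof (rule borel_measurable_times[OF borel_measurable_integrable[OF fi]])
        have "(indicator A :: real^'d \<Rightarrow> real) \<in> borel_measurable lborel" using A(1) by simp
        then show "(indicator A :: real^'d \<Rightarrow> real) \<in> borel_measurable lebesgue" by (rule measurable_completion)
      qed
      show "(\<lambda>x. (indicator \<Omega> x * f x) * \<phi> m x) \<in> borel_measurable lebesgue" for m
        by (rule borel_measurable_times[OF borel_measurable_integrable[OF fi] \<phi>m])
      show "integrable lebesgue (\<lambda>x. norm (indicator \<Omega> x * f x))" using fi by (rule integrable_norm)
      show "AE x in lebesgue. (\<lambda>m. (indicator \<Omega> x * f x) * \<phi> m x) \<longlonglongrightarrow> (indicator \<Omega> x * f x) * indicator A x"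
        using \<phi>(3) by (intro AE_I2 tendsto_mult tendsto_const) blast
      show "AE x in lebesgue. norm ((indicator \<Omega> x * f x) * \<phi> m x) \<le> norm (indicator \<Omega> x * f x)" for m
        using \<phi>(2) by (intro AE_I2) (auto simp: abs_mult intro!: mult_left_le)
    qed
    moreover have e1: "(indicator \<Omega> x * f x) * indicator A x = indicator A x *\<^sub>R f x" for x
      using A(2) by (auto simp: indicator_def)
    moreover have e2: "(indicator \<Omega> x * f x) * \<phi> m x = indicator \<Omega> x *\<^sub>R (f x * \<phi> m x)" for m x
      by simp
    ultimately show ?thesis unfolding set_lebesgue_integral_def by (simp only: e1 e2)
  qed
  have "(LINT x:\<Omega>|lebesgue. g x * \<phi> m x) = (LINT x:\<Omega>|lebesgue. vdiv q x * \<phi> m x)" for m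
    using weak[OF \<phi>\<Omega>] test_function_integration_by_parts[OF \<Omega> n q \<phi>\<Omega>] by simp
  then show ?thesis
    using LIMSEQ_unique[OF lim[OF g]] lim[OF divergence_theorem_vector(2)[OF \<Omega> n q]] by simp
qed

section \<open>Normals and fluxes of a partition\<close>

lemma outward_normal_inside:
  assumes \<nu>: "outward_unit_normal_at A x \<nu>" and w: "w \<bullet> \<nu> < 0"
  shows "\<exists>t0>0. \<forall>t. 0 < t \<and> t < t0 \<longrightarrow> x + t *\<^sub>R w \<in> A"
proof -
  have w0: "0 < norm w" using w by auto
  define \<epsilon> where "\<epsilon> = - (w \<bullet> \<nu>) / (2 * norm w)"
  have "0 < \<epsilon>" using w w0 by (simp add: \<epsilon>_def divide_neg_pos)
  then obtain r where r: "0 < r" "\<And>y. y \<in> ball x r \<Longrightarrow> (y - x) \<bullet> \<nu> < - \<epsilon> * norm (y - x) \<Longrightarrow> y \<in> A"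
    using \<nu> unfolding outward_unit_normal_at_def by blast
  have "x + t *\<^sub>R w \<in> A" if t: "0 < t" "t < r / norm w" for t
  proof (rule r(2))
    show "x + t *\<^sub>R w \<in> ball x r" using t w0 by (simp add: dist_norm field_simps)
    have "- \<epsilon> * norm w = (w \<bullet> \<nu>) / 2" using w0 by (simp add: \<epsilon>_def)
    then have "w \<bullet> \<nu> < - \<epsilon> * norm w" using w by simp
    then have "t * (w \<bullet> \<nu>) < t * (- \<epsilon> * norm w)" using t(1) by (rule mult_strict_left_mono)
    then show "(x + t *\<^sub>R w - x) \<bullet> \<nu> < - \<epsilon> * norm (x + t *\<^sub>R w - x)" using t by (simp add: ac_simps)
  qed
  then show ?thesis using r(1) w0 by (intro exI[of _ "r / norm w"]) auto
qed

lemma outward_normal_outside: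
  assumes \<nu>: "outward_unit_normal_at A x \<nu>" and w: "0 < w \<bullet> \<nu>"
  shows "\<exists>t0>0. \<forall>t. 0 < t \<and> t < t0 \<longrightarrow> x + t *\<^sub>R w \<notin> closure A"
proof -
  have w0: "0 < norm w" using w by auto
  define \<epsilon> where "\<epsilon> = (w \<bullet> \<nu>) / (2 * norm w)"
  have "0 < \<epsilon>" using w w0 by (simp add: \<epsilon>_def)
  then obtain r where r: "0 < r" "\<And>y. y \<in> ball x r \<Longrightarrow> \<epsilon> * norm (y - x) < (y - x) \<bullet> \<nu> \<Longrightarrow> y \<notin> A"
    using \<nu> unfolding outward_unit_normal_at_def by blast
  define U where "U = ball x r \<inter> {y. \<epsilon> * norm (y - x) < (y - x) \<bullet> \<nu>}"
  have "open U" unfolding U_def by (intro open_Int open_ball open_Collect_less continuous_intros)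
  moreover have "U \<inter> A = {}" using r(2) by (auto simp: U_def)
  ultimately have UA: "U \<inter> closure A = {}" by (simp add: open_Int_closure_eq_empty)
  have "x + t *\<^sub>R w \<in> U" if t: "0 < t" "t < r / norm w" for t
  proof -
    have "x + t *\<^sub>R w \<in> ball x r" using t w0 by (simp add: dist_norm field_simps)
    moreover have "\<epsilon> * norm w = (w \<bullet> \<nu>) / 2" using w0 by (simp add: \<epsilon>_def)
    then have "\<epsilon> * norm w < w \<bullet> \<nu>" using w by simp
    then have "t * (\<epsilon> * norm w) < t * (w \<bullet> \<nu>)" using t by simp
    then have "\<epsilon> * norm (x + t *\<^sub>R w - x) < (x + t *\<^sub>R w - x) \<bullet> \<nu>" using t by (simp add: ac_simps)
    ultimately show ?thesis by (simp add: U_def)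
  qed
  then show ?thesis using r(1) w0 UA by (intro exI[of _ "r / norm w"]) auto
qed

text \<open>
  If the normals were different, the direction \<open>\<nu>' - \<nu>\<close> would lead into \<open>A\<close> and out of \<open>B\<close>.
\<close>

lemma outward_normal_subset_eq:
  assumes \<nu>: "outward_unit_normal_at A x \<nu>" and \<nu>': "outward_unit_normal_at B x \<nu>'" and "A \<subseteq> B"
  shows "\<nu> = \<nu>'"
proof (rule ccontr)
  assume ne: "\<nu> \<noteq> \<nu>'"
  have n: "\<nu> \<bullet> \<nu> = 1" "\<nu>' \<bullet> \<nu>' = 1" using \<nu> \<nu>' by (auto simp: outward_unit_normal_at_def norm_eq_1)
  have "0 < (\<nu> - \<nu>') \<bullet> (\<nu> - \<nu>')" using ne by simp
  then have lt: "\<nu> \<bullet> \<nu>' < 1" using n by (simp add: inner_simps inner_commute)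
  let ?w = "\<nu>' - \<nu>"
  have "?w \<bullet> \<nu> < 0" "0 < ?w \<bullet> \<nu>'" using lt n by (auto simp: inner_simps inner_commute)
  from outward_normal_inside[OF \<nu> this(1)] outward_normal_outside[OF \<nu>' this(2)]
  obtain t0 t1 where t0: "0 < t0" "\<And>t. 0 < t \<Longrightarrow> t < t0 \<Longrightarrow> x + t *\<^sub>R ?w \<in> A"
    and t1: "0 < t1" "\<And>t. 0 < t \<Longrightarrow> t < t1 \<Longrightarrow> x + t *\<^sub>R ?w \<notin> closure B" by auto
  have "0 < min t0 t1 / 2" "min t0 t1 / 2 < t0" "min t0 t1 / 2 < t1" using t0(1) t1(1) by auto
  then show False using t0(2) t1(2) \<open>A \<subseteq> B\<close> closure_subset[of B] by blast
qed

text \<open>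
  If the normals were not opposite, the direction \<open>- (\<nu> + \<nu>')\<close> would lead into both sets.
\<close>

lemma outward_normal_disjoint:
  assumes \<nu>: "outward_unit_normal_at A x \<nu>" and \<nu>': "outward_unit_normal_at B x \<nu>'" and "A \<inter> B = {}"
  shows "\<nu>' = - \<nu>"
proof (rule ccontr)
  assume ne: "\<nu>' \<noteq> - \<nu>"
  have n: "\<nu> \<bullet> \<nu> = 1" "\<nu>' \<bullet> \<nu>' = 1" using \<nu> \<nu>' by (auto simp: outward_unit_normal_at_def norm_eq_1)
  have "\<nu> + \<nu>' \<noteq> 0" using ne by (metis add.commute add_eq_0_iff)
  then have "0 < (\<nu> + \<nu>') \<bullet> (\<nu> + \<nu>')" by simp
  then have lt: "- 1 < \<nu> \<bullet> \<nu>'" using n by (simp add: inner_simps inner_commute)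
  let ?w = "- (\<nu> + \<nu>')"
  have "?w \<bullet> \<nu> < 0" "?w \<bullet> \<nu>' < 0" using lt n by (auto simp: inner_simps inner_commute)
  from outward_normal_inside[OF \<nu> this(1)] outward_normal_inside[OF \<nu>' this(2)]
  obtain t0 t1 where t0: "0 < t0" "\<And>t. 0 < t \<Longrightarrow> t < t0 \<Longrightarrow> x + t *\<^sub>R ?w \<in> A"
    and t1: "0 < t1" "\<And>t. 0 < t \<Longrightarrow> t < t1 \<Longrightarrow> x + t *\<^sub>R ?w \<in> B" by auto
  have "0 < min t0 t1 / 2" "min t0 t1 / 2 < t0" "min t0 t1 / 2 < t1" using t0(1) t1(1) by auto
  then show False using t0(2) t1(2) \<open>A \<inter> B = {}\<close> by blast
qed

lemma outward_normals_disjoint_distinct: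
  assumes "outward_unit_normal_at A x \<nu>" "outward_unit_normal_at B x \<nu>" "A \<inter> B = {}"
  shows False
proof -
  have "\<nu> = - \<nu>" using outward_normal_disjoint[OF assms] .
  from arg_cong[OF this, of "\<lambda>y. y \<bullet> \<nu>"] have "\<nu> \<bullet> \<nu> = - (\<nu> \<bullet> \<nu>)" by (simp only: inner_minus_left)
  moreover have "\<nu> \<bullet> \<nu> = 1" using assms(1) by (simp add: outward_unit_normal_at_def norm_eq_1)
  ultimately show False by simp
qed

lemma set_integral_finite_AE_partition:
  fixes f :: "'a \<Rightarrow> real"
  assumes I: "finite I" and f: "set_integrable M A f" and S: "\<And>i. i \<in> I \<Longrightarrow> S i \<in> sets M" "\<And>i. i \<in> I \<Longrightarrow> S i \<subseteq> A"
    and part: "AE x in M. x \<in> A \<longrightarrow> (\<exists>!i. i \<in> I \<and> x \<in> S i)"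
  shows "(LINT x:A|M. f x) = (\<Sum>i\<in>I. LINT x:S i|M. f x)"
proof -
  have fi: "integrable M (\<lambda>x. indicator A x * f x)" using f by (simp add: set_integrable_def)
  have int: "integrable M (\<lambda>x. indicator (S i) x * f x)" if "i \<in> I" for i
    using set_integrable_subset[OF f S(1)[OF that] S(2)[OF that]] by (simp add: set_integrable_def)
  have one: "(\<Sum>i\<in>I. indicator (S i) x) = (1 :: real)" if ex: "\<exists>!i. i \<in> I \<and> x \<in> S i" for x
  proof -
    obtain i where i: "i \<in> I" "x \<in> S i" "\<And>j. j \<in> I \<Longrightarrow> x \<in> S j \<Longrightarrow> j = i" using ex by blast
    have "(\<Sum>j\<in>I. indicator (S j) x) = (\<Sum>j\<in>I. if j = i then 1 else (0 :: real))"
    proof (rule sum.cong[OF refl])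
      fix j assume j: "j \<in> I"
      show "indicator (S j) x = (if j = i then 1 else (0 :: real))"
      proof (cases "j = i")
        case False
        then have "x \<notin> S j" using i(3)[OF j] by blast
        then show ?thesis using False by simp
      qed (use i(2) in simp)
    qed
    then show ?thesis using I i(1) by simp
  qed
  have "(\<integral>x. indicator A x * f x \<partial>M) = (\<integral>x. (\<Sum>i\<in>I. indicator (S i) x * f x) \<partial>M)"
  proof (rule integral_cong_AE)
    show "AE x in M. indicator A x * f x = (\<Sum>i\<in>I. indicator (S i) x * f x)"
      using part
    proof eventually_elim
      fix x assume ex: "x \<in> A \<longrightarrow> (\<exists>!i. i \<in> I \<and> x \<in> S i)"
      show "indicator A x * f x = (\<Sum>i\<in>I. indicator (S i) x * f x)"
      proof (cases "x \<in> A")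
        case True
        then show ?thesis using one[of x] ex by (simp add: sum_distrib_right[symmetric])
      next
        case False
        then have "indicator (S i) x = (0 :: real)" if "i \<in> I" for i using S(2)[OF that] by (auto simp: indicator_def)
        then show ?thesis using False by simp
      qed
    qed
  qed (use fi int in \<open>auto intro: borel_measurable_integrable\<close>)
  also have "\<dots> = (\<Sum>i\<in>I. \<integral>x. indicator (S i) x * f x \<partial>M)"
    using int by (rule Bochner_Integration.integral_sum)
  finally show ?thesis by (simp add: set_lebesgue_integral_def)
qed

locale partitioned_domain =
  fixes \<Omega> :: "(real^'d) set" and \<nu> :: "real^'d \<Rightarrow> real^'d" and N :: nat
    and P :: "nat \<Rightarrow> (real^'d) set" and n :: "nat \<Rightarrow> real^'d \<Rightarrow> real^'d"
  assumes domain: "bounded_lipschitz_domain \<Omega>" and normal: "outward_unit_normal \<Omega> \<nu>"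
    and partition: "compatible_partition \<Omega> N P n"
begin

lemma open_\<Omega>: "open \<Omega>" using domain by (simp add: bounded_lipschitz_domain_def)

lemma part:
  assumes "i \<in> {1..N}"
  shows "P i \<subseteq> \<Omega>" "bounded_lipschitz_domain (P i)" "outward_unit_normal (P i) (n i)" "open (P i)"
  using partition assms by (auto simp: compatible_partition_def bounded_lipschitz_domain_def)

lemma closure_cover: "closure \<Omega> = (\<Union>i\<in>{1..N}. closure (P i))"
  using partition by (simp add: compatible_partition_def)

lemma parts_disjoint:
  assumes "i \<in> {1..N}" "j \<in> {1..N}" "i \<noteq> j"
  shows "P i \<inter> P j = {}"
  using partition assms part(4) by (auto simp: compatible_partition_def interior_open)

lemma not_in_frontier: "open S \<Longrightarrow> x \<in> frontier S \<longleftrightarrow> x \<in> closure S \<and> x \<notin> S"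
  by (auto simp: frontier_def interior_open)

lemma AE_lebesgue_unique_part: "AE x in lebesgue. x \<in> \<Omega> \<longrightarrow> (\<exists>!i. i \<in> {1..N} \<and> x \<in> P i)"
proof -
  have "frontier (P i) \<in> null_sets lebesgue" if "i \<in> {1..N}" for i
    using frontier_null[OF part(2)[OF that]] by (rule null_sets_completionI)
  then have "AE x in lebesgue. \<forall>i\<in>{1..N}. x \<notin> frontier (P i)"
    by (intro AE_finite_allI AE_not_in) auto
  then show ?thesis
  proof eventually_elim
    fix x assume nf: "\<forall>i\<in>{1..N}. x \<notin> frontier (P i)"
    show "x \<in> \<Omega> \<longrightarrow> (\<exists>!i. i \<in> {1..N} \<and> x \<in> P i)"
    proof
      assume "x \<in> \<Omega>"
      then have "x \<in> (\<Union>i\<in>{1..N}. closure (P i))" using closure_cover closure_subset by blast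
      then obtain i where i: "i \<in> {1..N}" "x \<in> closure (P i)" by blast
      then have "x \<in> P i" using nf not_in_frontier[OF part(4)] by blast
      then show "\<exists>!i. i \<in> {1..N} \<and> x \<in> P i" using i(1) parts_disjoint by blast
    qed
  qed
qed

lemma part_sets: "i \<in> {1..N} \<Longrightarrow> P i \<in> sets lebesgue"
  using part(4) by (simp add: borel_open)

lemma set_integral_parts:
  fixes f :: "real^'d \<Rightarrow> real"
  assumes "set_integrable lebesgue \<Omega> f"
  shows "(LINT x:\<Omega>|lebesgue. f x) = (\<Sum>i\<in>{1..N}. LINT x:P i|lebesgue. f x)"
  by (rule set_integral_finite_AE_partition[OF _ assms part_sets part(1) AE_lebesgue_unique_part]) auto

lemma AE_normals:
  "AE x in surface_measure. (x \<in> frontier \<Omega> \<longrightarrow> outward_unit_normal_at \<Omega> x (\<nu> x)) \<and>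
     (\<forall>i\<in>{1..N}. x \<in> frontier (P i) \<longrightarrow> outward_unit_normal_at (P i) x (n i x))"
proof (rule AE_conjI)
  show "AE x in surface_measure. x \<in> frontier \<Omega> \<longrightarrow> outward_unit_normal_at \<Omega> x (\<nu> x)"
    using normal by (simp add: outward_unit_normal_def)
  show "AE x in surface_measure. \<forall>i\<in>{1..N}. x \<in> frontier (P i) \<longrightarrow> outward_unit_normal_at (P i) x (n i x)"
    using part(3) by (intro AE_finite_allI) (auto simp: outward_unit_normal_def)
qed

lemma frontier_sets [measurable]: "frontier S \<in> sets borel"
  by (intro borel_closed) simp

text \<open>
  Two parts that meet at \<open>x\<close> would both have the normal of the domain, but they are disjoint.
\<close>

lemma unique_part_at_boundary:
  assumes x: "x \<in> frontier \<Omega>" "outward_unit_normal_at \<Omega> x (\<nu> x)"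
    and nP: "\<forall>i\<in>{1..N}. x \<in> frontier (P i) \<longrightarrow> outward_unit_normal_at (P i) x (n i x)"
  shows "\<exists>!i. i \<in> {1..N} \<and> x \<in> frontier (P i) \<inter> frontier \<Omega>"
proof -
  have "x \<in> (\<Union>i\<in>{1..N}. closure (P i))" "x \<notin> \<Omega>" using x(1) closure_cover not_in_frontier[OF open_\<Omega>] by auto
  then obtain i where i: "i \<in> {1..N}" "x \<in> closure (P i)" by blast
  then have "x \<in> frontier (P i)" using part(1)[OF i(1)] \<open>x \<notin> \<Omega>\<close> not_in_frontier[OF part(4)] by blast
  moreover have "k = j" if k: "k \<in> {1..N}" "x \<in> frontier (P k)" and j: "j \<in> {1..N}" "x \<in> frontier (P j)" for k j
  proof (rule ccontr)
    assume "k \<noteq> j"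
    have nk: "outward_unit_normal_at (P k) x (n k x)" and nj: "outward_unit_normal_at (P j) x (n j x)" using nP k j by auto
    have "n k x = \<nu> x" "n j x = \<nu> x"
      using outward_normal_subset_eq[OF nk x(2) part(1)[OF k(1)]] outward_normal_subset_eq[OF nj x(2) part(1)[OF j(1)]] by auto
    then show False using outward_normals_disjoint_distinct[of "P k" x "\<nu> x" "P j"] nk nj parts_disjoint[OF k(1) j(1) \<open>k \<noteq> j\<close>] by simp
  qed
  ultimately show ?thesis using i(1) x(1) by blast
qed

text \<open>
  The direction \<open>n i x\<close> leads out of the closure of \<open>P i\<close> but, for a while, not out of \<open>\<Omega>\<close>; so it leads into the
  closures of other parts.  Two different neighbours of \<open>P i\<close> at \<open>x\<close> would have the same normal
  \<open>- n i x\<close>.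
\<close>

lemma unique_neighbour:
  assumes i: "i \<in> {1..N}" and x: "x \<in> frontier (P i)" "x \<in> \<Omega>"
    and nP: "\<forall>i\<in>{1..N}. x \<in> frontier (P i) \<longrightarrow> outward_unit_normal_at (P i) x (n i x)"
  shows "\<exists>!j. j \<in> {1..N} - {i} \<and> x \<in> interface \<Omega> P i j"
proof -
  have ni: "outward_unit_normal_at (P i) x (n i x)" using nP i x by auto
  let ?U = "\<Union>j\<in>{1..N} - {i}. closure (P j)"
  have "x \<in> ?U"
  proof (rule ccontr)
    assume "x \<notin> ?U"
    moreover have "closed ?U" by (intro closed_UN) auto
    ultimately have "x \<in> \<Omega> - ?U" "open (\<Omega> - ?U)" using x(2) open_\<Omega> by (auto intro: open_Diff)
    then obtain r where r: "0 < r" "ball x r \<subseteq> \<Omega> - ?U" using open_contains_ball by metis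
    have nn: "n i x \<bullet> n i x = 1" "norm (n i x) = 1" using ni by (auto simp: outward_unit_normal_at_def norm_eq_1)
    then obtain t0 where t0: "0 < t0" "\<And>t. 0 < t \<Longrightarrow> t < t0 \<Longrightarrow> x + t *\<^sub>R n i x \<notin> closure (P i)"
      using outward_normal_outside[OF ni, of "n i x"] by auto
    define t where "t = min t0 r / 2"
    have t: "0 < t" "t < t0" "t < r" using r t0 by (auto simp: t_def)
    have "x + t *\<^sub>R n i x \<in> \<Omega> - ?U" using r(2) t nn by (auto simp: dist_norm subset_iff)
    moreover have "x + t *\<^sub>R n i x \<notin> closure (P i)" using t0(2) t by blast
    ultimately have "x + t *\<^sub>R n i x \<notin> closure \<Omega>" unfolding closure_cover by blast
    then show False using \<open>x + t *\<^sub>R n i x \<in> \<Omega> - ?U\<close> closure_subset by blast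
  qed
  then obtain j where j: "j \<in> {1..N}" "j \<noteq> i" "x \<in> closure (P j)" by blast
  have "P j \<inter> closure (P i) = {}"
    using parts_disjoint[OF j(1) i j(2)] part(4)[OF j(1)] by (simp add: open_Int_closure_eq_empty)
  then have "x \<notin> P j" using x(1) not_in_frontier[OF part(4)[OF i]] by blast
  then have "x \<in> frontier (P j)" using j(3) not_in_frontier[OF part(4)[OF j(1)]] by blast
  then have "j \<in> {1..N} - {i} \<and> x \<in> interface \<Omega> P i j" using j x by (simp add: interface_def)
  moreover have "k = l" if k: "k \<in> {1..N} - {i}" "x \<in> frontier (P k)" and l: "l \<in> {1..N} - {i}" "x \<in> frontier (P l)" for k l
  proof (rule ccontr)
    assume "k \<noteq> l"
    have nk: "outward_unit_normal_at (P k) x (n k x)" and nl: "outward_unit_normal_at (P l) x (n l x)" using nP k l by auto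
    have "n k x = - n i x" "n l x = - n i x"
      using outward_normal_disjoint[OF ni nk parts_disjoint[OF i]] outward_normal_disjoint[OF ni nl parts_disjoint[OF i]] k l by auto
    then show False using outward_normals_disjoint_distinct[of "P k" x "- n i x" "P l"] nk nl parts_disjoint[of k l] k l \<open>k \<noteq> l\<close> by simp
  qed
  ultimately show ?thesis unfolding interface_def by blast
qed

lemma boundary_integral_parts:
  assumes q\<Omega>: "set_integrable surface_measure (frontier \<Omega>) (\<lambda>x. q x \<bullet> \<nu> x)"
    and qP: "\<And>i. i \<in> {1..N} \<Longrightarrow> set_integrable surface_measure (frontier (P i)) (\<lambda>x. q x \<bullet> n i x)"
  shows "(LINT x:frontier \<Omega>|surface_measure. q x \<bullet> \<nu> x) =
    (\<Sum>i\<in>{1..N}. LINT x:frontier (P i) \<inter> frontier \<Omega>|surface_measure. q x \<bullet> n i x)"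
proof -
  have "(LINT x:frontier \<Omega>|surface_measure. q x \<bullet> \<nu> x) =
      (\<Sum>i\<in>{1..N}. LINT x:frontier (P i) \<inter> frontier \<Omega>|surface_measure. q x \<bullet> \<nu> x)"
  proof (rule set_integral_finite_AE_partition[OF _ q\<Omega>])
    show "AE x in surface_measure. x \<in> frontier \<Omega> \<longrightarrow> (\<exists>!i. i \<in> {1..N} \<and> x \<in> frontier (P i) \<inter> frontier \<Omega>)"
      using AE_normals by eventually_elim (use unique_part_at_boundary in blast)
  qed auto
  also have "\<dots> = (\<Sum>i\<in>{1..N}. LINT x:frontier (P i) \<inter> frontier \<Omega>|surface_measure. q x \<bullet> n i x)"
  proof (rule sum.cong[OF refl])
    fix i assume i: "i \<in> {1..N}"
    let ?S = "frontier (P i) \<inter> frontier \<Omega>"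
    show "(LINT x:?S|surface_measure. q x \<bullet> \<nu> x) = (LINT x:?S|surface_measure. q x \<bullet> n i x)"
      unfolding set_lebesgue_integral_def
    proof (rule integral_cong_AE)
      show "AE x in surface_measure. indicator ?S x *\<^sub>R (q x \<bullet> \<nu> x) = indicator ?S x *\<^sub>R (q x \<bullet> n i x)"
        using AE_normals
      proof eventually_elim
        fix x assume nx: "(x \<in> frontier \<Omega> \<longrightarrow> outward_unit_normal_at \<Omega> x (\<nu> x)) \<and>
           (\<forall>i\<in>{1..N}. x \<in> frontier (P i) \<longrightarrow> outward_unit_normal_at (P i) x (n i x))"
        show "indicator ?S x *\<^sub>R (q x \<bullet> \<nu> x) = indicator ?S x *\<^sub>R (q x \<bullet> n i x)"
        proof (cases "x \<in> ?S")
          case True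
          then have "n i x = \<nu> x" using nx i part(1)[OF i] by (intro outward_normal_subset_eq[of "P i" x _ \<Omega>]) auto
          then show ?thesis by simp
        qed simp
      qed
      have "set_integrable surface_measure ?S (\<lambda>x. q x \<bullet> \<nu> x)" by (rule set_integrable_subset[OF q\<Omega>]) auto
      then show "(\<lambda>x. indicator ?S x *\<^sub>R (q x \<bullet> \<nu> x)) \<in> borel_measurable surface_measure"
        by (simp add: set_integrable_def borel_measurable_integrable)
      have "set_integrable surface_measure ?S (\<lambda>x. q x \<bullet> n i x)" by (rule set_integrable_subset[OF qP[OF i]]) auto
      then show "(\<lambda>x. indicator ?S x *\<^sub>R (q x \<bullet> n i x)) \<in> borel_measurable surface_measure"
        by (simp add: set_integrable_def borel_measurable_integrable)
    qed
  qed
  finally show ?thesis .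
qed

lemma interface_sets [measurable]: "interface \<Omega> P i j \<in> sets borel"
  unfolding interface_def using open_\<Omega> by (intro sets.Int frontier_sets) simp

text \<open>
  The index \<open>i\<close> itself serves as the index of the piece on the outer boundary.
\<close>

lemma part_boundary_integral:
  assumes i: "i \<in> {1..N}" and qP: "set_integrable surface_measure (frontier (P i)) (\<lambda>x. q x \<bullet> n i x)"
  shows "(LINT x:frontier (P i)|surface_measure. q x \<bullet> n i x) =
    (LINT x:frontier (P i) \<inter> frontier \<Omega>|surface_measure. q x \<bullet> n i x) +
    (\<Sum>j\<in>{1..N} - {i}. LINT x:interface \<Omega> P i j|surface_measure. q x \<bullet> n i x)"
proof -
  define S where "S j = (if j = i then frontier (P i) \<inter> frontier \<Omega> else interface \<Omega> P i j)" for j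
  have "(LINT x:frontier (P i)|surface_measure. q x \<bullet> n i x) = (\<Sum>j\<in>{1..N}. LINT x:S j|surface_measure. q x \<bullet> n i x)"
  proof (rule set_integral_finite_AE_partition[OF _ qP])
    show "AE x in surface_measure. x \<in> frontier (P i) \<longrightarrow> (\<exists>!j. j \<in> {1..N} \<and> x \<in> S j)"
      using AE_normals
    proof eventually_elim
      fix x assume nx: "(x \<in> frontier \<Omega> \<longrightarrow> outward_unit_normal_at \<Omega> x (\<nu> x)) \<and>
         (\<forall>i\<in>{1..N}. x \<in> frontier (P i) \<longrightarrow> outward_unit_normal_at (P i) x (n i x))"
      show "x \<in> frontier (P i) \<longrightarrow> (\<exists>!j. j \<in> {1..N} \<and> x \<in> S j)"
      proof
        assume x: "x \<in> frontier (P i)"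
        show "\<exists>!j. j \<in> {1..N} \<and> x \<in> S j"
        proof (cases "x \<in> \<Omega>")
          case True
          then have "x \<notin> frontier \<Omega>" using not_in_frontier[OF open_\<Omega>] by blast
          moreover have "\<exists>!j. j \<in> {1..N} - {i} \<and> x \<in> interface \<Omega> P i j"
            using unique_neighbour[OF i x True] nx by blast
          ultimately show ?thesis unfolding S_def by (auto split: if_splits)
        next
          case False
          have "x \<in> closure (P i)" using x by (simp add: frontier_def)
          then have "x \<in> closure \<Omega>" using closure_mono[OF part(1)[OF i]] by blast
          then have "x \<in> frontier \<Omega>" using False not_in_frontier[OF open_\<Omega>] by blast
          then have "j \<in> {1..N} \<and> x \<in> S j \<longleftrightarrow> j = i" for j
            using x i False by (auto simp: S_def interface_def)
          then show ?thesis by auto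
        qed
      qed
    qed
  qed (auto simp: S_def interface_def[of \<Omega> P i] intro: sets.Int simp del: interface_sets, (use interface_sets[unfolded interface_def] in auto)?)
  also have "\<dots> = (LINT x:S i|surface_measure. q x \<bullet> n i x) + (\<Sum>j\<in>{1..N} - {i}. LINT x:S j|surface_measure. q x \<bullet> n i x)"
    using i by (intro sum.remove) auto
  also have "(\<Sum>j\<in>{1..N} - {i}. LINT x:S j|surface_measure. q x \<bullet> n i x) =
      (\<Sum>j\<in>{1..N} - {i}. LINT x:interface \<Omega> P i j|surface_measure. q x \<bullet> n i x)"
    by (intro sum.cong refl) (auto simp: S_def)
  finally show ?thesis by (simp add: S_def)
qed

text \<open>
  Interfaces are symmetric in \<open>i\<close> and \<open>j\<close> and the normals are opposite, so the flux is antisymmetric.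
\<close>

lemma interface_exchange_cancels:
  assumes qP: "\<And>i. i \<in> {1..N} \<Longrightarrow> set_integrable surface_measure (frontier (P i)) (\<lambda>x. q x \<bullet> n i x)"
  shows "(\<Sum>i\<in>{1..N}. \<Sum>j\<in>{1..N} - {i}. LINT x:interface \<Omega> P i j|surface_measure. q x \<bullet> n i x) = 0"
proof -
  define a where "a i j = (if i = j then 0 else LINT x:interface \<Omega> P i j|surface_measure. q x \<bullet> n i x)" for i j
  have anti: "a i j = - a j i" if i: "i \<in> {1..N}" and j: "j \<in> {1..N}" for i j
  proof (cases "i = j")
    case False
    have sym: "interface \<Omega> P j i = interface \<Omega> P i j" by (auto simp: interface_def)
    let ?S = "interface \<Omega> P i j"
    have "(LINT x:?S|surface_measure. q x \<bullet> n i x) = (LINT x:?S|surface_measure. - (q x \<bullet> n j x))"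
      unfolding set_lebesgue_integral_def
    proof (rule integral_cong_AE)
      show "AE x in surface_measure. indicator ?S x *\<^sub>R (q x \<bullet> n i x) = indicator ?S x *\<^sub>R (- (q x \<bullet> n j x))"
        using AE_normals
      proof eventually_elim
        fix x assume nx: "(x \<in> frontier \<Omega> \<longrightarrow> outward_unit_normal_at \<Omega> x (\<nu> x)) \<and>
           (\<forall>i\<in>{1..N}. x \<in> frontier (P i) \<longrightarrow> outward_unit_normal_at (P i) x (n i x))"
        show "indicator ?S x *\<^sub>R (q x \<bullet> n i x) = indicator ?S x *\<^sub>R (- (q x \<bullet> n j x))"
        proof (cases "x \<in> ?S")
          case True
          then have "n j x = - n i x"
            using nx i j parts_disjoint[OF i j False] by (intro outward_normal_disjoint[of "P i" x _ "P j"]) (auto simp: interface_def)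
          then show ?thesis by simp
        qed simp
      qed
      have "set_integrable surface_measure ?S (\<lambda>x. q x \<bullet> n i x)"
        by (rule set_integrable_subset[OF qP[OF i]]) (use interface_sets in \<open>auto simp: interface_def\<close>)
      then show "(\<lambda>x. indicator ?S x *\<^sub>R (q x \<bullet> n i x)) \<in> borel_measurable surface_measure"
        by (simp add: set_integrable_def borel_measurable_integrable)
      have "set_integrable surface_measure ?S (\<lambda>x. q x \<bullet> n j x)"
        by (rule set_integrable_subset[OF qP[OF j]]) (use interface_sets in \<open>auto simp: interface_def\<close>)
      then have "(\<lambda>x. indicator ?S x *\<^sub>R (q x \<bullet> n j x)) \<in> borel_measurable surface_measure"
        by (simp add: set_integrable_def borel_measurable_integrable)
      then show "(\<lambda>x. indicator ?S x *\<^sub>R (- (q x \<bullet> n j x))) \<in> borel_measurable surface_measure" by simp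
    qed
    then show ?thesis using False by (simp add: a_def sym set_lebesgue_integral_def)
  qed (simp add: a_def)
  have "(\<Sum>i\<in>{1..N}. \<Sum>j\<in>{1..N}. a i j) = (\<Sum>i\<in>{1..N}. \<Sum>j\<in>{1..N}. a j i)" by (rule sum.swap)
  also have "\<dots> = (\<Sum>i\<in>{1..N}. \<Sum>j\<in>{1..N}. - a i j)" using anti by (intro sum.cong refl) blast
  also have "\<dots> = - (\<Sum>i\<in>{1..N}. \<Sum>j\<in>{1..N}. a i j)" by (simp add: sum_negf)
  finally have z: "(\<Sum>i\<in>{1..N}. \<Sum>j\<in>{1..N}. a i j) = 0" by simp
  have "(\<Sum>j\<in>{1..N}. a i j) = (\<Sum>j\<in>{1..N} - {i}. LINT x:interface \<Omega> P i j|surface_measure. q x \<bullet> n i x)" if i: "i \<in> {1..N}" for i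
  proof -
    have "(\<Sum>j\<in>{1..N}. a i j) = a i i + (\<Sum>j\<in>{1..N} - {i}. a i j)" using i by (intro sum.remove) auto
    then show ?thesis by (simp add: a_def)
  qed
  then show ?thesis using z by simp
qed

end

section \<open>The energy balance on a part\<close>

lemma grad_inner:
  assumes "(f has_derivative f') (at w)"
  shows "grad f w \<bullet> h = f' h"
proof -
  have lin: "linear f'" using assms by (rule has_derivative_linear)
  have fd: "frechet_derivative f (at w) = f'" using assms by (metis frechet_derivative_at)
  have "h = (\<Sum>k\<in>UNIV. (h $ k) *\<^sub>R axis k 1)" using basis_expansion[of h] by (simp add: scalar_mult_eq_scaleR)
  then have "f' h = f' (\<Sum>k\<in>UNIV. (h $ k) *\<^sub>R axis k 1)" by simp
  also have "\<dots> = (\<Sum>k\<in>UNIV. (h $ k) * f' (axis k 1))" by (simp add: linear_sum[OF lin] linear_cmul[OF lin])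
  finally show ?thesis by (simp add: grad_def inner_vec_def fd mult.commute)
qed

lemma mdiv_has_derivative:
  assumes "(J has_derivative J') (at x)"
  shows "mdiv J x = (\<chi> i. \<Sum>k\<in>UNIV. J' (axis k 1) $ i $ k)"
proof -
  have "((\<lambda>y. J y $ i) has_derivative (\<lambda>w. J' w $ i)) (at x)" for i
    using assms by (rule bounded_linear.has_derivative[OF bounded_linear_vec_nth])
  then have "frechet_derivative (\<lambda>y. J y $ i) (at x) = (\<lambda>w. J' w $ i)" for i by (metis frechet_derivative_at)
  then show ?thesis by (simp add: mdiv_def vdiv_def)
qed

lemma mdiv_C1:
  fixes J :: "real^'d \<Rightarrow> real^'d^'m"
  assumes "open \<Omega>" "bounded \<Omega>" "Ck_on 1 (closure \<Omega>) J"
  obtains M where "continuous_on (closure \<Omega>) M" "\<forall>x\<in>\<Omega>. mdiv J x = M x" "\<forall>x\<in>\<Omega>. J differentiable (at x)"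
proof -
  obtain J' B where J': "\<forall>x\<in>\<Omega>. (J has_derivative J' x) (at x)" "\<forall>v. continuous_on (closure \<Omega>) (\<lambda>x. J' x v)"
    "0 \<le> B" "\<forall>x\<in>\<Omega>. \<forall>w. norm (J' x w) \<le> B * norm w"
    by (rule C1_up_to_boundary[OF assms])
  show ?thesis
  proof (rule that[of "\<lambda>x. \<chi> i. \<Sum>k\<in>UNIV. J' x (axis k 1) $ i $ k"])
    show "continuous_on (closure \<Omega>) (\<lambda>x. \<chi> i. \<Sum>k\<in>UNIV. J' x (axis k 1) $ i $ k)"
      using J'(2) by (intro continuous_on_vec_lambda continuous_on_sum continuous_on_component) blast
    show "\<forall>x\<in>\<Omega>. mdiv J x = (\<chi> i. \<Sum>k\<in>UNIV. J' x (axis k 1) $ i $ k)"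
      using J'(1) mdiv_has_derivative by blast
    show "\<forall>x\<in>\<Omega>. J differentiable (at x)" using J'(1) by (auto simp: differentiable_def)
  qed
qed

lemma mdiv_add:
  assumes "J differentiable (at x)" "L differentiable (at x)"
  shows "mdiv (\<lambda>y. J y + L y) x = mdiv J x + mdiv L x"
proof -
  obtain J' L' where d: "(J has_derivative J') (at x)" "(L has_derivative L') (at x)"
    using assms by (auto simp: differentiable_def)
  show ?thesis
    unfolding mdiv_has_derivative[OF d(1)] mdiv_has_derivative[OF d(2)] mdiv_has_derivative[OF has_derivative_add[OF d]]
    by (simp add: vec_eq_iff sum.distrib)
qed

lemma set_integrable_continuous_extension:
  fixes f g :: "real^'d \<Rightarrow> real"
  assumes o: "open \<Omega>" and bd: "bounded \<Omega>" and g: "continuous_on (closure \<Omega>) g" and eq: "\<And>x. x \<in> \<Omega> \<Longrightarrow> f x = g x"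
  shows "set_integrable lebesgue \<Omega> f"
proof (rule integrable_lborel_imp_set_integrable_lebesgue)
  have "compact (g ` closure \<Omega>)" using bd g by (intro compact_continuous_image) (simp_all add: compact_closure)
  then obtain b where b: "\<forall>y\<in>g ` closure \<Omega>. norm y \<le> b" using compact_imp_bounded bounded_iff by blast
  obtain R where R: "\<Omega> \<subseteq> ball 0 R" using bounded_subset_ballD[OF bd, of 0] by blast
  have m: "(\<lambda>x. indicator \<Omega> x * g x) \<in> borel_measurable borel"
    using borel_measurable_continuous_on_indicator[of \<Omega> g] continuous_on_subset[OF g closure_subset] o by simp
  have "indicator \<Omega> x * f x = indicator \<Omega> x * g x" for x using eq by (simp add: indicator_def)
  moreover have "integrable lborel (\<lambda>x. indicator \<Omega> x * g x)"
  proof (rule integrable_bounded_support[where B="\<bar>b\<bar>" and R=R, OF m])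
    fix x :: "real^'d"
    show "\<bar>indicator \<Omega> x * g x\<bar> \<le> \<bar>b\<bar>"
      using b closure_subset[of \<Omega>] by (force simp: indicator_def)
    show "R < norm x \<Longrightarrow> indicator \<Omega> x * g x = 0" using R by (auto simp: indicator_def)
  qed
  ultimately show "integrable lborel (\<lambda>x. indicator \<Omega> x * f x)" by (simp only:)
qed

text \<open>
  The joint derivative of the storage density is a continuous function up to the boundary of the
  domain, which supplies the bounds for integration and for differentiation under the integral.
\<close>

lemma storage_density_gradient:
  fixes T :: "('d::finite, 'm::finite, 'ye::real_normed_vector, 'yf::real_normed_vector) thermo_system"
  assumes T: "open_thermodynamic_system T W"
  obtains m :: "real^'d \<Rightarrow> real^'m \<Rightarrow> real^'m" where
    "continuous_on (closure (Omega T) \<times> states T) (\<lambda>z. m (fst z) (snd z))"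
    "\<forall>x\<in>Omega T. \<forall>w\<in>states T. (psi T x has_derivative (\<lambda>h. m x w \<bullet> h)) (at w)"
    "\<forall>x\<in>Omega T. \<forall>w\<in>states T. grad (psi T x) w = m x w"
proof -
  let ?S = "closure (Omega T) \<times> states T"
  have o: "open (Omega T)" and oU: "open (states T)" and C2: "Ck_on (Suc 1) ?S (\<lambda>(x, w). psi T x w)"
    using T by (auto simp: open_thermodynamic_system_def bounded_lipschitz_domain_def numeral_2_eq_2)
  from C2[unfolded Ck_on.simps(2)[of 1]] obtain D where D: "\<forall>z\<in>interior ?S. ((\<lambda>(x, w). psi T x w) has_derivative D z) (at z)"
    "\<forall>v. Ck_on 1 ?S (\<lambda>z. D z v)"
    by (elim conjE exE)
  define m :: "real^'d \<Rightarrow> real^'m \<Rightarrow> real^'m" where "m x w = (\<chi> k. D (x, w) (0, axis k 1))" for x w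
  have der: "(psi T x has_derivative (\<lambda>h. D (x, w) (0, h))) (at w)" if "x \<in> Omega T" "w \<in> states T" for x w
  proof -
    have "(x, w) \<in> interior ?S"
      using that o oU by (auto simp: interior_Times interior_open intro: subsetD[OF interior_maximal[OF closure_subset o]])
    then have "((\<lambda>(x, w). psi T x w) has_derivative D (x, w)) (at (x, w))" using D(1) by blast
    moreover have "((\<lambda>w. (x, w)) has_derivative (\<lambda>h. (0, h))) (at w)"
      by (intro has_derivative_Pair has_derivative_const has_derivative_ident)
    ultimately show ?thesis using has_derivative_compose[of "\<lambda>w. (x, w)" "\<lambda>h. (0, h)" w UNIV "\<lambda>(x, w). psi T x w"] by simp
  qed
  have gr: "grad (psi T x) w = m x w" if "x \<in> Omega T" "w \<in> states T" for x w
  proof -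
    have "frechet_derivative (psi T x) (at w) = (\<lambda>h. D (x, w) (0, h))" using der[OF that] by (metis frechet_derivative_at)
    then show ?thesis by (simp add: grad_def m_def)
  qed
  show ?thesis
  proof (rule that[of m])
    have "continuous_on ?S (\<lambda>z. D z (0, axis k 1))" for k using D(2) Ck_on_continuous by blast
    then show "continuous_on ?S (\<lambda>z. m (fst z) (snd z))"
      unfolding m_def by (intro continuous_on_vec_lambda) simp
    show "\<forall>x\<in>Omega T. \<forall>w\<in>states T. grad (psi T x) w = m x w" using gr by blast
    show "\<forall>x\<in>Omega T. \<forall>w\<in>states T. (psi T x has_derivative (\<lambda>h. m x w \<bullet> h)) (at w)"
    proof (intro ballI)
      fix x w assume xw: "x \<in> Omega T" "w \<in> states T"
      have "(\<lambda>h. m x w \<bullet> h) = (\<lambda>h. D (x, w) (0, h))"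
        using grad_inner[OF der[OF xw]] gr[OF xw] by auto
      then show "(psi T x has_derivative (\<lambda>h. m x w \<bullet> h)) (at w)" using der[OF xw] by simp
    qed
  qed
qed

text \<open>
  A continuous function that vanishes almost everywhere on an open set vanishes on it; the end points
  of the time interval follow by continuity in time.
\<close>

lemma evolution_equation_everywhere:
  fixes g :: "real \<Rightarrow> real^'d \<Rightarrow> real^'m"
  assumes "0 < \<tau>" "open \<Omega>" and cont: "continuous_on ({0..\<tau>} \<times> \<Omega>) (\<lambda>(t, x). g t x)"
    and AE: "AE (t, x) in (lebesgue :: (real \<times> (real^'d)) measure). t \<in> {0<..<\<tau>} \<and> x \<in> \<Omega> \<longrightarrow> g t x = 0"
    and t: "t \<in> {0..\<tau>}" and x: "x \<in> \<Omega>"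
  shows "g t x = 0"
proof -
  let ?V = "{0<..<\<tau>} \<times> \<Omega>"
  have oV: "open ?V" using assms(2) by (intro open_Times) auto
  have cV: "continuous_on ?V (\<lambda>(t, x). g t x)" by (rule continuous_on_subset[OF cont]) auto
  define Z where "Z = ?V \<inter> (\<lambda>(t, x). g t x) -` (- {0})"
  have oZ: "open Z" unfolding Z_def by (rule continuous_open_preimage[OF cV oV]) auto
  have "AE z\<in>Z in lebesgue. z \<in> {}"
    using AE by eventually_elim (auto simp: Z_def)
  then have Z0: "Z = {}" using mem_closed_if_AE_lebesgue_open[OF oZ closed_empty] by blast
  have in0: "g s x = 0" if "s \<in> {0<..<\<tau>}" for s
  proof (rule ccontr)
    assume "g s x \<noteq> 0"
    then have "(s, x) \<in> Z" using that x by (simp add: Z_def)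
    then show False using Z0 by blast
  qed
  have cl: "closure {0<..<\<tau>} = {0..\<tau>}" using \<open>0 < \<tau>\<close> by simp
  have "continuous_on {0..\<tau>} (\<lambda>s. g s x)"
  proof -
    have "continuous_on {0..\<tau>} ((\<lambda>(t, x). g t x) \<circ> (\<lambda>s. (s, x)))"
      using x by (intro continuous_on_compose continuous_intros continuous_on_subset[OF cont]) auto
    then show ?thesis by (simp add: o_def)
  qed
  then show ?thesis
    using continuous_constant_on_closure[of "{0<..<\<tau>}" "\<lambda>s. g s x" 0 t] in0 t unfolding cl by blast
qed

text \<open>
  The integrand is Lipschitz in time with the constant \<open>C\<close>, the maximum of \<open>\<bar>\<mu> \<bullet> \<partial>\<^sub>t u\<bar>\<close> on the compact set
  \<open>[0, \<tau>] \<times> closure \<Omega>\<close>, which dominates the difference quotients.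
\<close>

lemma free_energy_on_derivative:
  fixes T :: "('d::finite, 'm::finite, 'ye::real_normed_vector, 'yf::real_normed_vector) thermo_system"
    and u' :: "real \<Rightarrow> real^'d \<Rightarrow> real^'m"
  assumes T: "open_thermodynamic_system T W"
    and sf: "\<forall>t\<in>{0..\<tau>}. smooth_field T W (u t)"
    and cu: "continuous_on ({0..\<tau>} \<times> closure (Omega T)) (\<lambda>(t, x). u t x)"
    and cu': "continuous_on ({0..\<tau>} \<times> closure (Omega T)) (\<lambda>(t, x). u' t x)"
    and du: "\<forall>t\<in>{0..\<tau>}. \<forall>x\<in>closure (Omega T). ((\<lambda>s. u s x) has_vector_derivative u' t x) (at t within {0..\<tau>})"
    and A: "open A" "A \<subseteq> Omega T" and t: "t \<in> {0..\<tau>}"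
  shows "((\<lambda>s. free_energy_on T A (u s)) has_real_derivative
     (LINT x:A|lebesgue. potential T (u t) x \<bullet> u' t x)) (at t within {0..\<tau>})"
proof -
  let ?\<Omega> = "Omega T"
  have bd: "bounded ?\<Omega>" using T by (auto simp: open_thermodynamic_system_def bounded_lipschitz_domain_def)
  obtain m :: "real^'d \<Rightarrow> real^'m \<Rightarrow> real^'m" where m: "continuous_on (closure ?\<Omega> \<times> states T) (\<lambda>z. m (fst z) (snd z))"
    "\<forall>x\<in>?\<Omega>. \<forall>w\<in>states T. (psi T x has_derivative (\<lambda>h. m x w \<bullet> h)) (at w)"
    "\<forall>x\<in>?\<Omega>. \<forall>w\<in>states T. grad (psi T x) w = m x w"
    by (rule storage_density_gradient[OF T])
  have uU: "u s x \<in> states T" if "s \<in> {0..\<tau>}" "x \<in> closure ?\<Omega>" for s x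
  proof -
    have "u s ` closure ?\<Omega> \<subseteq> states T" using sf that(1) unfolding smooth_field_def by blast
    then show ?thesis using that(2) by blast
  qed
  have \<Omega>cl: "x \<in> closure ?\<Omega>" if "x \<in> ?\<Omega>" for x using that closure_subset by blast
  define p where "p s x = m x (u s x) \<bullet> u' s x" for s x
  have cont_p: "continuous_on ({0..\<tau>} \<times> closure ?\<Omega>) (\<lambda>z. p (fst z) (snd z))"
  proof -
    have c1: "continuous_on ({0..\<tau>} \<times> closure ?\<Omega>) (\<lambda>z. (snd z, u (fst z) (snd z)))"
      using cu by (intro continuous_on_Pair continuous_intros) (simp add: split_beta')
    have "continuous_on ({0..\<tau>} \<times> closure ?\<Omega>) (\<lambda>z. m (snd z) (u (fst z) (snd z)))"
    proof -
      have "(\<lambda>z. (snd z, u (fst z) (snd z))) ` ({0..\<tau>} \<times> closure ?\<Omega>) \<subseteq> closure ?\<Omega> \<times> states T"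
        using uU by (intro image_subsetI) (simp add: mem_Times_iff)
      from continuous_on_compose2[OF m(1) c1 this] show ?thesis by simp
    qed
    then show ?thesis
      unfolding p_def using cu' by (intro continuous_on_inner) (simp_all add: split_beta')
  qed
  have "compact ((\<lambda>z. p (fst z) (snd z)) ` ({0..\<tau>} \<times> closure ?\<Omega>))"
    using bd by (intro compact_continuous_image cont_p compact_Times) (auto simp: compact_closure)
  then obtain b where b: "\<forall>y\<in>(\<lambda>z. p (fst z) (snd z)) ` ({0..\<tau>} \<times> closure ?\<Omega>). norm y \<le> b"
    using compact_imp_bounded bounded_iff by blast
  define C where "C = \<bar>b\<bar>"
  have pC: "\<bar>p s x\<bar> \<le> C" if "s \<in> {0..\<tau>}" "x \<in> ?\<Omega>" for s x
    using b that \<Omega>cl by (force simp: C_def)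
  have dpsi: "((\<lambda>s. psi T x (u s x)) has_derivative (\<lambda>h. h * p s x)) (at s within {0..\<tau>})"
    if s: "s \<in> {0..\<tau>}" and x: "x \<in> ?\<Omega>" for s x
  proof -
    have "((\<lambda>s. u s x) has_derivative (\<lambda>h. h *\<^sub>R u' s x)) (at s within {0..\<tau>})"
      using du s \<Omega>cl[OF x] by (simp add: has_vector_derivative_def)
    moreover have "(psi T x has_derivative (\<lambda>h. m x (u s x) \<bullet> h)) (at (u s x))"
      using m(2) x uU[OF s \<Omega>cl[OF x]] by blast
    ultimately have "((\<lambda>s. psi T x (u s x)) has_derivative (\<lambda>h. m x (u s x) \<bullet> (h *\<^sub>R u' s x))) (at s within {0..\<tau>})"
      by (rule has_derivative_compose)
    then show ?thesis by (simp add: p_def)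
  qed
  have lip: "\<bar>psi T x (u s x) - psi T x (u t x)\<bar> \<le> C * \<bar>s - t\<bar>" if s: "s \<in> {0..\<tau>}" and x: "x \<in> ?\<Omega>" for s x
  proof -
    have "norm (psi T x (u s x) - psi T x (u t x)) \<le> C * norm (s - t)"
    proof (rule differentiable_bound[of "{0..\<tau>}" "\<lambda>s. psi T x (u s x)" "\<lambda>s h. h * p s x"])
      fix r assume r: "r \<in> {0..\<tau>}"
      show "((\<lambda>s. psi T x (u s x)) has_derivative (\<lambda>h. h * p r x)) (at r within {0..\<tau>})" by (rule dpsi[OF r x])
      show "onorm (\<lambda>h. h * p r x) \<le> C"
        using pC[OF r x] mult_right_mono[of "\<bar>p r x\<bar>" C "\<bar>_\<bar>"]
        by (intro onorm_bound) (auto simp: C_def abs_mult mult.commute)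
    qed (use s t in auto)
    then show ?thesis by simp
  qed
  have psi_int: "integrable lebesgue (\<lambda>x. indicator A x * psi T x (u s x))" if "s \<in> {0..\<tau>}" for s
  proof -
    have "set_integrable lebesgue ?\<Omega> (\<lambda>x. psi T x (u s x))"
      using sf that by (auto simp: smooth_field_def field_space_def)
    then have "set_integrable lebesgue A (\<lambda>x. psi T x (u s x))"
      by (rule set_integrable_subset) (use A in \<open>auto simp: borel_open\<close>)
    then show ?thesis by (simp add: set_integrable_def)
  qed
  have fin: "emeasure lebesgue A < \<infinity>"
  proof -
    have "bounded A" using bd A(2) bounded_subset by blast
    then show ?thesis using emeasure_bounded_finite[of A] A(1) by simp
  qed
  have "((\<lambda>s. (free_energy_on T A (u s) - free_energy_on T A (u t)) / (s - t)) \<longlongrightarrow>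
      (LINT x:A|lebesgue. potential T (u t) x \<bullet> u' t x)) (at t within {0..\<tau>})"
    unfolding tendsto_at_iff_sequentially
  proof (intro allI impI)
    fix X assume X: "\<forall>i. X i \<in> {0..\<tau>} - {t}" "X \<longlonglongrightarrow> t"
    have XI: "X j \<in> {0..\<tau>}" "X j \<noteq> t" for j using X(1) by auto
    define s where "s j x = (indicator A x * psi T x (u (X j) x) - indicator A x * psi T x (u t x)) / (X j - t)" for j x
    have si: "integrable lebesgue (s j)" for j
      unfolding s_def[abs_def] using psi_int[OF XI(1)] psi_int[OF t] by (intro integrable_divide Bochner_Integration.integrable_diff) auto
    have "(\<lambda>j. \<integral>x. s j x \<partial>lebesgue) \<longlonglongrightarrow> (\<integral>x. indicator A x * p t x \<partial>lebesgue)"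
    proof (rule integral_dominated_convergence[where w="\<lambda>x. C * indicator A x"])
      show "integrable lebesgue (\<lambda>x. C * indicator A x)"
        using fin A(1) by (intro integrable_mult_right integrable_real_indicator) (auto simp: borel_open)
      have lim: "(\<lambda>j. s j x) \<longlonglongrightarrow> indicator A x * p t x" for x
      proof (cases "x \<in> A")
        case True
        then have x: "x \<in> ?\<Omega>" using A(2) by blast
        have "((\<lambda>s. psi T x (u s x)) has_field_derivative p t x) (at t within {0..\<tau>})"
          using dpsi[OF t x] by (simp add: has_field_derivative_def mult_commute_abs)
        then have "((\<lambda>s. (psi T x (u s x) - psi T x (u t x)) / (s - t)) \<longlongrightarrow> p t x) (at t within {0..\<tau>})"
          by (simp add: has_field_derivative_iff)
        then have "((\<lambda>s. (psi T x (u s x) - psi T x (u t x)) / (s - t)) \<circ> X) \<longlonglongrightarrow> p t x"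
          using X unfolding tendsto_at_iff_sequentially by blast
        then show ?thesis using True by (simp add: s_def o_def)
      qed (simp add: s_def)
      then show "AE x in lebesgue. (\<lambda>j. s j x) \<longlonglongrightarrow> indicator A x * p t x" by simp
      show "(\<lambda>x. indicator A x * p t x) \<in> borel_measurable lebesgue"
        by (rule borel_measurable_LIMSEQ_real[where u=s]) (use lim si in \<open>auto intro: borel_measurable_integrable\<close>)
      show "s j \<in> borel_measurable lebesgue" for j using si by (rule borel_measurable_integrable)
      show "AE x in lebesgue. norm (s j x) \<le> C * indicator A x" for j
      proof (rule AE_I2)
        fix x
        show "norm (s j x) \<le> C * indicator A x"
        proof (cases "x \<in> A")
          case True
          then have "\<bar>psi T x (u (X j) x) - psi T x (u t x)\<bar> \<le> C * \<bar>X j - t\<bar>" using lip XI A(2) by blast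
          then show ?thesis using True XI(2)[of j] by (simp add: s_def divide_le_eq)
        qed (simp add: s_def)
      qed
    qed
    moreover have "(\<integral>x. s j x \<partial>lebesgue) = (free_energy_on T A (u (X j)) - free_energy_on T A (u t)) / (X j - t)" for j
      unfolding s_def free_energy_on_def set_lebesgue_integral_def
      using Bochner_Integration.integral_diff[OF psi_int[OF XI(1)] psi_int[OF t]] by simp
    moreover have "(\<integral>x. indicator A x * p t x \<partial>lebesgue) = (LINT x:A|lebesgue. potential T (u t) x \<bullet> u' t x)"
      unfolding set_lebesgue_integral_def
    proof (rule Bochner_Integration.integral_cong[OF refl])
      fix x show "indicator A x * p t x = indicator A x *\<^sub>R (potential T (u t) x \<bullet> u' t x)"
      proof (cases "x \<in> A")
        case True
        then have "grad (psi T x) (u t x) = m x (u t x)" using m(3) A(2) uU[OF t] \<Omega>cl by blast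
        then show ?thesis by (simp add: p_def potential_def)
      qed simp
    qed
    ultimately show "((\<lambda>s. (free_energy_on T A (u s) - free_energy_on T A (u t)) / (s - t)) \<circ> X) \<longlonglongrightarrow>
        (LINT x:A|lebesgue. potential T (u t) x \<bullet> u' t x)"
      by (simp add: o_def)
  qed
  then show ?thesis by (simp add: has_field_derivative_iff)
qed

text \<open>
  The conditions on \<open>Jrev\<close> and \<open>Jdiss\<close> say that \<open>\<mu> \<bullet> div Jrev\<close> and \<open>\<mu> \<bullet> div Jdiss - \<sigma>\<close> are the divergences of
  \<open>qrev\<close> and \<open>qdiss\<close>, so their integrals over \<open>A\<close> are fluxes through the frontier of \<open>A\<close>.
\<close>

lemma local_power_identity:
  fixes T :: "('d::finite, 'm::finite, 'ye::real_normed_vector, 'yf::real_normed_vector) thermo_system"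
  assumes T: "open_thermodynamic_system T W" and v: "smooth_field T W v"
    and A: "bounded_lipschitz_domain A" "A \<subseteq> Omega T" and n: "outward_unit_normal A n"
  shows "(LINT x:A|lebesgue. potential T v x \<bullet> mdiv (\<lambda>y. Jrev T v y + Jdiss T v y) x) =
      dissipation_on W A v + (LINT x:frontier A|surface_measure. qtot W v x \<bullet> n x)"
    and "set_integrable lebesgue (Omega T) (\<lambda>x. potential T v x \<bullet> mdiv (\<lambda>y. Jrev T v y + Jdiss T v y) x)"
    and "set_integrable surface_measure (frontier A) (\<lambda>x. qtot W v x \<bullet> n x)"
proof -
  let ?\<Omega> = "Omega T"
  have \<Omega>: "bounded_lipschitz_domain ?\<Omega>" and nu: "outward_unit_normal ?\<Omega> (normal T)" and adm: "thermodynamically_admissible T W"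
    using T by (auto simp: open_thermodynamic_system_def)
  have o: "open ?\<Omega>" and bd: "bounded ?\<Omega>" using \<Omega> by (auto simp: bounded_lipschitz_domain_def)
  have oA: "open A" using A by (simp add: bounded_lipschitz_domain_def)
  have Am: "A \<in> sets lebesgue" using oA by (simp add: borel_open)
  have C1: "Ck_on 1 (closure ?\<Omega>) v" "Ck_on 1 (closure ?\<Omega>) (Jrev T v)" "Ck_on 1 (closure ?\<Omega>) (Jdiss T v)"
    "Ck_on 1 (closure ?\<Omega>) (qrev W v)" "Ck_on 1 (closure ?\<Omega>) (qdiss W v)"
    and vX: "v \<in> field_space T" and vU: "v ` closure ?\<Omega> \<subseteq> states T"
    using v by (auto simp only: smooth_field_def)
  obtain m :: "real^'d \<Rightarrow> real^'m \<Rightarrow> real^'m" where m: "continuous_on (closure ?\<Omega> \<times> states T) (\<lambda>z. m (fst z) (snd z))"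
    "\<forall>x\<in>?\<Omega>. \<forall>w\<in>states T. (psi T x has_derivative (\<lambda>h. m x w \<bullet> h)) (at w)"
    "\<forall>x\<in>?\<Omega>. \<forall>w\<in>states T. grad (psi T x) w = m x w"
    by (rule storage_density_gradient[OF T])
  have c\<mu>: "continuous_on (closure ?\<Omega>) (\<lambda>x. m x (v x))"
  proof -
    have "continuous_on (closure ?\<Omega>) (\<lambda>x. (x, v x))"
      by (intro continuous_on_Pair continuous_on_id Ck_on_continuous[OF C1(1)])
    moreover have "(\<lambda>x. (x, v x)) ` closure ?\<Omega> \<subseteq> closure ?\<Omega> \<times> states T" using vU by auto
    ultimately show ?thesis using continuous_on_compose2[OF m(1)] by fastforce
  qed
  have \<mu>: "potential T v x = m x (v x)" if "x \<in> ?\<Omega>" for x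
  proof -
    have "x \<in> closure ?\<Omega>" using that closure_subset by blast
    then have "v x \<in> states T" using vU by blast
    then show ?thesis using m(3) that by (simp add: potential_def)
  qed
  obtain Mr where Mr: "continuous_on (closure ?\<Omega>) Mr" "\<forall>x\<in>?\<Omega>. mdiv (Jrev T v) x = Mr x" "\<forall>x\<in>?\<Omega>. Jrev T v differentiable (at x)"
    by (rule mdiv_C1[OF o bd C1(2)])
  obtain Md where Md: "continuous_on (closure ?\<Omega>) Md" "\<forall>x\<in>?\<Omega>. mdiv (Jdiss T v) x = Md x" "\<forall>x\<in>?\<Omega>. Jdiss T v differentiable (at x)"
    by (rule mdiv_C1[OF o bd C1(3)])
  let ?pr = "\<lambda>x. potential T v x \<bullet> mdiv (Jrev T v) x"
  let ?pd = "\<lambda>x. potential T v x \<bullet> mdiv (Jdiss T v) x"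
  have ir: "set_integrable lebesgue ?\<Omega> ?pr"
    by (rule set_integrable_continuous_extension[OF o bd continuous_on_inner[OF c\<mu> Mr(1)]]) (use \<mu> Mr(2) in simp)
  have id: "set_integrable lebesgue ?\<Omega> ?pd"
    by (rule set_integrable_continuous_extension[OF o bd continuous_on_inner[OF c\<mu> Md(1)]]) (use \<mu> Md(2) in simp)
  have i\<sigma>: "set_integrable lebesgue ?\<Omega> (sigma W v)"
    using adm vX by (simp add: thermodynamically_admissible_def L1_valued_map_def)
  have split: "potential T v x \<bullet> mdiv (\<lambda>y. Jrev T v y + Jdiss T v y) x = ?pr x + ?pd x" if "x \<in> ?\<Omega>" for x
    using mdiv_add[of "Jrev T v" x "Jdiss T v"] Mr(3) Md(3) that by (simp add: inner_add_right)
  have isum: "set_integrable lebesgue ?\<Omega> (\<lambda>x. ?pr x + ?pd x)" using set_integral_add(1)[OF ir id] .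
  show "set_integrable lebesgue ?\<Omega> (\<lambda>x. potential T v x \<bullet> mdiv (\<lambda>y. Jrev T v y + Jdiss T v y) x)"
  proof -
    have "indicator ?\<Omega> x *\<^sub>R (potential T v x \<bullet> mdiv (\<lambda>y. Jrev T v y + Jdiss T v y) x) = indicator ?\<Omega> x *\<^sub>R (?pr x + ?pd x)" for x
      using split[of x] by (cases "x \<in> ?\<Omega>") auto
    then show ?thesis using isum unfolding set_integrable_def by (simp only:)
  qed
  have w1: "(LINT x:?\<Omega>|lebesgue. ?pr x * \<phi> x) = - (LINT x:?\<Omega>|lebesgue. qrev W v x \<bullet> grad \<phi> x)"
    and w2: "(LINT x:?\<Omega>|lebesgue. ?pd x * \<phi> x) = - (LINT x:?\<Omega>|lebesgue. qdiss W v x \<bullet> grad \<phi> x) + (LINT x:?\<Omega>|lebesgue. sigma W v x * \<phi> x)"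
    if "\<phi> \<in> test_functions ?\<Omega>" for \<phi>
    using adm v that unfolding thermodynamically_admissible_def by blast+
  have dqr: "derivative_bounded_on ?\<Omega> (\<lambda>x. qrev W v x $ k) (\<lambda>x w. frechet_derivative (qrev W v) (at x) w $ k)"
    and dqd: "derivative_bounded_on ?\<Omega> (\<lambda>x. qdiss W v x $ k) (\<lambda>x w. frechet_derivative (qdiss W v) (at x) w $ k)" for k
    by (rule C1_component[OF o bd C1(4)], rule C1_component[OF o bd C1(5)])
  note dqrA = derivative_bounded_on_subset[OF dqr A(2)]
  note dqdA = derivative_bounded_on_subset[OF dqd A(2)]
  have 1: "(LINT x:A|lebesgue. ?pr x) = (LINT x:A|lebesgue. vdiv (qrev W v) x)"
    by (rule weak_divergence_integral[OF \<Omega> nu dqr ir w1 oA A(2)])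
  have bounded_test: "set_integrable lebesgue ?\<Omega> (\<lambda>x. f x * \<phi> x)"
    if f: "set_integrable lebesgue ?\<Omega> f" and \<phi>: "\<phi> \<in> test_functions ?\<Omega>" for f \<phi> :: "real^'d \<Rightarrow> real"
  proof -
    have "Ck_on 0 UNIV \<phi>" using \<phi> unfolding test_functions_def by blast
    then have c: "continuous_on UNIV \<phi>" by simp
    then have "compact (\<phi> ` closure ?\<Omega>)" using bd by (intro compact_continuous_image) (auto simp: compact_closure intro: continuous_on_subset)
    then obtain b where b: "\<forall>y\<in>\<phi> ` closure ?\<Omega>. norm y \<le> b" using compact_imp_bounded bounded_iff by blast
    have "\<phi> \<in> borel_measurable borel" using c by (rule borel_measurable_continuous_onI)
    then have \<phi>m: "\<phi> \<in> borel_measurable lebesgue" by (intro measurable_completion) simp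
    have fi: "integrable lebesgue (\<lambda>x. indicator ?\<Omega> x * f x)" using f by (simp add: set_integrable_def)
    have "integrable lebesgue (\<lambda>x. (indicator ?\<Omega> x * f x) * \<phi> x)"
    proof (rule Bochner_Integration.integrable_bound)
      show "integrable lebesgue (\<lambda>x. \<bar>b\<bar> * (indicator ?\<Omega> x * f x))" using fi by (rule integrable_mult_right)
      show "(\<lambda>x. (indicator ?\<Omega> x * f x) * \<phi> x) \<in> borel_measurable lebesgue"
        by (rule borel_measurable_times[OF borel_measurable_integrable[OF fi] \<phi>m])
      show "AE x in lebesgue. norm ((indicator ?\<Omega> x * f x) * \<phi> x) \<le> norm (\<bar>b\<bar> * (indicator ?\<Omega> x * f x))"
      proof (rule AE_I2)
        fix x
        show "norm ((indicator ?\<Omega> x * f x) * \<phi> x) \<le> norm (\<bar>b\<bar> * (indicator ?\<Omega> x * f x))"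
        proof (cases "x \<in> ?\<Omega>")
          case True
          then have "\<bar>\<phi> x\<bar> \<le> \<bar>b\<bar>" using b closure_subset[of ?\<Omega>] by force
          then have "\<bar>f x\<bar> * \<bar>\<phi> x\<bar> \<le> \<bar>f x\<bar> * \<bar>b\<bar>" by (rule mult_left_mono) simp
          then show ?thesis using True by (simp add: abs_mult mult.commute)
        qed simp
      qed
    qed
    then show ?thesis by (simp add: set_integrable_def mult.assoc)
  qed
  have 2: "(LINT x:A|lebesgue. ?pd x - sigma W v x) = (LINT x:A|lebesgue. vdiv (qdiss W v) x)"
  proof (rule weak_divergence_integral[OF \<Omega> nu dqd set_integral_diff(1)[OF id i\<sigma>] _ oA A(2)])
    fix \<phi> assume \<phi>: "\<phi> \<in> test_functions ?\<Omega>"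
    have "(LINT x:?\<Omega>|lebesgue. (?pd x - sigma W v x) * \<phi> x) = (LINT x:?\<Omega>|lebesgue. ?pd x * \<phi> x) - (LINT x:?\<Omega>|lebesgue. sigma W v x * \<phi> x)"
      using set_integral_diff(2)[OF bounded_test[OF id \<phi>] bounded_test[OF i\<sigma> \<phi>]] by (simp add: left_diff_distrib)
    then show "(LINT x:?\<Omega>|lebesgue. (?pd x - sigma W v x) * \<phi> x) = - (LINT x:?\<Omega>|lebesgue. qdiss W v x \<bullet> grad \<phi> x)"
      using w2[OF \<phi>] by simp
  qed
  note dr = divergence_theorem_vector[OF A(1) n dqrA]
  note dd = divergence_theorem_vector[OF A(1) n dqdA]
  have qadd: "qtot W v x \<bullet> n x = qrev W v x \<bullet> n x + qdiss W v x \<bullet> n x" for x by (simp add: qtot_def inner_add_left)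
  show "set_integrable surface_measure (frontier A) (\<lambda>x. qtot W v x \<bullet> n x)"
    unfolding qadd by (rule set_integral_add(1)[OF dr(3) dd(3)])
  have sA: "set_integrable lebesgue A f" if "set_integrable lebesgue ?\<Omega> f" for f :: "real^'d \<Rightarrow> real"
    using set_integrable_subset[OF that Am A(2)] .
  have "(LINT x:A|lebesgue. potential T v x \<bullet> mdiv (\<lambda>y. Jrev T v y + Jdiss T v y) x) = (LINT x:A|lebesgue. ?pr x + ?pd x)"
    by (rule set_lebesgue_integral_cong[OF Am]) (use split A(2) in blast)
  also have "\<dots> = (LINT x:A|lebesgue. ?pr x) + (LINT x:A|lebesgue. ?pd x)"
    by (rule set_integral_add(2)[OF sA[OF ir] sA[OF id]])
  also have "(LINT x:A|lebesgue. ?pd x) = (LINT x:A|lebesgue. ?pd x - sigma W v x) + (LINT x:A|lebesgue. sigma W v x)"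
    using set_integral_diff(2)[OF sA[OF id] sA[OF i\<sigma>]] by simp
  also have "(LINT x:A|lebesgue. ?pr x) + ((LINT x:A|lebesgue. ?pd x - sigma W v x) + (LINT x:A|lebesgue. sigma W v x)) =
      dissipation_on W A v + ((LINT x:frontier A|surface_measure. qrev W v x \<bullet> n x) + (LINT x:frontier A|surface_measure. qdiss W v x \<bullet> n x))"
    unfolding 1 2 dr(1) dd(1) dissipation_on_def by simp
  also have "(LINT x:frontier A|surface_measure. qrev W v x \<bullet> n x) + (LINT x:frontier A|surface_measure. qdiss W v x \<bullet> n x) =
      (LINT x:frontier A|surface_measure. qtot W v x \<bullet> n x)"
    unfolding qadd by (rule set_integral_add(2)[OF dr(3) dd(3), symmetric])
  finally show "(LINT x:A|lebesgue. potential T v x \<bullet> mdiv (\<lambda>y. Jrev T v y + Jdiss T v y) x) =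
      dissipation_on W A v + (LINT x:frontier A|surface_measure. qtot W v x \<bullet> n x)" .
qed

theorem theorem4p9:
  fixes T :: "('d::finite, 'm::finite, 'ye::real_normed_vector, 'yf::real_normed_vector) thermo_system"
    and W :: "('d, 'm) thermo_witness"
    and \<tau> :: real
    and u :: "real \<Rightarrow> real^'d \<Rightarrow> real^'m"
    and N :: nat
    and P :: "nat \<Rightarrow> (real^'d) set"
    and n :: "nat \<Rightarrow> real^'d \<Rightarrow> real^'d"
  assumes "open_thermodynamic_system T W"
    and "thermodynamically_consistent T W"
    and "smooth_admissible_trajectory T W \<tau> u"
    and "compatible_partition (Omega T) N P n"
  shows "\<forall>t\<in>{0..\<tau>}.
     free_energy T (u t) = (\<Sum>i=1..N. free_energy_on T (P i) (u t)) \<and>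
     dissipation T W (u t) = (\<Sum>i=1..N. dissipation_on W (P i) (u t)) \<and>
     source T (u t) = (\<Sum>i=1..N. source_on T (P i) (u t)) \<and>
     boundary_exchange T (u t) = (\<Sum>i=1..N. exchange_ext T W P n i (u t)) \<and>
     (\<forall>i\<in>{1..N}. ((\<lambda>s. free_energy_on T (P i) (u s)) has_real_derivative
        local_rate T W N P n i (u t)) (at t within {0..\<tau>})) \<and>
     ((\<lambda>s. \<Sum>i=1..N. free_energy_on T (P i) (u s)) has_real_derivative
        (\<Sum>i=1..N. local_rate T W N P n i (u t))) (at t within {0..\<tau>}) \<and>
     (\<Sum>i=1..N. local_rate T W N P n i (u t)) =
        - dissipation T W (u t) + boundary_exchange T (u t) + source T (u t) \<and>
     ((\<lambda>s. free_energy T (u s)) has_real_derivative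
        - dissipation T W (u t) + boundary_exchange T (u t) + source T (u t)) (at t within {0..\<tau>})"
proof (intro ballI)
  fix t assume t: "t \<in> {0..\<tau>}"
  note T = assms(1) and cons = assms(2) and traj = assms(3)
  let ?\<Omega> = "Omega T"
  have \<Omega>: "bounded_lipschitz_domain ?\<Omega>" and nu: "outward_unit_normal ?\<Omega> (normal T)" and adm: "thermodynamically_admissible T W"
    using T by (auto simp: open_thermodynamic_system_def)
  have o: "open ?\<Omega>" using \<Omega> by (simp add: bounded_lipschitz_domain_def)
  interpret partitioned_domain ?\<Omega> "normal T" N P n
    using \<Omega> nu assms(4) by unfold_locales
  have sf: "\<forall>t\<in>{0..\<tau>}. smooth_field T W (u t)" and \<tau>: "0 < \<tau>"
    and cu: "continuous_on ({0..\<tau>} \<times> closure ?\<Omega>) (\<lambda>(t, x). u t x)"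
    and cJ: "continuous_on ({0..\<tau>} \<times> ?\<Omega>) (\<lambda>(t, x). mdiv (\<lambda>y. Jrev T (u t) y + Jdiss T (u t) y) x)"
    and cR: "continuous_on ({0..\<tau>} \<times> ?\<Omega>) (\<lambda>(t, x). Rsrc T (u t) x)"
    using traj by (auto simp only: smooth_admissible_trajectory_def)
  obtain u' where cu': "continuous_on ({0..\<tau>} \<times> closure ?\<Omega>) (\<lambda>(t, x). u' t x)"
    and du: "\<forall>t\<in>{0..\<tau>}. \<forall>x\<in>closure ?\<Omega>. ((\<lambda>s. u s x) has_vector_derivative u' t x) (at t within {0..\<tau>})"
    and pde: "AE (t, x) in (lebesgue :: (real \<times> (real^'d)) measure). t \<in> {0<..<\<tau>} \<and> x \<in> ?\<Omega> \<longrightarrow>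
           u' t x + mdiv (\<lambda>y. Jrev T (u t) y + Jdiss T (u t) y) x = Rsrc T (u t) x"
    using traj unfolding smooth_admissible_trajectory_def by (elim conjE exE) (rule that)
  have v: "smooth_field T W (u t)" using sf t by blast
  then have vX: "u t \<in> field_space T" by (simp add: smooth_field_def)
  let ?div = "\<lambda>x. mdiv (\<lambda>y. Jrev T (u t) y + Jdiss T (u t) y) x"
  have ev: "u' t x = Rsrc T (u t) x - ?div x" if x: "x \<in> ?\<Omega>" for x
  proof -
    have "u' t x + ?div x - Rsrc T (u t) x = 0"
    proof (rule evolution_equation_everywhere[where g="\<lambda>t x. u' t x + mdiv (\<lambda>y. Jrev T (u t) y + Jdiss T (u t) y) x - Rsrc T (u t) x", OF \<tau> o _ _ t x])
      have "continuous_on ({0..\<tau>} \<times> ?\<Omega>) (\<lambda>(t, x). u' t x)"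
        by (rule continuous_on_subset[OF cu']) (use closure_subset in auto)
      then show "continuous_on ({0..\<tau>} \<times> ?\<Omega>) (\<lambda>(t, x). u' t x + mdiv (\<lambda>y. Jrev T (u t) y + Jdiss T (u t) y) x - Rsrc T (u t) x)"
        using cJ cR unfolding split_beta' by (intro continuous_on_diff continuous_on_add)
      show "AE (t, x) in (lebesgue :: (real \<times> (real^'d)) measure). t \<in> {0<..<\<tau>} \<and> x \<in> ?\<Omega> \<longrightarrow>
          u' t x + mdiv (\<lambda>y. Jrev T (u t) y + Jdiss T (u t) y) x - Rsrc T (u t) x = 0"
        using pde by eventually_elim auto
    qed
    then show ?thesis by (simp add: algebra_simps)
  qed
  have iR: "set_integrable lebesgue ?\<Omega> (\<lambda>x. potential T (u t) x \<bullet> Rsrc T (u t) x)"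
    and bx: "- (LINT x:frontier ?\<Omega>|surface_measure. qtot W (u t) x \<bullet> normal T x) = boundary_exchange T (u t)"
    using adm v unfolding thermodynamically_admissible_def by blast+
  have i\<sigma>: "set_integrable lebesgue ?\<Omega> (sigma W (u t))"
    using adm vX by (simp add: thermodynamically_admissible_def L1_valued_map_def)
  have i\<psi>: "set_integrable lebesgue ?\<Omega> (\<lambda>x. psi T x (u t x))" using vX by (simp add: field_space_def)
  have q\<Omega>: "set_integrable surface_measure (frontier ?\<Omega>) (\<lambda>x. qtot W (u t) x \<bullet> normal T x)"
    by (rule local_power_identity(3)[OF T v \<Omega> order_refl nu])
  have qP: "set_integrable surface_measure (frontier (P i)) (\<lambda>x. qtot W (u t) x \<bullet> n i x)" if "i \<in> {1..N}" for i
    by (rule local_power_identity(3)[OF T v part(2)[OF that] part(1)[OF that] part(3)[OF that]])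
  have F: "free_energy T (u t) = (\<Sum>i=1..N. free_energy_on T (P i) (u t))"
    unfolding free_energy_on_def by (rule set_integral_parts[OF i\<psi>])
  have D: "dissipation T W (u t) = (\<Sum>i=1..N. dissipation_on W (P i) (u t))"
    unfolding dissipation_on_def by (rule set_integral_parts[OF i\<sigma>])
  have S: "source T (u t) = (\<Sum>i=1..N. source_on T (P i) (u t))"
    unfolding source_on_def by (rule set_integral_parts[OF iR])
  have B: "boundary_exchange T (u t) = (\<Sum>i=1..N. exchange_ext T W P n i (u t))"
  proof -
    have "(LINT x:frontier ?\<Omega>|surface_measure. qtot W (u t) x \<bullet> normal T x) =
        (\<Sum>i\<in>{1..N}. LINT x:frontier (P i) \<inter> frontier ?\<Omega>|surface_measure. qtot W (u t) x \<bullet> n i x)"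
      by (rule boundary_integral_parts[OF q\<Omega> qP])
    then show ?thesis unfolding bx[symmetric] exchange_ext_def sum_negf by (simp only:)
  qed
  have loc: "((\<lambda>s. free_energy_on T (P i) (u s)) has_real_derivative local_rate T W N P n i (u t)) (at t within {0..\<tau>})"
    if i: "i \<in> {1..N}" for i
  proof -
    note li = local_power_identity[OF T v part(2)[OF i] part(1)[OF i] part(3)[OF i]]
    have "(LINT x:P i|lebesgue. potential T (u t) x \<bullet> u' t x) =
        (LINT x:P i|lebesgue. potential T (u t) x \<bullet> Rsrc T (u t) x - potential T (u t) x \<bullet> ?div x)"
      by (rule set_lebesgue_integral_cong[OF part_sets[OF i]]) (use ev part(1)[OF i] in \<open>auto simp: inner_diff_right\<close>)
    also have "\<dots> = source_on T (P i) (u t) - (LINT x:P i|lebesgue. potential T (u t) x \<bullet> ?div x)"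
      unfolding source_on_def
      by (rule set_integral_diff(2)[OF set_integrable_subset[OF iR part_sets[OF i] part(1)[OF i]]
            set_integrable_subset[OF li(2) part_sets[OF i] part(1)[OF i]]])
    also have "\<dots> = local_rate T W N P n i (u t)"
      unfolding li(1) part_boundary_integral[OF i qP[OF i]] local_rate_def exchange_ext_def exchange_int_def by simp
    finally show ?thesis
      using free_energy_on_derivative[OF T sf cu cu' du part(4)[OF i] part(1)[OF i] t] by simp
  qed
  have sumloc: "((\<lambda>s. \<Sum>i=1..N. free_energy_on T (P i) (u s)) has_real_derivative
        (\<Sum>i=1..N. local_rate T W N P n i (u t))) (at t within {0..\<tau>})"
    by (rule DERIV_sum) (rule loc)
  have rate: "(\<Sum>i=1..N. local_rate T W N P n i (u t)) =
        - dissipation T W (u t) + boundary_exchange T (u t) + source T (u t)"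
  proof -
    have "(\<Sum>i=1..N. exchange_int T W N P n i (u t)) = 0"
      unfolding exchange_int_def using interface_exchange_cancels[OF qP] by (simp add: sum_negf)
    then show ?thesis
      unfolding D B S local_rate_def sum.distrib sum_negf by simp
  qed
  have glob: "((\<lambda>s. free_energy T (u s)) has_real_derivative
        - dissipation T W (u t) + boundary_exchange T (u t) + source T (u t)) (at t within {0..\<tau>})"
    using cons traj t unfolding thermodynamically_consistent_def by blast
  show "free_energy T (u t) = (\<Sum>i=1..N. free_energy_on T (P i) (u t)) \<and>
     dissipation T W (u t) = (\<Sum>i=1..N. dissipation_on W (P i) (u t)) \<and>
     source T (u t) = (\<Sum>i=1..N. source_on T (P i) (u t)) \<and>
     boundary_exchange T (u t) = (\<Sum>i=1..N. exchange_ext T W P n i (u t)) \<and>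
     (\<forall>i\<in>{1..N}. ((\<lambda>s. free_energy_on T (P i) (u s)) has_real_derivative
        local_rate T W N P n i (u t)) (at t within {0..\<tau>})) \<and>
     ((\<lambda>s. \<Sum>i=1..N. free_energy_on T (P i) (u s)) has_real_derivative
        (\<Sum>i=1..N. local_rate T W N P n i (u t))) (at t within {0..\<tau>}) \<and>
     (\<Sum>i=1..N. local_rate T W N P n i (u t)) =
        - dissipation T W (u t) + boundary_exchange T (u t) + source T (u t) \<and>
     ((\<lambda>s. free_energy T (u s)) has_real_derivative
        - dissipation T W (u t) + boundary_exchange T (u t) + source T (u t)) (at t within {0..\<tau>})"
    using F D S B loc sumloc rate glob by blast
qed

end
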